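(* Let $\mathsf{B}$ be a category with finite products, $P\colon \mathsf{X}\to\mathsf{B}$ an opfibration, and $F\colon \mathsf{B}\to\mathbb{C}\mathsf{at}$ its associated pseudofunctor. Then the following statements are equivalent. (i) The category $\mathsf{X}$ has finite products and $P\colon (\mathsf{X},\times, I_{\mathsf{X}})\to (\mathsf{B},\times, I_{\mathsf{B}})$ is a monoidal opfibration, i.e. $P$ is a cartesian monoidal opfibration. (ii) The pseudonatural transformation $L^1$ has a right adjoint $R^1$ in the hom-2-category $\mathbf{CAT}(\mathbb{I},\mathbb{C}\mathsf{at})$, and the pseudonatural transformation $L$ has a right adjoint $R$ in the hom-2-category $\mathbf{CAT}(\mathsf{B}\times\mathsf{B},\mathbb{C}\mathsf{at})$. (iii) $F$ is endowed with a lax symmetric monoidal structure $$(F,R,R^1,\omega',\zeta',\xi',\theta')\colon (\mathsf{B},\times, I_{\mathsf{B}})\longrightarrow (\mathbb{C}\mathsf{at},\times, \mathsf{I})$$ where, for $X,Y$ in $\mathsf{X}$, $R^{P(X),P(Y)}(X,Y)=X\times Y$ and $R^1(\star)=I_{\mathsf{X}}$.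
   Context: $P$ is a (Grothendieck) cloven opfibration. Its associated pseudofunctor $F$ sends $A$ to the fibre $F(A)$ of $P$ over $A$, and $f\colon A\to B$ to the change-of-base functor $F(f)=f_*\colon F(A)\to F(B)$, where $\hat f\colon X\to f_*(X)$ is the chosen cocartesian lifting of $f$ at $X$. $\mathsf B$ is regarded as a locally discrete 2-category; $\mathbb{C}\mathsf{at}$ is the 2-category of locally small categories; $\mathbf{CAT}(\mathbb A,\mathbb{C}\mathsf{at})$ is the 2-category of pseudofunctors $\mathbb A\to\mathbb{C}\mathsf{at}$, pseudonatural transformations and modifications; $\mathbb I$ is the terminal 2-category and $\mathsf I$ the terminal category, with unique object $\star$. In any category, $\times$ denotes the binary product and $I$ (with the category as subscript) a terminal object. A monoidal opfibration is an opfibration $P\colon\mathsf X\to\mathsf B$ such that $\mathsf X$ and $\mathsf B$ are monoidal, $P$ is a strict monoidal functor, and the tensor product of cocartesian arrows is cocartesian. It is cartesian monoidal when both monoidal structures are given by finite products. $L^1\colon F(I_{\mathsf B})\to\mathsf I$ is the unique functor, regarded as a pseudonatural transformation between the pseudofunctors $\mathbb I\to\mathbb{C}\mathsf{at}$ with values $F(I_{\mathsf B})$ and $\mathsf I$. $L\colon F\circ\times\Rightarrow\times\circ(F\times F)$ is the pseudonatural transformation with components $L^{A,B}=\langle\pi_{1*},\pi_{2*}\rangle\colon F(A\times B)\to F(A)\times F(B)$, where $\pi_1,\pi_2$ are the product projections of $A\times B$, and with pseudonaturality isomorphisms $L^{(a,b)}\colon L^{A',B'}\circ F(a\times b)\Rightarrow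 (F(a)\times F(b))\circ L^{A,B}$ (for $a\colon A\to A'$, $b\colon B\to B'$) induced componentwise by the canonical isomorphisms $\pi_{1*}(a\times b)_*\cong a_*\pi_{1*}$ and $\pi_{2*}(a\times b)_*\cong b_*\pi_{2*}$. A lax symmetric monoidal structure on $F$ consists of pseudonatural transformations $R\colon\times\circ(F\times F)\Rightarrow F\circ\times$ (with components functors $R^{A,B}\colon F(A)\times F(B)\to F(A\times B)$) and $R^1\colon\mathsf I\to F(I_{\mathsf B})$, together with invertible modifications $\omega',\zeta',\xi',\theta'$ expressing compatibility with the cartesian associators, right and left unitors, and symmetries respectively, satisfying the usual coherence conditions for lax symmetric monoidal pseudofunctors.
   Formalization: In (iii), the equation R(X,Y)=X×Y is required as an equality of functors in X and Y, that is also on arrows of the total category for the tensor induced by R; with equality on objects only, (iii) does not imply (i). *)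

theory Defs
  imports Main
begin

section \<open>Categories, functors, natural transformations\<close>

record ('o, 'm) cat =
  obj :: "'o set"
  arr :: "'m set"
  src :: "'m \<Rightarrow> 'o"
  tgt :: "'m \<Rightarrow> 'o"
  ide :: "'o \<Rightarrow> 'm"
  cmp :: "'m \<Rightarrow> 'm \<Rightarrow> 'm"  ("(_/ \<cdot>\<index> _)" [56, 55] 55)

definition hom :: "('o, 'm, 'z) cat_scheme \<Rightarrow> 'o \<Rightarrow> 'o \<Rightarrow> 'm set" where
  "hom C x y = {f \<in> arr C. src C f = x \<and> tgt C f = y}"

definition category :: "('o, 'm) cat \<Rightarrow> bool" where
  "category C \<longleftrightarrow>
     (\<forall>f\<in>arr C. src C f \<in> obj C \<and> tgt C f \<in> obj C) \<and>
     (\<forall>x\<in>obj C. ide C x \<in> hom C x x) \<and>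
     (\<forall>f\<in>arr C. \<forall>g\<in>arr C. src C g = tgt C f \<longrightarrow> g \<cdot>\<^bsub>C\<^esub> f \<in> hom C (src C f) (tgt C g)) \<and>
     (\<forall>f\<in>arr C. f \<cdot>\<^bsub>C\<^esub> ide C (src C f) = f \<and> ide C (tgt C f) \<cdot>\<^bsub>C\<^esub> f = f) \<and>
     (\<forall>f\<in>arr C. \<forall>g\<in>arr C. \<forall>h\<in>arr C. src C g = tgt C f \<longrightarrow> src C h = tgt C g \<longrightarrow>
        h \<cdot>\<^bsub>C\<^esub> (g \<cdot>\<^bsub>C\<^esub> f) = (h \<cdot>\<^bsub>C\<^esub> g) \<cdot>\<^bsub>C\<^esub> f)"

definition inverse_arrows :: "('o, 'm) cat \<Rightarrow> 'm \<Rightarrow> 'm \<Rightarrow> bool" where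
  "inverse_arrows C f g \<longleftrightarrow> f \<in> arr C \<and> g \<in> hom C (tgt C f) (src C f) \<and>
     g \<cdot>\<^bsub>C\<^esub> f = ide C (src C f) \<and> f \<cdot>\<^bsub>C\<^esub> g = ide C (tgt C f)"

definition is_iso :: "('o, 'm) cat \<Rightarrow> 'm \<Rightarrow> bool" where
  "is_iso C f \<longleftrightarrow> (\<exists>g. inverse_arrows C f g)"

definition inv_arr :: "('o, 'm) cat \<Rightarrow> 'm \<Rightarrow> 'm" where
  "inv_arr C f = (THE g. inverse_arrows C f g)"

record ('o, 'm, 'p, 'n) func =
  fo :: "'o \<Rightarrow> 'p"
  fm :: "'m \<Rightarrow> 'n"

definition is_functor :: "('o, 'm) cat \<Rightarrow> ('p, 'n) cat \<Rightarrow> ('o, 'm, 'p, 'n) func \<Rightarrow> bool" where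
  "is_functor C D K \<longleftrightarrow> category C \<and> category D \<and>
     (\<forall>x\<in>obj C. fo K x \<in> obj D) \<and>
     (\<forall>f\<in>arr C. fm K f \<in> hom D (fo K (src C f)) (fo K (tgt C f))) \<and>
     (\<forall>x\<in>obj C. fm K (ide C x) = ide D (fo K x)) \<and>
     (\<forall>f\<in>arr C. \<forall>g\<in>arr C. src C g = tgt C f \<longrightarrow> fm K (g \<cdot>\<^bsub>C\<^esub> f) = fm K g \<cdot>\<^bsub>D\<^esub> fm K f)"

definition nat_trans ::
  "('o, 'm) cat \<Rightarrow> ('p, 'n) cat \<Rightarrow> ('o, 'm, 'p, 'n) func \<Rightarrow> ('o, 'm, 'p, 'n) func \<Rightarrow> ('o \<Rightarrow> 'n) \<Rightarrow> bool"
where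
  "nat_trans C D K K' t \<longleftrightarrow> is_functor C D K \<and> is_functor C D K' \<and>
     (\<forall>x\<in>obj C. t x \<in> hom D (fo K x) (fo K' x)) \<and>
     (\<forall>f\<in>arr C. t (tgt C f) \<cdot>\<^bsub>D\<^esub> fm K f = fm K' f \<cdot>\<^bsub>D\<^esub> t (src C f))"

definition nat_iso ::
  "('o, 'm) cat \<Rightarrow> ('p, 'n) cat \<Rightarrow> ('o, 'm, 'p, 'n) func \<Rightarrow> ('o, 'm, 'p, 'n) func \<Rightarrow> ('o \<Rightarrow> 'n) \<Rightarrow> bool"
where
  "nat_iso C D K K' t \<longleftrightarrow> nat_trans C D K K' t \<and> (\<forall>x\<in>obj C. is_iso D (t x))"

definition func_id :: "('o, 'm, 'o, 'm) func" where
  "func_id = \<lparr>fo = \<lambda>x. x, fm = \<lambda>f. f\<rparr>"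

definition func_comp ::
  "('p, 'n, 'q, 'l) func \<Rightarrow> ('o, 'm, 'p, 'n) func \<Rightarrow> ('o, 'm, 'q, 'l) func" where
  "func_comp H K = \<lparr>fo = \<lambda>x. fo H (fo K x), fm = \<lambda>f. fm H (fm K f)\<rparr>"

definition cat_prod :: "('o, 'm) cat \<Rightarrow> ('p, 'n) cat \<Rightarrow> ('o \<times> 'p, 'm \<times> 'n) cat" where
  "cat_prod C D =
     \<lparr>obj = obj C \<times> obj D, arr = arr C \<times> arr D,
      src = map_prod (src C) (src D), tgt = map_prod (tgt C) (tgt D),
      ide = map_prod (ide C) (ide D),
      cmp = \<lambda>(g, g') (f, f'). (g \<cdot>\<^bsub>C\<^esub> f, g' \<cdot>\<^bsub>D\<^esub> f')\<rparr>"

definition func_prod ::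
  "('o, 'm, 'p, 'n) func \<Rightarrow> ('o', 'm', 'p', 'n') func \<Rightarrow>
   ('o \<times> 'o', 'm \<times> 'm', 'p \<times> 'p', 'n \<times> 'n') func" where
  "func_prod H K = \<lparr>fo = map_prod (fo H) (fo K), fm = map_prod (fm H) (fm K)\<rparr>"

definition cat_unit :: "(unit, unit) cat" where
  "cat_unit = \<lparr>obj = UNIV, arr = UNIV, src = \<lambda>_. (), tgt = \<lambda>_. (), ide = \<lambda>_. (), cmp = \<lambda>_ _. ()\<rparr>"

definition func_point :: "('o, 'm) cat \<Rightarrow> 'o \<Rightarrow> (unit, unit, 'o, 'm) func" where
  "func_point C x = \<lparr>fo = \<lambda>_. x, fm = \<lambda>_. ide C x\<rparr>"

definition func_bang :: "('o, 'm, unit, unit) func" where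
  "func_bang = \<lparr>fo = \<lambda>_. (), fm = \<lambda>_. ()\<rparr>"

definition func_fst :: "('o \<times> 'p, 'm \<times> 'n, 'o, 'm) func" where
  "func_fst = \<lparr>fo = fst, fm = fst\<rparr>"

definition func_snd :: "('o \<times> 'p, 'm \<times> 'n, 'p, 'n) func" where
  "func_snd = \<lparr>fo = snd, fm = snd\<rparr>"

definition func_swap :: "('o \<times> 'p, 'm \<times> 'n, 'p \<times> 'o, 'n \<times> 'm) func" where
  "func_swap = \<lparr>fo = \<lambda>(x, y). (y, x), fm = \<lambda>(f, g). (g, f)\<rparr>"

definition func_assoc ::
  "(('o \<times> 'p) \<times> 'q, ('m \<times> 'n) \<times> 'l, 'o \<times> ('p \<times> 'q), 'm \<times> ('n \<times> 'l)) func" where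
  "func_assoc = \<lparr>fo = \<lambda>((x, y), z). (x, (y, z)), fm = \<lambda>((f, g), h). (f, (g, h))\<rparr>"

section \<open>Finite products\<close>

definition is_terminal :: "('o, 'm) cat \<Rightarrow> 'o \<Rightarrow> bool" where
  "is_terminal C t \<longleftrightarrow> t \<in> obj C \<and> (\<forall>x\<in>obj C. \<exists>!f. f \<in> hom C x t)"

definition is_product :: "('o, 'm) cat \<Rightarrow> 'o \<Rightarrow> 'o \<Rightarrow> 'o \<Rightarrow> 'm \<Rightarrow> 'm \<Rightarrow> bool" where
  "is_product C a b p p1 p2 \<longleftrightarrow> p1 \<in> hom C p a \<and> p2 \<in> hom C p b \<and>
     (\<forall>c\<in>obj C. \<forall>f\<in>hom C c a. \<forall>g\<in>hom C c b.
        \<exists>!h. h \<in> hom C c p \<and> p1 \<cdot>\<^bsub>C\<^esub> h = f \<and> p2 \<cdot>\<^bsub>C\<^esub> h = g)"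

record ('o, 'm) fprods =
  pr :: "'o \<Rightarrow> 'o \<Rightarrow> 'o"
  pi1 :: "'o \<Rightarrow> 'o \<Rightarrow> 'm"
  pi2 :: "'o \<Rightarrow> 'o \<Rightarrow> 'm"
  one :: "'o"

definition finite_products :: "('o, 'm) cat \<Rightarrow> ('o, 'm) fprods \<Rightarrow> bool" where
  "finite_products C S \<longleftrightarrow> category C \<and> is_terminal C (one S) \<and>
     (\<forall>a\<in>obj C. \<forall>b\<in>obj C. is_product C a b (pr S a b) (pi1 S a b) (pi2 S a b))"

definition pair :: "('o, 'm) cat \<Rightarrow> ('o, 'm) fprods \<Rightarrow> 'm \<Rightarrow> 'm \<Rightarrow> 'm" where
  "pair C S f g = (THE h. h \<in> hom C (src C f) (pr S (tgt C f) (tgt C g)) \<and>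
     pi1 S (tgt C f) (tgt C g) \<cdot>\<^bsub>C\<^esub> h = f \<and> pi2 S (tgt C f) (tgt C g) \<cdot>\<^bsub>C\<^esub> h = g)"

definition par :: "('o, 'm) cat \<Rightarrow> ('o, 'm) fprods \<Rightarrow> 'm \<Rightarrow> 'm \<Rightarrow> 'm" where
  "par C S f g = pair C S (f \<cdot>\<^bsub>C\<^esub> pi1 S (src C f) (src C g)) (g \<cdot>\<^bsub>C\<^esub> pi2 S (src C f) (src C g))"

definition prod_func :: "('o, 'm) cat \<Rightarrow> ('o, 'm) fprods \<Rightarrow> ('o \<times> 'o, 'm \<times> 'm, 'o, 'm) func" where
  "prod_func C S = \<lparr>fo = \<lambda>(a, b). pr S a b, fm = \<lambda>(f, g). par C S f g\<rparr>"

definition prod_assoc :: "('o, 'm) cat \<Rightarrow> ('o, 'm) fprods \<Rightarrow> 'o \<Rightarrow> 'o \<Rightarrow> 'o \<Rightarrow> 'm" where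
  "prod_assoc C S a b c =
     pair C S (pi1 S a b \<cdot>\<^bsub>C\<^esub> pi1 S (pr S a b) c)
       (pair C S (pi2 S a b \<cdot>\<^bsub>C\<^esub> pi1 S (pr S a b) c) (pi2 S (pr S a b) c))"

definition prod_swap :: "('o, 'm) cat \<Rightarrow> ('o, 'm) fprods \<Rightarrow> 'o \<Rightarrow> 'o \<Rightarrow> 'm" where
  "prod_swap C S a b = pair C S (pi2 S a b) (pi1 S a b)"

section \<open>Monoidal categories and strict monoidal functors\<close>

record ('o, 'm) mon =
  tens :: "('o \<times> 'o, 'm \<times> 'm, 'o, 'm) func"
  unit_obj :: "'o"
  massoc :: "'o \<Rightarrow> 'o \<Rightarrow> 'o \<Rightarrow> 'm"
  mlunit :: "'o \<Rightarrow> 'm"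
  mrunit :: "'o \<Rightarrow> 'm"

definition monoidal_category :: "('o, 'm) cat \<Rightarrow> ('o, 'm) mon \<Rightarrow> bool" where
  "monoidal_category C M \<longleftrightarrow> category C \<and>
     is_functor (cat_prod C C) C (tens M) \<and> unit_obj M \<in> obj C \<and>
     nat_iso (cat_prod (cat_prod C C) C) C
       (func_comp (tens M) (func_prod (tens M) func_id))
       (func_comp (func_comp (tens M) (func_prod func_id (tens M))) func_assoc)
       (\<lambda>((a, b), c). massoc M a b c) \<and>
     nat_iso C C \<lparr>fo = \<lambda>a. fo (tens M) (unit_obj M, a), fm = \<lambda>f. fm (tens M) (ide C (unit_obj M), f)\<rparr>
       func_id (mlunit M) \<and>
     nat_iso C C \<lparr>fo = \<lambda>a. fo (tens M) (a, unit_obj M), fm = \<lambda>f. fm (tens M) (f, ide C (unit_obj M))\<rparr>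
       func_id (mrunit M) \<and>
     (\<forall>a\<in>obj C. \<forall>b\<in>obj C. \<forall>c\<in>obj C. \<forall>d\<in>obj C.
        massoc M a b (fo (tens M) (c, d)) \<cdot>\<^bsub>C\<^esub> massoc M (fo (tens M) (a, b)) c d =
        fm (tens M) (ide C a, massoc M b c d) \<cdot>\<^bsub>C\<^esub>
          (massoc M a (fo (tens M) (b, c)) d \<cdot>\<^bsub>C\<^esub> fm (tens M) (massoc M a b c, ide C d))) \<and>
     (\<forall>a\<in>obj C. \<forall>b\<in>obj C.
        fm (tens M) (ide C a, mlunit M b) \<cdot>\<^bsub>C\<^esub> massoc M a (unit_obj M) b =
        fm (tens M) (mrunit M a, ide C b))"

definition cartesian_monoidal :: "('o, 'm) cat \<Rightarrow> ('o, 'm) fprods \<Rightarrow> ('o, 'm) mon" where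
  "cartesian_monoidal C S =
     \<lparr>tens = prod_func C S, unit_obj = one S, massoc = prod_assoc C S,
      mlunit = \<lambda>a. pi2 S (one S) a, mrunit = \<lambda>a. pi1 S a (one S)\<rparr>"

definition strict_monoidal_functor ::
  "('o, 'm) cat \<Rightarrow> ('o, 'm) mon \<Rightarrow> ('p, 'n) cat \<Rightarrow> ('p, 'n) mon \<Rightarrow> ('o, 'm, 'p, 'n) func \<Rightarrow> bool"
where
  "strict_monoidal_functor C M D N P \<longleftrightarrow> is_functor C D P \<and>
     (\<forall>x\<in>obj C. \<forall>y\<in>obj C. fo P (fo (tens M) (x, y)) = fo (tens N) (fo P x, fo P y)) \<and>
     (\<forall>f\<in>arr C. \<forall>g\<in>arr C. fm P (fm (tens M) (f, g)) = fm (tens N) (fm P f, fm P g)) \<and>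
     fo P (unit_obj M) = unit_obj N \<and>
     (\<forall>x\<in>obj C. \<forall>y\<in>obj C. \<forall>z\<in>obj C.
        fm P (massoc M x y z) = massoc N (fo P x) (fo P y) (fo P z)) \<and>
     (\<forall>x\<in>obj C. fm P (mlunit M x) = mlunit N (fo P x) \<and> fm P (mrunit M x) = mrunit N (fo P x))"

section \<open>Opfibrations\<close>

definition cocartesian ::
  "('o, 'm) cat \<Rightarrow> ('b, 'f) cat \<Rightarrow> ('o, 'm, 'b, 'f) func \<Rightarrow> 'm \<Rightarrow> bool" where
  "cocartesian X B P k \<longleftrightarrow> k \<in> arr X \<and>
     (\<forall>h\<in>arr X. \<forall>g\<in>hom B (fo P (tgt X k)) (fo P (tgt X h)).
        src X h = src X k \<longrightarrow> g \<cdot>\<^bsub>B\<^esub> fm P k = fm P h \<longrightarrow>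
        (\<exists>!u. u \<in> hom X (tgt X k) (tgt X h) \<and> fm P u = g \<and> u \<cdot>\<^bsub>X\<^esub> k = h))"

definition opfibration ::
  "('o, 'm) cat \<Rightarrow> ('b, 'f) cat \<Rightarrow> ('o, 'm, 'b, 'f) func \<Rightarrow> bool" where
  "opfibration X B P \<longleftrightarrow> is_functor X B P \<and>
     (\<forall>f\<in>arr B. \<forall>x\<in>obj X. fo P x = src B f \<longrightarrow>
        (\<exists>k. cocartesian X B P k \<and> src X k = x \<and> fm P k = f))"

definition cloven_opfibration ::
  "('o, 'm) cat \<Rightarrow> ('b, 'f) cat \<Rightarrow> ('o, 'm, 'b, 'f) func \<Rightarrow> ('f \<Rightarrow> 'o \<Rightarrow> 'm) \<Rightarrow> bool" where
  "cloven_opfibration X B P \<kappa> \<longleftrightarrow> is_functor X B P \<and>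
     (\<forall>f\<in>arr B. \<forall>x\<in>obj X. fo P x = src B f \<longrightarrow>
        cocartesian X B P (\<kappa> f x) \<and> src X (\<kappa> f x) = x \<and> fm P (\<kappa> f x) = f)"

definition monoidal_opfibration ::
  "('o, 'm) cat \<Rightarrow> ('o, 'm) mon \<Rightarrow> ('b, 'f) cat \<Rightarrow> ('b, 'f) mon \<Rightarrow> ('o, 'm, 'b, 'f) func \<Rightarrow> bool"
where
  "monoidal_opfibration X M B N P \<longleftrightarrow>
     opfibration X B P \<and> monoidal_category X M \<and> monoidal_category B N \<and>
     strict_monoidal_functor X M B N P \<and>
     (\<forall>h k. cocartesian X B P h \<longrightarrow> cocartesian X B P k \<longrightarrow> cocartesian X B P (fm (tens M) (h, k)))"

section \<open>Pseudofunctors to Cat, pseudonatural transformations, modifications\<close>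

text \<open>A category \<open>A\<close> is regarded as a locally discrete 2-category, so a pseudofunctor on it has no
  data on 2-cells.  The structure isomorphisms are oriented as
  \<open>F(g f) \<rightarrow> F(g) F(f)\<close> and \<open>F(1) \<rightarrow> 1\<close>.  The categories \<open>F(a)\<close> all live on one pair of types; a
  pseudonatural transformation may go between pseudofunctors with different value types.\<close>

record ('a, 'f, 'o, 'm) psf =
  pobj :: "'a \<Rightarrow> ('o, 'm) cat"
  pmor :: "'f \<Rightarrow> ('o, 'm, 'o, 'm) func"
  pcomp :: "'f \<Rightarrow> 'f \<Rightarrow> 'o \<Rightarrow> 'm"
  punit :: "'a \<Rightarrow> 'o \<Rightarrow> 'm"

definition pseudofunctor :: "('a, 'f) cat \<Rightarrow> ('a, 'f, 'o, 'm) psf \<Rightarrow> bool" where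
  "pseudofunctor A F \<longleftrightarrow> category A \<and>
     (\<forall>a\<in>obj A. category (pobj F a)) \<and>
     (\<forall>f\<in>arr A. is_functor (pobj F (src A f)) (pobj F (tgt A f)) (pmor F f)) \<and>
     (\<forall>a\<in>obj A. nat_iso (pobj F a) (pobj F a) (pmor F (ide A a)) func_id (punit F a)) \<and>
     (\<forall>f\<in>arr A. \<forall>g\<in>arr A. src A g = tgt A f \<longrightarrow>
        nat_iso (pobj F (src A f)) (pobj F (tgt A g))
          (pmor F (g \<cdot>\<^bsub>A\<^esub> f)) (func_comp (pmor F g) (pmor F f)) (pcomp F g f)) \<and>
     (\<forall>f\<in>arr A. \<forall>x\<in>obj (pobj F (src A f)).
        fm (pmor F f) (punit F (src A f) x) \<cdot>\<^bsub>pobj F (tgt A f)\<^esub> pcomp F f (ide A (src A f)) x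
          = ide (pobj F (tgt A f)) (fo (pmor F f) x) \<and>
        punit F (tgt A f) (fo (pmor F f) x) \<cdot>\<^bsub>pobj F (tgt A f)\<^esub> pcomp F (ide A (tgt A f)) f x
          = ide (pobj F (tgt A f)) (fo (pmor F f) x)) \<and>
     (\<forall>f\<in>arr A. \<forall>g\<in>arr A. \<forall>h\<in>arr A. src A g = tgt A f \<longrightarrow> src A h = tgt A g \<longrightarrow>
        (\<forall>x\<in>obj (pobj F (src A f)).
           fm (pmor F h) (pcomp F g f x) \<cdot>\<^bsub>pobj F (tgt A h)\<^esub> pcomp F h (g \<cdot>\<^bsub>A\<^esub> f) x
           = pcomp F h g (fo (pmor F f) x) \<cdot>\<^bsub>pobj F (tgt A h)\<^esub> pcomp F (h \<cdot>\<^bsub>A\<^esub> g) f x))"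

text \<open>The 2-cell at \<open>f : a \<rightarrow> b\<close> of a transformation \<open>\<tau> : F \<Rightarrow> G\<close> is oriented as
  \<open>\<tau>\<^sub>b F(f) \<Rightarrow> G(f) \<tau>\<^sub>a\<close>.\<close>

record ('a, 'f, 'o, 'm, 'p, 'n) pnt =
  tcomp :: "'a \<Rightarrow> ('o, 'm, 'p, 'n) func"
  tiso :: "'f \<Rightarrow> 'o \<Rightarrow> 'n"

definition pseudonat ::
  "('a, 'f) cat \<Rightarrow> ('a, 'f, 'o, 'm) psf \<Rightarrow> ('a, 'f, 'p, 'n) psf \<Rightarrow> ('a, 'f, 'o, 'm, 'p, 'n) pnt \<Rightarrow> bool"
where
  "pseudonat A F G \<tau> \<longleftrightarrow> pseudofunctor A F \<and> pseudofunctor A G \<and>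
     (\<forall>a\<in>obj A. is_functor (pobj F a) (pobj G a) (tcomp \<tau> a)) \<and>
     (\<forall>f\<in>arr A. nat_iso (pobj F (src A f)) (pobj G (tgt A f))
        (func_comp (tcomp \<tau> (tgt A f)) (pmor F f)) (func_comp (pmor G f) (tcomp \<tau> (src A f))) (tiso \<tau> f)) \<and>
     (\<forall>a\<in>obj A. \<forall>x\<in>obj (pobj F a).
        punit G a (fo (tcomp \<tau> a) x) \<cdot>\<^bsub>pobj G a\<^esub> tiso \<tau> (ide A a) x = fm (tcomp \<tau> a) (punit F a x)) \<and>
     (\<forall>f\<in>arr A. \<forall>g\<in>arr A. src A g = tgt A f \<longrightarrow> (\<forall>x\<in>obj (pobj F (src A f)).
        pcomp G g f (fo (tcomp \<tau> (src A f)) x) \<cdot>\<^bsub>pobj G (tgt A g)\<^esub> tiso \<tau> (g \<cdot>\<^bsub>A\<^esub> f) x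
        = fm (pmor G g) (tiso \<tau> f x) \<cdot>\<^bsub>pobj G (tgt A g)\<^esub>
            (tiso \<tau> g (fo (pmor F f) x) \<cdot>\<^bsub>pobj G (tgt A g)\<^esub> fm (tcomp \<tau> (tgt A g)) (pcomp F g f x))))"

definition modification ::
  "('a, 'f) cat \<Rightarrow> ('a, 'f, 'o, 'm) psf \<Rightarrow> ('a, 'f, 'p, 'n) psf \<Rightarrow>
   ('a, 'f, 'o, 'm, 'p, 'n) pnt \<Rightarrow> ('a, 'f, 'o, 'm, 'p, 'n) pnt \<Rightarrow> ('a \<Rightarrow> 'o \<Rightarrow> 'n) \<Rightarrow> bool"
where
  "modification A F G \<sigma> \<tau> m \<longleftrightarrow> pseudonat A F G \<sigma> \<and> pseudonat A F G \<tau> \<and>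
     (\<forall>a\<in>obj A. nat_trans (pobj F a) (pobj G a) (tcomp \<sigma> a) (tcomp \<tau> a) (m a)) \<and>
     (\<forall>f\<in>arr A. \<forall>x\<in>obj (pobj F (src A f)).
        fm (pmor G f) (m (src A f) x) \<cdot>\<^bsub>pobj G (tgt A f)\<^esub> tiso \<sigma> f x
        = tiso \<tau> f x \<cdot>\<^bsub>pobj G (tgt A f)\<^esub> m (tgt A f) (fo (pmor F f) x))"

definition invertible_modification ::
  "('a, 'f) cat \<Rightarrow> ('a, 'f, 'o, 'm) psf \<Rightarrow> ('a, 'f, 'p, 'n) psf \<Rightarrow>
   ('a, 'f, 'o, 'm, 'p, 'n) pnt \<Rightarrow> ('a, 'f, 'o, 'm, 'p, 'n) pnt \<Rightarrow> ('a \<Rightarrow> 'o \<Rightarrow> 'n) \<Rightarrow> bool"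
where
  "invertible_modification A F G \<sigma> \<tau> m \<longleftrightarrow> modification A F G \<sigma> \<tau> m \<and>
     (\<forall>a\<in>obj A. \<forall>x\<in>obj (pobj F a). is_iso (pobj G a) (m a x))"

definition psf_precomp ::
  "('a, 'f, 'b, 'g) func \<Rightarrow> ('b, 'g, 'o, 'm) psf \<Rightarrow> ('a, 'f, 'o, 'm) psf" where
  "psf_precomp K F =
     \<lparr>pobj = \<lambda>a. pobj F (fo K a), pmor = \<lambda>f. pmor F (fm K f),
      pcomp = \<lambda>g f. pcomp F (fm K g) (fm K f), punit = \<lambda>a. punit F (fo K a)\<rparr>"

text \<open>The composite of \<open>F \<times> G\<close> with the cartesian product of categories.\<close>

definition psf_prod ::
  "('a, 'f, 'o, 'm) psf \<Rightarrow> ('b, 'g, 'p, 'n) psf \<Rightarrow> ('a \<times> 'b, 'f \<times> 'g, 'o \<times> 'p, 'm \<times> 'n) psf" where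
  "psf_prod F G =
     \<lparr>pobj = \<lambda>(a, b). cat_prod (pobj F a) (pobj G b),
      pmor = \<lambda>(f, g). func_prod (pmor F f) (pmor G g),
      pcomp = \<lambda>(g, g') (f, f') (x, y). (pcomp F g f x, pcomp G g' f' y),
      punit = \<lambda>(a, b) (x, y). (punit F a x, punit G b y)\<rparr>"

definition psf_unit :: "(unit, unit, unit, unit) psf" where
  "psf_unit = \<lparr>pobj = \<lambda>_. cat_unit, pmor = \<lambda>_. func_id, pcomp = \<lambda>_ _ _. (), punit = \<lambda>_ _. ()\<rparr>"

definition pnt_id :: "('a, 'f) cat \<Rightarrow> ('a, 'f, 'o, 'm) psf \<Rightarrow> ('a, 'f, 'o, 'm, 'o, 'm) pnt" where
  "pnt_id A F = \<lparr>tcomp = \<lambda>_. func_id, tiso = \<lambda>f x. ide (pobj F (tgt A f)) (fo (pmor F f) x)\<rparr>"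

text \<open>The composite of \<open>\<tau> : F \<Rightarrow> G\<close> and \<open>\<sigma> : G \<Rightarrow> H\<close>.\<close>

definition pnt_comp ::
  "('a, 'f) cat \<Rightarrow> ('a, 'f, 'q, 'l) psf \<Rightarrow> ('a, 'f, 'p, 'n, 'q, 'l) pnt \<Rightarrow>
   ('a, 'f, 'o, 'm, 'p, 'n) pnt \<Rightarrow> ('a, 'f, 'o, 'm, 'q, 'l) pnt" where
  "pnt_comp A H \<sigma> \<tau> =
     \<lparr>tcomp = \<lambda>a. func_comp (tcomp \<sigma> a) (tcomp \<tau> a),
      tiso = \<lambda>f x. tiso \<sigma> f (fo (tcomp \<tau> (src A f)) x) \<cdot>\<^bsub>pobj H (tgt A f)\<^esub> fm (tcomp \<sigma> (tgt A f)) (tiso \<tau> f x)\<rparr>"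

definition pnt_precomp ::
  "('a, 'f, 'b, 'g) func \<Rightarrow> ('b, 'g, 'o, 'm, 'p, 'n) pnt \<Rightarrow> ('a, 'f, 'o, 'm, 'p, 'n) pnt" where
  "pnt_precomp K \<tau> = \<lparr>tcomp = \<lambda>a. tcomp \<tau> (fo K a), tiso = \<lambda>f. tiso \<tau> (fm K f)\<rparr>"

definition pnt_prod ::
  "('a, 'f, 'o, 'm, 'p, 'n) pnt \<Rightarrow> ('b, 'g, 'o', 'm', 'p', 'n') pnt \<Rightarrow>
   ('a \<times> 'b, 'f \<times> 'g, 'o \<times> 'o', 'm \<times> 'm', 'p \<times> 'p', 'n \<times> 'n') pnt" where
  "pnt_prod \<sigma> \<tau> =
     \<lparr>tcomp = \<lambda>(a, b). func_prod (tcomp \<sigma> a) (tcomp \<tau> b),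
      tiso = \<lambda>(f, g) (x, y). (tiso \<sigma> f x, tiso \<tau> g y)\<rparr>"

text \<open>\<open>F * \<alpha> : F K \<Rightarrow> F K'\<close> for a natural transformation \<open>\<alpha> : K \<Rightarrow> K'\<close> of functors from \<open>A\<close>.\<close>

definition pnt_whisker ::
  "('a, 'f) cat \<Rightarrow> ('b, 'g, 'o, 'm) psf \<Rightarrow> ('a, 'f, 'b, 'g) func \<Rightarrow> ('a, 'f, 'b, 'g) func \<Rightarrow>
   ('a \<Rightarrow> 'g) \<Rightarrow> ('a, 'f, 'o, 'm, 'o, 'm) pnt" where
  "pnt_whisker A F K K' \<alpha> =
     \<lparr>tcomp = \<lambda>a. pmor F (\<alpha> a),
      tiso = \<lambda>f x. pcomp F (fm K' f) (\<alpha> (src A f)) x \<cdot>\<^bsub>pobj F (fo K' (tgt A f))\<^esub>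
                   inv_arr (pobj F (fo K' (tgt A f))) (pcomp F (\<alpha> (tgt A f)) (fm K f) x)\<rparr>"

text \<open>The strictly natural transformation into \<open>G\<close> all of whose components are given by \<open>T\<close>.\<close>

definition pnt_strict ::
  "('a, 'f) cat \<Rightarrow> ('a, 'f, 'p, 'n) psf \<Rightarrow> ('o, 'm, 'p, 'n) func \<Rightarrow> ('a, 'f, 'o, 'm, 'p, 'n) pnt" where
  "pnt_strict A G T =
     \<lparr>tcomp = \<lambda>_. T, tiso = \<lambda>f x. ide (pobj G (tgt A f)) (fo (pmor G f) (fo T x))\<rparr>"

text \<open>Adjunction \<open>L \<stileturn> R\<close> in the 2-category of pseudofunctors from \<open>A\<close> to Cat: the unit and
  counit are modifications, and the triangle identities between modifications are written out at
  components.\<close>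

definition right_adjoint_in_CAT ::
  "('a, 'f) cat \<Rightarrow> ('a, 'f, 'o, 'm) psf \<Rightarrow> ('a, 'f, 'p, 'n) psf \<Rightarrow>
   ('a, 'f, 'o, 'm, 'p, 'n) pnt \<Rightarrow> ('a, 'f, 'p, 'n, 'o, 'm) pnt \<Rightarrow> bool" where
  "right_adjoint_in_CAT A F G L R \<longleftrightarrow>
     pseudonat A F G L \<and> pseudonat A G F R \<and>
     (\<exists>\<eta> \<epsilon>. modification A F F (pnt_id A F) (pnt_comp A F R L) \<eta> \<and>
        modification A G G (pnt_comp A G L R) (pnt_id A G) \<epsilon> \<and>
        (\<forall>a\<in>obj A. \<forall>x\<in>obj (pobj F a).
           \<epsilon> a (fo (tcomp L a) x) \<cdot>\<^bsub>pobj G a\<^esub> fm (tcomp L a) (\<eta> a x) = ide (pobj G a) (fo (tcomp L a) x)) \<and>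
        (\<forall>a\<in>obj A. \<forall>y\<in>obj (pobj G a).
           fm (tcomp R a) (\<epsilon> a y) \<cdot>\<^bsub>pobj F a\<^esub> \<eta> a (fo (tcomp R a) y) = ide (pobj F a) (fo (tcomp R a) y)))"

section \<open>The pseudofunctor of a cloven opfibration, and the transformations \<open>L\<^sup>1\<close>, \<open>L\<close>\<close>

definition fibre ::
  "('o, 'm) cat \<Rightarrow> ('b, 'f) cat \<Rightarrow> ('o, 'm, 'b, 'f) func \<Rightarrow> 'b \<Rightarrow> ('o, 'm) cat" where
  "fibre X B P a = X\<lparr>obj := {x \<in> obj X. fo P x = a}, arr := {u \<in> arr X. fm P u = ide B a}\<rparr>"

text \<open>The factorization of \<open>h\<close> through the cocartesian arrow \<open>k\<close> lying over \<open>g\<close>.\<close>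

definition cofactor :: "('o, 'm) cat \<Rightarrow> ('o, 'm, 'b, 'f) func \<Rightarrow> 'f \<Rightarrow> 'm \<Rightarrow> 'm \<Rightarrow> 'm" where
  "cofactor X P g k h = (THE u. u \<in> hom X (tgt X k) (tgt X h) \<and> fm P u = g \<and> u \<cdot>\<^bsub>X\<^esub> k = h)"

definition opfib_psf ::
  "('o, 'm) cat \<Rightarrow> ('b, 'f) cat \<Rightarrow> ('o, 'm, 'b, 'f) func \<Rightarrow> ('f \<Rightarrow> 'o \<Rightarrow> 'm) \<Rightarrow> ('b, 'f, 'o, 'm) psf" where
  "opfib_psf X B P \<kappa> =
     \<lparr>pobj = fibre X B P,
      pmor = \<lambda>f. \<lparr>fo = \<lambda>x. tgt X (\<kappa> f x),
                 fm = \<lambda>u. cofactor X P (ide B (tgt B f)) (\<kappa> f (src X u)) (\<kappa> f (tgt X u) \<cdot>\<^bsub>X\<^esub> u)\<rparr>,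
      pcomp = \<lambda>g f x. cofactor X P (ide B (tgt B g)) (\<kappa> (g \<cdot>\<^bsub>B\<^esub> f) x) (\<kappa> g (tgt X (\<kappa> f x)) \<cdot>\<^bsub>X\<^esub> \<kappa> f x),
      punit = \<lambda>a x. cofactor X P (ide B a) (\<kappa> (ide B a) x) (ide X x)\<rparr>"

text \<open>\<open>L\<^sup>1 : F(I) \<Rightarrow> \<I>\<close>, where \<open>F(I)\<close> stands for the composite of \<open>F\<close> with the functor from the
  terminal category selecting the terminal object \<open>I\<close>.\<close>

definition L1 :: "(unit, unit, 'o, 'm, unit, unit) pnt" where
  "L1 = \<lparr>tcomp = \<lambda>_. func_bang, tiso = \<lambda>_ _. ()\<rparr>"

text \<open>The 2-cell at \<open>(a, b)\<close> is the pair of isomorphisms \<open>\<pi>\<^sub>1\<^sub>* (a \<times> b)\<^sub>* \<cong> a\<^sub>* \<pi>\<^sub>1\<^sub>*\<close> and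
  \<open>\<pi>\<^sub>2\<^sub>* (a \<times> b)\<^sub>* \<cong> b\<^sub>* \<pi>\<^sub>2\<^sub>*\<close> that constitute \<open>F * \<pi>\<^sub>1\<close> and \<open>F * \<pi>\<^sub>2\<close>.\<close>

definition LL ::
  "('a, 'f) cat \<Rightarrow> ('a, 'f) fprods \<Rightarrow> ('a, 'f, 'o, 'm) psf \<Rightarrow>
   ('a \<times> 'a, 'f \<times> 'f, 'o, 'm, 'o \<times> 'o, 'm \<times> 'm) pnt" where
  "LL B S F = (let
       L\<^sub>1 = pnt_whisker (cat_prod B B) F (prod_func B S) func_fst (\<lambda>(a, b). pi1 S a b);
       L\<^sub>2 = pnt_whisker (cat_prod B B) F (prod_func B S) func_snd (\<lambda>(a, b). pi2 S a b)
     in \<lparr>tcomp = \<lambda>ab. \<lparr>fo = \<lambda>x. (fo (tcomp L\<^sub>1 ab) x, fo (tcomp L\<^sub>2 ab) x),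
                        fm = \<lambda>u. (fm (tcomp L\<^sub>1 ab) u, fm (tcomp L\<^sub>2 ab) u)\<rparr>,
         tiso = \<lambda>fg x. (tiso L\<^sub>1 fg x, tiso L\<^sub>2 fg x)\<rparr>)"

section \<open>Lax symmetric monoidal structures\<close>

text \<open>Components of pastings of 2-cells in the fibres of \<open>F\<close> are recorded as triples \<open>(x, f, v)\<close> with
  \<open>f : a \<rightarrow> b\<close> in the base, \<open>x\<close> in \<open>F(a)\<close> and \<open>v : f\<^sub>* x \<rightarrow> y\<close> in \<open>F(b)\<close>, i.e. as arrows of the
  Grothendieck construction of \<open>F\<close>.  In \<open>gtens\<close> a transformation
  \<open>R\<^sup>a\<^sup>b : F(a) \<times> F(b) \<rightarrow> F(a \<times> b)\<close> is applied, after the inverse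
  \<open>(f \<times> g)\<^sub>* R(x, y) \<rightarrow> R(f\<^sub>* x, g\<^sub>* y)\<close> of its 2-cell.\<close>

type_synonym ('o, 'f, 'm) garr = "'o \<times> 'f \<times> 'm"

definition gide :: "('a, 'f) cat \<Rightarrow> ('a, 'f, 'o, 'm) psf \<Rightarrow> 'a \<Rightarrow> 'o \<Rightarrow> ('o, 'f, 'm) garr" where
  "gide B F a x = (x, ide B a, punit F a x)"

definition gcomp ::
  "('a, 'f) cat \<Rightarrow> ('a, 'f, 'o, 'm) psf \<Rightarrow> ('o, 'f, 'm) garr \<Rightarrow> ('o, 'f, 'm) garr \<Rightarrow> ('o, 'f, 'm) garr" where
  "gcomp B F = (\<lambda>(y, g, w) (x, f, v).
     (x, g \<cdot>\<^bsub>B\<^esub> f, w \<cdot>\<^bsub>pobj F (tgt B g)\<^esub> (fm (pmor F g) v \<cdot>\<^bsub>pobj F (tgt B g)\<^esub> pcomp F g f x)))"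

definition ginv ::
  "('a, 'f) cat \<Rightarrow> ('a, 'f, 'o, 'm) psf \<Rightarrow> ('o, 'f, 'm) garr \<Rightarrow> ('o, 'f, 'm) garr" where
  "ginv B F = (\<lambda>(x, f, v). let f' = inv_arr B f; C = pobj F (src B f) in
     (tgt (pobj F (tgt B f)) v, f',
      punit F (src B f) x \<cdot>\<^bsub>C\<^esub>
        (inv_arr C (pcomp F f' f x) \<cdot>\<^bsub>C\<^esub> fm (pmor F f') (inv_arr (pobj F (tgt B f)) v))))"

definition gtens ::
  "('a, 'f) cat \<Rightarrow> ('a, 'f) fprods \<Rightarrow> ('a, 'f, 'o, 'm) psf \<Rightarrow>
   ('a \<times> 'a, 'f \<times> 'f, 'o \<times> 'o, 'm \<times> 'm, 'o, 'm) pnt \<Rightarrow>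
   ('o, 'f, 'm) garr \<Rightarrow> ('o, 'f, 'm) garr \<Rightarrow> ('o, 'f, 'm) garr" where
  "gtens B S F R = (\<lambda>(x, f, v) (y, g, w). let C = pobj F (pr S (tgt B f) (tgt B g)) in
     (fo (tcomp R (src B f, src B g)) (x, y), par B S f g,
      fm (tcomp R (tgt B f, tgt B g)) (v, w) \<cdot>\<^bsub>C\<^esub> inv_arr C (tiso R (f, g) (x, y))))"

text \<open>\<open>\<omega>\<close>, \<open>\<zeta>\<close>, \<open>\<xi>\<close>, \<open>\<theta>\<close> have components
  \<open>\<alpha>\<^sub>* R(R(x, y), z) \<rightarrow> R(x, R(y, z))\<close>, \<open>\<rho>\<^sub>* R(x, R\<^sup>1) \<rightarrow> x\<close>, \<open>\<lambda>\<^sub>* R(R\<^sup>1, x) \<rightarrow> x\<close> and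
  \<open>\<beta>\<^sub>* R(x, y) \<rightarrow> R(y, x)\<close>, for \<open>\<alpha>\<close>, \<open>\<rho>\<close>, \<open>\<lambda>\<close>, \<open>\<beta>\<close> the cartesian structure of the base.\<close>

definition assoc_mod ::
  "('a, 'f) cat \<Rightarrow> ('a, 'f) fprods \<Rightarrow> ('a, 'f, 'o, 'm) psf \<Rightarrow>
   ('a \<times> 'a, 'f \<times> 'f, 'o \<times> 'o, 'm \<times> 'm, 'o, 'm) pnt \<Rightarrow>
   (('a \<times> 'a) \<times> 'a \<Rightarrow> ('o \<times> 'o) \<times> 'o \<Rightarrow> 'm) \<Rightarrow> bool" where
  "assoc_mod B S F R \<omega> \<longleftrightarrow> (let
       A = cat_prod (cat_prod B B) B;
       T = prod_func B S;
       T\<^sub>l = func_comp T (func_prod T func_id);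
       K = func_comp (func_prod func_id T) func_assoc;
       T\<^sub>r = func_comp T K
     in invertible_modification A (psf_prod (psf_prod F F) F) (psf_precomp T\<^sub>r F)
          (pnt_comp A (psf_precomp T\<^sub>r F)
             (pnt_whisker A F T\<^sub>l T\<^sub>r (\<lambda>((a, b), c). prod_assoc B S a b c))
             (pnt_comp A (psf_precomp T\<^sub>l F)
                (pnt_precomp (func_prod T func_id) R)
                (pnt_prod R (pnt_id B F))))
          (pnt_comp A (psf_precomp T\<^sub>r F)
             (pnt_precomp K R)
             (pnt_comp A (psf_precomp K (psf_prod F F))
                (pnt_precomp func_assoc (pnt_prod (pnt_id B F) R))
                (pnt_strict A (psf_precomp func_assoc (psf_prod F (psf_prod F F))) func_assoc)))
          \<omega>)"

definition runit_mod ::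
  "('a, 'f) cat \<Rightarrow> ('a, 'f) fprods \<Rightarrow> ('a, 'f, 'o, 'm) psf \<Rightarrow>
   ('a \<times> 'a, 'f \<times> 'f, 'o \<times> 'o, 'm \<times> 'm, 'o, 'm) pnt \<Rightarrow> (unit, unit, unit, unit, 'o, 'm) pnt \<Rightarrow>
   ('a \<times> unit \<Rightarrow> 'o \<times> unit \<Rightarrow> 'm) \<Rightarrow> bool" where
  "runit_mod B S F R R1 \<zeta> \<longleftrightarrow> (let
       A = cat_prod B cat_unit;
       K = func_prod func_id (func_point B (one S));
       T = func_comp (prod_func B S) K
     in invertible_modification A (psf_prod F psf_unit) (psf_precomp func_fst F)
          (pnt_comp A (psf_precomp func_fst F)
             (pnt_whisker A F T func_fst (\<lambda>(a, _). pi1 S a (one S)))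
             (pnt_comp A (psf_precomp T F)
                (pnt_precomp K R)
                (pnt_prod (pnt_id B F) R1)))
          (pnt_strict A (psf_precomp func_fst F) func_fst)
          \<zeta>)"

definition lunit_mod ::
  "('a, 'f) cat \<Rightarrow> ('a, 'f) fprods \<Rightarrow> ('a, 'f, 'o, 'm) psf \<Rightarrow>
   ('a \<times> 'a, 'f \<times> 'f, 'o \<times> 'o, 'm \<times> 'm, 'o, 'm) pnt \<Rightarrow> (unit, unit, unit, unit, 'o, 'm) pnt \<Rightarrow>
   (unit \<times> 'a \<Rightarrow> unit \<times> 'o \<Rightarrow> 'm) \<Rightarrow> bool" where
  "lunit_mod B S F R R1 \<xi> \<longleftrightarrow> (let
       A = cat_prod cat_unit B;
       K = func_prod (func_point B (one S)) func_id;
       T = func_comp (prod_func B S) K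
     in invertible_modification A (psf_prod psf_unit F) (psf_precomp func_snd F)
          (pnt_comp A (psf_precomp func_snd F)
             (pnt_whisker A F T func_snd (\<lambda>(_, a). pi2 S (one S) a))
             (pnt_comp A (psf_precomp T F)
                (pnt_precomp K R)
                (pnt_prod R1 (pnt_id B F))))
          (pnt_strict A (psf_precomp func_snd F) func_snd)
          \<xi>)"

definition swap_mod ::
  "('a, 'f) cat \<Rightarrow> ('a, 'f) fprods \<Rightarrow> ('a, 'f, 'o, 'm) psf \<Rightarrow>
   ('a \<times> 'a, 'f \<times> 'f, 'o \<times> 'o, 'm \<times> 'm, 'o, 'm) pnt \<Rightarrow>
   ('a \<times> 'a \<Rightarrow> 'o \<times> 'o \<Rightarrow> 'm) \<Rightarrow> bool" where
  "swap_mod B S F R \<theta> \<longleftrightarrow> (let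
       A = cat_prod B B;
       T = prod_func B S;
       T' = func_comp T func_swap
     in invertible_modification A (psf_prod F F) (psf_precomp T' F)
          (pnt_comp A (psf_precomp T' F)
             (pnt_whisker A F T T' (\<lambda>(a, b). prod_swap B S a b))
             R)
          (pnt_comp A (psf_precomp T' F)
             (pnt_precomp func_swap R)
             (pnt_strict A (psf_precomp func_swap (psf_prod F F)) func_swap))
          \<theta>)"

text \<open>The coherence conditions are the two axioms of a monoidal pseudofunctor (associativity, unit),
  the two braiding axioms, and the symmetry axiom.\<close>

definition lax_symmetric_monoidal ::
  "('a, 'f) cat \<Rightarrow> ('a, 'f) fprods \<Rightarrow> ('a, 'f, 'o, 'm) psf \<Rightarrow>
   ('a \<times> 'a, 'f \<times> 'f, 'o \<times> 'o, 'm \<times> 'm, 'o, 'm) pnt \<Rightarrow> (unit, unit, unit, unit, 'o, 'm) pnt \<Rightarrow>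
   (('a \<times> 'a) \<times> 'a \<Rightarrow> ('o \<times> 'o) \<times> 'o \<Rightarrow> 'm) \<Rightarrow> ('a \<times> unit \<Rightarrow> 'o \<times> unit \<Rightarrow> 'm) \<Rightarrow>
   (unit \<times> 'a \<Rightarrow> unit \<times> 'o \<Rightarrow> 'm) \<Rightarrow> ('a \<times> 'a \<Rightarrow> 'o \<times> 'o \<Rightarrow> 'm) \<Rightarrow> bool" where
  "lax_symmetric_monoidal B S F R R1 \<omega> \<zeta> \<xi> \<theta> \<longleftrightarrow>
     pseudonat (cat_prod B B) (psf_prod F F) (psf_precomp (prod_func B S) F) R \<and>
     pseudonat cat_unit psf_unit (psf_precomp (func_point B (one S)) F) R1 \<and>
     assoc_mod B S F R \<omega> \<and> runit_mod B S F R R1 \<zeta> \<and> lunit_mod B S F R R1 \<xi> \<and> swap_mod B S F R \<theta> \<and>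
     (let
        I = one S;
        r = fo (tcomp R1 ()) ();
        T = (\<lambda>a b x y. fo (tcomp R (a, b)) (x, y));
        assoc = (\<lambda>a b c x y z. (T (pr S a b) c (T a b x y) z, prod_assoc B S a b c, \<omega> ((a, b), c) ((x, y), z)));
        runit = (\<lambda>a x. (T a I x r, pi1 S a I, \<zeta> (a, ()) (x, ())));
        lunit = (\<lambda>a x. (T I a r x, pi2 S I a, \<xi> ((), a) ((), x)));
        swap = (\<lambda>a b x y. (T a b x y, prod_swap B S a b, \<theta> (a, b) (x, y)));
        comp = gcomp B F; idt = gide B F; inv = ginv B F; ten = gtens B S F R
      in
       (\<forall>a\<in>obj B. \<forall>b\<in>obj B. \<forall>c\<in>obj B. \<forall>d\<in>obj B. \<forall>x\<in>obj (pobj F a). \<forall>y\<in>obj (pobj F b).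
         \<forall>z\<in>obj (pobj F c). \<forall>w\<in>obj (pobj F d).
           comp (assoc a b (pr S c d) x y (T c d z w)) (assoc (pr S a b) c d (T a b x y) z w)
           = comp (ten (idt a x) (assoc b c d y z w))
               (comp (assoc a (pr S b c) d x (T b c y z) w) (ten (assoc a b c x y z) (idt d w)))) \<and>
       (\<forall>a\<in>obj B. \<forall>b\<in>obj B. \<forall>x\<in>obj (pobj F a). \<forall>y\<in>obj (pobj F b).
           comp (ten (idt a x) (lunit b y)) (assoc a I b x r y) = ten (runit a x) (idt b y)) \<and>
       (\<forall>a\<in>obj B. \<forall>b\<in>obj B. \<forall>c\<in>obj B. \<forall>x\<in>obj (pobj F a). \<forall>y\<in>obj (pobj F b). \<forall>z\<in>obj (pobj F c).
           comp (assoc b c a y z x) (comp (swap a (pr S b c) x (T b c y z)) (assoc a b c x y z))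
           = comp (ten (idt b y) (swap a c x z))
               (comp (assoc b a c y x z) (ten (swap a b x y) (idt c z)))) \<and>
       (\<forall>a\<in>obj B. \<forall>b\<in>obj B. \<forall>c\<in>obj B. \<forall>x\<in>obj (pobj F a). \<forall>y\<in>obj (pobj F b). \<forall>z\<in>obj (pobj F c).
           comp (inv (assoc c a b z x y)) (comp (swap (pr S a b) c (T a b x y) z) (inv (assoc a b c x y z)))
           = comp (ten (swap a c x z) (idt b y))
               (comp (inv (assoc a c b x z y)) (ten (idt a x) (swap b c y z)))) \<and>
       (\<forall>a\<in>obj B. \<forall>b\<in>obj B. \<forall>x\<in>obj (pobj F a). \<forall>y\<in>obj (pobj F b).
           comp (swap b a y x) (swap a b x y) = idt (pr S a b) (T a b x y)))"

section \<open>The tensor product on the total category\<close>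

text \<open>Arrows of the total category correspond to triples \<open>(x, f, v)\<close> as above.  Transporting \<open>gtens\<close> along this
  correspondence gives the action on arrows of the tensor product on the total category that is
  induced by \<open>R\<close>; on objects it is \<open>(x, y) \<mapsto> R(x, y)\<close>.  The requirement \<open>R(x, y) = x \<times> y\<close> is an
  equality of functors of \<open>x\<close> and \<open>y\<close> in the total category: this functor is the product functor.\<close>

definition arr_to_garr ::
  "('o, 'm) cat \<Rightarrow> ('b, 'f) cat \<Rightarrow> ('o, 'm, 'b, 'f) func \<Rightarrow> ('f \<Rightarrow> 'o \<Rightarrow> 'm) \<Rightarrow> 'm \<Rightarrow> ('o, 'f, 'm) garr" where
  "arr_to_garr X B P \<kappa> h =
     (src X h, fm P h, cofactor X P (ide B (fo P (tgt X h))) (\<kappa> (fm P h) (src X h)) h)"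

definition garr_to_arr ::
  "('o, 'm) cat \<Rightarrow> ('f \<Rightarrow> 'o \<Rightarrow> 'm) \<Rightarrow> ('o, 'f, 'm) garr \<Rightarrow> 'm" where
  "garr_to_arr X \<kappa> = (\<lambda>(x, f, v). v \<cdot>\<^bsub>X\<^esub> \<kappa> f x)"

definition total_tensor ::
  "('o, 'm) cat \<Rightarrow> ('b, 'f) cat \<Rightarrow> ('b, 'f) fprods \<Rightarrow> ('o, 'm, 'b, 'f) func \<Rightarrow> ('f \<Rightarrow> 'o \<Rightarrow> 'm) \<Rightarrow>
   ('b \<times> 'b, 'f \<times> 'f, 'o \<times> 'o, 'm \<times> 'm, 'o, 'm) pnt \<Rightarrow> ('o \<times> 'o, 'm \<times> 'm, 'o, 'm) func" where
  "total_tensor X B S P \<kappa> R =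
     \<lparr>fo = \<lambda>(x, y). fo (tcomp R (fo P x, fo P y)) (x, y),
      fm = \<lambda>(h, k). garr_to_arr X \<kappa>
             (gtens B S (opfib_psf X B P \<kappa>) R (arr_to_garr X B P \<kappa> h) (arr_to_garr X B P \<kappa> k))\<rparr>"

end

theory Submission
  imports Defs
begin

text \<open>A pseudofunctor \<open>G\<close> on \<open>A\<close> that comes from a total category over \<open>A\<close> is handled through arrows of the
  total category: equations between 2-cells in the fibres are checked after composition with
  cocartesian lifts. Pseudonatural transformations become maps of arrows over the base that preserve
  cocartesian lifts, and modifications become vertical natural families.

  All three conditions are compared with one statement about the total category \<open>X\<close>: it has finite
  products, \<open>P\<close> preserves the product cones strictly, and products of cocartesian arrows are
  cocartesian. In this language an arrow \<open>z \<rightarrow> R(x, y)\<close> over \<open>\<langle>f, g\<rangle>\<close> is a vertical arrow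
  \<open>\<langle>f, g\<rangle>\<^sub>* z \<rightarrow> R(x, y)\<close>, hence by \<open>L \<stileturn> R\<close> a pair of vertical arrows \<open>f\<^sub>* z \<rightarrow> x\<close>,
  \<open>g\<^sub>* z \<rightarrow> y\<close>, that is, a pair \<open>z \<rightarrow> x\<close>, \<open>z \<rightarrow> y\<close> over \<open>f\<close>, \<open>g\<close>; so fibrewise adjunctions
  are products in \<open>X\<close>, and pseudonaturality of \<open>R\<close> says that products of cocartesian arrows are
  cocartesian. The coherence of a lax symmetric monoidal structure is that of the cartesian monoidal
  category \<open>X\<close>.\<close>

section \<open>Categories\<close>

text \<open>The pseudofunctors that occur live over B \<times> B, (B \<times> B) \<times> B, B
  \<times> 1 and so on, and arise from \<open>F\<close> by products and precomposition. Keeping the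
  old total category under precomposition, and recording only which of its arrows lie over a base
  arrow, makes these constructions nearly strict; pastings of pseudonatural transformations become
  composites of maps on arrows.

  Strictness of \<open>P\<close> on product objects costs nothing, since \<open>R\<close> at
  \<open>(a, b)\<close> takes values in the fibre over \<open>pr S a b\<close>. The projections are
  the delicate point: a monoidal structure mentions them only in its unit constraints. They are
  recovered by factoring \<open>pi1 x y\<close> as id \<times> ! followed by \<open>pi1 x 1\<close>,
  so \<open>P\<close> is known on all projections once it is known on the unit constraints. In (i)
  these constraints are projections. In (iii) they come from \<zeta> and \<xi> and agree with
  projections only up to natural automorphisms of the identity functor, which must be built into the
  product cones. Naturality of the automorphisms keeps the product functor unchanged.\<close>

locale categ =
  fixes C :: "('o, 'm) cat" (structure)
  assumes category: "category C"
begin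

lemma src_obj [simp]: "f \<in> arr C \<Longrightarrow> src C f \<in> obj C"
  and tgt_obj [simp]: "f \<in> arr C \<Longrightarrow> tgt C f \<in> obj C"
  and ide_arr [simp]: "x \<in> obj C \<Longrightarrow> ide C x \<in> arr C"
  and src_ide [simp]: "x \<in> obj C \<Longrightarrow> src C (ide C x) = x"
  and tgt_ide [simp]: "x \<in> obj C \<Longrightarrow> tgt C (ide C x) = x"
  using category by (auto simp: category_def hom_def)

lemma cmp_arr [simp]: "f \<in> arr C \<Longrightarrow> g \<in> arr C \<Longrightarrow> src C g = tgt C f \<Longrightarrow> g \<cdot> f \<in> arr C"
  and src_cmp [simp]: "f \<in> arr C \<Longrightarrow> g \<in> arr C \<Longrightarrow> src C g = tgt C f \<Longrightarrow> src C (g \<cdot> f) = src C f"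
  and tgt_cmp [simp]: "f \<in> arr C \<Longrightarrow> g \<in> arr C \<Longrightarrow> src C g = tgt C f \<Longrightarrow> tgt C (g \<cdot> f) = tgt C g"
  using category by (auto simp: category_def hom_def)

lemma cmp_ide_right [simp]: "f \<in> arr C \<Longrightarrow> src C f = x \<Longrightarrow> f \<cdot> ide C x = f"
  and cmp_ide_left [simp]: "f \<in> arr C \<Longrightarrow> tgt C f = x \<Longrightarrow> ide C x \<cdot> f = f"
  using category by (auto simp: category_def)

lemma cmp_assoc [simp]:
  "f \<in> arr C \<Longrightarrow> g \<in> arr C \<Longrightarrow> h \<in> arr C \<Longrightarrow> src C g = tgt C f \<Longrightarrow> src C h = tgt C g \<Longrightarrow>
    (h \<cdot> g) \<cdot> f = h \<cdot> (g \<cdot> f)"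
  using category by (auto simp: category_def)

text \<open>\<open>cmp_assoc\<close> nests composites to the right, which hides the factor
  \<open>g \<cdot> f\<close> of a known equation inside \<open>g \<cdot> (f \<cdot> h)\<close>. This
  form makes such an equation applicable again.\<close>

lemma cmp_reassoc:
  "g \<cdot> f = k \<Longrightarrow> f \<in> arr C \<Longrightarrow> g \<in> arr C \<Longrightarrow> src C g = tgt C f \<Longrightarrow> h \<in> arr C \<Longrightarrow> src C f = tgt C h \<Longrightarrow>
    g \<cdot> (f \<cdot> h) = k \<cdot> h"
  by (metis cmp_assoc)

lemma inverse_arrows_unique:
  assumes "inverse_arrows C f g" "inverse_arrows C f g'"
  shows "g = g'"
proof -
  have "g \<cdot> (f \<cdot> g') = (g \<cdot> f) \<cdot> g'"
    using assms by (intro cmp_assoc[symmetric]) (auto simp: inverse_arrows_def hom_def)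
  then show ?thesis using assms by (simp add: inverse_arrows_def hom_def)
qed

lemma inv_arr_eqI: "inverse_arrows C f g \<Longrightarrow> inv_arr C f = g"
  unfolding inv_arr_def by (rule the_equality) (auto intro: inverse_arrows_unique)

lemma inverse_inv_arr: "is_iso C f \<Longrightarrow> inverse_arrows C f (inv_arr C f)"
  by (metis inv_arr_eqI is_iso_def)

lemma is_iso_arr: "is_iso C f \<Longrightarrow> f \<in> arr C"
  by (auto simp: is_iso_def inverse_arrows_def)

lemma inv_arr_simps [simp]:
  assumes "is_iso C f"
  shows "inv_arr C f \<in> arr C" "src C (inv_arr C f) = tgt C f" "tgt C (inv_arr C f) = src C f"
    "inv_arr C f \<cdot> f = ide C (src C f)" "f \<cdot> inv_arr C f = ide C (tgt C f)"
  using inverse_inv_arr[OF assms] by (auto simp: inverse_arrows_def hom_def)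

lemma inv_arr_cancel [simp]:
  assumes "is_iso C f" "h \<in> arr C"
  shows "src C f = tgt C h \<Longrightarrow> inv_arr C f \<cdot> (f \<cdot> h) = h"
    and "tgt C f = tgt C h \<Longrightarrow> f \<cdot> (inv_arr C f \<cdot> h) = h"
  using assms by (simp_all add: is_iso_arr cmp_reassoc[OF inv_arr_simps(4)] cmp_reassoc[OF inv_arr_simps(5)])

lemma is_isoI:
  "f \<in> arr C \<Longrightarrow> g \<in> arr C \<Longrightarrow> src C g = tgt C f \<Longrightarrow> tgt C g = src C f \<Longrightarrow>
    g \<cdot> f = ide C (src C f) \<Longrightarrow> f \<cdot> g = ide C (tgt C f) \<Longrightarrow> is_iso C f"
  by (auto simp: is_iso_def inverse_arrows_def hom_def)

lemma is_iso_ide [simp]: "x \<in> obj C \<Longrightarrow> is_iso C (ide C x)"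
  by (rule is_isoI[of _ "ide C x"]) auto

lemma is_iso_inv_arr [simp]: "is_iso C f \<Longrightarrow> is_iso C (inv_arr C f)"
  by (rule is_isoI[of _ f]) (auto simp: is_iso_arr)

lemma is_iso_cmp [simp]:
  assumes "is_iso C f" "is_iso C g" "src C g = tgt C f"
  shows "is_iso C (g \<cdot> f)"
  by (rule is_isoI[of _ "inv_arr C f \<cdot> inv_arr C g"]) (use assms in \<open>simp_all add: is_iso_arr\<close>)

lemma iso_cancel_left:
  assumes "is_iso C f" "f \<cdot> g = f \<cdot> h" "g \<in> arr C" "h \<in> arr C" "tgt C g = src C f" "tgt C h = src C f"
  shows "g = h"
  using assms by (metis inv_arr_cancel(1))

end

section \<open>Finite products\<close>

locale fin_prod =
  fixes C :: "('o, 'm) cat" (structure) and S :: "('o, 'm) fprods"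
  assumes finite_products: "finite_products C S"
begin

sublocale categ C
  using finite_products by unfold_locales (simp add: finite_products_def)

lemma product: "a \<in> obj C \<Longrightarrow> b \<in> obj C \<Longrightarrow> is_product C a b (pr S a b) (pi1 S a b) (pi2 S a b)"
  using finite_products by (simp add: finite_products_def)

lemma pi_simps [simp]:
  assumes "a \<in> obj C" "b \<in> obj C"
  shows "pi1 S a b \<in> arr C" "src C (pi1 S a b) = pr S a b" "tgt C (pi1 S a b) = a"
    "pi2 S a b \<in> arr C" "src C (pi2 S a b) = pr S a b" "tgt C (pi2 S a b) = b"
  using product[OF assms] by (auto simp: is_product_def hom_def)

lemma pr_obj [simp]: "a \<in> obj C \<Longrightarrow> b \<in> obj C \<Longrightarrow> pr S a b \<in> obj C"
  by (metis pi_simps(1,2) src_obj)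

lemma one_obj [simp]: "one S \<in> obj C"
  using finite_products by (simp add: finite_products_def is_terminal_def)

lemma bang_unique:
  assumes "f \<in> arr C" "g \<in> arr C" "src C f = src C g" "tgt C f = one S" "tgt C g = one S"
  shows "f = g"
proof -
  have "\<exists>!h. h \<in> hom C (src C f) (one S)"
    using finite_products assms(1) by (simp add: finite_products_def is_terminal_def)
  then show ?thesis using assms by (auto simp: hom_def)
qed

lemma bang_ex: "x \<in> obj C \<Longrightarrow> \<exists>f. f \<in> arr C \<and> src C f = x \<and> tgt C f = one S"
  using finite_products by (fastforce simp: finite_products_def is_terminal_def hom_def)

lemma pair_ex1:
  assumes "f \<in> arr C" "g \<in> arr C" "src C f = src C g"
  shows "\<exists>!h. h \<in> hom C (src C f) (pr S (tgt C f) (tgt C g)) \<and>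
     pi1 S (tgt C f) (tgt C g) \<cdot> h = f \<and> pi2 S (tgt C f) (tgt C g) \<cdot> h = g"
  using product[of "tgt C f" "tgt C g"] assms
  unfolding is_product_def by (simp add: hom_def)

lemma pair_simps [simp]:
  assumes "f \<in> arr C" "g \<in> arr C" "src C f = src C g"
  shows "pair C S f g \<in> arr C" "src C (pair C S f g) = src C g"
    "tgt C (pair C S f g) = pr S (tgt C f) (tgt C g)"
  using theI'[OF pair_ex1[OF assms]] assms unfolding pair_def by (auto simp: hom_def)

lemma pi_pair [simp]:
  assumes "f \<in> arr C" "g \<in> arr C" "src C f = src C g" "tgt C f = a" "tgt C g = b"
  shows "pi1 S a b \<cdot> pair C S f g = f" "pi2 S a b \<cdot> pair C S f g = g"
  using theI'[OF pair_ex1[OF assms(1-3)]] assms unfolding pair_def by (auto simp: hom_def)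

lemma pi_pair_cmp [simp]:
  assumes "f \<in> arr C" "g \<in> arr C" "src C f = src C g" "tgt C f = a" "tgt C g = b"
    "h \<in> arr C" "tgt C h = src C g"
  shows "pi1 S a b \<cdot> (pair C S f g \<cdot> h) = f \<cdot> h" "pi2 S a b \<cdot> (pair C S f g \<cdot> h) = g \<cdot> h"
  using assms by (auto intro: cmp_reassoc[OF pi_pair(1)] cmp_reassoc[OF pi_pair(2)])

lemma prod_eqI:
  assumes "a \<in> obj C" "b \<in> obj C" "h \<in> arr C" "k \<in> arr C" "src C h = src C k"
    "tgt C h = pr S a b" "tgt C k = pr S a b"
    "pi1 S a b \<cdot> h = pi1 S a b \<cdot> k" "pi2 S a b \<cdot> h = pi2 S a b \<cdot> k"
  shows "h = k"
proof -
  have "\<exists>!t. t \<in> hom C (src C k) (pr S a b) \<and> pi1 S a b \<cdot> t = pi1 S a b \<cdot> k \<and> pi2 S a b \<cdot> t = pi2 S a b \<cdot> k"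
    using pair_ex1[of "pi1 S a b \<cdot> k" "pi2 S a b \<cdot> k"] assms by simp
  then show ?thesis using assms by (auto simp: hom_def)
qed

lemma pair_cmp [simp]:
  assumes "f \<in> arr C" "g \<in> arr C" "src C f = src C g" "h \<in> arr C" "tgt C h = src C g"
  shows "pair C S f g \<cdot> h = pair C S (f \<cdot> h) (g \<cdot> h)"
  by (rule prod_eqI[of "tgt C f" "tgt C g"]) (use assms in simp_all)

lemma pair_eta [simp]:
  assumes "h \<in> arr C" "tgt C h = pr S a b" "a \<in> obj C" "b \<in> obj C"
  shows "pair C S (pi1 S a b \<cdot> h) (pi2 S a b \<cdot> h) = h"
  by (rule prod_eqI[of a b]) (use assms in simp_all)

lemma pair_pi [simp]: "a \<in> obj C \<Longrightarrow> b \<in> obj C \<Longrightarrow> pair C S (pi1 S a b) (pi2 S a b) = ide C (pr S a b)"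
  by (rule prod_eqI[of a b]) simp_all

lemma par_simps [simp]:
  assumes "f \<in> arr C" "g \<in> arr C"
  shows "par C S f g \<in> arr C" "src C (par C S f g) = pr S (src C f) (src C g)"
    "tgt C (par C S f g) = pr S (tgt C f) (tgt C g)"
  unfolding par_def using assms by simp_all

lemma pi_par:
  assumes "f \<in> arr C" "g \<in> arr C" "tgt C f = a" "tgt C g = b"
  shows "pi1 S a b \<cdot> par C S f g = f \<cdot> pi1 S (src C f) (src C g)"
    "pi2 S a b \<cdot> par C S f g = g \<cdot> pi2 S (src C f) (src C g)"
  unfolding par_def using assms by simp_all

lemma par_cmp:
  assumes "f \<in> arr C" "g \<in> arr C" "f' \<in> arr C" "g' \<in> arr C" "src C f' = tgt C f" "src C g' = tgt C g"
  shows "par C S (f' \<cdot> f) (g' \<cdot> g) = par C S f' g' \<cdot> par C S f g"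
  unfolding par_def using assms by simp

lemma par_ide: "a \<in> obj C \<Longrightarrow> b \<in> obj C \<Longrightarrow> par C S (ide C a) (ide C b) = ide C (pr S a b)"
  unfolding par_def by simp

lemma par_pair:
  assumes "f \<in> arr C" "g \<in> arr C" "h \<in> arr C" "k \<in> arr C" "src C f = tgt C h" "src C g = tgt C k" "src C h = src C k"
  shows "par C S f g \<cdot> pair C S h k = pair C S (f \<cdot> h) (g \<cdot> k)"
  unfolding par_def using assms by simp

lemma par_eqI:
  assumes "f \<in> arr C" "g \<in> arr C" "h \<in> arr C" "src C h = pr S (src C f) (src C g)"
    "tgt C h = pr S (tgt C f) (tgt C g)"
    "pi1 S (tgt C f) (tgt C g) \<cdot> h = f \<cdot> pi1 S (src C f) (src C g)"
    "pi2 S (tgt C f) (tgt C g) \<cdot> h = g \<cdot> pi2 S (src C f) (src C g)"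
  shows "h = par C S f g"
  by (rule prod_eqI[of "tgt C f" "tgt C g"]) (use assms in \<open>simp_all add: pi_par\<close>)

lemma prod_assoc_simps [simp]:
  assumes "a \<in> obj C" "b \<in> obj C" "c \<in> obj C"
  shows "prod_assoc C S a b c \<in> arr C" "src C (prod_assoc C S a b c) = pr S (pr S a b) c"
    "tgt C (prod_assoc C S a b c) = pr S a (pr S b c)"
  unfolding prod_assoc_def using assms by simp_all

lemma prod_swap_simps [simp]:
  assumes "a \<in> obj C" "b \<in> obj C"
  shows "prod_swap C S a b \<in> arr C" "src C (prod_swap C S a b) = pr S a b"
    "tgt C (prod_swap C S a b) = pr S b a"
  unfolding prod_swap_def using assms by simp_all

lemma prod_assoc_natural:
  assumes "f \<in> arr C" "g \<in> arr C" "h \<in> arr C"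
  shows "prod_assoc C S (tgt C f) (tgt C g) (tgt C h) \<cdot> par C S (par C S f g) h =
    par C S f (par C S g h) \<cdot> prod_assoc C S (src C f) (src C g) (src C h)"
  unfolding prod_assoc_def par_def using assms by simp

lemma prod_swap_natural:
  assumes "f \<in> arr C" "g \<in> arr C"
  shows "prod_swap C S (tgt C f) (tgt C g) \<cdot> par C S f g = par C S g f \<cdot> prod_swap C S (src C f) (src C g)"
  unfolding prod_swap_def par_def using assms by simp

text \<open>The inverse associator as an explicit tuple of projections. \<open>inv_arr\<close> is a
  definite description, on which the rules for pairs cannot act; with the tuple,
  \<open>hexagon2\<close> is checked by the same simplification as the other laws.\<close>

definition assoc_inv :: "'o \<Rightarrow> 'o \<Rightarrow> 'o \<Rightarrow> 'm" where
  "assoc_inv a b c = pair C S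
     (pair C S (pi1 S a (pr S b c)) (pi1 S b c \<cdot> pi2 S a (pr S b c))) (pi2 S b c \<cdot> pi2 S a (pr S b c))"

lemma inverse_prod_assoc:
  assumes "a \<in> obj C" "b \<in> obj C" "c \<in> obj C"
  shows "inverse_arrows C (prod_assoc C S a b c) (assoc_inv a b c)"
  using assms unfolding inverse_arrows_def hom_def prod_assoc_def assoc_inv_def by simp

lemma is_iso_prod_assoc: "a \<in> obj C \<Longrightarrow> b \<in> obj C \<Longrightarrow> c \<in> obj C \<Longrightarrow> is_iso C (prod_assoc C S a b c)"
  using inverse_prod_assoc by (auto simp: is_iso_def)

lemma swap_swap: "a \<in> obj C \<Longrightarrow> b \<in> obj C \<Longrightarrow> prod_swap C S b a \<cdot> prod_swap C S a b = ide C (pr S a b)"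
  unfolding prod_swap_def by simp

lemma is_iso_prod_swap: "a \<in> obj C \<Longrightarrow> b \<in> obj C \<Longrightarrow> is_iso C (prod_swap C S a b)"
  by (rule is_isoI[of _ "prod_swap C S b a"]) (simp_all add: swap_swap)

lemma is_iso_pi_one:
  assumes "a \<in> obj C"
  shows "is_iso C (pi1 S a (one S))" "is_iso C (pi2 S (one S) a)"
proof -
  obtain t where t: "t \<in> arr C" "src C t = a" "tgt C t = one S" using bang_ex assms by blast
  show "is_iso C (pi1 S a (one S))"
    by (rule is_isoI[of _ "pair C S (ide C a) t"], insert t assms)
      (simp_all, rule prod_eqI[of a "one S"], auto intro: bang_unique)
  show "is_iso C (pi2 S (one S) a)"
    by (rule is_isoI[of _ "pair C S t (ide C a)"], insert t assms)
      (simp_all, rule prod_eqI[of "one S" a], auto intro: bang_unique)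
qed

text \<open>A projection away from a factor forgets that factor, so the factor may be sent to the
  terminal object beforehand. This reduces every projection to a unit constraint, the only form in
  which a monoidal structure records projections.\<close>

lemma pi_via_one:
  assumes "a \<in> obj C" "b \<in> obj C" "t \<in> arr C"
  shows "src C t = b \<Longrightarrow> tgt C t = one S \<Longrightarrow> pi1 S a (one S) \<cdot> par C S (ide C a) t = pi1 S a b"
    and "src C t = a \<Longrightarrow> tgt C t = one S \<Longrightarrow> pi2 S (one S) b \<cdot> par C S t (ide C b) = pi2 S a b"
  using assms by (simp_all add: pi_par)

text \<open>Every structural arrow is a tuple of composites of projections, and
  \<open>pair_cmp\<close>, \<open>pi_pair\<close> and \<open>pair_eta\<close> bring such tuples to a
  normal form. The coherence laws therefore hold by simplification.\<close>

lemma pentagon: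
  assumes "a \<in> obj C" "b \<in> obj C" "c \<in> obj C" "d \<in> obj C"
  shows "prod_assoc C S a b (pr S c d) \<cdot> prod_assoc C S (pr S a b) c d =
    par C S (ide C a) (prod_assoc C S b c d) \<cdot>
      (prod_assoc C S a (pr S b c) d \<cdot> par C S (prod_assoc C S a b c) (ide C d))"
  using assms unfolding prod_assoc_def par_def by simp

lemma triangle:
  assumes "a \<in> obj C" "b \<in> obj C"
  shows "par C S (ide C a) (pi2 S (one S) b) \<cdot> prod_assoc C S a (one S) b =
    par C S (pi1 S a (one S)) (ide C b)"
  using assms unfolding prod_assoc_def par_def by simp

lemma hexagon1:
  assumes "a \<in> obj C" "b \<in> obj C" "c \<in> obj C"
  shows "prod_assoc C S b c a \<cdot> (prod_swap C S a (pr S b c) \<cdot> prod_assoc C S a b c) =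
    par C S (ide C b) (prod_swap C S a c) \<cdot>
      (prod_assoc C S b a c \<cdot> par C S (prod_swap C S a b) (ide C c))"
  using assms unfolding prod_assoc_def par_def prod_swap_def by simp

lemma hexagon2:
  assumes "a \<in> obj C" "b \<in> obj C" "c \<in> obj C"
  shows "assoc_inv c a b \<cdot> (prod_swap C S (pr S a b) c \<cdot> assoc_inv a b c) =
    par C S (prod_swap C S a c) (ide C b) \<cdot>
      (assoc_inv a c b \<cdot> par C S (ide C a) (prod_swap C S b c))"
  using assms unfolding assoc_inv_def par_def prod_swap_def by simp

end

lemma cat_prod_simps [simp]:
  "obj (cat_prod C D) = obj C \<times> obj D" "arr (cat_prod C D) = arr C \<times> arr D"
  "src (cat_prod C D) fg = (src C (fst fg), src D (snd fg))"
  "tgt (cat_prod C D) fg = (tgt C (fst fg), tgt D (snd fg))"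
  "ide (cat_prod C D) xy = (ide C (fst xy), ide D (snd xy))"
  "cmp (cat_prod C D) gg ff = (cmp C (fst gg) (fst ff), cmp D (snd gg) (snd ff))"
  by (cases fg; cases xy; cases gg; cases ff; simp add: cat_prod_def)+

lemma category_cat_prod: "category C \<Longrightarrow> category D \<Longrightarrow> category (cat_prod C D)"
  by (fastforce simp: category_def hom_def)

lemma cat_unit_simps [simp]:
  "obj cat_unit = UNIV" "arr cat_unit = UNIV"
  by (simp_all add: cat_unit_def)

lemma category_cat_unit: "category cat_unit"
  by (simp add: category_def cat_unit_def hom_def)

context fin_prod
begin

lemma functor_prod_func: "is_functor (cat_prod C C) C (prod_func C S)"
  by (auto simp: is_functor_def category category_cat_prod prod_func_def hom_def par_cmp par_ide)

lemma monoidal_category_cartesian: "monoidal_category C (cartesian_monoidal C S)"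
proof -
  have "is_functor C C func_id" by (simp add: is_functor_def category func_id_def hom_def)
  then show ?thesis
  unfolding monoidal_category_def cartesian_monoidal_def nat_iso_def nat_trans_def
  using functor_prod_func
  by (auto simp: category functor_prod_func prod_assoc_natural pentagon triangle is_iso_pi_one is_iso_prod_assoc
     is_functor_def func_comp_def func_prod_def func_id_def func_assoc_def prod_func_def
     hom_def category_cat_prod par_cmp par_ide pi_par simp flip: par_cmp)
qed

end

section \<open>Pseudofunctors arising from categories over the base\<close>

text \<open>\<open>D f\<close> consists of the arrows of \<open>E\<close> lying over \<open>f\<close>, and \<open>L f x\<close> is the chosen cocartesian lift.
  There is no functor from \<open>E\<close> to \<open>A\<close>, and the sets \<open>D f\<close> may overlap: a pseudofunctor precomposed
  with \<open>K\<close> keeps its total category, and the arrows over \<open>f\<close> become those over \<open>K f\<close>.\<close>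

locale displayed =
  A: categ A + E: categ E
  for A :: "('a, 'f) cat" and E :: "('o, 'm) cat" +
  fixes G :: "('a, 'f, 'o, 'm) psf" and D :: "'f \<Rightarrow> 'm set" and L :: "'f \<Rightarrow> 'o \<Rightarrow> 'm"
  assumes pobj_simps [simp]:
      "a \<in> obj A \<Longrightarrow> arr (pobj G a) = D (ide A a)"
      "a \<in> obj A \<Longrightarrow> src (pobj G a) = src E" "a \<in> obj A \<Longrightarrow> tgt (pobj G a) = tgt E"
      "a \<in> obj A \<Longrightarrow> ide (pobj G a) = ide E" "a \<in> obj A \<Longrightarrow> cmp (pobj G a) = cmp E"
    and fibre_obj: "a \<in> obj A \<Longrightarrow> x \<in> obj (pobj G a) \<Longrightarrow> x \<in> obj E"
    and over_arr: "f \<in> arr A \<Longrightarrow> h \<in> D f \<Longrightarrow> h \<in> arr E"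
    and over_src: "f \<in> arr A \<Longrightarrow> h \<in> D f \<Longrightarrow> src E h \<in> obj (pobj G (src A f))"
    and over_tgt: "f \<in> arr A \<Longrightarrow> h \<in> D f \<Longrightarrow> tgt E h \<in> obj (pobj G (tgt A f))"
    and over_ide: "a \<in> obj A \<Longrightarrow> x \<in> obj (pobj G a) \<Longrightarrow> ide E x \<in> D (ide A a)"
    and over_cmp: "f \<in> arr A \<Longrightarrow> g \<in> arr A \<Longrightarrow> src A g = tgt A f \<Longrightarrow> h \<in> D f \<Longrightarrow> k \<in> D g \<Longrightarrow>
      src E k = tgt E h \<Longrightarrow> k \<cdot>\<^bsub>E\<^esub> h \<in> D (g \<cdot>\<^bsub>A\<^esub> f)"
    and lift_over: "f \<in> arr A \<Longrightarrow> x \<in> obj (pobj G (src A f)) \<Longrightarrow> L f x \<in> D f"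
    and lift_src [simp]: "f \<in> arr A \<Longrightarrow> x \<in> obj (pobj G (src A f)) \<Longrightarrow> src E (L f x) = x"
    and lift_factor: "f \<in> arr A \<Longrightarrow> g \<in> arr A \<Longrightarrow> src A g = tgt A f \<Longrightarrow> x \<in> obj (pobj G (src A f)) \<Longrightarrow>
      h \<in> D (g \<cdot>\<^bsub>A\<^esub> f) \<Longrightarrow> src E h = x \<Longrightarrow>
      \<exists>u. u \<in> D g \<and> src E u = tgt E (L f x) \<and> u \<cdot>\<^bsub>E\<^esub> L f x = h"
    and lift_unique: "f \<in> arr A \<Longrightarrow> g \<in> arr A \<Longrightarrow> src A g = tgt A f \<Longrightarrow> x \<in> obj (pobj G (src A f)) \<Longrightarrow>
      u \<in> D g \<Longrightarrow> v \<in> D g \<Longrightarrow> src E u = tgt E (L f x) \<Longrightarrow> src E v = tgt E (L f x) \<Longrightarrow>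
      u \<cdot>\<^bsub>E\<^esub> L f x = v \<cdot>\<^bsub>E\<^esub> L f x \<Longrightarrow> u = v"
    and pmor_obj: "f \<in> arr A \<Longrightarrow> x \<in> obj (pobj G (src A f)) \<Longrightarrow> fo (pmor G f) x = tgt E (L f x)"
    and pmor_over: "f \<in> arr A \<Longrightarrow> u \<in> D (ide A (src A f)) \<Longrightarrow> fm (pmor G f) u \<in> D (ide A (tgt A f))"
    and pmor_src: "f \<in> arr A \<Longrightarrow> u \<in> D (ide A (src A f)) \<Longrightarrow> src E (fm (pmor G f) u) = tgt E (L f (src E u))"
    and pmor_lift: "f \<in> arr A \<Longrightarrow> u \<in> D (ide A (src A f)) \<Longrightarrow>
      fm (pmor G f) u \<cdot>\<^bsub>E\<^esub> L f (src E u) = L f (tgt E u) \<cdot>\<^bsub>E\<^esub> u"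
    and pcomp_over: "f \<in> arr A \<Longrightarrow> g \<in> arr A \<Longrightarrow> src A g = tgt A f \<Longrightarrow> x \<in> obj (pobj G (src A f)) \<Longrightarrow>
      pcomp G g f x \<in> D (ide A (tgt A g))"
    and pcomp_src: "f \<in> arr A \<Longrightarrow> g \<in> arr A \<Longrightarrow> src A g = tgt A f \<Longrightarrow> x \<in> obj (pobj G (src A f)) \<Longrightarrow>
      src E (pcomp G g f x) = tgt E (L (g \<cdot>\<^bsub>A\<^esub> f) x)"
    and pcomp_lift: "f \<in> arr A \<Longrightarrow> g \<in> arr A \<Longrightarrow> src A g = tgt A f \<Longrightarrow> x \<in> obj (pobj G (src A f)) \<Longrightarrow>
      pcomp G g f x \<cdot>\<^bsub>E\<^esub> L (g \<cdot>\<^bsub>A\<^esub> f) x = L g (tgt E (L f x)) \<cdot>\<^bsub>E\<^esub> L f x"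
    and punit_over: "a \<in> obj A \<Longrightarrow> x \<in> obj (pobj G a) \<Longrightarrow> punit G a x \<in> D (ide A a)"
    and punit_src: "a \<in> obj A \<Longrightarrow> x \<in> obj (pobj G a) \<Longrightarrow> src E (punit G a x) = tgt E (L (ide A a) x)"
    and punit_lift: "a \<in> obj A \<Longrightarrow> x \<in> obj (pobj G a) \<Longrightarrow> punit G a x \<cdot>\<^bsub>E\<^esub> L (ide A a) x = ide E x"
begin

lemma lift_simps [simp]:
  assumes "f \<in> arr A" "x \<in> obj (pobj G (src A f))"
  shows "L f x \<in> arr E" "tgt E (L f x) \<in> obj (pobj G (tgt A f))"
  using assms lift_over over_arr over_tgt by blast+

lemma vert_cmp:
  "a \<in> obj A \<Longrightarrow> h \<in> D (ide A a) \<Longrightarrow> k \<in> D (ide A a) \<Longrightarrow> src E k = tgt E h \<Longrightarrow> k \<cdot>\<^bsub>E\<^esub> h \<in> D (ide A a)"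
  using over_cmp[of "ide A a" "ide A a" h k] by simp

lemma vert_simps:
  assumes "a \<in> obj A" "u \<in> D (ide A a)"
  shows "u \<in> arr E" "src E u \<in> obj (pobj G a)" "tgt E u \<in> obj (pobj G a)"
  using assms over_arr[of "ide A a" u] over_src[of "ide A a" u] over_tgt[of "ide A a" u] by auto

lemma vert_over:
  assumes "f \<in> arr A" "h \<in> D f" "u \<in> D (ide A (tgt A f))" "src E u = tgt E h"
  shows "u \<cdot>\<^bsub>E\<^esub> h \<in> D f"
  using assms over_cmp[of f "ide A (tgt A f)" h u] by simp

lemma over_vert:
  assumes "f \<in> arr A" "h \<in> D f" "u \<in> D (ide A (src A f))" "src E h = tgt E u"
  shows "h \<cdot>\<^bsub>E\<^esub> u \<in> D f"
  using assms over_cmp[of "ide A (src A f)" f u h] by simp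

lemma vert_unique:
  assumes "f \<in> arr A" "x \<in> obj (pobj G (src A f))" "u \<in> D (ide A (tgt A f))" "v \<in> D (ide A (tgt A f))"
    "src E u = tgt E (L f x)" "src E v = tgt E (L f x)" "u \<cdot>\<^bsub>E\<^esub> L f x = v \<cdot>\<^bsub>E\<^esub> L f x"
  shows "u = v"
  using lift_unique[of f "ide A (tgt A f)" x u v] assms by simp

lemma vert_factor:
  assumes "f \<in> arr A" "h \<in> D f"
  obtains u where "u \<in> D (ide A (tgt A f))" "src E u = tgt E (L f (src E h))" "u \<cdot>\<^bsub>E\<^esub> L f (src E h) = h"
    "tgt E u = tgt E h"
proof -
  have s: "src E h \<in> obj (pobj G (src A f))" using assms over_src by blast
  then obtain u where u: "u \<in> D (ide A (tgt A f))" "src E u = tgt E (L f (src E h))" "u \<cdot>\<^bsub>E\<^esub> L f (src E h) = h"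
    using lift_factor[of f "ide A (tgt A f)" "src E h" h] assms by auto
  moreover have "tgt E u = tgt E h"
    using E.tgt_cmp[of "L f (src E h)" u] u s assms vert_simps(1)[OF _ u(1)] by simp
  ultimately show ?thesis using that by blast
qed

lemma category_fibre: "a \<in> obj A \<Longrightarrow> category (pobj G a)"
  unfolding category_def hom_def
  by (auto simp: vert_simps over_ide fibre_obj vert_cmp)

lemma pmor_simps:
  assumes "f \<in> arr A" "u \<in> D (ide A (src A f))"
  shows "fm (pmor G f) u \<in> arr E" "tgt E (fm (pmor G f) u) = tgt E (L f (tgt E u))"
proof -
  have s: "src E u \<in> obj (pobj G (src A f))" "tgt E u \<in> obj (pobj G (src A f))" "u \<in> arr E"
    using vert_simps[of "src A f" u] assms by auto
  show m: "fm (pmor G f) u \<in> arr E"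
    using vert_simps(1)[of "tgt A f"] pmor_over[OF assms] assms by auto
  have "tgt E (fm (pmor G f) u) = tgt E (fm (pmor G f) u \<cdot>\<^bsub>E\<^esub> L f (src E u))"
    using E.tgt_cmp[OF _ m] s assms pmor_src by auto
  also have "\<dots> = tgt E (L f (tgt E u))"
    unfolding pmor_lift[OF assms] using s assms by auto
  finally show "tgt E (fm (pmor G f) u) = tgt E (L f (tgt E u))" .
qed

lemma pmor_eqI:
  assumes "f \<in> arr A" "u \<in> D (ide A (src A f))" "w \<in> D (ide A (tgt A f))" "src E w = tgt E (L f (src E u))"
    "w \<cdot>\<^bsub>E\<^esub> L f (src E u) = L f (tgt E u) \<cdot>\<^bsub>E\<^esub> u"
  shows "fm (pmor G f) u = w"
proof -
  have x: "src E u \<in> obj (pobj G (src A f))" using vert_simps(2)[OF _ assms(2)] assms(1) by simp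
  show ?thesis
    by (rule vert_unique[OF assms(1) x pmor_over[OF assms(1,2)] assms(3) pmor_src[OF assms(1,2)] assms(4)])
      (simp only: pmor_lift[OF assms(1,2)] assms(5))
qed

lemma functor_pmor:
  assumes f: "f \<in> arr A"
  shows "is_functor (pobj G (src A f)) (pobj G (tgt A f)) (pmor G f)"
proof -
  have a: "src A f \<in> obj A" "tgt A f \<in> obj A" using f by auto
  have ide: "fm (pmor G f) (ide E x) = ide E (tgt E (L f x))" if "x \<in> obj (pobj G (src A f))" for x
  proof (rule pmor_eqI[OF f])
    have x: "x \<in> obj E" "tgt E (L f x) \<in> obj E"
      using that f fibre_obj[OF a(1)] fibre_obj[OF a(2), of "tgt E (L f x)"] by simp_all
    show "ide E x \<in> D (ide A (src A f))" using that a over_ide by blast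
    show "ide E (tgt E (L f x)) \<in> D (ide A (tgt A f))" using that a f by (auto intro: over_ide)
    show "src E (ide E (tgt E (L f x))) = tgt E (L f (src E (ide E x)))" using x by simp
    show "ide E (tgt E (L f x)) \<cdot>\<^bsub>E\<^esub> L f (src E (ide E x)) = L f (tgt E (ide E x)) \<cdot>\<^bsub>E\<^esub> ide E x"
      using x f that by simp
  qed
  have cmp: "fm (pmor G f) (v \<cdot>\<^bsub>E\<^esub> u) = fm (pmor G f) v \<cdot>\<^bsub>E\<^esub> fm (pmor G f) u"
    if u: "u \<in> D (ide A (src A f))" and v: "v \<in> D (ide A (src A f))" and uv: "src E v = tgt E u" for u v
  proof (rule pmor_eqI[OF f])
    note s = vert_simps[OF a(1) u] vert_simps[OF a(1) v] pmor_simps[OF f u] pmor_simps[OF f v]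
      pmor_src[OF f u] pmor_src[OF f v]
    show "v \<cdot>\<^bsub>E\<^esub> u \<in> D (ide A (src A f))" using a u v uv by (auto intro: vert_cmp)
    show "fm (pmor G f) v \<cdot>\<^bsub>E\<^esub> fm (pmor G f) u \<in> D (ide A (tgt A f))"
      using a u v uv f s by (intro vert_cmp) (auto simp: pmor_over)
    show "src E (fm (pmor G f) v \<cdot>\<^bsub>E\<^esub> fm (pmor G f) u) = tgt E (L f (src E (v \<cdot>\<^bsub>E\<^esub> u)))"
      using s uv by simp
    have "(fm (pmor G f) v \<cdot>\<^bsub>E\<^esub> fm (pmor G f) u) \<cdot>\<^bsub>E\<^esub> L f (src E u) = fm (pmor G f) v \<cdot>\<^bsub>E\<^esub> (L f (tgt E u) \<cdot>\<^bsub>E\<^esub> u)"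
      using s uv f by (simp add: pmor_lift[OF f u])
    also have "\<dots> = (L f (tgt E v) \<cdot>\<^bsub>E\<^esub> v) \<cdot>\<^bsub>E\<^esub> u"
      using E.cmp_reassoc[OF pmor_lift[OF f v], of u] s uv f by simp
    finally show "(fm (pmor G f) v \<cdot>\<^bsub>E\<^esub> fm (pmor G f) u) \<cdot>\<^bsub>E\<^esub> L f (src E (v \<cdot>\<^bsub>E\<^esub> u)) = L f (tgt E (v \<cdot>\<^bsub>E\<^esub> u)) \<cdot>\<^bsub>E\<^esub> (v
      \<cdot>\<^bsub>E\<^esub> u)"
      using s uv f by simp
  qed
  show ?thesis unfolding is_functor_def hom_def
    using f a by (auto simp: category_fibre pmor_obj pmor_over pmor_src pmor_simps vert_simps ide cmp)
qed

lemma is_iso_fibreI: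
  assumes "a \<in> obj A" "u \<in> D (ide A a)" "v \<in> D (ide A a)" "src E v = tgt E u" "tgt E v = src E u"
    "v \<cdot>\<^bsub>E\<^esub> u = ide E (src E u)" "u \<cdot>\<^bsub>E\<^esub> v = ide E (tgt E u)"
  shows "is_iso (pobj G a) u"
  using assms by (auto simp: is_iso_def inverse_arrows_def hom_def)

lemma iso_fibre:
  assumes "a \<in> obj A" "is_iso (pobj G a) u"
  shows "u \<in> D (ide A a)" "inv_arr (pobj G a) u \<in> D (ide A a)" "src E (inv_arr (pobj G a) u) = tgt E u"
    "tgt E (inv_arr (pobj G a) u) = src E u" "inv_arr (pobj G a) u \<cdot>\<^bsub>E\<^esub> u = ide E (src E u)"
    "u \<cdot>\<^bsub>E\<^esub> inv_arr (pobj G a) u = ide E (tgt E u)"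
proof -
  interpret P: categ "pobj G a" using assms category_fibre by unfold_locales
  show "u \<in> D (ide A a)" "inv_arr (pobj G a) u \<in> D (ide A a)" "src E (inv_arr (pobj G a) u) = tgt E u"
    "tgt E (inv_arr (pobj G a) u) = src E u" "inv_arr (pobj G a) u \<cdot>\<^bsub>E\<^esub> u = ide E (src E u)"
    "u \<cdot>\<^bsub>E\<^esub> inv_arr (pobj G a) u = ide E (tgt E u)"
    using P.inv_arr_simps[OF assms(2)] P.is_iso_arr[OF assms(2)] assms(1) by auto
qed

text \<open>Invertibility of 2-cells is a statement in a fibre, whereas the cancellations take place
  between non-vertical arrows; the two notions of inverse have to be matched.\<close>

lemma iso_fibre_total:
  assumes "a \<in> obj A" "is_iso (pobj G a) u"
  shows "is_iso E u" "inv_arr E u = inv_arr (pobj G a) u"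
proof -
  have "inverse_arrows E u (inv_arr (pobj G a) u)"
    using iso_fibre[OF assms] vert_simps assms(1) by (auto simp: inverse_arrows_def hom_def)
  then show "is_iso E u" "inv_arr E u = inv_arr (pobj G a) u"
    by (auto simp: is_iso_def intro: E.inv_arr_eqI)
qed

text \<open>The locale grants cancellation only for the chosen lifts. An arrow that a vertical
  isomorphism carries to a chosen lift inherits it: \<open>k\<close> is the lift followed by the
  inverse of \<open>t\<close>. This applies to images of lifts under transformations, which are in
  general not lifts themselves.\<close>

lemma iso_lift_unique:
  assumes "f \<in> arr A" "g \<in> arr A" "src A g = tgt A f" "k \<in> D f"
    and t: "is_iso (pobj G (tgt A f)) t" "src E t = tgt E k" "t \<cdot>\<^bsub>E\<^esub> k = L f (src E k)"
    and u: "u \<in> D g" "v \<in> D g" "src E u = tgt E k" "src E v = tgt E k" "u \<cdot>\<^bsub>E\<^esub> k = v \<cdot>\<^bsub>E\<^esub> k"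
  shows "u = v"
proof -
  let ?x = "src E k" and ?s = "inv_arr (pobj G (tgt A f)) t"
  have x: "?x \<in> obj (pobj G (src A f))" using assms over_src by blast
  have a: "tgt A f \<in> obj A" using assms by simp
  note ti = iso_fibre[OF a t(1)]
  note tv = vert_simps[OF a ti(1)] vert_simps[OF a ti(2)]
  have ua: "u \<in> arr E" "v \<in> arr E" "k \<in> arr E" using u assms over_arr by blast+
  have tt: "tgt E t = tgt E (L f ?x)" using E.tgt_cmp[of k t] t tv ua by simp
  have k: "k = ?s \<cdot>\<^bsub>E\<^esub> L f ?x"
    using E.cmp_reassoc[OF ti(5), of k] t ti tv ua by simp
  have "u \<cdot>\<^bsub>E\<^esub> ?s = v \<cdot>\<^bsub>E\<^esub> ?s"
  proof (rule lift_unique[OF assms(1-3) x])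
    show "u \<cdot>\<^bsub>E\<^esub> ?s \<in> D g" "v \<cdot>\<^bsub>E\<^esub> ?s \<in> D g"
      using over_vert[of g _ ?s] u assms(1-3) ti t by auto
    show "src E (u \<cdot>\<^bsub>E\<^esub> ?s) = tgt E (L f ?x)" "src E (v \<cdot>\<^bsub>E\<^esub> ?s) = tgt E (L f ?x)"
      using u ua ti tv t tt by simp_all
    show "(u \<cdot>\<^bsub>E\<^esub> ?s) \<cdot>\<^bsub>E\<^esub> L f ?x = (v \<cdot>\<^bsub>E\<^esub> ?s) \<cdot>\<^bsub>E\<^esub> L f ?x"
      using u(5) k u ua ti tv t tt x assms(1) by simp
  qed
  then have "(u \<cdot>\<^bsub>E\<^esub> ?s) \<cdot>\<^bsub>E\<^esub> t = (v \<cdot>\<^bsub>E\<^esub> ?s) \<cdot>\<^bsub>E\<^esub> t" by simp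
  then show ?thesis using u ua ti tv t by simp
qed

lemma vert_tgt:
  assumes "a \<in> obj A" "u \<in> D (ide A a)" "h \<in> arr E" "u \<cdot>\<^bsub>E\<^esub> h = k" "src E u = tgt E h"
  shows "tgt E u = tgt E k"
  using assms E.tgt_cmp[of h u] vert_simps(1) by auto

lemma pcomp_simps:
  assumes f: "f \<in> arr A" "g \<in> arr A" "src A g = tgt A f" "x \<in> obj (pobj G (src A f))"
  shows "pcomp G g f x \<in> arr E" "tgt E (pcomp G g f x) = tgt E (L g (tgt E (L f x)))"
    "is_iso (pobj G (tgt A g)) (pcomp G g f x)"
proof -
  have a: "tgt A g \<in> obj A" using assms by simp
  have x': "tgt E (L f x) \<in> obj (pobj G (src A g))" using f by simp
  show p: "pcomp G g f x \<in> arr E" using vert_simps(1)[OF a] pcomp_over[OF f] by blast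
  have "tgt E (pcomp G g f x) = tgt E (L g (tgt E (L f x)) \<cdot>\<^bsub>E\<^esub> L f x)"
    by (rule vert_tgt[OF a pcomp_over[OF f] _ pcomp_lift[OF f]]) (use f pcomp_src in auto)
  also have "\<dots> = tgt E (L g (tgt E (L f x)))" using f x' by simp
  finally show pt: "tgt E (pcomp G g f x) = tgt E (L g (tgt E (L f x)))" .
  \<comment> \<open>The inverse \<open>v\<close> of the comparison comes from factoring the lift of
    \<open>g \<cdot> f\<close> twice: through \<open>L f x\<close>, leaving \<open>u\<close> over
    \<open>g\<close>, and then \<open>u\<close> through the lift of \<open>g\<close>, leaving the
    vertical arrow \<open>v\<close>.\<close>
  obtain u where u: "u \<in> D g" "src E u = tgt E (L f x)" "u \<cdot>\<^bsub>E\<^esub> L f x = L (g \<cdot>\<^bsub>A\<^esub> f) x"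
    using lift_factor[of f g x "L (g \<cdot>\<^bsub>A\<^esub> f) x"] f lift_over[of "g \<cdot>\<^bsub>A\<^esub> f" x] by auto
  then obtain v where v: "v \<in> D (ide A (tgt A g))" "src E v = tgt E (L g (tgt E (L f x)))"
      "v \<cdot>\<^bsub>E\<^esub> L g (tgt E (L f x)) = u" "tgt E v = tgt E u"
    using vert_factor[of g u] f by metis
  have ua: "u \<in> arr E" "v \<in> arr E" using u v f a over_arr vert_simps by blast+
  have ut: "tgt E u = tgt E (L (g \<cdot>\<^bsub>A\<^esub> f) x)" using u ua E.tgt_cmp[of "L f x" u] f by simp
  have vp: "v \<cdot>\<^bsub>E\<^esub> pcomp G g f x = ide E (tgt E (L (g \<cdot>\<^bsub>A\<^esub> f) x))"
  proof (rule vert_unique[of "g \<cdot>\<^bsub>A\<^esub> f" x])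
    show "g \<cdot>\<^bsub>A\<^esub> f \<in> arr A" "x \<in> obj (pobj G (src A (g \<cdot>\<^bsub>A\<^esub> f)))" using f by simp_all
    show "v \<cdot>\<^bsub>E\<^esub> pcomp G g f x \<in> D (ide A (tgt A (g \<cdot>\<^bsub>A\<^esub> f)))"
      using f v pt a by (simp add: vert_cmp pcomp_over)
    show "ide E (tgt E (L (g \<cdot>\<^bsub>A\<^esub> f) x)) \<in> D (ide A (tgt A (g \<cdot>\<^bsub>A\<^esub> f)))"
      using over_ide[of "tgt A g" "tgt E (L (g \<cdot>\<^bsub>A\<^esub> f) x)"] lift_simps(2)[of "g \<cdot>\<^bsub>A\<^esub> f" x] f by simp
    show "src E (v \<cdot>\<^bsub>E\<^esub> pcomp G g f x) = tgt E (L (g \<cdot>\<^bsub>A\<^esub> f) x)"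
      using ua p pt v pcomp_src[OF f] by simp
    show "src E (ide E (tgt E (L (g \<cdot>\<^bsub>A\<^esub> f) x))) = tgt E (L (g \<cdot>\<^bsub>A\<^esub> f) x)" using f by simp
    have "(v \<cdot>\<^bsub>E\<^esub> pcomp G g f x) \<cdot>\<^bsub>E\<^esub> L (g \<cdot>\<^bsub>A\<^esub> f) x = v \<cdot>\<^bsub>E\<^esub> (L g (tgt E (L f x)) \<cdot>\<^bsub>E\<^esub> L f x)"
      using f ua p pt v pcomp_src[OF f] by (simp add: pcomp_lift)
    also have "\<dots> = L (g \<cdot>\<^bsub>A\<^esub> f) x" using E.cmp_reassoc[OF v(3), of "L f x"] f ua x' v u by simp
    finally show "(v \<cdot>\<^bsub>E\<^esub> pcomp G g f x) \<cdot>\<^bsub>E\<^esub> L (g \<cdot>\<^bsub>A\<^esub> f) x =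
      ide E (tgt E (L (g \<cdot>\<^bsub>A\<^esub> f) x)) \<cdot>\<^bsub>E\<^esub> L (g \<cdot>\<^bsub>A\<^esub> f) x" using f by simp
  qed
  have pu: "pcomp G g f x \<cdot>\<^bsub>E\<^esub> u = L g (tgt E (L f x))"
  proof (rule lift_unique[OF f])
    show "pcomp G g f x \<cdot>\<^bsub>E\<^esub> u \<in> D g" using vert_over[of g u] f u pcomp_over[OF f] pcomp_src[OF f] ut by simp
    show "L g (tgt E (L f x)) \<in> D g" using lift_over f x' by blast
    show "src E (pcomp G g f x \<cdot>\<^bsub>E\<^esub> u) = tgt E (L f x)" using ua p pcomp_src[OF f] ut u by simp
    show "src E (L g (tgt E (L f x))) = tgt E (L f x)" using f x' by simp
    show "(pcomp G g f x \<cdot>\<^bsub>E\<^esub> u) \<cdot>\<^bsub>E\<^esub> L f x = L g (tgt E (L f x)) \<cdot>\<^bsub>E\<^esub> L f x"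
      using ua p pcomp_src[OF f] ut u f by (simp add: pcomp_lift[OF f])
  qed
  have pv: "pcomp G g f x \<cdot>\<^bsub>E\<^esub> v = ide E (tgt E (L g (tgt E (L f x))))"
  proof (rule vert_unique[OF f(2) x'])
    show "pcomp G g f x \<cdot>\<^bsub>E\<^esub> v \<in> D (ide A (tgt A g))"
      using f v pcomp_src[OF f] a ut by (simp add: vert_cmp pcomp_over)
    show "ide E (tgt E (L g (tgt E (L f x)))) \<in> D (ide A (tgt A g))"
      using over_ide[OF a] lift_simps(2) f x' by simp
    show "src E (pcomp G g f x \<cdot>\<^bsub>E\<^esub> v) = tgt E (L g (tgt E (L f x)))"
      using ua p pcomp_src[OF f] v ut by simp
    show "src E (ide E (tgt E (L g (tgt E (L f x))))) = tgt E (L g (tgt E (L f x)))"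
      using f x' by simp
    show "(pcomp G g f x \<cdot>\<^bsub>E\<^esub> v) \<cdot>\<^bsub>E\<^esub> L g (tgt E (L f x)) = ide E (tgt E (L g (tgt E (L f x)))) \<cdot>\<^bsub>E\<^esub> L g (tgt E (L f x))"
      using ua p pcomp_src[OF f] v ut f x' pu by simp
  qed
  show "is_iso (pobj G (tgt A g)) (pcomp G g f x)"
    by (rule is_iso_fibreI[OF a pcomp_over[OF f] v(1)])
      (use v pt ut pcomp_src[OF f] vp pv in simp_all)
qed

text \<open>The lift of an identity arrow is itself vertical, and it is the inverse of
  \<open>punit\<close>.\<close>

lemma punit_simps:
  assumes a: "a \<in> obj A" and x: "x \<in> obj (pobj G a)"
  shows "punit G a x \<in> arr E" "tgt E (punit G a x) = x" "is_iso (pobj G a) (punit G a x)"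
proof -
  show p: "punit G a x \<in> arr E" using vert_simps(1)[OF a] punit_over[OF a x] by blast
  have x': "x \<in> obj E" using fibre_obj a x by blast
  have L: "L (ide A a) x \<in> arr E" "src E (L (ide A a) x) = x" "L (ide A a) x \<in> D (ide A a)"
    "tgt E (L (ide A a) x) \<in> obj (pobj G a)"
    using lift_simps[of "ide A a" x] lift_over[of "ide A a" x] a x by auto
  have "tgt E (punit G a x) = tgt E (ide E x)"
    by (rule vert_tgt[OF a punit_over[OF a x] _ punit_lift[OF a x]]) (use L punit_src a x in auto)
  then show pt: "tgt E (punit G a x) = x" using x' by simp
  have pv: "L (ide A a) x \<cdot>\<^bsub>E\<^esub> punit G a x = ide E (tgt E (L (ide A a) x))"
  proof (rule vert_unique[of "ide A a" x])
    show "(L (ide A a) x \<cdot>\<^bsub>E\<^esub> punit G a x) \<cdot>\<^bsub>E\<^esub> L (ide A a) x = ide E (tgt E (L (ide A a) x)) \<cdot>\<^bsub>E\<^esub> L (ide A a) x"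
      using L p pt punit_src[OF a x] punit_lift[OF a x] by simp
  qed (use a x L p pt punit_src[OF a x] punit_over[OF a x] in \<open>auto intro!: vert_cmp over_ide\<close>)
  show "is_iso (pobj G a) (punit G a x)"
    by (rule is_iso_fibreI[OF a punit_over[OF a x] L(3)])
      (use L pt punit_src[OF a x] punit_lift[OF a x] pv in simp_all)
qed

text \<open>Cancel the lift of \<open>f\<close> first, between arrows lying over \<open>g\<close>,
  and then the lift of \<open>g\<close>, between vertical arrows.\<close>

lemma lift_unique2:
  assumes "f \<in> arr A" "g \<in> arr A" "src A g = tgt A f" "x \<in> obj (pobj G (src A f))"
    "u \<in> D (ide A (tgt A g))" "v \<in> D (ide A (tgt A g))"
    "src E u = tgt E (L g (tgt E (L f x)))" "src E v = tgt E (L g (tgt E (L f x)))"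
    "u \<cdot>\<^bsub>E\<^esub> (L g (tgt E (L f x)) \<cdot>\<^bsub>E\<^esub> L f x) = v \<cdot>\<^bsub>E\<^esub> (L g (tgt E (L f x)) \<cdot>\<^bsub>E\<^esub> L f x)"
  shows "u = v"
proof -
  have x': "tgt E (L f x) \<in> obj (pobj G (src A g))" using assms by simp
  have ua: "u \<in> arr E" "v \<in> arr E" using assms vert_simps[of "tgt A g"] by auto
  have "u \<cdot>\<^bsub>E\<^esub> L g (tgt E (L f x)) = v \<cdot>\<^bsub>E\<^esub> L g (tgt E (L f x))"
    by (rule lift_unique[OF assms(1-4)])
      (use assms x' ua vert_over[OF assms(2) lift_over[OF assms(2) x']] in simp_all)
  then show ?thesis using vert_unique[OF assms(2) x'] assms by blast
qed

text \<open>This equation and the laws for \<open>punit\<close> and \<open>pcomp\<close> below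
  equate vertical arrows out of the target of a lift, so \<open>vert_unique\<close> decides them.
  Here both sides, after the lift of \<open>g \<cdot> f\<close>, are the lift of \<open>f\<close> at
  \<open>tgt u\<close> preceded by \<open>u\<close> and followed by the lift of
  \<open>g\<close>.\<close>

lemma pcomp_natural:
  assumes f: "f \<in> arr A" "g \<in> arr A" "src A g = tgt A f" and u: "u \<in> D (ide A (src A f))"
  shows "pcomp G g f (tgt E u) \<cdot>\<^bsub>E\<^esub> fm (pmor G (g \<cdot>\<^bsub>A\<^esub> f)) u =
    fm (pmor G g) (fm (pmor G f) u) \<cdot>\<^bsub>E\<^esub> pcomp G g f (src E u)"
proof -
  have gf: "g \<cdot>\<^bsub>A\<^esub> f \<in> arr A" and ug: "u \<in> D (ide A (src A (g \<cdot>\<^bsub>A\<^esub> f)))" using f u by simp_all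
  note us = vert_simps[OF _ u]
  have x: "src E u \<in> obj (pobj G (src A f))" "tgt E u \<in> obj (pobj G (src A f))" "u \<in> arr E" using us f by auto
  have fu: "fm (pmor G f) u \<in> D (ide A (src A g))" using pmor_over[OF f(1) u] f by simp
  note p1 = pmor_simps[OF f(1) u] pmor_src[OF f(1) u]
  note p2 = pmor_simps[OF f(2) fu] pmor_src[OF f(2) fu]
  note p3 = pmor_simps[OF gf ug] pmor_src[OF gf ug]
  note c1 = pcomp_simps(1,2)[OF f x(1)] pcomp_src[OF f x(1)]
  note c2 = pcomp_simps(1,2)[OF f x(2)] pcomp_src[OF f x(2)]
  have l: "tgt E (L f (src E u)) \<in> obj (pobj G (src A g))" "tgt E (L f (tgt E u)) \<in> obj (pobj G (src A g))"
    using x f by simp_all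
  show ?thesis
  proof (rule vert_unique[OF gf])
    show "src E u \<in> obj (pobj G (src A (g \<cdot>\<^bsub>A\<^esub> f)))" using x f by simp
    show "pcomp G g f (tgt E u) \<cdot>\<^bsub>E\<^esub> fm (pmor G (g \<cdot>\<^bsub>A\<^esub> f)) u \<in> D (ide A (tgt A (g \<cdot>\<^bsub>A\<^esub> f)))"
      using pcomp_over[OF f x(2)] pmor_over[OF gf ug] f p3 c2 by (auto intro: vert_cmp)
    show "fm (pmor G g) (fm (pmor G f) u) \<cdot>\<^bsub>E\<^esub> pcomp G g f (src E u) \<in> D (ide A (tgt A (g \<cdot>\<^bsub>A\<^esub> f)))"
      using pcomp_over[OF f x(1)] pmor_over[OF f(2) fu] f p2 p1 c1 by (auto intro: vert_cmp)
    show "src E (pcomp G g f (tgt E u) \<cdot>\<^bsub>E\<^esub> fm (pmor G (g \<cdot>\<^bsub>A\<^esub> f)) u) = tgt E (L (g \<cdot>\<^bsub>A\<^esub> f) (src E u))"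
      using p3 c2 by simp
    show "src E (fm (pmor G g) (fm (pmor G f) u) \<cdot>\<^bsub>E\<^esub> pcomp G g f (src E u)) = tgt E (L (g \<cdot>\<^bsub>A\<^esub> f) (src E u))"
      using p1 p2 c1 by simp
    have "(pcomp G g f (tgt E u) \<cdot>\<^bsub>E\<^esub> fm (pmor G (g \<cdot>\<^bsub>A\<^esub> f)) u) \<cdot>\<^bsub>E\<^esub> L (g \<cdot>\<^bsub>A\<^esub> f) (src E u)
        = pcomp G g f (tgt E u) \<cdot>\<^bsub>E\<^esub> (L (g \<cdot>\<^bsub>A\<^esub> f) (tgt E u) \<cdot>\<^bsub>E\<^esub> u)"
      using p3 c2 x f by (simp add: pmor_lift[OF gf ug])
    also have "\<dots> = L g (tgt E (L f (tgt E u))) \<cdot>\<^bsub>E\<^esub> (L f (tgt E u) \<cdot>\<^bsub>E\<^esub> u)"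
      using E.cmp_reassoc[OF pcomp_lift[OF f x(2)], of u] c2 x f l by simp
    also have "\<dots> = (fm (pmor G g) (fm (pmor G f) u) \<cdot>\<^bsub>E\<^esub> L g (tgt E (L f (src E u)))) \<cdot>\<^bsub>E\<^esub> L f (src E u)"
      using pmor_lift[OF f(2) fu] pmor_lift[OF f(1) u] p1 p2 x f l by simp
    also have "\<dots> = (fm (pmor G g) (fm (pmor G f) u) \<cdot>\<^bsub>E\<^esub> pcomp G g f (src E u)) \<cdot>\<^bsub>E\<^esub> L (g \<cdot>\<^bsub>A\<^esub> f) (src E u)"
      using pcomp_lift[OF f x(1)] p1 p2 c1 x f l by simp
    finally show "(pcomp G g f (tgt E u) \<cdot>\<^bsub>E\<^esub> fm (pmor G (g \<cdot>\<^bsub>A\<^esub> f)) u) \<cdot>\<^bsub>E\<^esub> L (g \<cdot>\<^bsub>A\<^esub> f) (src E u) =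
      (fm (pmor G g) (fm (pmor G f) u) \<cdot>\<^bsub>E\<^esub> pcomp G g f (src E u)) \<cdot>\<^bsub>E\<^esub> L (g \<cdot>\<^bsub>A\<^esub> f) (src E u)" .
  qed
qed

lemma punit_natural:
  assumes a: "a \<in> obj A" and u: "u \<in> D (ide A a)"
  shows "punit G a (tgt E u) \<cdot>\<^bsub>E\<^esub> fm (pmor G (ide A a)) u = u \<cdot>\<^bsub>E\<^esub> punit G a (src E u)"
proof -
  have i: "ide A a \<in> arr A" "u \<in> D (ide A (src A (ide A a)))" using a u by simp_all
  note x = vert_simps[OF a u]
  note p = pmor_simps[OF i] pmor_src[OF i]
  note c1 = punit_simps(1,2)[OF a x(2)] punit_src[OF a x(2)]
  note c2 = punit_simps(1,2)[OF a x(3)] punit_src[OF a x(3)]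
  have l: "L (ide A a) (src E u) \<in> arr E" "src E (L (ide A a) (src E u)) = src E u"
    "L (ide A a) (tgt E u) \<in> arr E" "src E (L (ide A a) (tgt E u)) = tgt E u"
    using lift_simps[of "ide A a"] lift_src[of "ide A a"] a x by auto
  show ?thesis
  proof (rule vert_unique[OF i(1)])
    show "src E u \<in> obj (pobj G (src A (ide A a)))" using x a by simp
    show "punit G a (tgt E u) \<cdot>\<^bsub>E\<^esub> fm (pmor G (ide A a)) u \<in> D (ide A (tgt A (ide A a)))"
      using punit_over[OF a x(3)] pmor_over[OF i] a p c2 by (auto intro: vert_cmp)
    show "u \<cdot>\<^bsub>E\<^esub> punit G a (src E u) \<in> D (ide A (tgt A (ide A a)))"
      using punit_over[OF a x(2)] u a p c1 by (auto intro: vert_cmp)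
    show "(punit G a (tgt E u) \<cdot>\<^bsub>E\<^esub> fm (pmor G (ide A a)) u) \<cdot>\<^bsub>E\<^esub> L (ide A a) (src E u) =
      (u \<cdot>\<^bsub>E\<^esub> punit G a (src E u)) \<cdot>\<^bsub>E\<^esub> L (ide A a) (src E u)"
      using p c1 c2 l x pmor_lift[OF i] punit_lift[OF a x(2)] E.cmp_reassoc[OF punit_lift[OF a x(3)], of u]
      by simp
  qed (use p c1 c2 x in simp_all)
qed

lemma pcomp_punit:
  assumes f: "f \<in> arr A" and x: "x \<in> obj (pobj G (src A f))"
  shows "fm (pmor G f) (punit G (src A f) x) \<cdot>\<^bsub>E\<^esub> pcomp G f (ide A (src A f)) x = ide E (tgt E (L f x))"
    and "punit G (tgt A f) (tgt E (L f x)) \<cdot>\<^bsub>E\<^esub> pcomp G (ide A (tgt A f)) f x = ide E (tgt E (L f x))"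
proof -
  let ?i = "ide A (src A f)" and ?j = "ide A (tgt A f)"
  have a: "src A f \<in> obj A" "tgt A f \<in> obj A" using f by simp_all
  have y: "tgt E (L f x) \<in> obj (pobj G (tgt A f))" using f x by simp
  have x': "x \<in> obj (pobj G (src A ?i))" using x a by simp
  note pa = punit_over[OF a(1) x] punit_simps[OF a(1) x] punit_src[OF a(1) x] punit_lift[OF a(1) x]
  note pb = punit_over[OF a(2) y] punit_simps[OF a(2) y] punit_src[OF a(2) y] punit_lift[OF a(2) y]
  have ci: "?i \<in> arr A" "f \<in> arr A" "src A f = tgt A ?i" using f by simp_all
  note c = pcomp_over[OF ci x'] pcomp_simps[OF ci x'] pcomp_src[OF ci x'] pcomp_lift[OF ci x']
  have cj: "f \<in> arr A" "?j \<in> arr A" "src A ?j = tgt A f" using f by simp_all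
  note d = pcomp_over[OF cj x] pcomp_simps[OF cj x] pcomp_src[OF cj x] pcomp_lift[OF cj x]
  note m = pmor_over[OF f pa(1)] pmor_simps[OF f pa(1)] pmor_src[OF f pa(1)] pmor_lift[OF f pa(1)]
  have l: "L ?i x \<in> arr E" "src E (L ?i x) = x" "tgt E (L ?i x) \<in> obj (pobj G (src A f))"
    using lift_simps[of ?i x] lift_src[of ?i x] x a by auto
  have l': "L ?j (tgt E (L f x)) \<in> arr E" "src E (L ?j (tgt E (L f x))) = tgt E (L f x)"
    using lift_simps[of ?j] lift_src[of ?j] y a by auto
  show "fm (pmor G f) (punit G (src A f) x) \<cdot>\<^bsub>E\<^esub> pcomp G f ?i x = ide E (tgt E (L f x))"
  proof (rule vert_unique[OF f x])
    show "fm (pmor G f) (punit G (src A f) x) \<cdot>\<^bsub>E\<^esub> pcomp G f ?i x \<in> D ?j"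
      using m c a f pa by (intro vert_cmp) simp_all
    show "ide E (tgt E (L f x)) \<in> D ?j" using over_ide a y by blast
    show "src E (fm (pmor G f) (punit G (src A f) x) \<cdot>\<^bsub>E\<^esub> pcomp G f ?i x) = tgt E (L f x)"
      "src E (ide E (tgt E (L f x))) = tgt E (L f x)" using m c f x pa by simp_all
    have "fm (pmor G f) (punit G (src A f) x) \<cdot>\<^bsub>E\<^esub> (pcomp G f ?i x \<cdot>\<^bsub>E\<^esub> L f x)
      = fm (pmor G f) (punit G (src A f) x) \<cdot>\<^bsub>E\<^esub> (L f (tgt E (L ?i x)) \<cdot>\<^bsub>E\<^esub> L ?i x)"
      using c f by simp
    also have "\<dots> = L f x \<cdot>\<^bsub>E\<^esub> (punit G (src A f) x \<cdot>\<^bsub>E\<^esub> L ?i x)"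
      using E.cmp_reassoc[OF m(5), of "L ?i x"] m l pa f x by simp
    finally show "(fm (pmor G f) (punit G (src A f) x) \<cdot>\<^bsub>E\<^esub> pcomp G f ?i x) \<cdot>\<^bsub>E\<^esub> L f x = ide E (tgt E (L f x)) \<cdot>\<^bsub>E\<^esub> L f x"
      using m c pa f x by simp
  qed
  show "punit G (tgt A f) (tgt E (L f x)) \<cdot>\<^bsub>E\<^esub> pcomp G ?j f x = ide E (tgt E (L f x))"
  proof (rule vert_unique[OF f x])
    show "punit G (tgt A f) (tgt E (L f x)) \<cdot>\<^bsub>E\<^esub> pcomp G ?j f x \<in> D ?j"
      using pb d a f by (intro vert_cmp) simp_all
    show "ide E (tgt E (L f x)) \<in> D ?j" using over_ide a y by blast
    show "src E (punit G (tgt A f) (tgt E (L f x)) \<cdot>\<^bsub>E\<^esub> pcomp G ?j f x) = tgt E (L f x)"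
      "src E (ide E (tgt E (L f x))) = tgt E (L f x)" using pb d f x by simp_all
    have "punit G (tgt A f) (tgt E (L f x)) \<cdot>\<^bsub>E\<^esub> (pcomp G ?j f x \<cdot>\<^bsub>E\<^esub> L f x)
      = punit G (tgt A f) (tgt E (L f x)) \<cdot>\<^bsub>E\<^esub> (L ?j (tgt E (L f x)) \<cdot>\<^bsub>E\<^esub> L f x)"
      using d f by simp
    also have "\<dots> = ide E (tgt E (L f x)) \<cdot>\<^bsub>E\<^esub> L f x"
      by (rule E.cmp_reassoc[OF pb(6)]) (use pb l' f x in simp_all)
    finally show "(punit G (tgt A f) (tgt E (L f x)) \<cdot>\<^bsub>E\<^esub> pcomp G ?j f x) \<cdot>\<^bsub>E\<^esub> L f x = ide E (tgt E (L f x)) \<cdot>\<^bsub>E\<^esub> L f x"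
      using pb d f x by simp
  qed
qed

text \<open>After the lift of \<open>h \<cdot> (g \<cdot> f)\<close> both sides become the composite
  of the successive lifts of \<open>f\<close>, \<open>g\<close> and \<open>h\<close>.\<close>

lemma pcomp_assoc:
  assumes f: "f \<in> arr A" "g \<in> arr A" "h \<in> arr A" "src A g = tgt A f" "src A h = tgt A g"
    and x: "x \<in> obj (pobj G (src A f))"
  shows "fm (pmor G h) (pcomp G g f x) \<cdot>\<^bsub>E\<^esub> pcomp G h (g \<cdot>\<^bsub>A\<^esub> f) x =
    pcomp G h g (tgt E (L f x)) \<cdot>\<^bsub>E\<^esub> pcomp G (h \<cdot>\<^bsub>A\<^esub> g) f x"
proof -
  let ?y = "tgt E (L f x)"
  have y: "?y \<in> obj (pobj G (src A g))" and z: "tgt E (L g ?y) \<in> obj (pobj G (src A h))" using f x by simp_all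
  have w: "tgt E (L (g \<cdot>\<^bsub>A\<^esub> f) x) \<in> obj (pobj G (src A h))"
    using lift_simps(2)[of "g \<cdot>\<^bsub>A\<^esub> f" x] f x by simp
  have gf: "g \<cdot>\<^bsub>A\<^esub> f \<in> arr A" "h \<in> arr A" "src A h = tgt A (g \<cdot>\<^bsub>A\<^esub> f)" "x \<in> obj (pobj G (src A (g \<cdot>\<^bsub>A\<^esub> f)))"
    and hg: "f \<in> arr A" "h \<cdot>\<^bsub>A\<^esub> g \<in> arr A" "src A (h \<cdot>\<^bsub>A\<^esub> g) = tgt A f" using f x by simp_all
  note c1 = pcomp_over[OF f(1,2,4) x] pcomp_simps[OF f(1,2,4) x] pcomp_src[OF f(1,2,4) x] pcomp_lift[OF f(1,2,4) x]
  note c2 = pcomp_over[OF gf] pcomp_simps[OF gf] pcomp_src[OF gf] pcomp_lift[OF gf]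
  note c3 = pcomp_over[OF f(2,3,5) y] pcomp_simps[OF f(2,3,5) y] pcomp_src[OF f(2,3,5) y] pcomp_lift[OF f(2,3,5) y]
  note c4 = pcomp_over[OF hg x] pcomp_simps[OF hg x] pcomp_src[OF hg x] pcomp_lift[OF hg x]
  have p: "pcomp G g f x \<in> D (ide A (src A h))" using c1 f by simp
  note m = pmor_over[OF f(3) p] pmor_simps[OF f(3) p] pmor_src[OF f(3) p] pmor_lift[OF f(3) p]
  have ass: "(h \<cdot>\<^bsub>A\<^esub> g) \<cdot>\<^bsub>A\<^esub> f = h \<cdot>\<^bsub>A\<^esub> (g \<cdot>\<^bsub>A\<^esub> f)" and t: "tgt A (h \<cdot>\<^bsub>A\<^esub> (g \<cdot>\<^bsub>A\<^esub> f)) = tgt A h"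
    and hgf: "h \<cdot>\<^bsub>A\<^esub> (g \<cdot>\<^bsub>A\<^esub> f) \<in> arr A" "x \<in> obj (pobj G (src A (h \<cdot>\<^bsub>A\<^esub> (g \<cdot>\<^bsub>A\<^esub> f))))"
    using f x by simp_all
  have l: "L (g \<cdot>\<^bsub>A\<^esub> f) x \<in> arr E" "L f x \<in> arr E" "L h (tgt E (L g ?y)) \<in> arr E" "L g ?y \<in> arr E"
    "src E (L h (tgt E (L g ?y))) = tgt E (L g ?y)" "src E (L g ?y) = ?y" "L (h \<cdot>\<^bsub>A\<^esub> (g \<cdot>\<^bsub>A\<^esub> f)) x \<in> arr E"
    "L (h \<cdot>\<^bsub>A\<^esub> g) ?y \<in> arr E" "src E (L (h \<cdot>\<^bsub>A\<^esub> g) ?y) = ?y"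
    "L h (tgt E (L (g \<cdot>\<^bsub>A\<^esub> f) x)) \<in> arr E" "src E (L h (tgt E (L (g \<cdot>\<^bsub>A\<^esub> f) x))) = tgt E (L (g \<cdot>\<^bsub>A\<^esub> f) x)"
    using f x y z w hgf by simp_all
  have ch: "tgt A (h \<cdot>\<^bsub>A\<^esub> g) = tgt A h" using f by simp
  show ?thesis
  proof (rule vert_unique[OF hgf])
    show "fm (pmor G h) (pcomp G g f x) \<cdot>\<^bsub>E\<^esub> pcomp G h (g \<cdot>\<^bsub>A\<^esub> f) x \<in> D (ide A (tgt A (h \<cdot>\<^bsub>A\<^esub> (g \<cdot>\<^bsub>A\<^esub> f))))"
      unfolding t using m c2 c1 f by (intro vert_cmp) simp_all
    show "pcomp G h g ?y \<cdot>\<^bsub>E\<^esub> pcomp G (h \<cdot>\<^bsub>A\<^esub> g) f x \<in> D (ide A (tgt A (h \<cdot>\<^bsub>A\<^esub> (g \<cdot>\<^bsub>A\<^esub> f))))"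
      unfolding t using c3 c4 f ch by (intro vert_cmp) simp_all
    show "src E (fm (pmor G h) (pcomp G g f x) \<cdot>\<^bsub>E\<^esub> pcomp G h (g \<cdot>\<^bsub>A\<^esub> f) x) = tgt E (L (h \<cdot>\<^bsub>A\<^esub> (g \<cdot>\<^bsub>A\<^esub> f)) x)"
      using m c1 c2 by simp
    show "src E (pcomp G h g ?y \<cdot>\<^bsub>E\<^esub> pcomp G (h \<cdot>\<^bsub>A\<^esub> g) f x) = tgt E (L (h \<cdot>\<^bsub>A\<^esub> (g \<cdot>\<^bsub>A\<^esub> f)) x)"
      using c3 c4 ass by simp
    have "fm (pmor G h) (pcomp G g f x) \<cdot>\<^bsub>E\<^esub> (pcomp G h (g \<cdot>\<^bsub>A\<^esub> f) x \<cdot>\<^bsub>E\<^esub> L (h \<cdot>\<^bsub>A\<^esub> (g \<cdot>\<^bsub>A\<^esub> f)) x)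
      = fm (pmor G h) (pcomp G g f x) \<cdot>\<^bsub>E\<^esub> (L h (tgt E (L (g \<cdot>\<^bsub>A\<^esub> f) x)) \<cdot>\<^bsub>E\<^esub> L (g \<cdot>\<^bsub>A\<^esub> f) x)"
      using c2 by simp
    also have "\<dots> = (L h (tgt E (L g ?y)) \<cdot>\<^bsub>E\<^esub> pcomp G g f x) \<cdot>\<^bsub>E\<^esub> L (g \<cdot>\<^bsub>A\<^esub> f) x"
      using E.cmp_reassoc[OF m(5), of "L (g \<cdot>\<^bsub>A\<^esub> f) x"] m c1 l by simp
    also have "\<dots> = L h (tgt E (L g ?y)) \<cdot>\<^bsub>E\<^esub> (L g ?y \<cdot>\<^bsub>E\<^esub> L f x)"
      using c1 l by simp
    also have "\<dots> = pcomp G h g ?y \<cdot>\<^bsub>E\<^esub> (L (h \<cdot>\<^bsub>A\<^esub> g) ?y \<cdot>\<^bsub>E\<^esub> L f x)"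
      using E.cmp_reassoc[OF c3(6), of "L f x"] c3 l by simp
    also have "\<dots> = pcomp G h g ?y \<cdot>\<^bsub>E\<^esub> (pcomp G (h \<cdot>\<^bsub>A\<^esub> g) f x \<cdot>\<^bsub>E\<^esub> L (h \<cdot>\<^bsub>A\<^esub> (g \<cdot>\<^bsub>A\<^esub> f)) x)"
      using c4 ass by simp
    finally show "(fm (pmor G h) (pcomp G g f x) \<cdot>\<^bsub>E\<^esub> pcomp G h (g \<cdot>\<^bsub>A\<^esub> f) x) \<cdot>\<^bsub>E\<^esub> L (h \<cdot>\<^bsub>A\<^esub> (g \<cdot>\<^bsub>A\<^esub> f)) x =
      (pcomp G h g ?y \<cdot>\<^bsub>E\<^esub> pcomp G (h \<cdot>\<^bsub>A\<^esub> g) f x) \<cdot>\<^bsub>E\<^esub> L (h \<cdot>\<^bsub>A\<^esub> (g \<cdot>\<^bsub>A\<^esub> f)) x"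
      using m c1 c2 c3 c4 l ass by simp
  qed
qed

lemma functor_pmor_cmp:
  assumes "f \<in> arr A" "g \<in> arr A" "src A g = tgt A f"
  shows "is_functor (pobj G (src A f)) (pobj G (tgt A g)) (func_comp (pmor G g) (pmor G f))"
  using functor_pmor[of f] functor_pmor[of g] assms
  by (fastforce simp: is_functor_def func_comp_def hom_def)

lemma functor_fibre_id: "a \<in> obj A \<Longrightarrow> is_functor (pobj G a) (pobj G a) func_id"
  by (auto simp: is_functor_def func_id_def hom_def category_fibre vert_simps over_ide vert_cmp)

text \<open>The locale postulates no functoriality, naturality, invertibility or coherence for
  \<open>pmor\<close>, \<open>pcomp\<close> and \<open>punit\<close>, only their equations with the
  lifts. Uniqueness of factorizations yields all the rest.\<close>

theorem pseudofunctor: "pseudofunctor A G"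
proof -
  have unit: "nat_iso (pobj G a) (pobj G a) (pmor G (ide A a)) func_id (punit G a)" if "a \<in> obj A" for a
    using that functor_pmor[of "ide A a"] functor_fibre_id[of a]
    by (auto simp: nat_iso_def nat_trans_def hom_def func_id_def punit_over punit_src punit_simps
        pmor_obj punit_natural)
  have comp: "nat_iso (pobj G (src A f)) (pobj G (tgt A g)) (pmor G (g \<cdot>\<^bsub>A\<^esub> f)) (func_comp (pmor G g) (pmor G f)) (pcomp
    G g f)"
    if "f \<in> arr A" "g \<in> arr A" "src A g = tgt A f" for f g
    using that functor_pmor[of "g \<cdot>\<^bsub>A\<^esub> f"] functor_pmor_cmp[of f g]
    by (auto simp: nat_iso_def nat_trans_def hom_def func_comp_def pcomp_over pcomp_src pcomp_simps
        pmor_obj pcomp_natural)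
  show ?thesis
    unfolding pseudofunctor_def
    using unit comp by (auto simp: A.category category_fibre functor_pmor pmor_obj pcomp_punit pcomp_assoc)
qed

end

text \<open>\<open>\<Phi>\<close> is the action of \<open>\<tau>\<close> on arrows over the base. It is indexed by the base arrow since
  \<open>E\<close> does not determine it.\<close>

locale displayed_nat =
  G: displayed A E G D L + H: displayed A E' H D' L'
  for A :: "('a, 'f) cat"
    and E :: "('o, 'm) cat" and G :: "('a, 'f, 'o, 'm) psf" and D :: "'f \<Rightarrow> 'm set" and L :: "'f \<Rightarrow> 'o \<Rightarrow> 'm"
    and E' :: "('p, 'n) cat" and H :: "('a, 'f, 'p, 'n) psf" and D' :: "'f \<Rightarrow> 'n set" and L' :: "'f \<Rightarrow> 'p \<Rightarrow> 'n" +
  fixes \<tau> :: "('a, 'f, 'o, 'm, 'p, 'n) pnt" and \<Phi> :: "'f \<Rightarrow> 'm \<Rightarrow> 'n"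
  assumes Phi_obj: "a \<in> obj A \<Longrightarrow> x \<in> obj (pobj G a) \<Longrightarrow> fo (tcomp \<tau> a) x \<in> obj (pobj H a)"
    and Phi_over: "f \<in> arr A \<Longrightarrow> h \<in> D f \<Longrightarrow> \<Phi> f h \<in> D' f"
    and Phi_src: "f \<in> arr A \<Longrightarrow> h \<in> D f \<Longrightarrow> src E' (\<Phi> f h) = fo (tcomp \<tau> (src A f)) (src E h)"
    and Phi_tgt: "f \<in> arr A \<Longrightarrow> h \<in> D f \<Longrightarrow> tgt E' (\<Phi> f h) = fo (tcomp \<tau> (tgt A f)) (tgt E h)"
    and Phi_ide: "a \<in> obj A \<Longrightarrow> x \<in> obj (pobj G a) \<Longrightarrow> \<Phi> (ide A a) (ide E x) = ide E' (fo (tcomp \<tau> a) x)"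
    and Phi_cmp: "f \<in> arr A \<Longrightarrow> g \<in> arr A \<Longrightarrow> src A g = tgt A f \<Longrightarrow> h \<in> D f \<Longrightarrow> k \<in> D g \<Longrightarrow>
      src E k = tgt E h \<Longrightarrow> \<Phi> (g \<cdot>\<^bsub>A\<^esub> f) (k \<cdot>\<^bsub>E\<^esub> h) = \<Phi> g k \<cdot>\<^bsub>E'\<^esub> \<Phi> f h"
    and Phi_vert: "a \<in> obj A \<Longrightarrow> u \<in> D (ide A a) \<Longrightarrow> fm (tcomp \<tau> a) u = \<Phi> (ide A a) u"
    and tiso_iso: "f \<in> arr A \<Longrightarrow> x \<in> obj (pobj G (src A f)) \<Longrightarrow> is_iso (pobj H (tgt A f)) (tiso \<tau> f x)"
    and tiso_src: "f \<in> arr A \<Longrightarrow> x \<in> obj (pobj G (src A f)) \<Longrightarrow>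
      src E' (tiso \<tau> f x) = fo (tcomp \<tau> (tgt A f)) (tgt E (L f x))"
    and tiso_lift: "f \<in> arr A \<Longrightarrow> x \<in> obj (pobj G (src A f)) \<Longrightarrow>
      tiso \<tau> f x \<cdot>\<^bsub>E'\<^esub> \<Phi> f (L f x) = L' f (fo (tcomp \<tau> (src A f)) x)"
begin

lemma Phi_arr: "f \<in> arr A \<Longrightarrow> h \<in> D f \<Longrightarrow> \<Phi> f h \<in> arr E'"
  using Phi_over H.over_arr by blast

lemma tiso_simps:
  assumes "f \<in> arr A" "x \<in> obj (pobj G (src A f))"
  shows "tiso \<tau> f x \<in> D' (ide A (tgt A f))" "tiso \<tau> f x \<in> arr E'"
    "tgt E' (tiso \<tau> f x) = tgt E' (L' f (fo (tcomp \<tau> (src A f)) x))"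
proof -
  have a: "tgt A f \<in> obj A" using assms by simp
  have l: "L f x \<in> D f" using G.lift_over assms by blast
  show t: "tiso \<tau> f x \<in> D' (ide A (tgt A f))" using H.iso_fibre(1)[OF a tiso_iso[OF assms]] .
  show "tiso \<tau> f x \<in> arr E'" using H.vert_simps(1)[OF a t] .
  show "tgt E' (tiso \<tau> f x) = tgt E' (L' f (fo (tcomp \<tau> (src A f)) x))"
    by (rule H.vert_tgt[OF a t Phi_arr[OF assms(1) l] tiso_lift[OF assms]])
      (simp add: tiso_src[OF assms] Phi_tgt[OF assms(1) l])
qed

lemma Phi_lift_simps:
  assumes "f \<in> arr A" "x \<in> obj (pobj G (src A f))"
  shows "\<Phi> f (L f x) \<in> D' f" "\<Phi> f (L f x) \<in> arr E'" "src E' (\<Phi> f (L f x)) = fo (tcomp \<tau> (src A f)) x"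
    "tgt E' (\<Phi> f (L f x)) = fo (tcomp \<tau> (tgt A f)) (tgt E (L f x))"
  using assms G.lift_over[OF assms] by (simp_all add: Phi_over Phi_arr Phi_src Phi_tgt)

text \<open>The image of a lift under \<open>\<Phi>\<close> need not be a chosen lift, but
  \<open>tiso\<close> carries it to one by a vertical isomorphism, which is the situation of
  \<open>iso_lift_unique\<close>.\<close>

lemma Phi_lift_unique:
  assumes "f \<in> arr A" "g \<in> arr A" "src A g = tgt A f" "x \<in> obj (pobj G (src A f))"
    "u \<in> D' g" "v \<in> D' g" "src E' u = fo (tcomp \<tau> (tgt A f)) (tgt E (L f x))"
    "src E' v = fo (tcomp \<tau> (tgt A f)) (tgt E (L f x))"
    "u \<cdot>\<^bsub>E'\<^esub> \<Phi> f (L f x) = v \<cdot>\<^bsub>E'\<^esub> \<Phi> f (L f x)"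
  shows "u = v"
  by (rule H.iso_lift_unique[OF assms(1-3) Phi_lift_simps(1)[OF assms(1,4)] tiso_iso[OF assms(1,4)]])
    (use assms(4-) in \<open>simp_all add: Phi_lift_simps[OF assms(1,4)] tiso_src[OF assms(1,4)] tiso_lift[OF assms(1,4)]\<close>)

lemma Phi_vert_lift_unique:
  assumes "f \<in> arr A" "x \<in> obj (pobj G (src A f))"
    "u \<in> D' (ide A (tgt A f))" "v \<in> D' (ide A (tgt A f))" "src E' u = fo (tcomp \<tau> (tgt A f)) (tgt E (L f x))"
    "src E' v = fo (tcomp \<tau> (tgt A f)) (tgt E (L f x))"
    "u \<cdot>\<^bsub>E'\<^esub> \<Phi> f (L f x) = v \<cdot>\<^bsub>E'\<^esub> \<Phi> f (L f x)"
  shows "u = v"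
  by (rule Phi_lift_unique[of f "ide A (tgt A f)" x]) (use assms in simp_all)

lemma Phi_vert_cmp:
  assumes "f \<in> arr A" "h \<in> D f" "u \<in> D (ide A (tgt A f))" "src E u = tgt E h"
  shows "\<Phi> f (u \<cdot>\<^bsub>E\<^esub> h) = \<Phi> (ide A (tgt A f)) u \<cdot>\<^bsub>E'\<^esub> \<Phi> f h"
  using Phi_cmp[of f "ide A (tgt A f)" h u] assms by simp

lemma Phi_cmp_vert:
  assumes "f \<in> arr A" "h \<in> D f" "u \<in> D (ide A (src A f))" "src E h = tgt E u"
  shows "\<Phi> f (h \<cdot>\<^bsub>E\<^esub> u) = \<Phi> f h \<cdot>\<^bsub>E'\<^esub> \<Phi> (ide A (src A f)) u"
  using Phi_cmp[of "ide A (src A f)" f u h] assms by simp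

lemma Phi_vert_simps:
  assumes "a \<in> obj A" "u \<in> D (ide A a)"
  shows "\<Phi> (ide A a) u \<in> D' (ide A a)" "\<Phi> (ide A a) u \<in> arr E'"
    "src E' (\<Phi> (ide A a) u) = fo (tcomp \<tau> a) (src E u)" "tgt E' (\<Phi> (ide A a) u) = fo (tcomp \<tau> a) (tgt E u)"
  using Phi_over[of "ide A a" u] Phi_arr[of "ide A a" u] Phi_src[of "ide A a" u] Phi_tgt[of "ide A a" u] assms
  by simp_all

lemma functor_tcomp:
  assumes "a \<in> obj A"
  shows "is_functor (pobj G a) (pobj H a) (tcomp \<tau> a)"
  using assms Phi_cmp[of "ide A a" "ide A a"]
  by (auto simp: is_functor_def G.category_fibre H.category_fibre hom_def Phi_vert Phi_obj Phi_ide
      G.over_ide G.vert_cmp Phi_vert_simps)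

text \<open>The naturality square is tested on the image of the lift. Both sides then equal
  \<open>\<Phi>\<close> of \<open>u\<close> followed by the lift in the target pseudofunctor,
  because \<open>\<Phi>\<close> preserves the square that defines \<open>pmor G f\<close> on
  \<open>u\<close>.\<close>

lemma tiso_natural:
  assumes f: "f \<in> arr A" and u: "u \<in> D (ide A (src A f))"
  shows "tiso \<tau> f (tgt E u) \<cdot>\<^bsub>E'\<^esub> \<Phi> (ide A (tgt A f)) (fm (pmor G f) u) =
    fm (pmor H f) (\<Phi> (ide A (src A f)) u) \<cdot>\<^bsub>E'\<^esub> tiso \<tau> f (src E u)"
proof -
  have a: "src A f \<in> obj A" "tgt A f \<in> obj A" using f by simp_all
  note us = G.vert_simps[OF a(1) u]
  note v = Phi_vert_simps[OF a(1) u]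
  note fu = G.pmor_over[OF f u] G.pmor_simps[OF f u] G.pmor_src[OF f u]
  note fv = H.pmor_over[OF f v(1)] H.pmor_simps[OF f v(1)] H.pmor_src[OF f v(1)]
  note w = Phi_vert_simps[OF a(2) fu(1)]
  note tx = tiso_simps[OF f us(2)] tiso_src[OF f us(2)]
  note ty = tiso_simps[OF f us(3)] tiso_src[OF f us(3)]
  note lx = Phi_lift_simps[OF f us(2)]
  note ly = Phi_lift_simps[OF f us(3)]
  show ?thesis
  proof (rule Phi_vert_lift_unique[OF f us(2)])
    show "tiso \<tau> f (tgt E u) \<cdot>\<^bsub>E'\<^esub> \<Phi> (ide A (tgt A f)) (fm (pmor G f) u) \<in> D' (ide A (tgt A f))"
      by (intro H.vert_cmp) (use a w ty fu in simp_all)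
    show "fm (pmor H f) (\<Phi> (ide A (src A f)) u) \<cdot>\<^bsub>E'\<^esub> tiso \<tau> f (src E u) \<in> D' (ide A (tgt A f))"
      by (intro H.vert_cmp) (use a fv tx v in simp_all)
    show "src E' (tiso \<tau> f (tgt E u) \<cdot>\<^bsub>E'\<^esub> \<Phi> (ide A (tgt A f)) (fm (pmor G f) u)) =
        fo (tcomp \<tau> (tgt A f)) (tgt E (L f (src E u)))"
      "src E' (fm (pmor H f) (\<Phi> (ide A (src A f)) u) \<cdot>\<^bsub>E'\<^esub> tiso \<tau> f (src E u)) =
        fo (tcomp \<tau> (tgt A f)) (tgt E (L f (src E u)))"
      using w ty fu fv tx v by simp_all
    have "tiso \<tau> f (tgt E u) \<cdot>\<^bsub>E'\<^esub> (\<Phi> (ide A (tgt A f)) (fm (pmor G f) u) \<cdot>\<^bsub>E'\<^esub> \<Phi> f (L f (src E u)))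
      = tiso \<tau> f (tgt E u) \<cdot>\<^bsub>E'\<^esub> (\<Phi> f (L f (tgt E u)) \<cdot>\<^bsub>E'\<^esub> \<Phi> (ide A (src A f)) u)"
      using Phi_vert_cmp[OF f G.lift_over[OF f us(2)] fu(1)] Phi_cmp_vert[OF f G.lift_over[OF f us(3)] u]
        fu us f by (simp add: G.pmor_lift[OF f u])
    also have "\<dots> = L' f (fo (tcomp \<tau> (src A f)) (tgt E u)) \<cdot>\<^bsub>E'\<^esub> \<Phi> (ide A (src A f)) u"
      by (rule H.E.cmp_reassoc[OF tiso_lift[OF f us(3)]]) (use ly ty v in simp_all)
    also have "\<dots> = fm (pmor H f) (\<Phi> (ide A (src A f)) u) \<cdot>\<^bsub>E'\<^esub> (tiso \<tau> f (src E u) \<cdot>\<^bsub>E'\<^esub> \<Phi> f (L f (src E u)))"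
      using H.pmor_lift[OF f v(1)] v tiso_lift[OF f us(2)] by simp
    finally show "(tiso \<tau> f (tgt E u) \<cdot>\<^bsub>E'\<^esub> \<Phi> (ide A (tgt A f)) (fm (pmor G f) u)) \<cdot>\<^bsub>E'\<^esub> \<Phi> f (L f (src E u)) =
      (fm (pmor H f) (\<Phi> (ide A (src A f)) u) \<cdot>\<^bsub>E'\<^esub> tiso \<tau> f (src E u)) \<cdot>\<^bsub>E'\<^esub> \<Phi> f (L f (src E u))"
      using w ty fu fv tx v lx by simp
  qed
qed

lemma tiso_ide:
  assumes a: "a \<in> obj A" and x: "x \<in> obj (pobj G a)"
  shows "punit H a (fo (tcomp \<tau> a) x) \<cdot>\<^bsub>E'\<^esub> tiso \<tau> (ide A a) x = \<Phi> (ide A a) (punit G a x)"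
proof -
  have i: "ide A a \<in> arr A" "x \<in> obj (pobj G (src A (ide A a)))" and ai: "src A (ide A a) = a" "tgt A (ide A a) = a"
    using a x by simp_all
  have y: "fo (tcomp \<tau> a) x \<in> obj (pobj H a)" using Phi_obj a x by blast
  note p = G.punit_over[OF a x] G.punit_simps[OF a x] G.punit_src[OF a x]
  note q = H.punit_over[OF a y] H.punit_simps[OF a y] H.punit_src[OF a y]
  note t = tiso_simps[OF i] tiso_src[OF i]
  note w = Phi_vert_simps[OF a p(1)]
  note l = Phi_lift_simps[OF i]
  show ?thesis
  proof (rule Phi_vert_lift_unique[OF i])
    show "punit H a (fo (tcomp \<tau> a) x) \<cdot>\<^bsub>E'\<^esub> tiso \<tau> (ide A a) x \<in> D' (ide A (tgt A (ide A a)))"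
      "\<Phi> (ide A a) (punit G a x) \<in> D' (ide A (tgt A (ide A a)))"
      using a q t w ai by (simp_all add: H.vert_cmp)
    show "src E' (punit H a (fo (tcomp \<tau> a) x) \<cdot>\<^bsub>E'\<^esub> tiso \<tau> (ide A a) x) =
      fo (tcomp \<tau> (tgt A (ide A a))) (tgt E (L (ide A a) x))"
      "src E' (\<Phi> (ide A a) (punit G a x)) = fo (tcomp \<tau> (tgt A (ide A a))) (tgt E (L (ide A a) x))"
      using a q t w p ai by simp_all
    have "(punit H a (fo (tcomp \<tau> a) x) \<cdot>\<^bsub>E'\<^esub> tiso \<tau> (ide A a) x) \<cdot>\<^bsub>E'\<^esub> \<Phi> (ide A a) (L (ide A a) x) = ide E' (fo (tcomp
      \<tau> a) x)"
      using q t l ai tiso_lift[OF i] H.punit_lift[OF a y] by simp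
    also have "\<dots> = \<Phi> (ide A a) (punit G a x \<cdot>\<^bsub>E\<^esub> L (ide A a) x)"
      using G.punit_lift[OF a x] Phi_ide[OF a x] by simp
    also have "\<dots> = \<Phi> (ide A a) (punit G a x) \<cdot>\<^bsub>E'\<^esub> \<Phi> (ide A a) (L (ide A a) x)"
      using Phi_vert_cmp[OF i(1) G.lift_over[OF i]] p ai by simp
    finally show "(punit H a (fo (tcomp \<tau> a) x) \<cdot>\<^bsub>E'\<^esub> tiso \<tau> (ide A a) x) \<cdot>\<^bsub>E'\<^esub> \<Phi> (ide A a) (L (ide A a) x) =
      \<Phi> (ide A a) (punit G a x) \<cdot>\<^bsub>E'\<^esub> \<Phi> (ide A a) (L (ide A a) x)" .
  qed
qed

text \<open>Tested on the image of the lift of \<open>g \<cdot> f\<close>, both sides become the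
  composite of the successive lifts of \<open>f\<close> and \<open>g\<close> in the target. On the
  right this uses that \<open>\<Phi>\<close> maps the defining equation of
  \<open>pcomp G g f\<close> to a composite.\<close>

lemma tiso_cmp:
  assumes f: "f \<in> arr A" "g \<in> arr A" "src A g = tgt A f" and x: "x \<in> obj (pobj G (src A f))"
  shows "pcomp H g f (fo (tcomp \<tau> (src A f)) x) \<cdot>\<^bsub>E'\<^esub> tiso \<tau> (g \<cdot>\<^bsub>A\<^esub> f) x =
    fm (pmor H g) (tiso \<tau> f x) \<cdot>\<^bsub>E'\<^esub> (tiso \<tau> g (tgt E (L f x)) \<cdot>\<^bsub>E'\<^esub> \<Phi> (ide A (tgt A g)) (pcomp G g f x))"
proof -
  have gf: "g \<cdot>\<^bsub>A\<^esub> f \<in> arr A" "x \<in> obj (pobj G (src A (g \<cdot>\<^bsub>A\<^esub> f)))" and ai: "src A (g \<cdot>\<^bsub>A\<^esub> f) = src A f" "tgt A (g \<cdot>\<^bsub>A\<^esub>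
    f) = tgt A g"
    using f x by simp_all
  have a: "src A f \<in> obj A" "tgt A g \<in> obj A" using f by simp_all
  have x2: "tgt E (L f x) \<in> obj (pobj G (src A g))" using f x by simp
  have y: "fo (tcomp \<tau> (src A f)) x \<in> obj (pobj H (src A f))" using Phi_obj a x by blast
  note p = G.pcomp_over[OF f x] G.pcomp_simps[OF f x] G.pcomp_src[OF f x]
  note q = H.pcomp_over[OF f y] H.pcomp_simps[OF f y] H.pcomp_src[OF f y]
  note tf = tiso_simps[OF f(1) x] tiso_src[OF f(1) x]
  note tg = tiso_simps[OF f(2) x2] tiso_src[OF f(2) x2]
  note tgf = tiso_simps[OF gf] tiso_src[OF gf]
  have tv: "tiso \<tau> f x \<in> D' (ide A (src A g))" using tf f by simp
  note m = H.pmor_over[OF f(2) tv] H.pmor_simps[OF f(2) tv] H.pmor_src[OF f(2) tv]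
  note w = Phi_vert_simps[OF a(2) p(1)]
  note lf = Phi_lift_simps[OF f(1) x]
  note lg = Phi_lift_simps[OF f(2) x2]
  note lgf = Phi_lift_simps[OF gf]
  have L'g: "L' g (fo (tcomp \<tau> (src A g)) (tgt E (L f x))) \<in> arr E'"
    "src E' (L' g (fo (tcomp \<tau> (src A g)) (tgt E (L f x)))) = fo (tcomp \<tau> (src A g)) (tgt E (L f x))"
    using H.lift_simps[of g] H.lift_src[of g] Phi_obj[OF _ x2] f by simp_all
  show ?thesis
  proof (rule Phi_vert_lift_unique[OF gf])
    show "pcomp H g f (fo (tcomp \<tau> (src A f)) x) \<cdot>\<^bsub>E'\<^esub> tiso \<tau> (g \<cdot>\<^bsub>A\<^esub> f) x \<in> D' (ide A (tgt A (g \<cdot>\<^bsub>A\<^esub> f)))"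
      unfolding ai by (intro H.vert_cmp) (use a q tgf ai in simp_all)
    show "fm (pmor H g) (tiso \<tau> f x) \<cdot>\<^bsub>E'\<^esub> (tiso \<tau> g (tgt E (L f x)) \<cdot>\<^bsub>E'\<^esub> \<Phi> (ide A (tgt A g)) (pcomp G g f x)) \<in> D'
      (ide A (tgt A (g \<cdot>\<^bsub>A\<^esub> f)))"
      unfolding ai by (intro H.vert_cmp) (use a m tg w p ai tf f in simp_all)
    show "src E' (pcomp H g f (fo (tcomp \<tau> (src A f)) x) \<cdot>\<^bsub>E'\<^esub> tiso \<tau> (g \<cdot>\<^bsub>A\<^esub> f) x) =
        fo (tcomp \<tau> (tgt A (g \<cdot>\<^bsub>A\<^esub> f))) (tgt E (L (g \<cdot>\<^bsub>A\<^esub> f) x))"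
      "src E' (fm (pmor H g) (tiso \<tau> f x) \<cdot>\<^bsub>E'\<^esub> (tiso \<tau> g (tgt E (L f x)) \<cdot>\<^bsub>E'\<^esub> \<Phi> (ide A (tgt A g)) (pcomp G g f x))) =
        fo (tcomp \<tau> (tgt A (g \<cdot>\<^bsub>A\<^esub> f))) (tgt E (L (g \<cdot>\<^bsub>A\<^esub> f) x))"
      using q tgf ai m tg w p tf f by simp_all
    have "(pcomp H g f (fo (tcomp \<tau> (src A f)) x) \<cdot>\<^bsub>E'\<^esub> tiso \<tau> (g \<cdot>\<^bsub>A\<^esub> f) x) \<cdot>\<^bsub>E'\<^esub> \<Phi> (g \<cdot>\<^bsub>A\<^esub> f) (L (g \<cdot>\<^bsub>A\<^esub> f) x)
      = L' g (tgt E' (L' f (fo (tcomp \<tau> (src A f)) x))) \<cdot>\<^bsub>E'\<^esub> L' f (fo (tcomp \<tau> (src A f)) x)"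
      using q tgf lgf ai tiso_lift[OF gf] H.pcomp_lift[OF f y] by simp
    also have "\<dots> = (L' g (tgt E' (tiso \<tau> f x)) \<cdot>\<^bsub>E'\<^esub> tiso \<tau> f x) \<cdot>\<^bsub>E'\<^esub> \<Phi> f (L f x)"
      using tf lf tiso_lift[OF f(1) x] f y by simp
    also have "\<dots> = fm (pmor H g) (tiso \<tau> f x) \<cdot>\<^bsub>E'\<^esub> (L' g (fo (tcomp \<tau> (tgt A f)) (tgt E (L f x))) \<cdot>\<^bsub>E'\<^esub> \<Phi> f (L f x))"
      unfolding H.pmor_lift[OF f(2) tv, symmetric] using m tf lf L'g f by simp
    also have "L' g (fo (tcomp \<tau> (tgt A f)) (tgt E (L f x))) \<cdot>\<^bsub>E'\<^esub> \<Phi> f (L f x) =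
      tiso \<tau> g (tgt E (L f x)) \<cdot>\<^bsub>E'\<^esub> (\<Phi> g (L g (tgt E (L f x))) \<cdot>\<^bsub>E'\<^esub> \<Phi> f (L f x))"
      by (rule H.E.cmp_reassoc[OF tiso_lift[OF f(2) x2, unfolded f(3)], symmetric]) (use f lg tg lf in simp_all)
    also have "\<Phi> g (L g (tgt E (L f x))) \<cdot>\<^bsub>E'\<^esub> \<Phi> f (L f x) = \<Phi> (g \<cdot>\<^bsub>A\<^esub> f) (pcomp G g f x \<cdot>\<^bsub>E\<^esub> L (g \<cdot>\<^bsub>A\<^esub> f) x)"
      using Phi_cmp[OF f G.lift_over[OF f(1) x] G.lift_over[OF f(2) x2]] f x x2 G.pcomp_lift[OF f x] by simp
    also have "\<dots> = \<Phi> (ide A (tgt A g)) (pcomp G g f x) \<cdot>\<^bsub>E'\<^esub> \<Phi> (g \<cdot>\<^bsub>A\<^esub> f) (L (g \<cdot>\<^bsub>A\<^esub> f) x)"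
      using Phi_vert_cmp[OF gf(1) G.lift_over[OF gf]] p ai by simp
    finally show "(pcomp H g f (fo (tcomp \<tau> (src A f)) x) \<cdot>\<^bsub>E'\<^esub> tiso \<tau> (g \<cdot>\<^bsub>A\<^esub> f) x) \<cdot>\<^bsub>E'\<^esub> \<Phi> (g \<cdot>\<^bsub>A\<^esub> f) (L (g \<cdot>\<^bsub>A\<^esub> f) x) =
     (fm (pmor H g) (tiso \<tau> f x) \<cdot>\<^bsub>E'\<^esub> (tiso \<tau> g (tgt E (L f x)) \<cdot>\<^bsub>E'\<^esub> \<Phi> (ide A (tgt A g)) (pcomp G g f x))) \<cdot>\<^bsub>E'\<^esub> \<Phi> (g
       \<cdot>\<^bsub>A\<^esub> f) (L (g \<cdot>\<^bsub>A\<^esub> f) x)"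
      using m tg w p tf lgf ai f by simp
  qed
qed

theorem pseudonat: "pseudonat A G H \<tau>"
proof -
  have F: "is_functor (pobj G (src A f)) (pobj H (tgt A f)) (func_comp (tcomp \<tau> (tgt A f)) (pmor G f))"
    "is_functor (pobj G (src A f)) (pobj H (tgt A f)) (func_comp (pmor H f) (tcomp \<tau> (src A f)))" if "f \<in> arr A" for f
    using functor_tcomp[of "tgt A f"] functor_tcomp[of "src A f"] G.functor_pmor[OF that] H.functor_pmor[OF that] that
    by (fastforce simp: is_functor_def func_comp_def hom_def)+
  have "nat_iso (pobj G (src A f)) (pobj H (tgt A f))
        (func_comp (tcomp \<tau> (tgt A f)) (pmor G f)) (func_comp (pmor H f) (tcomp \<tau> (src A f))) (tiso \<tau> f)"
    if "f \<in> arr A" for f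
    using that F[OF that]
    by (auto simp: nat_iso_def nat_trans_def hom_def func_comp_def tiso_iso tiso_simps tiso_src
        G.pmor_obj H.pmor_obj Phi_obj Phi_vert G.pmor_over tiso_natural)
  then show ?thesis
    unfolding pseudonat_def using G.pseudofunctor H.pseudofunctor
    by (auto simp: functor_tcomp tiso_ide Phi_vert G.punit_over G.pmor_obj G.pcomp_over tiso_cmp)
qed

text \<open>Every arrow over \<open>f\<close> is a lift followed by a vertical arrow, so this
  formula shows that \<open>\<tau>\<close> determines \<open>\<Phi>\<close>. Its right-hand side has
  the shape of \<open>gtens\<close>, which is how the triples in the coherence conditions are later
  read as arrows of the total category.\<close>

lemma Phi_eq:
  assumes f: "f \<in> arr A" "x \<in> obj (pobj G (src A f))" and u: "u \<in> D (ide A (tgt A f))" "src E u = tgt E (L f x)"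
  shows "\<Phi> f (u \<cdot>\<^bsub>E\<^esub> L f x) = (fm (tcomp \<tau> (tgt A f)) u \<cdot>\<^bsub>E'\<^esub> inv_arr (pobj H (tgt A f)) (tiso \<tau> f x)) \<cdot>\<^bsub>E'\<^esub>
    L' f (fo (tcomp \<tau> (src A f)) x)"
proof -
  have a: "tgt A f \<in> obj A" using f by simp
  note w = Phi_vert_simps[OF a u(1)]
  note i = H.iso_fibre[OF a tiso_iso[OF f]]
  note t = tiso_simps[OF f] tiso_src[OF f]
  note l = Phi_lift_simps[OF f]
  have y: "fo (tcomp \<tau> (src A f)) x \<in> obj (pobj H (src A f))" using Phi_obj f by simp
  have "inv_arr (pobj H (tgt A f)) (tiso \<tau> f x) \<cdot>\<^bsub>E'\<^esub> L' f (fo (tcomp \<tau> (src A f)) x) = \<Phi> f (L f x)"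
    using H.E.cmp_reassoc[OF i(5), of "\<Phi> f (L f x)"] H.vert_simps(1)[OF a i(2)] i t l tiso_lift[OF f] by simp
  then show ?thesis
    using Phi_vert_cmp[OF f(1) G.lift_over[OF f] u] H.vert_simps(1)[OF a i(2)] i w t f y u
    by (simp add: Phi_vert[OF a u(1)])
qed

end

section \<open>Modifications\<close>

locale displayed_nat_pair =
  S: displayed_nat A E G D L E' H D' L' \<sigma> \<Phi> + T: displayed_nat A E G D L E' H D' L' \<tau> \<Psi>
  for A :: "('a, 'f) cat"
    and E :: "('o, 'm) cat" and G :: "('a, 'f, 'o, 'm) psf" and D :: "'f \<Rightarrow> 'm set" and L :: "'f \<Rightarrow> 'o \<Rightarrow> 'm"
    and E' :: "('p, 'n) cat" and H :: "('a, 'f, 'p, 'n) psf" and D' :: "'f \<Rightarrow> 'n set" and L' :: "'f \<Rightarrow> 'p \<Rightarrow> 'n"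
    and \<sigma> \<Phi> \<tau> \<Psi>
begin

text \<open>One naturality condition over all base arrows contains both conditions on a
  modification. At vertical arrows it is naturality of the component at \<open>a\<close>; at a lift
  it is the axiom that involves \<open>tiso\<close>, tested on the image of that lift.\<close>

lemma modificationI:
  assumes over: "\<And>a x. a \<in> obj A \<Longrightarrow> x \<in> obj (pobj G a) \<Longrightarrow> m a x \<in> D' (ide A a)"
    and src: "\<And>a x. a \<in> obj A \<Longrightarrow> x \<in> obj (pobj G a) \<Longrightarrow> src E' (m a x) = fo (tcomp \<sigma> a) x"
    and tgt: "\<And>a x. a \<in> obj A \<Longrightarrow> x \<in> obj (pobj G a) \<Longrightarrow> tgt E' (m a x) = fo (tcomp \<tau> a) x"
    and nat: "\<And>f h. f \<in> arr A \<Longrightarrow> h \<in> D f \<Longrightarrow>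
      m (tgt A f) (tgt E h) \<cdot>\<^bsub>E'\<^esub> \<Phi> f h = \<Psi> f h \<cdot>\<^bsub>E'\<^esub> m (src A f) (src E h)"
  shows "modification A G H \<sigma> \<tau> m"
proof -
  have "m a (tgt E u) \<cdot>\<^bsub>E'\<^esub> \<Phi> (ide A a) u = \<Psi> (ide A a) u \<cdot>\<^bsub>E'\<^esub> m a (src E u)"
    if "a \<in> obj A" "u \<in> D (ide A a)" for a u
    using nat[of "ide A a" u] that by simp
  moreover have "fm (pmor H f) (m (src A f) x) \<cdot>\<^bsub>E'\<^esub> tiso \<sigma> f x = tiso \<tau> f x \<cdot>\<^bsub>E'\<^esub> m (tgt A f) (tgt E (L f x))"
    if f: "f \<in> arr A" and x: "x \<in> obj (pobj G (src A f))" for f x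
  proof (rule S.Phi_vert_lift_unique[OF f x])
    have a: "src A f \<in> obj A" "tgt A f \<in> obj A" using f by simp_all
    have z: "tgt E (L f x) \<in> obj (pobj G (tgt A f))" using f x by simp
    note o1 = over[OF a(1) x] and o2 = over[OF a(2) z]
    note v1 = S.H.vert_simps[OF a(1) o1] src[OF a(1) x] tgt[OF a(1) x]
    note v2 = S.H.vert_simps[OF a(2) o2] src[OF a(2) z] tgt[OF a(2) z]
    note p = S.H.pmor_over[OF f o1] S.H.pmor_simps[OF f o1] S.H.pmor_src[OF f o1]
    note ts = S.tiso_simps[OF f x] S.tiso_src[OF f x]
    note tt = T.tiso_simps[OF f x] T.tiso_src[OF f x]
    note ls = S.Phi_lift_simps[OF f x] and lt = T.Phi_lift_simps[OF f x]
    show "fm (pmor H f) (m (src A f) x) \<cdot>\<^bsub>E'\<^esub> tiso \<sigma> f x \<in> D' (ide A (tgt A f))"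
      "tiso \<tau> f x \<cdot>\<^bsub>E'\<^esub> m (tgt A f) (tgt E (L f x)) \<in> D' (ide A (tgt A f))"
      by (intro S.H.vert_cmp; use a p ts tt o2 v1 v2 in simp)+
    show "src E' (fm (pmor H f) (m (src A f) x) \<cdot>\<^bsub>E'\<^esub> tiso \<sigma> f x) = fo (tcomp \<sigma> (tgt A f)) (tgt E (L f x))"
      "src E' (tiso \<tau> f x \<cdot>\<^bsub>E'\<^esub> m (tgt A f) (tgt E (L f x))) = fo (tcomp \<sigma> (tgt A f)) (tgt E (L f x))"
      using p ts tt v1 v2 by simp_all
    have "(fm (pmor H f) (m (src A f) x) \<cdot>\<^bsub>E'\<^esub> tiso \<sigma> f x) \<cdot>\<^bsub>E'\<^esub> \<Phi> f (L f x) =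
      L' f (fo (tcomp \<tau> (src A f)) x) \<cdot>\<^bsub>E'\<^esub> m (src A f) x"
      using p ts v1 ls S.tiso_lift[OF f x] S.H.pmor_lift[OF f o1] by simp
    also have "\<dots> = tiso \<tau> f x \<cdot>\<^bsub>E'\<^esub> (\<Psi> f (L f x) \<cdot>\<^bsub>E'\<^esub> m (src A f) x)"
      by (rule S.H.E.cmp_reassoc[OF T.tiso_lift[OF f x], symmetric]) (use tt lt v1 in simp_all)
    also have "\<dots> = (tiso \<tau> f x \<cdot>\<^bsub>E'\<^esub> m (tgt A f) (tgt E (L f x))) \<cdot>\<^bsub>E'\<^esub> \<Phi> f (L f x)"
      using nat[OF f S.G.lift_over[OF f x]] tt ls v2 f x by simp
    finally show "(fm (pmor H f) (m (src A f) x) \<cdot>\<^bsub>E'\<^esub> tiso \<sigma> f x) \<cdot>\<^bsub>E'\<^esub> \<Phi> f (L f x) =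
      (tiso \<tau> f x \<cdot>\<^bsub>E'\<^esub> m (tgt A f) (tgt E (L f x))) \<cdot>\<^bsub>E'\<^esub> \<Phi> f (L f x)" .
  qed
  ultimately show ?thesis
    unfolding modification_def nat_trans_def hom_def
    using S.pseudonat T.pseudonat S.functor_tcomp T.functor_tcomp
    by (auto simp: over src tgt S.Phi_vert T.Phi_vert S.G.pmor_obj)
qed

text \<open>An arrow over \<open>f\<close> is a lift followed by a vertical arrow. The required
  square is pasted from the square at the lift, which encodes the modification axiom, and the square
  at the vertical arrow, which is naturality within a fibre.\<close>

lemma modificationD:
  assumes m: "modification A G H \<sigma> \<tau> m"
  shows "\<And>a x. a \<in> obj A \<Longrightarrow> x \<in> obj (pobj G a) \<Longrightarrow> m a x \<in> D' (ide A a)"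
    and "\<And>a x. a \<in> obj A \<Longrightarrow> x \<in> obj (pobj G a) \<Longrightarrow> src E' (m a x) = fo (tcomp \<sigma> a) x"
    and "\<And>a x. a \<in> obj A \<Longrightarrow> x \<in> obj (pobj G a) \<Longrightarrow> tgt E' (m a x) = fo (tcomp \<tau> a) x"
    and "\<And>f h. f \<in> arr A \<Longrightarrow> h \<in> D f \<Longrightarrow>
      m (tgt A f) (tgt E h) \<cdot>\<^bsub>E'\<^esub> \<Phi> f h = \<Psi> f h \<cdot>\<^bsub>E'\<^esub> m (src A f) (src E h)"
proof -
  have n: "nat_trans (pobj G a) (pobj H a) (tcomp \<sigma> a) (tcomp \<tau> a) (m a)" if "a \<in> obj A" for a
    using m that by (simp add: modification_def)
  show over: "m a x \<in> D' (ide A a)" and src: "src E' (m a x) = fo (tcomp \<sigma> a) x" and tgt: "tgt E' (m a x) = fo (tcomp \<tau> a) x"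
    if "a \<in> obj A" "x \<in> obj (pobj G a)" for a x
    using n[OF that(1)] that by (auto simp: nat_trans_def hom_def)
  show "m (tgt A f) (tgt E h) \<cdot>\<^bsub>E'\<^esub> \<Phi> f h = \<Psi> f h \<cdot>\<^bsub>E'\<^esub> m (src A f) (src E h)" if f: "f \<in> arr A" and h: "h \<in> D f" for f h
  proof -
    let ?x = "src E h"
    have x: "?x \<in> obj (pobj G (src A f))" using S.G.over_src f h by blast
    obtain u where u: "u \<in> D (ide A (tgt A f))" "src E u = tgt E (L f ?x)" "u \<cdot>\<^bsub>E\<^esub> L f ?x = h" "tgt E u = tgt E h"
      using S.G.vert_factor[OF f h] by blast
    have a: "src A f \<in> obj A" "tgt A f \<in> obj A" using f by simp_all
    have z: "tgt E (L f ?x) \<in> obj (pobj G (tgt A f))" "tgt E h \<in> obj (pobj G (tgt A f))"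
      using f x h S.G.over_tgt by simp_all
    note o1 = over[OF a(1) x] and o2 = over[OF a(2) z(1)] and o3 = over[OF a(2) z(2)]
    note v1 = S.H.vert_simps[OF a(1) o1] src[OF a(1) x] tgt[OF a(1) x]
    note v2 = S.H.vert_simps[OF a(2) o2] src[OF a(2) z(1)] tgt[OF a(2) z(1)]
    note v3 = S.H.vert_simps[OF a(2) o3] src[OF a(2) z(2)] tgt[OF a(2) z(2)]
    note p = S.H.pmor_over[OF f o1] S.H.pmor_simps[OF f o1] S.H.pmor_src[OF f o1]
    note ts = S.tiso_simps[OF f x] S.tiso_src[OF f x]
    note tt = T.tiso_simps[OF f x] T.tiso_src[OF f x]
    note ls = S.Phi_lift_simps[OF f x] and lt = T.Phi_lift_simps[OF f x]
    note ws = S.Phi_vert_simps[OF a(2) u(1)] and wt = T.Phi_vert_simps[OF a(2) u(1)]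
    have sq: "m (tgt A f) (tgt E u) \<cdot>\<^bsub>E'\<^esub> \<Phi> (ide A (tgt A f)) u = \<Psi> (ide A (tgt A f)) u \<cdot>\<^bsub>E'\<^esub> m (tgt A f) (src E u)"
      using n[OF a(2)] u(1) a by (simp add: nat_trans_def S.Phi_vert T.Phi_vert)
    have mod: "fm (pmor H f) (m (src A f) ?x) \<cdot>\<^bsub>E'\<^esub> tiso \<sigma> f ?x = tiso \<tau> f ?x \<cdot>\<^bsub>E'\<^esub> m (tgt A f) (tgt E (L f ?x))"
      using m f x by (simp add: modification_def S.G.pmor_obj)
    \<comment> \<open>The modification axiom is an equation after composition with the isomorphism
      \<open>tiso \<tau> f\<close>, which is cancelled here.\<close>
    have lift: "m (tgt A f) (tgt E (L f ?x)) \<cdot>\<^bsub>E'\<^esub> \<Phi> f (L f ?x) = \<Psi> f (L f ?x) \<cdot>\<^bsub>E'\<^esub> m (src A f) ?x"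
    proof (rule S.H.E.iso_cancel_left[OF S.H.iso_fibre_total(1)[OF a(2) T.tiso_iso[OF f x]]])
      have "tiso \<tau> f ?x \<cdot>\<^bsub>E'\<^esub> (m (tgt A f) (tgt E (L f ?x)) \<cdot>\<^bsub>E'\<^esub> \<Phi> f (L f ?x)) =
        (fm (pmor H f) (m (src A f) ?x) \<cdot>\<^bsub>E'\<^esub> tiso \<sigma> f ?x) \<cdot>\<^bsub>E'\<^esub> \<Phi> f (L f ?x)"
        by (rule S.H.E.cmp_reassoc[OF mod[symmetric]]) (use tt v2 ls in simp_all)
      also have "\<dots> = L' f (fo (tcomp \<tau> (src A f)) ?x) \<cdot>\<^bsub>E'\<^esub> m (src A f) ?x"
        using p ts v1 ls S.tiso_lift[OF f x] S.H.pmor_lift[OF f o1] by simp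
      also have "\<dots> = tiso \<tau> f ?x \<cdot>\<^bsub>E'\<^esub> (\<Psi> f (L f ?x) \<cdot>\<^bsub>E'\<^esub> m (src A f) ?x)"
        by (rule S.H.E.cmp_reassoc[OF T.tiso_lift[OF f x], symmetric]) (use tt lt v1 in simp_all)
      finally show "tiso \<tau> f ?x \<cdot>\<^bsub>E'\<^esub> (m (tgt A f) (tgt E (L f ?x)) \<cdot>\<^bsub>E'\<^esub> \<Phi> f (L f ?x)) = tiso \<tau> f ?x \<cdot>\<^bsub>E'\<^esub> (\<Psi> f (L f
        ?x) \<cdot>\<^bsub>E'\<^esub> m (src A f) ?x)" .
    qed (use v1 v2 ls lt tt in simp_all)
    have "m (tgt A f) (tgt E h) \<cdot>\<^bsub>E'\<^esub> \<Phi> f h = m (tgt A f) (tgt E u) \<cdot>\<^bsub>E'\<^esub> (\<Phi> (ide A (tgt A f)) u \<cdot>\<^bsub>E'\<^esub> \<Phi> f (L f ?x))"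
      using S.Phi_vert_cmp[OF f S.G.lift_over[OF f x] u(1,2)] u by simp
    also have "\<dots> = \<Psi> (ide A (tgt A f)) u \<cdot>\<^bsub>E'\<^esub> (m (tgt A f) (src E u) \<cdot>\<^bsub>E'\<^esub> \<Phi> f (L f ?x))"
      using S.H.E.cmp_reassoc[OF sq, of "\<Phi> f (L f ?x)"] ws wt v2 v3 u ls by simp
    also have "\<dots> = \<Psi> (ide A (tgt A f)) u \<cdot>\<^bsub>E'\<^esub> (\<Psi> f (L f ?x) \<cdot>\<^bsub>E'\<^esub> m (src A f) ?x)"
      using u lift by simp
    also have "\<dots> = (\<Psi> (ide A (tgt A f)) u \<cdot>\<^bsub>E'\<^esub> \<Psi> f (L f ?x)) \<cdot>\<^bsub>E'\<^esub> m (src A f) ?x"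
      using wt lt v1 u by simp
    also have "\<dots> = \<Psi> f h \<cdot>\<^bsub>E'\<^esub> m (src A f) ?x"
      using T.Phi_vert_cmp[OF f S.G.lift_over[OF f x] u(1,2)] u by simp
    finally show ?thesis .
  qed
qed

end

section \<open>Functors between categories\<close>

locale functr =
  C: categ C + D: categ D
  for C :: "('o, 'm) cat" and D :: "('p, 'n) cat" +
  fixes K :: "('o, 'm, 'p, 'n) func"
  assumes is_functor: "is_functor C D K"
begin

lemma fo_obj [simp]: "x \<in> obj C \<Longrightarrow> fo K x \<in> obj D"
  and fm_arr [simp]: "f \<in> arr C \<Longrightarrow> fm K f \<in> arr D"
  and src_fm [simp]: "f \<in> arr C \<Longrightarrow> src D (fm K f) = fo K (src C f)"
  and tgt_fm [simp]: "f \<in> arr C \<Longrightarrow> tgt D (fm K f) = fo K (tgt C f)"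
  and fm_ide [simp]: "x \<in> obj C \<Longrightarrow> fm K (ide C x) = ide D (fo K x)"
  and fm_cmp [simp]: "f \<in> arr C \<Longrightarrow> g \<in> arr C \<Longrightarrow> src C g = tgt C f \<Longrightarrow> fm K (g \<cdot>\<^bsub>C\<^esub> f) = fm K g \<cdot>\<^bsub>D\<^esub> fm K f"
  using is_functor by (auto simp: is_functor_def hom_def)

lemma fm_inverse:
  assumes "inverse_arrows C f g"
  shows "inverse_arrows D (fm K f) (fm K g)"
proof -
  have f: "f \<in> arr C" "g \<in> arr C" "src C g = tgt C f" "tgt C g = src C f"
    "g \<cdot>\<^bsub>C\<^esub> f = ide C (src C f)" "f \<cdot>\<^bsub>C\<^esub> g = ide C (tgt C f)"
    using assms by (auto simp: inverse_arrows_def hom_def)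
  have "fm K g \<cdot>\<^bsub>D\<^esub> fm K f = ide D (fo K (src C f))" "fm K f \<cdot>\<^bsub>D\<^esub> fm K g = ide D (fo K (tgt C f))"
    using fm_cmp[of f g] fm_cmp[of g f] f by simp_all
  then show ?thesis using f by (simp add: inverse_arrows_def hom_def)
qed

end

lemma functr_prod:
  assumes "functr C D K" "functr C' D' K'"
  shows "functr (cat_prod C C') (cat_prod D D') (func_prod K K')"
proof -
  interpret K: functr C D K by fact
  interpret K': functr C' D' K' by fact
  interpret CC: categ "cat_prod C C'" by unfold_locales (simp add: category_cat_prod K.C.category K'.C.category)
  interpret DD: categ "cat_prod D D'" by unfold_locales (simp add: category_cat_prod K.D.category K'.D.category)
  show ?thesis
    by unfold_locales (auto simp: is_functor_def func_prod_def CC.category DD.category hom_def)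
qed

lemma functr_comp:
  assumes "functr C D K" "functr D D' K'"
  shows "functr C D' (func_comp K' K)"
proof -
  interpret K: functr C D K by fact
  interpret K': functr D D' K' by fact
  show ?thesis
    by unfold_locales (auto simp: is_functor_def func_comp_def K.C.category K'.D.category hom_def)
qed

lemma functrI: "is_functor C D K \<Longrightarrow> functr C D K"
  by unfold_locales (auto simp: is_functor_def)

lemma functr_structural:
  assumes "category C" "category D"
  shows "functr C C func_id" "functr (cat_prod C D) C func_fst" "functr (cat_prod C D) D func_snd"
    "functr (cat_prod C D) (cat_prod D C) func_swap"
  using assms
  by (auto intro!: functrI simp: is_functor_def hom_def func_id_def func_fst_def func_snd_def func_swap_def
      category_cat_prod category_def)

lemma functr_assoc:
  assumes "category C" "category D" "category E"
  shows "functr (cat_prod (cat_prod C D) E) (cat_prod C (cat_prod D E)) func_assoc"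
  using assms
  by (auto intro!: functrI simp: is_functor_def hom_def func_assoc_def category_cat_prod)

lemma functr_point: "category C \<Longrightarrow> x \<in> obj C \<Longrightarrow> functr cat_unit C (func_point C x)"
  by (rule functrI) (auto simp: is_functor_def hom_def func_point_def category_cat_unit categ_def
      categ.ide_arr categ.src_ide categ.tgt_ide categ.cmp_ide_left)

section \<open>Constructions on pseudofunctors over the base\<close>

lemma psf_precomp_simps [simp]:
  "pobj (psf_precomp K G) = (\<lambda>a. pobj G (fo K a))" "pmor (psf_precomp K G) = (\<lambda>f. pmor G (fm K f))"
  "pcomp (psf_precomp K G) = (\<lambda>g f. pcomp G (fm K g) (fm K f))" "punit (psf_precomp K G) = (\<lambda>a. punit G (fo K a))"
  by (simp_all add: psf_precomp_def)

lemma psf_prod_simps [simp]: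
  "pobj (psf_prod F G) ab = cat_prod (pobj F (fst ab)) (pobj G (snd ab))"
  "pmor (psf_prod F G) ff = func_prod (pmor F (fst ff)) (pmor G (snd ff))"
  "pcomp (psf_prod F G) gg ff xy = (pcomp F (fst gg) (fst ff) (fst xy), pcomp G (snd gg) (snd ff) (snd xy))"
  "punit (psf_prod F G) ab xy = (punit F (fst ab) (fst xy), punit G (snd ab) (snd xy))"
  by (simp_all add: psf_prod_def case_prod_beta)

lemma func_prod_simps [simp]:
  "fo (func_prod H K) x = (fo H (fst x), fo K (snd x))" "fm (func_prod H K) u = (fm H (fst u), fm K (snd u))"
  by (simp_all add: func_prod_def map_prod_def case_prod_beta)

lemma func_comp_simps [simp]: "fo (func_comp H K) x = fo H (fo K x)" "fm (func_comp H K) f = fm H (fm K f)"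
  by (simp_all add: func_comp_def)

lemma displayed_precomp:
  assumes "functr A A' K" "displayed A' E G D L"
  shows "displayed A E (psf_precomp K G) (\<lambda>f. D (fm K f)) (\<lambda>f. L (fm K f))"
proof -
  interpret K: functr A A' K by fact
  interpret G: displayed A' E G D L by fact
  show ?thesis
  proof (intro displayed.intro displayed_axioms.intro, goal_cases)
    case 1 show ?case by unfold_locales
  next case 2 show ?case by unfold_locales
  next case (8 a x) then show ?case using G.fibre_obj[of "fo K a" x] by simp
  next case (9 f h) then show ?case using G.over_arr[of "fm K f" h] by simp
  next case (10 f h) then show ?case using G.over_src[of "fm K f" h] by simp
  next case (11 f h) then show ?case using G.over_tgt[of "fm K f" h] by simp
  next case (12 a x) then show ?case using G.over_ide[of "fo K a" x] by simp
  next case (13 f g h k) then show ?case using G.over_cmp[of "fm K f" "fm K g" h k] by simp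
  next case (14 f x) then show ?case using G.lift_over[of "fm K f" x] by simp
  next case (16 f g x h) then show ?case using G.lift_factor[of "fm K f" "fm K g" x h] by simp
  next case (17 f g x u v) then show ?case using G.lift_unique[of "fm K f" "fm K g" x u v] by simp
  next case (18 f x) then show ?case using G.pmor_obj[of "fm K f" x] by simp
  next case (19 f u) then show ?case using G.pmor_over[of "fm K f" u] by simp
  next case (20 f u) then show ?case using G.pmor_src[of "fm K f" u] by simp
  next case (21 f u) then show ?case using G.pmor_lift[of "fm K f" u] by simp
  next case (22 f g x) then show ?case using G.pcomp_over[of "fm K f" "fm K g" x] by simp
  next case (23 f g x) then show ?case using G.pcomp_src[of "fm K f" "fm K g" x] by simp
  next case (24 f g x) then show ?case using G.pcomp_lift[of "fm K f" "fm K g" x] by simp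
  next case (25 a x) then show ?case using G.punit_over[of "fo K a" x] by simp
  next case (26 a x) then show ?case using G.punit_src[of "fo K a" x] by simp
  next case (27 a x) then show ?case using G.punit_lift[of "fo K a" x] by simp
  qed simp_all
qed

lemma displayed_prod:
  assumes "displayed A E G D L" "displayed A' E' G' D' L'"
  shows "displayed (cat_prod A A') (cat_prod E E') (psf_prod G G') (\<lambda>f. D (fst f) \<times> D' (snd f))
    (\<lambda>f x. (L (fst f) (fst x), L' (snd f) (snd x)))"
proof -
  interpret G: displayed A E G D L by fact
  interpret G': displayed A' E' G' D' L' by fact
  show ?thesis
  proof (intro displayed.intro displayed_axioms.intro, goal_cases)
    case 1 then show ?case by (simp add: categ_def category_cat_prod G.A.category G'.A.category)
  next case 2 then show ?case by (simp add: categ_def category_cat_prod G.E.category G'.E.category)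
  next case (8 a x) then show ?case using G.fibre_obj[of "fst a" "fst x"] G'.fibre_obj[of "snd a" "snd x"] by (simp add:
    mem_Times_iff)
  next case (9 f h) then show ?case using G.over_arr[of "fst f" "fst h"] G'.over_arr[of "snd f" "snd h"] by (simp add:
    mem_Times_iff)
  next case (10 f h) then show ?case using G.over_src[of "fst f" "fst h"] G'.over_src[of "snd f" "snd h"] by (simp add:
    mem_Times_iff)
  next case (11 f h) then show ?case using G.over_tgt[of "fst f" "fst h"] G'.over_tgt[of "snd f" "snd h"] by (simp add:
    mem_Times_iff)
  next case (12 a x) then show ?case using G.over_ide[of "fst a" "fst x"] G'.over_ide[of "snd a" "snd x"] by (simp add:
    mem_Times_iff)
  next case (13 f g h k) then show ?case using G.over_cmp[of "fst f" "fst g" "fst h" "fst k"] G'.over_cmp[of "snd f"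
    "snd g" "snd h" "snd k"] by (simp add: mem_Times_iff)
  next case (14 f x) then show ?case using G.lift_over[of "fst f" "fst x"] G'.lift_over[of "snd f" "snd x"] by (simp
    add: mem_Times_iff)
  next case (16 f g x h)
    then obtain u u' where "u \<in> D (fst g)" "src E u = tgt E (L (fst f) (fst x))" "u \<cdot>\<^bsub>E\<^esub> L (fst f) (fst x) = fst h"
      "u' \<in> D' (snd g)" "src E' u' = tgt E' (L' (snd f) (snd x))" "u' \<cdot>\<^bsub>E'\<^esub> L' (snd f) (snd x) = snd h"
      using G.lift_factor[of "fst f" "fst g" "fst x" "fst h"] G'.lift_factor[of "snd f" "snd g" "snd x" "snd h"] by
        (auto simp: mem_Times_iff)
    then show ?case by (intro exI[of _ "(u, u')"]) simp
  next case (17 f g x u v) then show ?case using G.lift_unique[of "fst f" "fst g" "fst x" "fst u" "fst v"]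
    G'.lift_unique[of "snd f" "snd g" "snd x" "snd u" "snd v"] by (simp add: mem_Times_iff prod_eq_iff)
  next case (18 f x) then show ?case using G.pmor_obj[of "fst f" "fst x"] G'.pmor_obj[of "snd f" "snd x"] by (simp add:
    mem_Times_iff)
  next case (19 f u) then show ?case using G.pmor_over[of "fst f" "fst u"] G'.pmor_over[of "snd f" "snd u"] by (simp
    add: mem_Times_iff)
  next case (20 f u) then show ?case using G.pmor_src[of "fst f" "fst u"] G'.pmor_src[of "snd f" "snd u"] by (simp add:
    mem_Times_iff)
  next case (21 f u) then show ?case using G.pmor_lift[of "fst f" "fst u"] G'.pmor_lift[of "snd f" "snd u"] by (simp
    add: mem_Times_iff)
  next case (22 f g x) then show ?case using G.pcomp_over[of "fst f" "fst g" "fst x"] G'.pcomp_over[of "snd f" "snd g"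
    "snd x"] by (simp add: mem_Times_iff)
  next case (23 f g x) then show ?case using G.pcomp_src[of "fst f" "fst g" "fst x"] G'.pcomp_src[of "snd f" "snd g"
    "snd x"] by (simp add: mem_Times_iff)
  next case (24 f g x) then show ?case using G.pcomp_lift[of "fst f" "fst g" "fst x"] G'.pcomp_lift[of "snd f" "snd g"
    "snd x"] by (simp add: mem_Times_iff)
  next case (25 a x) then show ?case using G.punit_over[of "fst a" "fst x"] G'.punit_over[of "snd a" "snd x"] by (simp
    add: mem_Times_iff)
  next case (26 a x) then show ?case using G.punit_src[of "fst a" "fst x"] G'.punit_src[of "snd a" "snd x"] by (simp
    add: mem_Times_iff)
  next case (27 a x) then show ?case using G.punit_lift[of "fst a" "fst x"] G'.punit_lift[of "snd a" "snd x"] by (simp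
    add: mem_Times_iff)
  qed (auto simp: mem_Times_iff fun_eq_iff)
qed

lemma displayed_unit: "displayed cat_unit cat_unit psf_unit (\<lambda>_. UNIV) (\<lambda>_ _. ())"
  by unfold_locales (auto simp: category_cat_unit psf_unit_def)

lemma is_iso_cat_prod:
  assumes "is_iso C u" "is_iso D v"
  shows "is_iso (cat_prod C D) (u, v)"
  using assms by (fastforce simp: is_iso_def inverse_arrows_def hom_def)

section \<open>Constructions on transformations\<close>

text \<open>Converse to \<open>displayed_nat.pseudonat\<close>. If an arrow over \<open>f\<close> is
  written as \<open>v \<cdot> L f x\<close> with \<open>v\<close> vertical, its image is forced to
  be the lift \<open>L' f\<close> at the image of \<open>x\<close>, followed by the inverse of
  \<open>tiso\<close> and by the image of \<open>v\<close>. The axioms of a pseudonatural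
  transformation are what makes this functorial: the unit axiom handles vertical arrows, while the
  composition axiom and naturality of \<open>tiso\<close> handle composites.\<close>

lemma pseudonat_displayed:
  assumes "displayed A E G D L" "displayed A E' H D' L'" and \<tau>: "pseudonat A G H \<tau>"
  shows "\<exists>\<Phi>. displayed_nat A E G D L E' H D' L' \<tau> \<Phi>"
proof -
  interpret G: displayed A E G D L by fact
  interpret H: displayed A E' H D' L' by fact
  define v where "v f h = (SOME u. u \<in> D (ide A (tgt A f)) \<and> src E u = tgt E (L f (src E h)) \<and> u \<cdot>\<^bsub>E\<^esub> L f (src E h) = h
    \<and> tgt E u = tgt E h)" for f h
  have v: "v f h \<in> D (ide A (tgt A f))" "src E (v f h) = tgt E (L f (src E h))"
      "v f h \<cdot>\<^bsub>E\<^esub> L f (src E h) = h" "tgt E (v f h) = tgt E h" if "f \<in> arr A" "h \<in> D f" for f h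
  proof -
    have "\<exists>u. u \<in> D (ide A (tgt A f)) \<and> src E u = tgt E (L f (src E h)) \<and> u \<cdot>\<^bsub>E\<^esub> L f (src E h) = h \<and> tgt E u = tgt E h"
      using G.vert_factor[OF that] by metis
    from someI_ex[OF this] show "v f h \<in> D (ide A (tgt A f))" "src E (v f h) = tgt E (L f (src E h))"
      "v f h \<cdot>\<^bsub>E\<^esub> L f (src E h) = h" "tgt E (v f h) = tgt E h" unfolding v_def by simp_all
  qed
  define s where "s f x = inv_arr (pobj H (tgt A f)) (tiso \<tau> f x)" for f x
  define \<Phi> where "\<Phi> f h = fm (tcomp \<tau> (tgt A f)) (v f h) \<cdot>\<^bsub>E'\<^esub> (s f (src E h) \<cdot>\<^bsub>E'\<^esub> L' f (fo (tcomp \<tau> (src A f)) (src E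
    h)))" for f h
  have fct: "is_functor (pobj G a) (pobj H a) (tcomp \<tau> a)" if "a \<in> obj A" for a
    using \<tau> that by (simp add: pseudonat_def)
  have obj: "fo (tcomp \<tau> a) x \<in> obj (pobj H a)" if "a \<in> obj A" "x \<in> obj (pobj G a)" for a x
    using fct[OF that(1)] that by (simp add: is_functor_def)
  have vert: "fm (tcomp \<tau> a) u \<in> D' (ide A a)" "src E' (fm (tcomp \<tau> a) u) = fo (tcomp \<tau> a) (src E u)"
      "tgt E' (fm (tcomp \<tau> a) u) = fo (tcomp \<tau> a) (tgt E u)" "fm (tcomp \<tau> a) u \<in> arr E'"
    if "a \<in> obj A" "u \<in> D (ide A a)" for a u
    using fct[OF that(1)] that H.vert_simps(1)[OF that(1)] by (auto simp: is_functor_def hom_def)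
  have vcmp: "fm (tcomp \<tau> a) (w \<cdot>\<^bsub>E\<^esub> u) = fm (tcomp \<tau> a) w \<cdot>\<^bsub>E'\<^esub> fm (tcomp \<tau> a) u"
    if "a \<in> obj A" "u \<in> D (ide A a)" "w \<in> D (ide A a)" "src E w = tgt E u" for a u w
    using fct[OF that(1)] that by (simp add: is_functor_def)
  have vide: "fm (tcomp \<tau> a) (ide E x) = ide E' (fo (tcomp \<tau> a) x)"
    if "a \<in> obj A" "x \<in> obj (pobj G a)" for a x
    using fct[OF that(1)] that by (simp add: is_functor_def)
  have niso: "nat_iso (pobj G (src A f)) (pobj H (tgt A f))
        (func_comp (tcomp \<tau> (tgt A f)) (pmor G f)) (func_comp (pmor H f) (tcomp \<tau> (src A f))) (tiso \<tau> f)" if "f \<in> arr A"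
          for f
    using \<tau> that by (simp add: pseudonat_def)
  have iso: "is_iso (pobj H (tgt A f)) (tiso \<tau> f x)" and tsrc: "src E' (tiso \<tau> f x) = fo (tcomp \<tau> (tgt A f)) (tgt E (L f x))"
     and ttgt: "tgt E' (tiso \<tau> f x) = tgt E' (L' f (fo (tcomp \<tau> (src A f)) x))"
     if "f \<in> arr A" "x \<in> obj (pobj G (src A f))" for f x
    using niso[OF that(1)] that obj by (auto simp: nat_iso_def nat_trans_def hom_def G.pmor_obj H.pmor_obj)
  have s: "s f x \<in> D' (ide A (tgt A f))" "s f x \<in> arr E'" "src E' (s f x) = tgt E' (L' f (fo (tcomp \<tau> (src A f)) x))"
    "tgt E' (s f x) = fo (tcomp \<tau> (tgt A f)) (tgt E (L f x))"
    "tiso \<tau> f x \<cdot>\<^bsub>E'\<^esub> s f x = ide E' (tgt E' (L' f (fo (tcomp \<tau> (src A f)) x)))"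
    "s f x \<cdot>\<^bsub>E'\<^esub> tiso \<tau> f x = ide E' (fo (tcomp \<tau> (tgt A f)) (tgt E (L f x)))"
    "tiso \<tau> f x \<in> D' (ide A (tgt A f))" "tiso \<tau> f x \<in> arr E'"
    if "f \<in> arr A" "x \<in> obj (pobj G (src A f))" for f x
  proof -
    have a: "tgt A f \<in> obj A" using that by simp
    note i = H.iso_fibre[OF a iso[OF that]]
    show "s f x \<in> D' (ide A (tgt A f))" "src E' (s f x) = tgt E' (L' f (fo (tcomp \<tau> (src A f)) x))"
    "tgt E' (s f x) = fo (tcomp \<tau> (tgt A f)) (tgt E (L f x))"
    "tiso \<tau> f x \<cdot>\<^bsub>E'\<^esub> s f x = ide E' (tgt E' (L' f (fo (tcomp \<tau> (src A f)) x)))"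
    "s f x \<cdot>\<^bsub>E'\<^esub> tiso \<tau> f x = ide E' (fo (tcomp \<tau> (tgt A f)) (tgt E (L f x)))"
    "tiso \<tau> f x \<in> D' (ide A (tgt A f))" "tiso \<tau> f x \<in> arr E'" "s f x \<in> arr E'"
      using i tsrc[OF that] ttgt[OF that] H.vert_simps(1)[OF a i(1)] H.vert_simps(1)[OF a i(2)] by (simp_all add: s_def)
  qed
  have L': "L' f (fo (tcomp \<tau> (src A f)) x) \<in> D' f" "L' f (fo (tcomp \<tau> (src A f)) x) \<in> arr E'"
    "src E' (L' f (fo (tcomp \<tau> (src A f)) x)) = fo (tcomp \<tau> (src A f)) x"
    "tgt E' (L' f (fo (tcomp \<tau> (src A f)) x)) \<in> obj (pobj H (tgt A f))"
    if "f \<in> arr A" "x \<in> obj (pobj G (src A f))" for f x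
    using that obj[of "src A f" x] by (simp_all add: H.lift_over)
  \<comment> \<open>The future image of the lift \<open>L f x\<close>; by construction
    \<open>tiso\<close> carries it to the lift in the target.\<close>
  define l where "l f x = s f x \<cdot>\<^bsub>E'\<^esub> L' f (fo (tcomp \<tau> (src A f)) x)" for f x
  have l: "l f x \<in> D' f" "l f x \<in> arr E'" "src E' (l f x) = fo (tcomp \<tau> (src A f)) x"
    "tgt E' (l f x) = fo (tcomp \<tau> (tgt A f)) (tgt E (L f x))"
    "tiso \<tau> f x \<cdot>\<^bsub>E'\<^esub> l f x = L' f (fo (tcomp \<tau> (src A f)) x)" if "f \<in> arr A" "x \<in> obj (pobj G (src A f))" for f x
  proof -
    show "l f x \<in> D' f" "l f x \<in> arr E'" "src E' (l f x) = fo (tcomp \<tau> (src A f)) x"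
      "tgt E' (l f x) = fo (tcomp \<tau> (tgt A f)) (tgt E (L f x))"
      using s[OF that] L'[OF that] that by (simp_all add: l_def H.vert_over)
    show "tiso \<tau> f x \<cdot>\<^bsub>E'\<^esub> l f x = L' f (fo (tcomp \<tau> (src A f)) x)"
      unfolding l_def using H.E.cmp_reassoc[OF s(5)[OF that], of "L' f (fo (tcomp \<tau> (src A f)) x)"]
        s[OF that] L'[OF that] tsrc[OF that] by simp
  qed
  have Phi: "\<Phi> f h = fm (tcomp \<tau> (tgt A f)) (v f h) \<cdot>\<^bsub>E'\<^esub> l f (src E h)" for f h
    unfolding \<Phi>_def l_def ..
  have P: "\<Phi> f (u \<cdot>\<^bsub>E\<^esub> L f x) = fm (tcomp \<tau> (tgt A f)) u \<cdot>\<^bsub>E'\<^esub> l f x"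
    if f: "f \<in> arr A" "x \<in> obj (pobj G (src A f))" and u: "u \<in> D (ide A (tgt A f))" "src E u = tgt E (L f x)" for f x u
  proof -
    have ua: "u \<in> arr E" using G.vert_simps(1)[OF _ u(1)] f by simp
    have h: "u \<cdot>\<^bsub>E\<^esub> L f x \<in> D f" "src E (u \<cdot>\<^bsub>E\<^esub> L f x) = x" using f u ua by (simp_all add: G.vert_over G.lift_over)
    have "v f (u \<cdot>\<^bsub>E\<^esub> L f x) = u"
      by (rule G.vert_unique[OF f]) (use v[OF f(1) h(1)] h u in simp_all)
    then show ?thesis by (simp add: Phi h)
  qed
  have Pl: "\<Phi> f (L f x) = l f x" if f: "f \<in> arr A" "x \<in> obj (pobj G (src A f))" for f x
  proof -
    have z: "tgt E (L f x) \<in> obj (pobj G (tgt A f))" "tgt E (L f x) \<in> obj E" "tgt A f \<in> obj A" using f by simp_all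
    show ?thesis
      using P[OF f, of "ide E (tgt E (L f x))"] f z l[OF f] G.over_ide[OF z(3,1)] vide[OF z(3,1)] by simp
  qed
  have Pv: "\<Phi> (ide A a) u = fm (tcomp \<tau> a) u" if a: "a \<in> obj A" and u: "u \<in> D (ide A a)" for a u
  proof -
    let ?x = "src E u"
    have i: "ide A a \<in> arr A" "tgt A (ide A a) = a" "src A (ide A a) = a" using a by simp_all
    note us = G.vert_simps[OF a u]
    have x: "?x \<in> obj (pobj G (src A (ide A a)))" using us a by simp
    note p = G.punit_over[OF a us(2)] G.punit_simps[OF a us(2)] G.punit_src[OF a us(2)] G.punit_lift[OF a us(2)]
    have y: "fo (tcomp \<tau> a) ?x \<in> obj (pobj H a)" using obj a us by blast
    note q = H.punit_over[OF a y] H.punit_simps[OF a y] H.punit_src[OF a y] H.punit_lift[OF a y]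
    have L: "L (ide A a) ?x \<in> arr E" "src E (L (ide A a) ?x) = ?x" using i x by simp_all
    \<comment> \<open>A vertical arrow factors through the lift of the identity, with vertical part
      \<open>u\<close> after \<open>punit\<close>. The unit axiom then cancels \<open>tiso\<close>
      against its inverse.\<close>
    have e: "u = (u \<cdot>\<^bsub>E\<^esub> punit G a ?x) \<cdot>\<^bsub>E\<^esub> L (ide A a) ?x"
      using p us L by simp
    have n: "punit H a (fo (tcomp \<tau> a) ?x) \<cdot>\<^bsub>E'\<^esub> tiso \<tau> (ide A a) ?x = fm (tcomp \<tau> a) (punit G a ?x)"
      using \<tau> a us by (simp add: pseudonat_def)
    have "\<Phi> (ide A a) u = fm (tcomp \<tau> a) (u \<cdot>\<^bsub>E\<^esub> punit G a ?x) \<cdot>\<^bsub>E'\<^esub> l (ide A a) ?x"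
      using P[OF i(1) x, of "u \<cdot>\<^bsub>E\<^esub> punit G a ?x"] p us a u i e by (simp add: G.vert_cmp)
    also have "\<dots> = (fm (tcomp \<tau> a) u \<cdot>\<^bsub>E'\<^esub> (punit H a (fo (tcomp \<tau> a) ?x) \<cdot>\<^bsub>E'\<^esub> tiso \<tau> (ide A a) ?x)) \<cdot>\<^bsub>E'\<^esub> l (ide A a) ?x"
      using vcmp[OF a p(1) u] p n by simp
    also have "\<dots> = fm (tcomp \<tau> a) u"
      using vert[OF a u] q l[OF i(1) x] s[OF i(1) x] ttgt[OF i(1) x] tsrc[OF i(1) x] i by simp
    finally show ?thesis .
  qed
  have Pc: "\<Phi> (g \<cdot>\<^bsub>A\<^esub> f) (k \<cdot>\<^bsub>E\<^esub> h) = \<Phi> g k \<cdot>\<^bsub>E'\<^esub> \<Phi> f h"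
    if f: "f \<in> arr A" "g \<in> arr A" "src A g = tgt A f" and h: "h \<in> D f" "k \<in> D g" "src E k = tgt E h" for f g h k
  proof -
    define x y where "x = src E h" and "y = tgt E h"
    have x: "x \<in> obj (pobj G (src A f))" and y: "y \<in> obj (pobj G (src A g))"
      using G.over_src[OF f(1) h(1)] G.over_tgt[OF f(1) h(1)] f by (simp_all add: x_def y_def)
    define z where "z = tgt E (L f x)"
    have z: "z \<in> obj (pobj G (src A g))" using x f by (simp add: z_def)
    have ha: "h \<in> arr E" "k \<in> arr E" using G.over_arr f h by blast+
    note vh = v[OF f(1) h(1), folded x_def y_def, folded z_def]
    note vk = v[OF f(2) h(2), unfolded h(3), folded y_def]
    have vh': "v f h \<in> D (ide A (src A g))" using vh f by simp
    have a: "src A f \<in> obj A" "tgt A f \<in> obj A" "tgt A g \<in> obj A" using f by simp_all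
    have va: "v f h \<in> arr E" "v g k \<in> arr E" using G.vert_simps(1)[OF _ vh(1)] G.vert_simps(1)[OF _ vk(1)] a by simp_all
    have gf: "g \<cdot>\<^bsub>A\<^esub> f \<in> arr A" "x \<in> obj (pobj G (src A (g \<cdot>\<^bsub>A\<^esub> f)))" and i: "src A (g \<cdot>\<^bsub>A\<^esub> f) = src A f" "tgt A (g \<cdot>\<^bsub>A\<^esub>
      f) = tgt A g"
      using f x by simp_all
    note p = G.pcomp_over[OF f x] G.pcomp_simps[OF f x] G.pcomp_src[OF f x] G.pcomp_lift[OF f x]
    have y1: "fo (tcomp \<tau> (src A f)) x \<in> obj (pobj H (src A f))" using obj a x by simp
    note q = H.pcomp_over[OF f y1] H.pcomp_simps[OF f y1] H.pcomp_src[OF f y1] H.pcomp_lift[OF f y1]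
    note m = G.pmor_over[OF f(2) vh'] G.pmor_simps[OF f(2) vh'] G.pmor_src[OF f(2) vh'] G.pmor_lift[OF f(2) vh']
    have L: "L f x \<in> arr E" "src E (L f x) = x" "L g z \<in> arr E" "src E (L g z) = z" "L g y \<in> arr E" "src E (L g y) = y"
      "L (g \<cdot>\<^bsub>A\<^esub> f) x \<in> arr E"
      using f x y z gf by simp_all
    \<comment> \<open>The vertical part of \<open>k \<cdot> h\<close>: push the vertical part of
      \<open>h\<close> forward along \<open>g\<close>, put the comparison \<open>pcomp\<close>
      before it and the vertical part of \<open>k\<close> after it. This is composition in the
      Grothendieck construction.\<close>
    let ?w = "v g k \<cdot>\<^bsub>E\<^esub> (fm (pmor G g) (v f h) \<cdot>\<^bsub>E\<^esub> pcomp G g f x)"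
    have mv: "fm (pmor G g) (v f h) \<cdot>\<^bsub>E\<^esub> pcomp G g f x \<in> D (ide A (tgt A g))"
      using a m p vh by (simp add: G.vert_cmp z_def)
    have w: "?w \<in> D (ide A (tgt A (g \<cdot>\<^bsub>A\<^esub> f)))" "src E ?w = tgt E (L (g \<cdot>\<^bsub>A\<^esub> f) x)"
      using mv vk m p vh va a i by (simp_all add: G.vert_cmp z_def)
    have "?w \<cdot>\<^bsub>E\<^esub> L (g \<cdot>\<^bsub>A\<^esub> f) x = v g k \<cdot>\<^bsub>E\<^esub> (fm (pmor G g) (v f h) \<cdot>\<^bsub>E\<^esub> (L g z \<cdot>\<^bsub>E\<^esub> L f x))"
      using va vk m p vh L by (simp add: z_def)
    also have "\<dots> = v g k \<cdot>\<^bsub>E\<^esub> (L g y \<cdot>\<^bsub>E\<^esub> (v f h \<cdot>\<^bsub>E\<^esub> L f x))"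
      using G.E.cmp_reassoc[OF m(5), of "L f x"] va vk m vh L by (simp add: z_def)
    also have "\<dots> = k \<cdot>\<^bsub>E\<^esub> h" using G.E.cmp_reassoc[OF vk(3), of h] vk vh va L ha y_def by simp
    finally have e: "k \<cdot>\<^bsub>E\<^esub> h = ?w \<cdot>\<^bsub>E\<^esub> L (g \<cdot>\<^bsub>A\<^esub> f) x" by simp
    let ?s = "tiso \<tau> f x"
    note lf = l[OF f(1) x, folded z_def] and lg = l[OF f(2) z] and lgy = l[OF f(2) y] and lgf = l[OF gf]
    note sf = s[OF f(1) x] tsrc[OF f(1) x] ttgt[OF f(1) x]
    note sg = s[OF f(2) z] tsrc[OF f(2) z] ttgt[OF f(2) z]
    note sgy = s[OF f(2) y] tsrc[OF f(2) y] ttgt[OF f(2) y]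
    note sgf = s[OF gf] tsrc[OF gf] ttgt[OF gf]
    have sv: "?s \<in> D' (ide A (src A g))" using sf f by simp
    note M = H.pmor_over[OF f(2) sv] H.pmor_simps[OF f(2) sv] H.pmor_src[OF f(2) sv] H.pmor_lift[OF f(2) sv]
    have vhT: "fm (tcomp \<tau> (tgt A f)) (v f h) \<in> D' (ide A (src A g))" using vert[OF a(2) vh(1)] f by simp
    note V = vert[OF a(2) vh(1)] vert[OF a(3) m(1)] vert[OF a(3) p(1)] vert[OF a(3) vk(1)]
    note N = H.pmor_over[OF f(2) vhT] H.pmor_simps[OF f(2) vhT] H.pmor_src[OF f(2) vhT] H.pmor_lift[OF f(2) vhT]
    have ax: "pcomp H g f (fo (tcomp \<tau> (src A f)) x) \<cdot>\<^bsub>E'\<^esub> tiso \<tau> (g \<cdot>\<^bsub>A\<^esub> f) x =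
       fm (pmor H g) ?s \<cdot>\<^bsub>E'\<^esub> (tiso \<tau> g z \<cdot>\<^bsub>E'\<^esub> fm (tcomp \<tau> (tgt A g)) (pcomp G g f x))"
      using \<tau> f x by (simp add: pseudonat_def G.pmor_obj z_def)
    have nat: "tiso \<tau> g y \<cdot>\<^bsub>E'\<^esub> fm (tcomp \<tau> (tgt A g)) (fm (pmor G g) (v f h)) =
       fm (pmor H g) (fm (tcomp \<tau> (tgt A f)) (v f h)) \<cdot>\<^bsub>E'\<^esub> tiso \<tau> g z"
    proof -
      have "\<forall>u\<in>D (ide A (tgt A f)). tiso \<tau> g (tgt E u) \<cdot>\<^bsub>E'\<^esub> fm (tcomp \<tau> (tgt A g)) (fm (pmor G g) u) =
         fm (pmor H g) (fm (tcomp \<tau> (tgt A f)) u) \<cdot>\<^bsub>E'\<^esub> tiso \<tau> g (src E u)"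
        using niso[OF f(2)] f by (simp add: nat_iso_def nat_trans_def)
      from bspec[OF this vh(1)] show ?thesis by (simp add: vh)
    qed
    have L'z: "L' g (fo (tcomp \<tau> (src A g)) z) \<in> arr E'" "src E' (L' g (fo (tcomp \<tau> (src A g)) z)) = fo (tcomp \<tau> (src A
      g)) z"
      "L' g (tgt E' (L' f (fo (tcomp \<tau> (src A f)) x))) \<in> arr E'"
      "src E' (L' g (tgt E' (L' f (fo (tcomp \<tau> (src A f)) x)))) = tgt E' (L' f (fo (tcomp \<tau> (src A f)) x))"
      using L'[OF f(2) z] L'[OF f(1) x] f by simp_all
    have isoM: "is_iso E' (fm (pmor H g) ?s)"
    proof -
      interpret FH: functr "pobj H (src A g)" "pobj H (tgt A g)" "pmor H g"
        using H.functor_pmor[OF f(2)] by (rule functrI)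
      have "is_iso (pobj H (src A g)) ?s" using iso[OF f(1) x] f by simp
      then have "is_iso (pobj H (tgt A g)) (fm (pmor H g) ?s)"
        unfolding is_iso_def using FH.fm_inverse by blast
      then show ?thesis using H.iso_fibre_total(1) a by blast
    qed
    have isog: "is_iso E' (tiso \<tau> g z)" "is_iso E' (tiso \<tau> g y)"
      using H.iso_fibre_total(1) iso[OF f(2) z] iso[OF f(2) y] a by blast+
    \<comment> \<open>The composition axiom, stated for the images of lifts. The isomorphism
      cancelled on the left is the one through which that axiom compares a two-step lift with its
      image.\<close>
    have key1: "fm (tcomp \<tau> (tgt A g)) (pcomp G g f x) \<cdot>\<^bsub>E'\<^esub> l (g \<cdot>\<^bsub>A\<^esub> f) x = l g z \<cdot>\<^bsub>E'\<^esub> l f x"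
    proof (rule H.E.iso_cancel_left[OF H.E.is_iso_cmp[OF isog(1) isoM]])
      have "(fm (pmor H g) ?s \<cdot>\<^bsub>E'\<^esub> tiso \<tau> g z) \<cdot>\<^bsub>E'\<^esub> (fm (tcomp \<tau> (tgt A g)) (pcomp G g f x) \<cdot>\<^bsub>E'\<^esub> l (g \<cdot>\<^bsub>A\<^esub> f) x)
        = (fm (pmor H g) ?s \<cdot>\<^bsub>E'\<^esub> (tiso \<tau> g z \<cdot>\<^bsub>E'\<^esub> fm (tcomp \<tau> (tgt A g)) (pcomp G g f x))) \<cdot>\<^bsub>E'\<^esub> l (g \<cdot>\<^bsub>A\<^esub> f) x"
        using M sg sf V p lgf i f by (simp add: z_def)
      also have "\<dots> = pcomp H g f (fo (tcomp \<tau> (src A f)) x) \<cdot>\<^bsub>E'\<^esub> (tiso \<tau> (g \<cdot>\<^bsub>A\<^esub> f) x \<cdot>\<^bsub>E'\<^esub> l (g \<cdot>\<^bsub>A\<^esub> f) x)"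
        unfolding ax[symmetric] using q sgf lgf i by simp
      also have "\<dots> = L' g (tgt E' (L' f (fo (tcomp \<tau> (src A f)) x))) \<cdot>\<^bsub>E'\<^esub> L' f (fo (tcomp \<tau> (src A f)) x)"
        using lgf q i by simp
      also have "\<dots> = (L' g (tgt E' ?s) \<cdot>\<^bsub>E'\<^esub> ?s) \<cdot>\<^bsub>E'\<^esub> l f x"
        using lf sf L'z by (simp add: z_def)
      also have "\<dots> = fm (pmor H g) ?s \<cdot>\<^bsub>E'\<^esub> (L' g (fo (tcomp \<tau> (src A g)) z) \<cdot>\<^bsub>E'\<^esub> l f x)"
        using H.E.cmp_reassoc[OF M(5), of "l f x"] M(1-4) sf lf L'z f by (simp add: z_def)
      also have "L' g (fo (tcomp \<tau> (src A g)) z) \<cdot>\<^bsub>E'\<^esub> l f x = tiso \<tau> g z \<cdot>\<^bsub>E'\<^esub> (l g z \<cdot>\<^bsub>E'\<^esub> l f x)"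
        by (rule H.E.cmp_reassoc[OF lg(5), symmetric]) (use lg lf sg f in simp_all)
      also have "fm (pmor H g) ?s \<cdot>\<^bsub>E'\<^esub> (tiso \<tau> g z \<cdot>\<^bsub>E'\<^esub> (l g z \<cdot>\<^bsub>E'\<^esub> l f x)) = (fm (pmor H g) ?s \<cdot>\<^bsub>E'\<^esub> tiso \<tau> g z)
        \<cdot>\<^bsub>E'\<^esub> (l g z \<cdot>\<^bsub>E'\<^esub> l f x)"
        using M sg lg lf sf f by (simp add: z_def)
      finally show "(fm (pmor H g) ?s \<cdot>\<^bsub>E'\<^esub> tiso \<tau> g z) \<cdot>\<^bsub>E'\<^esub> (fm (tcomp \<tau> (tgt A g)) (pcomp G g f x) \<cdot>\<^bsub>E'\<^esub> l (g \<cdot>\<^bsub>A\<^esub> f) x)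
         = (fm (pmor H g) ?s \<cdot>\<^bsub>E'\<^esub> tiso \<tau> g z) \<cdot>\<^bsub>E'\<^esub> (l g z \<cdot>\<^bsub>E'\<^esub> l f x)" .
    qed (use M sg lg lf sf f V p lgf i in \<open>simp_all add: z_def\<close>)
    \<comment> \<open>Naturality of \<open>tiso\<close> at the vertical part of \<open>h\<close>,
      likewise stated for the images of lifts. It moves that vertical part past the lift of
      \<open>g\<close>.\<close>
    have key2: "fm (tcomp \<tau> (tgt A g)) (fm (pmor G g) (v f h)) \<cdot>\<^bsub>E'\<^esub> l g z = l g y \<cdot>\<^bsub>E'\<^esub> fm (tcomp \<tau> (tgt A f)) (v f h)"
    proof (rule H.E.iso_cancel_left[OF isog(2)])
      have "tiso \<tau> g y \<cdot>\<^bsub>E'\<^esub> (fm (tcomp \<tau> (tgt A g)) (fm (pmor G g) (v f h)) \<cdot>\<^bsub>E'\<^esub> l g z) =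
        (fm (pmor H g) (fm (tcomp \<tau> (tgt A f)) (v f h)) \<cdot>\<^bsub>E'\<^esub> tiso \<tau> g z) \<cdot>\<^bsub>E'\<^esub> l g z"
        by (rule H.E.cmp_reassoc[OF nat]) (use V sgy lg m vh in simp_all)
      also have "\<dots> = fm (pmor H g) (fm (tcomp \<tau> (tgt A f)) (v f h)) \<cdot>\<^bsub>E'\<^esub> L' g (fo (tcomp \<tau> (tgt A f)) z)"
        using N sg lg V vh f by simp
      also have "\<dots> = L' g (fo (tcomp \<tau> (src A g)) y) \<cdot>\<^bsub>E'\<^esub> fm (tcomp \<tau> (tgt A f)) (v f h)"
        using N(5) V vh f by simp
      also have "\<dots> = tiso \<tau> g y \<cdot>\<^bsub>E'\<^esub> (l g y \<cdot>\<^bsub>E'\<^esub> fm (tcomp \<tau> (tgt A f)) (v f h))"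
        by (rule H.E.cmp_reassoc[OF lgy(5), symmetric]) (use lgy sgy V vh f in simp_all)
      finally show "tiso \<tau> g y \<cdot>\<^bsub>E'\<^esub> (fm (tcomp \<tau> (tgt A g)) (fm (pmor G g) (v f h)) \<cdot>\<^bsub>E'\<^esub> l g z) =
        tiso \<tau> g y \<cdot>\<^bsub>E'\<^esub> (l g y \<cdot>\<^bsub>E'\<^esub> fm (tcomp \<tau> (tgt A f)) (v f h))" .
    qed (use V lg lgy sgy m vh f in simp_all)
    have "\<Phi> (g \<cdot>\<^bsub>A\<^esub> f) (k \<cdot>\<^bsub>E\<^esub> h) = fm (tcomp \<tau> (tgt A g)) ?w \<cdot>\<^bsub>E'\<^esub> l (g \<cdot>\<^bsub>A\<^esub> f) x"
      unfolding e using P[OF gf w] i by simp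
    also have "fm (tcomp \<tau> (tgt A g)) ?w = fm (tcomp \<tau> (tgt A g)) (v g k) \<cdot>\<^bsub>E'\<^esub>
       (fm (tcomp \<tau> (tgt A g)) (fm (pmor G g) (v f h)) \<cdot>\<^bsub>E'\<^esub> fm (tcomp \<tau> (tgt A g)) (pcomp G g f x))"
      using vcmp[OF a(3) mv vk(1)] vcmp[OF a(3) p(1) m(1)] m p vk vh by (simp add: z_def)
    also have "\<dots> \<cdot>\<^bsub>E'\<^esub> l (g \<cdot>\<^bsub>A\<^esub> f) x = fm (tcomp \<tau> (tgt A g)) (v g k) \<cdot>\<^bsub>E'\<^esub>
       (fm (tcomp \<tau> (tgt A g)) (fm (pmor G g) (v f h)) \<cdot>\<^bsub>E'\<^esub> (l g z \<cdot>\<^bsub>E'\<^esub> l f x))"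
      using V lgf m p vk vh i key1 by (simp add: z_def)
    also have "\<dots> = fm (tcomp \<tau> (tgt A g)) (v g k) \<cdot>\<^bsub>E'\<^esub> (l g y \<cdot>\<^bsub>E'\<^esub> (fm (tcomp \<tau> (tgt A f)) (v f h) \<cdot>\<^bsub>E'\<^esub> l f x))"
      using H.E.cmp_reassoc[OF key2, of "l f x"] V lg lf lgy m vh f by simp
    also have "\<dots> = \<Phi> g k \<cdot>\<^bsub>E'\<^esub> \<Phi> f h"
      unfolding Phi using V lgy lf vk vh h f by (simp flip: x_def y_def)
    finally show ?thesis .
  qed
  have "displayed_nat A E G D L E' H D' L' \<tau> \<Phi>"
  proof (unfold_locales, goal_cases)
    case (1 a x) then show ?case using obj by blast
  next case (2 f h)
    then show ?case unfolding Phi using v[OF 2] G.over_src[OF 2] l[OF 2(1) G.over_src[OF 2]] vert[of "tgt A f" "v f h"]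
      by (simp add: H.vert_over)
  next case (3 f h)
    then show ?case unfolding Phi using v[OF 3] G.over_src[OF 3] l[OF 3(1) G.over_src[OF 3]] vert[of "tgt A f" "v f h"]
      by simp
  next case (4 f h)
    then show ?case unfolding Phi using v[OF 4] G.over_src[OF 4] l[OF 4(1) G.over_src[OF 4]] vert[of "tgt A f" "v f h"]
      by simp
  next case (5 a x) then show ?case using Pv[of a "ide E x"] vide[of a x] G.over_ide[of a x] by simp
  next case (6 f g h k) then show ?case using Pc by blast
  next case (7 a u) then show ?case using Pv by simp
  next case (8 f x) then show ?case using iso by blast
  next case (9 f x) then show ?case using tsrc by blast
  next case (10 f x) then show ?case using Pl l by simp
  qed
  then show ?thesis by blast
qed

section \<open>Identities, composites, reindexing, products and whiskering of
  transformations\<close>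

lemma displayed_nat_id:
  assumes "displayed A E G D L"
  shows "displayed_nat A E G D L E G D L (pnt_id A G) (\<lambda>_ h. h)"
proof -
  interpret G: displayed A E G D L by fact
  have iso: "is_iso (pobj G (tgt A f)) (ide E (tgt E (L f x)))" if "f \<in> arr A" "x \<in> obj (pobj G (src A f))" for f x
  proof -
    interpret P: categ "pobj G (tgt A f)" using that by unfold_locales (simp add: G.category_fibre)
    show ?thesis using P.is_iso_ide[of "tgt E (L f x)"] that by simp
  qed
  show ?thesis
    by (intro displayed_nat.intro displayed_nat_axioms.intro assms)
      (simp_all add: pnt_id_def func_id_def G.pmor_obj iso)
qed

text \<open>The composite 2-cell compares the image of a lift with a lift in two stages:
  \<open>\<Psi>\<close> applied to the 2-cell of \<open>\<tau>\<close> reaches the image under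
  \<open>\<Psi>\<close> of a chosen lift, and the 2-cell of \<open>\<sigma>\<close>
  finishes.\<close>

lemma displayed_nat_comp:
  assumes "displayed_nat A E G D L E' H D' L' \<tau> \<Phi>" "displayed_nat A E' H D' L' E'' K D'' L'' \<sigma> \<Psi>"
  shows "displayed_nat A E G D L E'' K D'' L'' (pnt_comp A K \<sigma> \<tau>) (\<lambda>f h. \<Psi> f (\<Phi> f h))"
proof -
  interpret T: displayed_nat A E G D L E' H D' L' \<tau> \<Phi> by fact
  interpret S: displayed_nat A E' H D' L' E'' K D'' L'' \<sigma> \<Psi> by fact
  have t: "tiso (pnt_comp A K \<sigma> \<tau>) f x = tiso \<sigma> f (fo (tcomp \<tau> (src A f)) x) \<cdot>\<^bsub>E''\<^esub> \<Psi> (ide A (tgt A f)) (tiso \<tau> f x)"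
    if "f \<in> arr A" "x \<in> obj (pobj G (src A f))" for f x
    using that by (simp add: pnt_comp_def S.Phi_vert T.tiso_simps)
  have tc: "tcomp (pnt_comp A K \<sigma> \<tau>) = (\<lambda>a. func_comp (tcomp \<sigma> a) (tcomp \<tau> a))" by (simp add: pnt_comp_def)
  show ?thesis
  proof (intro displayed_nat.intro displayed_nat_axioms.intro, goal_cases)
    case 1 show ?case by unfold_locales
  next case 2 show ?case by unfold_locales
  next case (10 f x)
    have y: "fo (tcomp \<tau> (src A f)) x \<in> obj (pobj H (src A f))" using T.Phi_obj 10 by simp
    have a: "tgt A f \<in> obj A" using 10 by simp
    interpret P: functr "pobj H (tgt A f)" "pobj K (tgt A f)" "tcomp \<sigma> (tgt A f)"
      using S.functor_tcomp 10 by (intro functrI) simp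
    have "is_iso (pobj K (tgt A f)) (fm (tcomp \<sigma> (tgt A f)) (tiso \<tau> f x))"
      using P.fm_inverse T.tiso_iso[OF 10] unfolding is_iso_def by blast
    then show ?case
      unfolding t[OF 10]
      using P.D.is_iso_cmp[OF _ S.tiso_iso[OF 10(1) y], of "\<Psi> (ide A (tgt A f)) (tiso \<tau> f x)"] 10 a T.tiso_simps[OF 10]
        S.Phi_vert_simps[OF a T.tiso_simps(1)[OF 10]] S.tiso_src[OF 10(1) y]
      by (simp add: S.Phi_vert)
  next case (11 f x)
    have y: "fo (tcomp \<tau> (src A f)) x \<in> obj (pobj H (src A f))" using T.Phi_obj 11 by simp
    have a: "tgt A f \<in> obj A" using 11 by simp
    show ?case unfolding t[OF 11]
      using T.tiso_simps[OF 11] T.tiso_src[OF 11] S.tiso_simps[OF 11(1) y] S.tiso_src[OF 11(1) y]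
        S.Phi_vert_simps[OF a T.tiso_simps(1)[OF 11]] by (simp add: tc)
  next case (12 f x)
    have y: "fo (tcomp \<tau> (src A f)) x \<in> obj (pobj H (src A f))" using T.Phi_obj 12 by simp
    have a: "tgt A f \<in> obj A" using 12 by simp
    note ls = T.Phi_lift_simps[OF 12]
    have "\<Psi> (ide A (tgt A f)) (tiso \<tau> f x) \<cdot>\<^bsub>E''\<^esub> \<Psi> f (\<Phi> f (L f x)) = \<Psi> f (L' f (fo (tcomp \<tau> (src A f)) x))"
      using S.Phi_vert_cmp[OF 12(1) ls(1) T.tiso_simps(1)[OF 12]] T.tiso_src[OF 12] ls T.tiso_lift[OF 12] by simp
    then show ?case unfolding t[OF 12]
      using T.tiso_simps[OF 12] T.tiso_src[OF 12] S.tiso_simps[OF 12(1) y] S.tiso_src[OF 12(1) y]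
        S.Phi_vert_simps[OF a T.tiso_simps(1)[OF 12]] S.tiso_lift[OF 12(1) y]
        S.Phi_arr[OF 12(1) ls(1)] S.Phi_tgt[OF 12(1) ls(1)] ls
      by (simp add: tc)
  next case (6 f h) then show ?case using T.Phi_over[of f h] by (simp add: tc T.Phi_tgt S.Phi_tgt)
  next case (5 f h) then show ?case using T.Phi_over[of f h] by (simp add: tc T.Phi_src S.Phi_src)
  next case (8 f g h k) then show ?case
      using T.Phi_over[of f h] T.Phi_over[of g k] by (simp add: T.Phi_cmp S.Phi_cmp T.Phi_src T.Phi_tgt)
  qed (simp_all add: tc T.Phi_obj S.Phi_obj T.Phi_over S.Phi_over T.Phi_ide S.Phi_ide T.Phi_vert S.Phi_vert T.Phi_vert_simps)
qed

lemma displayed_nat_precomp: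
  assumes "functr A B K" "displayed_nat B E G D L E' H D' L' \<tau> \<Phi>"
  shows "displayed_nat A E (psf_precomp K G) (\<lambda>f. D (fm K f)) (\<lambda>f. L (fm K f))
    E' (psf_precomp K H) (\<lambda>f. D' (fm K f)) (\<lambda>f. L' (fm K f)) (pnt_precomp K \<tau>) (\<lambda>f. \<Phi> (fm K f))"
proof -
  interpret K: functr A B K by fact
  interpret T: displayed_nat B E G D L E' H D' L' \<tau> \<Phi> by fact
  have t: "tcomp (pnt_precomp K \<tau>) = (\<lambda>a. tcomp \<tau> (fo K a))" "tiso (pnt_precomp K \<tau>) = (\<lambda>f. tiso \<tau> (fm K f))"
    by (simp_all add: pnt_precomp_def)
  show ?thesis
  proof (intro displayed_nat.intro displayed_nat_axioms.intro, goal_cases)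
    case 1 show ?case by (rule displayed_precomp[OF assms(1) T.G.displayed_axioms])
  next case 2 show ?case by (rule displayed_precomp[OF assms(1) T.H.displayed_axioms])
  next case (3 a x) then show ?case using T.Phi_obj[of "fo K a" x] by (simp add: t)
  next case (4 f h) then show ?case using T.Phi_over[of "fm K f" h] by (simp add: t)
  next case (5 f h) then show ?case using T.Phi_src[of "fm K f" h] by (simp add: t)
  next case (6 f h) then show ?case using T.Phi_tgt[of "fm K f" h] by (simp add: t)
  next case (7 a x) then show ?case using T.Phi_ide[of "fo K a" x] by (simp add: t)
  next case (8 f g h k) then show ?case using T.Phi_cmp[of "fm K f" "fm K g" h k] by (simp add: t)
  next case (9 a u) then show ?case using T.Phi_vert[of "fo K a" u] by (simp add: t)
  next case (10 f x) then show ?case using T.tiso_iso[of "fm K f" x] by (simp add: t)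
  next case (11 f x) then show ?case using T.tiso_src[of "fm K f" x] by (simp add: t)
  next case (12 f x) then show ?case using T.tiso_lift[of "fm K f" x] by (simp add: t)
  qed
qed

lemma displayed_nat_prod:
  assumes "displayed_nat A E G D L E' H D' L' \<sigma> \<Phi>" "displayed_nat B M J N R M' J' N' R' \<tau> \<Psi>"
  shows "displayed_nat (cat_prod A B)
    (cat_prod E M) (psf_prod G J) (\<lambda>f. D (fst f) \<times> N (snd f)) (\<lambda>f x. (L (fst f) (fst x), R (snd f) (snd x)))
    (cat_prod E' M') (psf_prod H J') (\<lambda>f. D' (fst f) \<times> N' (snd f)) (\<lambda>f x. (L' (fst f) (fst x), R' (snd f) (snd x)))
    (pnt_prod \<sigma> \<tau>) (\<lambda>f h. (\<Phi> (fst f) (fst h), \<Psi> (snd f) (snd h)))"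
proof -
  interpret S: displayed_nat A E G D L E' H D' L' \<sigma> \<Phi> by fact
  interpret T: displayed_nat B M J N R M' J' N' R' \<tau> \<Psi> by fact
  have t: "tcomp (pnt_prod \<sigma> \<tau>) a = func_prod (tcomp \<sigma> (fst a)) (tcomp \<tau> (snd a))"
    "tiso (pnt_prod \<sigma> \<tau>) f x = (tiso \<sigma> (fst f) (fst x), tiso \<tau> (snd f) (snd x))" for a f x
    by (simp_all add: pnt_prod_def case_prod_beta)
  show ?thesis
  proof (intro displayed_nat.intro displayed_nat_axioms.intro, goal_cases)
    case 1 show ?case by (intro displayed_prod S.G.displayed_axioms T.G.displayed_axioms)
  next case 2 show ?case by (intro displayed_prod S.H.displayed_axioms T.H.displayed_axioms)
  next case (3 a x) then show ?case using S.Phi_obj[of "fst a" "fst x"] T.Phi_obj[of "snd a" "snd x"] by (simp add: t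
    mem_Times_iff)
  next case (4 f h) then show ?case using S.Phi_over[of "fst f" "fst h"] T.Phi_over[of "snd f" "snd h"] by (simp add: t
    mem_Times_iff)
  next case (5 f h) then show ?case using S.Phi_src[of "fst f" "fst h"] T.Phi_src[of "snd f" "snd h"] by (simp add: t
    mem_Times_iff)
  next case (6 f h) then show ?case using S.Phi_tgt[of "fst f" "fst h"] T.Phi_tgt[of "snd f" "snd h"] by (simp add: t
    mem_Times_iff)
  next case (7 a x) then show ?case using S.Phi_ide[of "fst a" "fst x"] T.Phi_ide[of "snd a" "snd x"] by (simp add: t
    mem_Times_iff)
  next case (8 f g h k) then show ?case using S.Phi_cmp[of "fst f" "fst g" "fst h" "fst k"] T.Phi_cmp[of "snd f" "snd g"
    "snd h" "snd k"] by (simp add: t mem_Times_iff)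
  next case (9 a u) then show ?case using S.Phi_vert[of "fst a" "fst u"] T.Phi_vert[of "snd a" "snd u"] by (simp add: t
    mem_Times_iff)
  next case (10 f x) then show ?case using S.tiso_iso[of "fst f" "fst x"] T.tiso_iso[of "snd f" "snd x"] by (simp add: t
    mem_Times_iff is_iso_cat_prod)
  next case (11 f x) then show ?case using S.tiso_src[of "fst f" "fst x"] T.tiso_src[of "snd f" "snd x"] by (simp add: t
    mem_Times_iff)
  next case (12 f x) then show ?case using S.tiso_lift[of "fst f" "fst x"] T.tiso_lift[of "snd f" "snd x"] by (simp add:
    t mem_Times_iff)
  qed
qed

text \<open>Meant for rebracketing, exchanging or dropping factors of a product of fibres. Such
  functors carry chosen lifts to chosen lifts, so identities can serve as 2-cells.\<close>

lemma displayed_nat_strict: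
  assumes "displayed A E G D L" "displayed A E' H D' L'" "functr E E' T"
    and obj: "\<And>a x. a \<in> obj A \<Longrightarrow> x \<in> obj (pobj G a) \<Longrightarrow> fo T x \<in> obj (pobj H a)"
    and over: "\<And>f h. f \<in> arr A \<Longrightarrow> h \<in> D f \<Longrightarrow> fm T h \<in> D' f"
    and lift: "\<And>f x. f \<in> arr A \<Longrightarrow> x \<in> obj (pobj G (src A f)) \<Longrightarrow> fm T (L f x) = L' f (fo T x)"
    and \<Phi>: "\<Phi> = (\<lambda>_ h. fm T h)"
  shows "displayed_nat A E G D L E' H D' L' (pnt_strict A H T) \<Phi>"
proof -
  interpret G: displayed A E G D L by fact
  interpret H: displayed A E' H D' L' by fact
  interpret T: functr E E' T by fact
  have l: "fo T (tgt E (L f x)) = tgt E' (L' f (fo T x))" if "f \<in> arr A" "x \<in> obj (pobj G (src A f))" for f x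
    using T.tgt_fm[of "L f x"] lift[OF that] that by simp
  have iso: "is_iso (pobj H (tgt A f)) (ide E' (tgt E' (L' f (fo T x))))" if "f \<in> arr A" "x \<in> obj (pobj G (src A f))" for f x
  proof -
    interpret P: categ "pobj H (tgt A f)" using that by unfold_locales (simp add: H.category_fibre)
    show ?thesis using P.is_iso_ide[of "tgt E' (L' f (fo T x))"] that obj[of "src A f" x] by simp
  qed
  have o: "h \<in> arr E" if "f \<in> arr A" "h \<in> D f" for f h using G.over_arr that by blast
  have x: "x \<in> obj E" if "a \<in> obj A" "x \<in> obj (pobj G a)" for a x using G.fibre_obj that by blast
  show ?thesis
    unfolding \<Phi>
  proof (intro displayed_nat.intro displayed_nat_axioms.intro assms(1,2), goal_cases)
    case (2 f h) then show ?case by (rule over)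
  next case (3 f h) then show ?case using o[OF 3] by (simp add: pnt_strict_def)
  next case (4 f h) then show ?case using o[OF 4] by (simp add: pnt_strict_def)
  next case (5 a y) then show ?case using x[OF 5] by (simp add: pnt_strict_def)
  next case (6 f g h k) then show ?case using o[of f h] o[of g k] by simp
  qed (simp_all add: pnt_strict_def obj H.pmor_obj iso l lift)
qed

text \<open>By naturality of \<alpha>, the arrow \<open>h\<close> followed by the lift of \<alpha>
  at its target lies over \<open>K' f\<close> after \<alpha>, hence factors uniquely through the
  lift of \<alpha> at the source of \<open>h\<close>. The factor is the action of the whiskered
  transformation, and the second conjunct is the characterization by which later arguments compute
  with it.\<close>

lemma displayed_nat_whisker:
  assumes "displayed B E F D L" "functr A B K" "functr A B K'"
    and \<alpha>: "\<And>a. a \<in> obj A \<Longrightarrow> \<alpha> a \<in> arr B" "\<And>a. a \<in> obj A \<Longrightarrow> src B (\<alpha> a) = fo K a" "\<And>a. a \<in> obj A \<Longrightarrow> tgt B (\<alpha> a) = fo K' a"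
      "\<And>f. f \<in> arr A \<Longrightarrow> \<alpha> (tgt A f) \<cdot>\<^bsub>B\<^esub> fm K f = fm K' f \<cdot>\<^bsub>B\<^esub> \<alpha> (src A f)"
  shows "\<exists>\<Phi>. displayed_nat A E (psf_precomp K F) (\<lambda>f. D (fm K f)) (\<lambda>f. L (fm K f))
      E (psf_precomp K' F) (\<lambda>f. D (fm K' f)) (\<lambda>f. L (fm K' f)) (pnt_whisker A F K K' \<alpha>) \<Phi> \<and>
    (\<forall>f\<in>arr A. \<forall>h\<in>D (fm K f). \<Phi> f h \<cdot>\<^bsub>E\<^esub> L (\<alpha> (src A f)) (src E h) = L (\<alpha> (tgt A f)) (tgt E h) \<cdot>\<^bsub>E\<^esub> h)"
proof -
  interpret F: displayed B E F D L by fact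
  interpret K: functr A B K by fact
  interpret K': functr A B K' by fact
  let ?is = "\<lambda>f h u. u \<in> D (fm K' f) \<and> src E u = tgt E (L (\<alpha> (src A f)) (src E h)) \<and>
    u \<cdot>\<^bsub>E\<^esub> L (\<alpha> (src A f)) (src E h) = L (\<alpha> (tgt A f)) (tgt E h) \<cdot>\<^bsub>E\<^esub> h"
  define \<Phi> where "\<Phi> f h = (SOME u. ?is f h u)" for f h
  have s: "h \<in> arr E" "src E h \<in> obj (pobj F (src B (\<alpha> (src A f))))" "tgt E h \<in> obj (pobj F (src B (\<alpha> (tgt A f))))"
    if "f \<in> arr A" "h \<in> D (fm K f)" for f h
    using that F.over_arr[of "fm K f" h] F.over_src[of "fm K f" h] F.over_tgt[of "fm K f" h] by (simp_all add: \<alpha>)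
  have P: "\<Phi> f h \<in> D (fm K' f)" "src E (\<Phi> f h) = tgt E (L (\<alpha> (src A f)) (src E h))"
    "\<Phi> f h \<cdot>\<^bsub>E\<^esub> L (\<alpha> (src A f)) (src E h) = L (\<alpha> (tgt A f)) (tgt E h) \<cdot>\<^bsub>E\<^esub> h" "\<Phi> f h \<in> arr E"
    "tgt E (\<Phi> f h) = tgt E (L (\<alpha> (tgt A f)) (tgt E h))"
    if f: "f \<in> arr A" and h: "h \<in> D (fm K f)" for f h
  proof -
    note s = s[OF f h]
    have "L (\<alpha> (tgt A f)) (tgt E h) \<cdot>\<^bsub>E\<^esub> h \<in> D (\<alpha> (tgt A f) \<cdot>\<^bsub>B\<^esub> fm K f)"
      by (rule F.over_cmp) (use f h s in \<open>simp_all add: \<alpha> F.lift_over\<close>)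
    then have "\<exists>u. ?is f h u"
      using F.lift_factor[of "\<alpha> (src A f)" "fm K' f" "src E h" "L (\<alpha> (tgt A f)) (tgt E h) \<cdot>\<^bsub>E\<^esub> h"] f s
      by (simp add: \<alpha>)
    from someI_ex[OF this] show p: "\<Phi> f h \<in> D (fm K' f)" "src E (\<Phi> f h) = tgt E (L (\<alpha> (src A f)) (src E h))"
      "\<Phi> f h \<cdot>\<^bsub>E\<^esub> L (\<alpha> (src A f)) (src E h) = L (\<alpha> (tgt A f)) (tgt E h) \<cdot>\<^bsub>E\<^esub> h" unfolding \<Phi>_def by simp_all
    show pa: "\<Phi> f h \<in> arr E" using F.over_arr[OF _ p(1)] f by simp
    show "tgt E (\<Phi> f h) = tgt E (L (\<alpha> (tgt A f)) (tgt E h))"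
      using F.E.tgt_cmp[of "L (\<alpha> (src A f)) (src E h)" "\<Phi> f h"] pa p s f by (simp add: \<alpha>)
  qed
  \<comment> \<open>The action is unique with its commuting square, so identities, composites and
    vertical arrows are handled by exhibiting another arrow that completes the square.\<close>
  have U: "\<Phi> f h = u" if f: "f \<in> arr A" and h: "h \<in> D (fm K f)" and u: "u \<in> D (fm K' f)"
    "src E u = tgt E (L (\<alpha> (src A f)) (src E h))"
    "u \<cdot>\<^bsub>E\<^esub> L (\<alpha> (src A f)) (src E h) = L (\<alpha> (tgt A f)) (tgt E h) \<cdot>\<^bsub>E\<^esub> h" for f h u
    by (rule F.lift_unique[of "\<alpha> (src A f)" "fm K' f" "src E h"]) (use that P[OF f h] s[OF f h] in \<open>simp_all add: \<alpha>\<close>)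
  have t: "tcomp (pnt_whisker A F K K' \<alpha>) = (\<lambda>a. pmor F (\<alpha> a))" by (simp add: pnt_whisker_def)
  \<comment> \<open>The 2-cell is one \<open>pcomp\<close> after the inverse of another. These are
    the comparisons for the two sides of the naturality square of \<alpha>; on the lift of their
    common composite they produce the two-step lifts along the two sides, which identifies the image
    of the lift of \<open>K f\<close>.\<close>
  have T: "is_iso (pobj F (fo K' (tgt A f))) (tiso (pnt_whisker A F K K' \<alpha>) f x)"
    "src E (tiso (pnt_whisker A F K K' \<alpha>) f x) = tgt E (L (\<alpha> (tgt A f)) (tgt E (L (fm K f) x)))"
    "tiso (pnt_whisker A F K K' \<alpha>) f x \<cdot>\<^bsub>E\<^esub> \<Phi> f (L (fm K f) x) = L (fm K' f) (tgt E (L (\<alpha> (src A f)) x))"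
    if f: "f \<in> arr A" and x: "x \<in> obj (pobj F (fo K (src A f)))" for f x
  proof -
    have a: "src A f \<in> obj A" "tgt A f \<in> obj A" "fo K' (tgt A f) \<in> obj B" using f by simp_all
    have c1: "\<alpha> (src A f) \<in> arr B" "fm K' f \<in> arr B" "src B (fm K' f) = tgt B (\<alpha> (src A f))" "x \<in> obj (pobj F (src B (\<alpha>
      (src A f))))"
      and c2: "fm K f \<in> arr B" "\<alpha> (tgt A f) \<in> arr B" "src B (\<alpha> (tgt A f)) = tgt B (fm K f)" "x \<in> obj (pobj F (src B (fm
        K f)))"
      using f x by (simp_all add: \<alpha>)
    note p = F.pcomp_over[OF c1] F.pcomp_simps[OF c1] F.pcomp_src[OF c1] F.pcomp_lift[OF c1]
    note q = F.pcomp_over[OF c2] F.pcomp_simps[OF c2] F.pcomp_src[OF c2] F.pcomp_lift[OF c2]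
    let ?q = "pcomp F (\<alpha> (tgt A f)) (fm K f) x" and ?p = "pcomp F (fm K' f) (\<alpha> (src A f)) x"
    let ?i = "inv_arr (pobj F (fo K' (tgt A f))) ?q"
    interpret C: categ "pobj F (fo K' (tgt A f))" using a by unfold_locales (simp add: F.category_fibre)
    have qi: "is_iso (pobj F (fo K' (tgt A f))) ?q" and pi: "is_iso (pobj F (fo K' (tgt A f))) ?p"
      using p q f by (simp_all add: \<alpha>)
    note i = F.iso_fibre[OF a(3) qi]
    have te: "tiso (pnt_whisker A F K K' \<alpha>) f x = ?p \<cdot>\<^bsub>E\<^esub> ?i" using a by (simp add: pnt_whisker_def)
    have ia: "?i \<in> arr E" using F.vert_simps(1)[OF a(3) i(2)] .
    have eq: "\<alpha> (tgt A f) \<cdot>\<^bsub>B\<^esub> fm K f = fm K' f \<cdot>\<^bsub>B\<^esub> \<alpha> (src A f)" using \<alpha> f by blast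
    show "is_iso (pobj F (fo K' (tgt A f))) (tiso (pnt_whisker A F K K' \<alpha>) f x)"
      unfolding te using C.is_iso_cmp[OF C.is_iso_inv_arr[OF qi] pi] p i q a eq by simp
    show ts: "src E (tiso (pnt_whisker A F K K' \<alpha>) f x) = tgt E (L (\<alpha> (tgt A f)) (tgt E (L (fm K f) x)))"
      unfolding te using p q i ia eq by simp
    have l: "L (fm K f) x \<in> D (fm K f)" using c2 F.lift_over by blast
    note Pl = P[OF f l]
    have lx: "src E (L (fm K f) x) = x" using c2 by simp
    have tov: "?p \<cdot>\<^bsub>E\<^esub> ?i \<in> D (ide B (fo K' (tgt A f)))" using p i q eq f by (intro F.vert_cmp) simp_all
    have ta: "?p \<cdot>\<^bsub>E\<^esub> ?i \<in> arr E" using F.vert_simps(1)[OF a(3) tov] .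
    show "tiso (pnt_whisker A F K K' \<alpha>) f x \<cdot>\<^bsub>E\<^esub> \<Phi> f (L (fm K f) x) = L (fm K' f) (tgt E (L (\<alpha> (src A f)) x))"
    proof (rule F.lift_unique[OF c1])
      show "tiso (pnt_whisker A F K K' \<alpha>) f x \<cdot>\<^bsub>E\<^esub> \<Phi> f (L (fm K f) x) \<in> D (fm K' f)"
        unfolding te by (rule F.vert_over) (use tov Pl c1 ts te f in simp_all)
      show "L (fm K' f) (tgt E (L (\<alpha> (src A f)) x)) \<in> D (fm K' f)"
        using c1 by (intro F.lift_over) simp_all
      show "src E (tiso (pnt_whisker A F K K' \<alpha>) f x \<cdot>\<^bsub>E\<^esub> \<Phi> f (L (fm K f) x)) = tgt E (L (\<alpha> (src A f)) x)"
        unfolding te using ta ts te Pl lx by simp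
      show "src E (L (fm K' f) (tgt E (L (\<alpha> (src A f)) x))) = tgt E (L (\<alpha> (src A f)) x)"
        using c1 by simp
      have "(tiso (pnt_whisker A F K K' \<alpha>) f x \<cdot>\<^bsub>E\<^esub> \<Phi> f (L (fm K f) x)) \<cdot>\<^bsub>E\<^esub> L (\<alpha> (src A f)) x
        = (?p \<cdot>\<^bsub>E\<^esub> ?i) \<cdot>\<^bsub>E\<^esub> (\<Phi> f (L (fm K f) x) \<cdot>\<^bsub>E\<^esub> L (\<alpha> (src A f)) x)"
        unfolding te by (rule F.E.cmp_assoc) (use ta ts te Pl lx c1 in simp_all)
      also have "\<dots> = (?p \<cdot>\<^bsub>E\<^esub> ?i) \<cdot>\<^bsub>E\<^esub> (?q \<cdot>\<^bsub>E\<^esub> L (\<alpha> (tgt A f) \<cdot>\<^bsub>B\<^esub> fm K f) x)"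
        using Pl(3) lx q by simp
      also have "\<dots> = ?p \<cdot>\<^bsub>E\<^esub> L (fm K' f \<cdot>\<^bsub>B\<^esub> \<alpha> (src A f)) x"
        using F.E.cmp_reassoc[OF i(5), of "L (\<alpha> (tgt A f) \<cdot>\<^bsub>B\<^esub> fm K f) x"] i ia p q c1 c2 eq by simp
      also have "\<dots> = L (fm K' f) (tgt E (L (\<alpha> (src A f)) x)) \<cdot>\<^bsub>E\<^esub> L (\<alpha> (src A f)) x" using p by simp
      finally show "(tiso (pnt_whisker A F K K' \<alpha>) f x \<cdot>\<^bsub>E\<^esub> \<Phi> f (L (fm K f) x)) \<cdot>\<^bsub>E\<^esub> L (\<alpha> (src A f)) x =
        L (fm K' f) (tgt E (L (\<alpha> (src A f)) x)) \<cdot>\<^bsub>E\<^esub> L (\<alpha> (src A f)) x" .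
    qed
  qed
  have "displayed_nat A E (psf_precomp K F) (\<lambda>f. D (fm K f)) (\<lambda>f. L (fm K f))
      E (psf_precomp K' F) (\<lambda>f. D (fm K' f)) (\<lambda>f. L (fm K' f)) (pnt_whisker A F K K' \<alpha>) \<Phi>"
  proof (intro displayed_nat.intro displayed_nat_axioms.intro displayed_precomp[OF assms(2,1)] displayed_precomp[OF
    assms(3,1)], goal_cases)
    case (1 a x)
    then have "x \<in> obj (pobj F (src B (\<alpha> a)))" by (simp add: \<alpha>)
    then show ?case using F.lift_simps(2)[of "\<alpha> a" x] F.pmor_obj[of "\<alpha> a" x] 1 by (simp add: t \<alpha>)
  next case (2 f h) then show ?case using P by simp
  next case (3 f h) then show ?case using P[OF 3] s[OF 3] by (simp add: t F.pmor_obj \<alpha>)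
  next case (4 f h) then show ?case using P[OF 4] s[OF 4] by (simp add: t F.pmor_obj \<alpha>)
  next case (5 a x)
    then have x: "x \<in> obj (pobj F (src B (\<alpha> a)))" "x \<in> obj E" "fo K a \<in> obj B" "ide E x \<in> D (ide B (fo K a))"
      using F.fibre_obj[of "fo K a" x] F.over_ide[of "fo K a" x] by (simp_all add: \<alpha>)
    have z: "tgt E (L (\<alpha> a) x) \<in> obj (pobj F (fo K' a))" "tgt E (L (\<alpha> a) x) \<in> obj E"
      using F.lift_simps[of "\<alpha> a" x] x 5 by (simp_all add: \<alpha>)
    show ?case
      by (rule U) (use 5 x z F.over_ide[OF _ z(1)] in \<open>simp_all add: t \<alpha> F.pmor_obj\<close>)
  next case (6 f g h k)
    note Pf = P[OF 6(1,4)] s[OF 6(1,4)] and Pg = P[OF 6(2,5)] s[OF 6(2,5)]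
    have kh: "k \<cdot>\<^bsub>E\<^esub> h \<in> D (fm K (g \<cdot>\<^bsub>A\<^esub> f))" using F.over_cmp[of "fm K f" "fm K g" h k] 6 by simp
    show ?case
    proof (rule U)
      show "g \<cdot>\<^bsub>A\<^esub> f \<in> arr A" using 6 by simp
      show "\<Phi> g k \<cdot>\<^bsub>E\<^esub> \<Phi> f h \<in> D (fm K' (g \<cdot>\<^bsub>A\<^esub> f))"
        using F.over_cmp[of "fm K' f" "fm K' g" "\<Phi> f h" "\<Phi> g k"] 6 Pf Pg by simp
      show "src E (\<Phi> g k \<cdot>\<^bsub>E\<^esub> \<Phi> f h) = tgt E (L (\<alpha> (src A (g \<cdot>\<^bsub>A\<^esub> f))) (src E (k \<cdot>\<^bsub>E\<^esub> h)))"
        using 6 Pf Pg by simp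
      have "(\<Phi> g k \<cdot>\<^bsub>E\<^esub> \<Phi> f h) \<cdot>\<^bsub>E\<^esub> L (\<alpha> (src A f)) (src E h) = \<Phi> g k \<cdot>\<^bsub>E\<^esub> (L (\<alpha> (tgt A f)) (tgt E h) \<cdot>\<^bsub>E\<^esub> h)"
        using 6 Pf Pg by (simp add: \<alpha>)
      also have "\<dots> = (L (\<alpha> (tgt A g)) (tgt E k) \<cdot>\<^bsub>E\<^esub> k) \<cdot>\<^bsub>E\<^esub> h"
        using F.E.cmp_reassoc[OF Pg(3), of h] 6 Pf Pg by (simp add: \<alpha>)
      finally show "(\<Phi> g k \<cdot>\<^bsub>E\<^esub> \<Phi> f h) \<cdot>\<^bsub>E\<^esub> L (\<alpha> (src A (g \<cdot>\<^bsub>A\<^esub> f))) (src E (k \<cdot>\<^bsub>E\<^esub> h)) =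
        L (\<alpha> (tgt A (g \<cdot>\<^bsub>A\<^esub> f))) (tgt E (k \<cdot>\<^bsub>E\<^esub> h)) \<cdot>\<^bsub>E\<^esub> (k \<cdot>\<^bsub>E\<^esub> h)"
        using 6 Pf Pg by (simp add: \<alpha>)
    qed (rule kh)
  next case (7 a u)
    then have i: "ide A a \<in> arr A" "u \<in> D (fm K (ide A a))" and u: "u \<in> D (ide B (src B (\<alpha> a)))" "\<alpha> a \<in> arr B"
      by (simp_all add: \<alpha>)
    show ?case
      unfolding t by (rule U[OF i, symmetric])
        (use 7 F.pmor_over[OF u(2,1)] F.pmor_simps[OF u(2,1)] F.pmor_src[OF u(2,1)] F.pmor_lift[OF u(2,1)] in \<open>simp_all
          add: \<alpha>\<close>)
  next case (8 f x) then show ?case using T by simp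
  next case (9 f x)
    then have "tgt E (L (fm K f) x) \<in> obj (pobj F (src B (\<alpha> (tgt A f))))" using F.lift_simps(2)[of "fm K f" x] by (simp
      add: \<alpha>)
    then show ?case using T[of f x] 9 by (simp add: t F.pmor_obj \<alpha>)
  next case (10 f x) then show ?case using T[of f x] by (simp add: t F.pmor_obj \<alpha>)
  qed
  then show ?thesis using P by blast
qed

text \<open>The shape of \<open>LL\<close>, which pairs the whiskerings along the two product
  projections.\<close>

definition pnt_pair :: "('a, 'f, 'o, 'm, 'p, 'n) pnt \<Rightarrow> ('a, 'f, 'o, 'm, 'q, 'l) pnt \<Rightarrow>
    ('a, 'f, 'o, 'm, 'p \<times> 'q, 'n \<times> 'l) pnt" where
  "pnt_pair \<sigma> \<tau> = \<lparr>tcomp = \<lambda>a. \<lparr>fo = \<lambda>x. (fo (tcomp \<sigma> a) x, fo (tcomp \<tau> a) x), fm = \<lambda>u. (fm (tcomp \<sigma> a) u, fm (tcomp \<tau>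
    a) u)\<rparr>,
     tiso = \<lambda>f x. (tiso \<sigma> f x, tiso \<tau> f x)\<rparr>"

lemma func_structural_simps [simp]:
  "fo func_id = (\<lambda>x. x)" "fm func_id = (\<lambda>f. f)" "fo func_fst = fst" "fm func_fst = fst" "fo func_snd = snd" "fm func_snd
    = snd"
  "fo func_swap x = (snd x, fst x)" "fm func_swap f = (snd f, fst f)"
  "fo func_assoc z = (fst (fst z), (snd (fst z), snd z))" "fm func_assoc h = (fst (fst h), (snd (fst h), snd h))"
  by (simp_all add: func_id_def func_fst_def func_snd_def func_swap_def func_assoc_def case_prod_beta)

lemma displayed_nat_pair:
  assumes "displayed B E\<^sub>1 F\<^sub>1 D\<^sub>1 L\<^sub>1" "displayed B' E\<^sub>2 F\<^sub>2 D\<^sub>2 L\<^sub>2"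
    and "displayed_nat (cat_prod B B') E G D L
      E\<^sub>1 (psf_precomp func_fst F\<^sub>1) (\<lambda>f. D\<^sub>1 (fst f)) (\<lambda>f. L\<^sub>1 (fst f)) \<sigma> \<Phi>"
    and "displayed_nat (cat_prod B B') E G D L
      E\<^sub>2 (psf_precomp func_snd F\<^sub>2) (\<lambda>f. D\<^sub>2 (snd f)) (\<lambda>f. L\<^sub>2 (snd f)) \<tau> \<Psi>"
  shows "displayed_nat (cat_prod B B') E G D L
    (cat_prod E\<^sub>1 E\<^sub>2) (psf_prod F\<^sub>1 F\<^sub>2) (\<lambda>f. D\<^sub>1 (fst f) \<times> D\<^sub>2 (snd f)) (\<lambda>f x. (L\<^sub>1 (fst f) (fst x), L\<^sub>2 (snd f) (snd x)))
    (pnt_pair \<sigma> \<tau>) (\<lambda>f h. (\<Phi> f h, \<Psi> f h))"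
proof -
  interpret S: displayed_nat "cat_prod B B'" E G D L
      E\<^sub>1 "psf_precomp func_fst F\<^sub>1" "\<lambda>f. D\<^sub>1 (fst f)" "\<lambda>f. L\<^sub>1 (fst f)" \<sigma> \<Phi> by fact
  interpret T: displayed_nat "cat_prod B B'" E G D L
      E\<^sub>2 "psf_precomp func_snd F\<^sub>2" "\<lambda>f. D\<^sub>2 (snd f)" "\<lambda>f. L\<^sub>2 (snd f)" \<tau> \<Psi> by fact
  show ?thesis
  proof (intro displayed_nat.intro displayed_nat_axioms.intro S.G.displayed_axioms displayed_prod[OF assms(1,2)], goal_cases)
    case (1 a x) then show ?case using S.Phi_obj[of a x] T.Phi_obj[of a x] by (simp add: pnt_pair_def mem_Times_iff)
  next case (2 f h) then show ?case using S.Phi_over[of f h] T.Phi_over[of f h] by (simp add: pnt_pair_def mem_Times_iff)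
  next case (3 f h) then show ?case using S.Phi_src[of f h] T.Phi_src[of f h] by (simp add: pnt_pair_def mem_Times_iff)
  next case (4 f h) then show ?case using S.Phi_tgt[of f h] T.Phi_tgt[of f h] by (simp add: pnt_pair_def mem_Times_iff)
  next case (5 a x) then show ?case using S.Phi_ide[of a x] T.Phi_ide[of a x] by (simp add: pnt_pair_def mem_Times_iff)
  next case (6 f g h k) then show ?case using S.Phi_cmp[of f g h k] T.Phi_cmp[of f g h k] by (simp add: pnt_pair_def
    mem_Times_iff)
  next case (7 a u) then show ?case using S.Phi_vert[of a u] T.Phi_vert[of a u] by (simp add: pnt_pair_def mem_Times_iff)
  next case (8 f x) then show ?case using S.tiso_iso[of f x] T.tiso_iso[of f x] by (simp add: pnt_pair_def mem_Times_iff
    is_iso_cat_prod)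
  next case (9 f x) then show ?case using S.tiso_src[of f x] T.tiso_src[of f x] by (simp add: pnt_pair_def mem_Times_iff)
  next case (10 f x) then show ?case using S.tiso_lift[of f x] T.tiso_lift[of f x] by (simp add: pnt_pair_def mem_Times_iff)
  qed
qed

section \<open>Cloven opfibrations\<close>

locale cloven =
  fixes X :: "('o, 'm) cat" and B :: "('b, 'f) cat" and P :: "('o, 'm, 'b, 'f) func" and \<kappa> :: "'f \<Rightarrow> 'o \<Rightarrow> 'm"
  assumes cloven: "cloven_opfibration X B P \<kappa>"
begin

sublocale functr X B P
  using cloven by (auto simp: cloven_opfibration_def intro: functrI)

abbreviation F where "F \<equiv> opfib_psf X B P \<kappa>"

definition over :: "'f \<Rightarrow> 'm set" where "over f = {h \<in> arr X. fm P h = f}"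

lemma overI: "h \<in> arr X \<Longrightarrow> fm P h = f \<Longrightarrow> h \<in> over f"
  by (simp add: over_def)

lemma overD: "h \<in> over f \<Longrightarrow> h \<in> arr X" "h \<in> over f \<Longrightarrow> fm P h = f"
  by (simp_all add: over_def)

lemma over_base: "h \<in> over f \<Longrightarrow> f \<in> arr B"
  by (auto simp: over_def)

lemma lift_simps:
  assumes "f \<in> arr B" "x \<in> obj X" "fo P x = src B f"
  shows "\<kappa> f x \<in> arr X" "src X (\<kappa> f x) = x" "fm P (\<kappa> f x) = f" "fo P (tgt X (\<kappa> f x)) = tgt B f"
    "cocartesian X B P (\<kappa> f x)"
proof -
  show *: "\<kappa> f x \<in> arr X" "src X (\<kappa> f x) = x" "fm P (\<kappa> f x) = f" "cocartesian X B P (\<kappa> f x)"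
    using cloven assms by (auto simp: cloven_opfibration_def cocartesian_def)
  show "fo P (tgt X (\<kappa> f x)) = tgt B f" using tgt_fm[of "\<kappa> f x"] * by simp
qed

lemma cocartesian_factor:
  assumes "cocartesian X B P k" "h \<in> arr X" "g \<in> arr B" "src B g = fo P (tgt X k)" "tgt B g = fo P (tgt X h)"
    "src X h = src X k" "g \<cdot>\<^bsub>B\<^esub> fm P k = fm P h"
  shows "\<exists>!u. u \<in> hom X (tgt X k) (tgt X h) \<and> fm P u = g \<and> u \<cdot>\<^bsub>X\<^esub> k = h"
  using assms unfolding cocartesian_def by (simp add: hom_def)

lemma cofactor_simps:
  assumes "cocartesian X B P k" "h \<in> arr X" "g \<in> arr B" "src B g = fo P (tgt X k)" "tgt B g = fo P (tgt X h)"
    "src X h = src X k" "g \<cdot>\<^bsub>B\<^esub> fm P k = fm P h"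
  shows "cofactor X P g k h \<in> arr X" "src X (cofactor X P g k h) = tgt X k" "tgt X (cofactor X P g k h) = tgt X h"
    "fm P (cofactor X P g k h) = g" "cofactor X P g k h \<cdot>\<^bsub>X\<^esub> k = h"
  using theI'[OF cocartesian_factor[OF assms]] by (auto simp: cofactor_def hom_def)

lemma cofactor_over:
  assumes "f \<in> arr B" "h \<in> over f"
  shows "cofactor X P (ide B (tgt B f)) (\<kappa> f (src X h)) h \<in> over (ide B (tgt B f))"
    "src X (cofactor X P (ide B (tgt B f)) (\<kappa> f (src X h)) h) = tgt X (\<kappa> f (src X h))"
    "tgt X (cofactor X P (ide B (tgt B f)) (\<kappa> f (src X h)) h) = tgt X h"
    "cofactor X P (ide B (tgt B f)) (\<kappa> f (src X h)) h \<cdot>\<^bsub>X\<^esub> \<kappa> f (src X h) = h"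
proof -
  note h = overD[OF assms(2)]
  have x: "src X h \<in> obj X" "fo P (src X h) = src B f" "fo P (tgt X h) = tgt B f"
    using h src_fm[of h] tgt_fm[of h] by simp_all
  note l = lift_simps[OF assms(1) x(1,2)]
  note c = cofactor_simps[of "\<kappa> f (src X h)" h "ide B (tgt B f)"]
  show "cofactor X P (ide B (tgt B f)) (\<kappa> f (src X h)) h \<in> over (ide B (tgt B f))"
    "src X (cofactor X P (ide B (tgt B f)) (\<kappa> f (src X h)) h) = tgt X (\<kappa> f (src X h))"
    "tgt X (cofactor X P (ide B (tgt B f)) (\<kappa> f (src X h)) h) = tgt X h"
    "cofactor X P (ide B (tgt B f)) (\<kappa> f (src X h)) h \<cdot>\<^bsub>X\<^esub> \<kappa> f (src X h) = h"
    using c l x h assms(1) by (simp_all add: over_def)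
qed

lemma fibre_simps:
  "obj (fibre X B P a) = {x \<in> obj X. fo P x = a}" "arr (fibre X B P a) = over (ide B a)"
  "src (fibre X B P a) = src X" "tgt (fibre X B P a) = tgt X" "ide (fibre X B P a) = ide X"
  "cmp (fibre X B P a) = cmp X"
  by (simp_all add: fibre_def over_def)

lemma F_simps:
  "pobj F = fibre X B P" "fo (pmor F f) x = tgt X (\<kappa> f x)"
  "fm (pmor F f) u = cofactor X P (ide B (tgt B f)) (\<kappa> f (src X u)) (\<kappa> f (tgt X u) \<cdot>\<^bsub>X\<^esub> u)"
  "pcomp F g f x = cofactor X P (ide B (tgt B g)) (\<kappa> (g \<cdot>\<^bsub>B\<^esub> f) x) (\<kappa> g (tgt X (\<kappa> f x)) \<cdot>\<^bsub>X\<^esub> \<kappa> f x)"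
  "punit F a x = cofactor X P (ide B a) (\<kappa> (ide B a) x) (ide X x)"
  by (simp_all add: opfib_psf_def)

lemma obj_F [simp]: "x \<in> obj (pobj F a) \<longleftrightarrow> x \<in> obj X \<and> fo P x = a"
  by (auto simp: F_simps fibre_simps)

lemma displayed: "displayed B X F over \<kappa>"
proof -
  have m: "\<kappa> f (tgt X u) \<cdot>\<^bsub>X\<^esub> u \<in> over f" "src X (\<kappa> f (tgt X u) \<cdot>\<^bsub>X\<^esub> u) = src X u"
    if "f \<in> arr B" "u \<in> over (ide B (src B f))" for f u
  proof -
    have "u \<in> arr X" "fo P (tgt X u) = src B f" using that tgt_fm[of u] by (simp_all add: over_def)
    then show "\<kappa> f (tgt X u) \<cdot>\<^bsub>X\<^esub> u \<in> over f" "src X (\<kappa> f (tgt X u) \<cdot>\<^bsub>X\<^esub> u) = src X u"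
      using that lift_simps[of f "tgt X u"] by (simp_all add: over_def)
  qed
  have c: "\<kappa> g (tgt X (\<kappa> f x)) \<cdot>\<^bsub>X\<^esub> \<kappa> f x \<in> over (g \<cdot>\<^bsub>B\<^esub> f)" "src X (\<kappa> g (tgt X (\<kappa> f x)) \<cdot>\<^bsub>X\<^esub> \<kappa> f x) = x"
    if "f \<in> arr B" "g \<in> arr B" "src B g = tgt B f" "x \<in> obj X" "fo P x = src B f" for f g x
    using that lift_simps[of f x] lift_simps[of g "tgt X (\<kappa> f x)"] by (simp_all add: over_def)
  have u: "ide X x \<in> over (ide B a)" if "x \<in> obj X" "fo P x = a" for x a using that by (auto simp: over_def)
  have fs: "fo P (src X h) = src B f" "fo P (tgt X h) = tgt B f" "h \<in> arr X" "fm P h = f" if "h \<in> over f" for f h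
    using that src_fm[of h] tgt_fm[of h] by (simp_all add: over_def)
  show ?thesis
  proof (intro displayed.intro displayed_axioms.intro, goal_cases)
    case 1 show ?case by unfold_locales
  next case 2 show ?case by unfold_locales
  next case (8 a x) then show ?case by simp
  next case (9 f h) then show ?case by (simp add: over_def)
  next case (10 f h) then show ?case using fs[of h f] by simp
  next case (11 f h) then show ?case using fs[of h f] by simp
  next case (12 a x) then show ?case by (simp add: u)
  next case (13 f g h k) then show ?case by (simp add: over_def)
  next case (14 f x) then show ?case by (simp add: over_def lift_simps)
  next case (15 f x) then show ?case by (simp add: lift_simps)
  next case (16 f g x h)
    then have x: "x \<in> obj X" "fo P x = src B f" by simp_all
    note l = lift_simps[OF 16(1) x] and h = fs[OF 16(5)]
    show ?case using cofactor_simps[OF l(5) h(3) 16(2)] l h 16 by (auto simp: over_def)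
  next case (17 f g x u v)
    then have x: "x \<in> obj X" "fo P x = src B f" by simp_all
    note l = lift_simps[OF 17(1) x] and u = fs[OF 17(5)] and v = fs[OF 17(6)]
    have vl: "v \<cdot>\<^bsub>X\<^esub> \<kappa> f x \<in> arr X" "src X (v \<cdot>\<^bsub>X\<^esub> \<kappa> f x) = x" "tgt X (v \<cdot>\<^bsub>X\<^esub> \<kappa> f x) = tgt X v" "fm P (v \<cdot>\<^bsub>X\<^esub> \<kappa> f x) = g
      \<cdot>\<^bsub>B\<^esub> f"
      "tgt X (u \<cdot>\<^bsub>X\<^esub> \<kappa> f x) = tgt X u"
      using 17(1-4,7,8) l u v by simp_all
    then have "tgt X u = tgt X v" using 17 by simp
    then show ?case
      using cocartesian_factor[OF l(5) vl(1) 17(2)] l u v vl 17 by (auto simp: hom_def)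
  next case (18 f x) then show ?case by (simp add: F_simps)
  next case (19 f u) then show ?case using cofactor_over[OF 19(1) m(1)[OF 19]] by (simp add: F_simps m(2)[OF 19])
  next case (20 f u) then show ?case using cofactor_over[OF 20(1) m(1)[OF 20]] by (simp add: F_simps m(2)[OF 20])
  next case (21 f u) then show ?case using cofactor_over[OF 21(1) m(1)[OF 21]] by (simp add: F_simps m(2)[OF 21])
  next case (22 f g x) then show ?case using cofactor_over[OF _ c(1)[of f g x]] c(2)[of f g x] by (simp add: F_simps(4))
  next case (23 f g x) then show ?case using cofactor_over[OF _ c(1)[of f g x]] c(2)[of f g x] by (simp add: F_simps(4))
  next case (24 f g x) then show ?case using cofactor_over[OF _ c(1)[of f g x]] c(2)[of f g x] by (simp add: F_simps(4))
  next case (25 a x) then show ?case using cofactor_over[OF _ u[of x a]] by (simp add: F_simps(5))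
  next case (26 a x) then show ?case using cofactor_over[OF _ u[of x a]] by (simp add: F_simps(5))
  next case (27 a x) then show ?case using cofactor_over[OF _ u[of x a]] by (simp add: F_simps(5))
  qed (simp_all add: F_simps(1) fibre_simps)
qed

sublocale F: displayed B X F over \<kappa>
  by (rule displayed)

lemma over_obj: "h \<in> over f \<Longrightarrow> fo P (src X h) = src B f" "h \<in> over f \<Longrightarrow> fo P (tgt X h) = tgt B f"
  using src_fm[of h] tgt_fm[of h] by (simp_all add: over_def)

text \<open>Reduces the universal property to the cleavage: two cocartesian arrows over the same
  base arrow with the same source differ by a vertical isomorphism. In this form the property passes
  through transformations, because their components preserve vertical isomorphisms and their 2-cells
  are invertible.\<close>

lemma cocartesian_iff:
  assumes k: "k \<in> arr X"
  shows "cocartesian X B P k \<longleftrightarrow>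
    (\<exists>t. is_iso (pobj F (fo P (tgt X k))) t \<and> src X t = tgt X k \<and> t \<cdot>\<^bsub>X\<^esub> k = \<kappa> (fm P k) (src X k))"
    (is "?C \<longleftrightarrow> ?R")
proof
  let ?f = "fm P k" and ?x = "src X k"
  have x: "?f \<in> arr B" "?x \<in> obj X" "fo P ?x = src B ?f" "fo P (tgt X k) = tgt B ?f" using k by simp_all
  note l = lift_simps[OF x(1-3)]
  {
    assume C: ?C
    have "\<exists>!u. u \<in> hom X (tgt X k) (tgt X (\<kappa> ?f ?x)) \<and> fm P u = ide B (tgt B ?f) \<and> u \<cdot>\<^bsub>X\<^esub> k = \<kappa> ?f ?x"
      by (rule cocartesian_factor[OF C]) (use x l k in simp_all)
    then obtain t where t: "t \<in> arr X" "src X t = tgt X k" "tgt X t = tgt X (\<kappa> ?f ?x)" "fm P t = ide B (tgt B ?f)" "t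
      \<cdot>\<^bsub>X\<^esub> k = \<kappa> ?f ?x"
      by (auto simp: hom_def)
    \<comment> \<open>The vertical part of \<open>k\<close> is the candidate inverse of
      \<open>t\<close>. One composite is the identity because the lift can be cancelled, the other
      because \<open>k\<close> can, by its own universal property.\<close>
    obtain v where v: "v \<in> over (ide B (tgt B ?f))" "src X v = tgt X (\<kappa> ?f ?x)" "v \<cdot>\<^bsub>X\<^esub> \<kappa> ?f ?x = k" "tgt X v = tgt X k"
      using F.vert_factor[OF x(1) overI[OF k refl]] by blast
    note va = overD[OF v(1)]
    have tv: "t \<cdot>\<^bsub>X\<^esub> v = ide X (tgt X (\<kappa> ?f ?x))"
      by (rule F.vert_unique[of ?f ?x]) (use x l k t va v in \<open>simp_all add: over_def\<close>)
    have "\<exists>!u. u \<in> hom X (tgt X k) (tgt X k) \<and> fm P u = ide B (tgt B ?f) \<and> u \<cdot>\<^bsub>X\<^esub> k = k"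
      by (rule cocartesian_factor[OF C]) (use x k in simp_all)
    moreover have "v \<cdot>\<^bsub>X\<^esub> t \<in> hom X (tgt X k) (tgt X k) \<and> fm P (v \<cdot>\<^bsub>X\<^esub> t) = ide B (tgt B ?f) \<and> (v \<cdot>\<^bsub>X\<^esub> t) \<cdot>\<^bsub>X\<^esub> k = k"
      using t v va x(1) k by (simp add: hom_def)
    moreover have "ide X (tgt X k) \<in> hom X (tgt X k) (tgt X k) \<and> fm P (ide X (tgt X k)) = ide B (tgt B ?f) \<and> ide X (tgt
      X k) \<cdot>\<^bsub>X\<^esub> k = k"
      using k by (simp add: hom_def)
    ultimately have vt: "v \<cdot>\<^bsub>X\<^esub> t = ide X (tgt X k)" by blast
    have "is_iso (pobj F (fo P (tgt X k))) t"
      by (rule F.is_iso_fibreI[where v = v]) (use x t v vt tv in \<open>simp_all add: over_def\<close>)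
    then show ?R using t by blast
  next
    assume ?R
    then obtain t where t: "is_iso (pobj F (tgt B ?f)) t" "src X t = tgt X k" "t \<cdot>\<^bsub>X\<^esub> k = \<kappa> ?f ?x"
      using x by auto
    have a: "tgt B ?f \<in> obj B" using x by simp
    have to: "t \<in> over (ide B (tgt B ?f))" "t \<in> arr X" using F.iso_fibre(1)[OF a t(1)] overD by blast+
    have tt: "tgt X t = tgt X (\<kappa> ?f ?x)" using C.tgt_cmp[of k t] to t k by simp
    show ?C unfolding cocartesian_def
    proof (intro conjI ballI impI k)
      fix h g assume h: "h \<in> arr X" and g: "g \<in> hom B (fo P (tgt X k)) (fo P (tgt X h))" and s: "src X h = src X k"
        and e: "g \<cdot>\<^bsub>B\<^esub> fm P k = fm P h"
      have g': "g \<in> arr B" "src B g = tgt B ?f" "tgt B g = fo P (tgt X h)" using g x by (auto simp: hom_def)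
      obtain u where u: "u \<in> over g" "src X u = tgt X (\<kappa> ?f ?x)" "u \<cdot>\<^bsub>X\<^esub> \<kappa> ?f ?x = h"
        using F.lift_factor[of ?f g ?x h] x g' h s e by (auto simp: over_def)
      note ua = overD[OF u(1)]
      have ut: "tgt X u = tgt X h" using C.tgt_cmp[of "\<kappa> ?f ?x" u] u ua l by simp
      have th: "fm P t = ide B (tgt B ?f)" using to overD by blast
      show "\<exists>!u. u \<in> hom X (tgt X k) (tgt X h) \<and> fm P u = g \<and> u \<cdot>\<^bsub>X\<^esub> k = h"
      proof (rule ex1I[of _ "u \<cdot>\<^bsub>X\<^esub> t"])
        show "u \<cdot>\<^bsub>X\<^esub> t \<in> hom X (tgt X k) (tgt X h) \<and> fm P (u \<cdot>\<^bsub>X\<^esub> t) = g \<and> (u \<cdot>\<^bsub>X\<^esub> t) \<cdot>\<^bsub>X\<^esub> k = h"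
          using u ua ut to t tt th g' k by (simp add: hom_def)
        fix w assume w: "w \<in> hom X (tgt X k) (tgt X h) \<and> fm P w = g \<and> w \<cdot>\<^bsub>X\<^esub> k = h"
        then have wa: "w \<in> arr X" "src X w = tgt X k" "fm P w = g" "w \<cdot>\<^bsub>X\<^esub> k = h" by (simp_all add: hom_def)
        have uk: "(u \<cdot>\<^bsub>X\<^esub> t) \<cdot>\<^bsub>X\<^esub> k = h" using u ua ut to t tt k by simp
        have uv: "u \<cdot>\<^bsub>X\<^esub> t \<in> over g" using u ua to t tt th g' by (simp add: over_def)
        have us: "src X (u \<cdot>\<^bsub>X\<^esub> t) = tgt X k" using u ua to t tt by simp
        have gs: "src B g = tgt B ?f" using g' by simp
        show "w = u \<cdot>\<^bsub>X\<^esub> t"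
          by (rule F.iso_lift_unique[OF x(1) g'(1) gs overI[OF k refl] t overI[OF wa(1,3)] uv wa(2) us])
            (simp only: wa(4) uk)
      qed
    qed
  }
qed

lemma cocartesian_ide: "x \<in> obj X \<Longrightarrow> cocartesian X B P (ide X x)"
  unfolding cocartesian_def hom_def by auto

lemma is_iso_lift_ide:
  assumes "x \<in> obj X" "fo P x = a"
  shows "is_iso (pobj F a) (\<kappa> (ide B a) x)"
proof -
  obtain t where "is_iso (pobj F a) t" "src X t = x" "t \<cdot>\<^bsub>X\<^esub> ide X x = \<kappa> (ide B a) x"
    using cocartesian_ide[OF assms(1)] cocartesian_iff[of "ide X x"] assms by auto
  moreover have "a \<in> obj B" using assms by auto
  ultimately show ?thesis using F.iso_fibre(1)[of a t] overD by simp
qed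

text \<open>Factoring the identity through the lift, over the inverse of \<open>f\<close>, gives a
  left inverse; it is also a right inverse because the lift can be cancelled. This makes the arrows
  attached to invertible modifications invertible, whenever the base arrow is.\<close>

lemma is_iso_lift:
  assumes "x \<in> obj X" "fo P x = src B f" "is_iso B f"
  shows "is_iso X (\<kappa> f x)"
proof -
  let ?g = "inv_arr B f"
  have f: "f \<in> arr B" using assms D.is_iso_arr by blast
  note l = lift_simps[OF f assms(1,2)]
  obtain u where u: "u \<in> over ?g" "src X u = tgt X (\<kappa> f x)" "u \<cdot>\<^bsub>X\<^esub> \<kappa> f x = ide X x"
    using F.lift_factor[of f ?g x "ide X x"] assms f by (auto simp: over_def)
  note ua = overD[OF u(1)]
  have ut: "tgt X u = x" using C.tgt_cmp[of "\<kappa> f x" u] u ua l assms by simp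
  have "\<kappa> f x \<cdot>\<^bsub>X\<^esub> u = ide X (tgt X (\<kappa> f x))"
    by (rule F.vert_unique[of f x]) (use u ua ut l f assms in \<open>simp_all add: over_def\<close>)
  then show ?thesis by (intro C.is_isoI[of _ u]) (use u ua ut l in simp_all)
qed

end

section \<open>Cartesian opfibrations\<close>

locale cloven_prod = cloven X B P \<kappa> + S: fin_prod B S
  for X :: "('o, 'm) cat" and B :: "('b, 'f) cat" and P :: "('o, 'm, 'b, 'f) func" and \<kappa> :: "'f \<Rightarrow> 'o \<Rightarrow> 'm" and S
begin

lemma prod_func_simps [simp]:
  "fo (prod_func B S) ab = pr S (fst ab) (snd ab)" "fm (prod_func B S) fg = par B S (fst fg) (snd fg)"
  by (simp_all add: prod_func_def case_prod_beta)

lemma functr_prod_func: "functr (cat_prod B B) B (prod_func B S)"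
  by (rule functrI) (rule S.functor_prod_func)

lemma func_point_simps [simp]: "fo (func_point C x) = (\<lambda>_. x)" "fm (func_point C x) = (\<lambda>_. ide C x)"
  by (simp_all add: func_point_def)

lemma functr_one: "functr cat_unit B (func_point B (one S))"
  by (rule functr_point) (simp_all add: D.category)

abbreviation "over2 \<equiv> \<lambda>f. over (fst f) \<times> over (snd f)"
abbreviation "\<kappa>2 \<equiv> \<lambda>f x. (\<kappa> (fst f) (fst x), \<kappa> (snd f) (snd x))"
abbreviation "over_pr \<equiv> \<lambda>f. over (par B S (fst f) (snd f))"
abbreviation "\<kappa>_pr \<equiv> \<lambda>f. \<kappa> (par B S (fst f) (snd f))"

text \<open>Here \<open>\<Psi>\<close> is the tensor product on arrows of \<open>X\<close> that
  \<open>R\<close> induces: \<open>\<Psi> (f, g)\<close> takes a pair over \<open>f\<close> and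
  \<open>g\<close> to an arrow over \<open>f \<times> g\<close>.\<close>

abbreviation "nat_R \<equiv> displayed_nat (cat_prod B B) (cat_prod X X) (psf_prod F F) over2 \<kappa>2
   X (psf_precomp (prod_func B S) F) over_pr \<kappa>_pr"
abbreviation "nat_R1 \<equiv> displayed_nat cat_unit cat_unit psf_unit (\<lambda>_. UNIV) (\<lambda>_ _. ())
   X (psf_precomp (func_point B (one S)) F) (\<lambda>_. over (ide B (one S))) (\<lambda>_. \<kappa> (ide B (one S)))"

lemma displayed_FF: "displayed (cat_prod B B) (cat_prod X X) (psf_prod F F) over2 \<kappa>2"
  by (rule displayed_prod[OF displayed displayed])

lemma displayed_F_pr: "displayed (cat_prod B B) X (psf_precomp (prod_func B S) F) over_pr \<kappa>_pr"
  using displayed_precomp[OF functr_prod_func displayed] by simp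

lemma displayed_F_one: "displayed cat_unit X (psf_precomp (func_point B (one S)) F) (\<lambda>_. over (ide B (one S))) (\<lambda>_. \<kappa>
  (ide B (one S)))"
  using displayed_precomp[OF functr_one displayed] by simp

lemma ex_nat_R:
  "pseudonat (cat_prod B B) (psf_prod F F) (psf_precomp (prod_func B S) F) R \<Longrightarrow> \<exists>\<Psi>. nat_R R \<Psi>"
  by (rule pseudonat_displayed[OF displayed_FF displayed_F_pr])

lemma ex_nat_R1:
  "pseudonat cat_unit psf_unit (psf_precomp (func_point B (one S)) F) R1 \<Longrightarrow> \<exists>\<Psi>. nat_R1 R1 \<Psi>"
  by (rule pseudonat_displayed[OF displayed_unit displayed_F_one])

text \<open>For two chosen lifts the 2-cell of \<open>R\<close> compares the image with a chosen
  lift. In general, vertical isomorphisms \<open>s\<close> and \<open>t\<close> carry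
  \<open>h\<close> and \<open>k\<close> to chosen lifts, and the image of \<open>(s, t)\<close>
  under \<open>R\<close> is again a vertical isomorphism; composing it with the 2-cell gives what
  \<open>cocartesian_iff\<close> asks for.\<close>

lemma cocartesian_R:
  assumes "nat_R R \<Psi>" and c: "cocartesian X B P h" "cocartesian X B P k"
  shows "cocartesian X B P (\<Psi> (fm P h, fm P k) (h, k))"
proof -
  interpret R: displayed_nat "cat_prod B B" "cat_prod X X" "psf_prod F F" over2 \<kappa>2
    X "psf_precomp (prod_func B S) F" over_pr \<kappa>_pr R \<Psi> by fact
  have a: "h \<in> arr X" "k \<in> arr X" using c by (auto simp: cocartesian_def)
  obtain s where s: "is_iso (pobj F (fo P (tgt X h))) s" "src X s = tgt X h" "s \<cdot>\<^bsub>X\<^esub> h = \<kappa> (fm P h) (src X h)"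
    using cocartesian_iff a c by blast
  obtain t where t: "is_iso (pobj F (fo P (tgt X k))) t" "src X t = tgt X k" "t \<cdot>\<^bsub>X\<^esub> k = \<kappa> (fm P k) (src X k)"
    using cocartesian_iff a c by blast
  let ?f = "(fm P h, fm P k)" and ?x = "(src X h, src X k)"
  have f: "?f \<in> arr (cat_prod B B)" "?x \<in> obj (pobj (psf_prod F F) (src (cat_prod B B) ?f))" using a by simp_all
  have b: "tgt (cat_prod B B) ?f \<in> obj (cat_prod B B)" using a by simp
  have st: "is_iso (pobj (psf_prod F F) (tgt (cat_prod B B) ?f)) (s, t)"
    using is_iso_cat_prod[OF s(1) t(1)] a by simp
  note so = R.G.iso_fibre(1)[OF b st]
  note ti = R.tiso_iso[OF f]
  interpret Q: functr "pobj (psf_prod F F) (tgt (cat_prod B B) ?f)" "pobj (psf_precomp (prod_func B S) F) (tgt (cat_prod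
    B B) ?f)"
    "tcomp R (tgt (cat_prod B B) ?f)"
    by (rule functrI[OF R.functor_tcomp[OF b]])
  have "is_iso (pobj (psf_precomp (prod_func B S) F) (tgt (cat_prod B B) ?f)) (fm (tcomp R (tgt (cat_prod B B) ?f)) (s, t))"
    using Q.fm_inverse st unfolding is_iso_def by blast
  then have vi: "is_iso (pobj (psf_precomp (prod_func B S) F) (tgt (cat_prod B B) ?f)) (\<Psi> (ide (cat_prod B B) (tgt
    (cat_prod B B) ?f)) (s, t))"
    by (simp only: R.Phi_vert[OF b so])
  note vs = R.Phi_vert_simps[OF b so]
  have hk: "(h, k) \<in> over2 ?f" using a by (simp add: over_def)
  have st': "\<kappa>2 ?f ?x = (s, t) \<cdot>\<^bsub>cat_prod X X\<^esub> (h, k)" using s t by simp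
  have e: "\<Psi> ?f (\<kappa>2 ?f ?x) = \<Psi> (ide (cat_prod B B) (tgt (cat_prod B B) ?f)) (s, t) \<cdot>\<^bsub>X\<^esub> \<Psi> ?f (h, k)"
    unfolding st' by (rule R.Phi_vert_cmp[OF f(1) hk so]) (use s t in simp)
  note \<psi> = R.Phi_over[OF f(1) hk] R.Phi_arr[OF f(1) hk] R.Phi_src[OF f(1) hk] R.Phi_tgt[OF f(1) hk]
  have st_tgt: "tgt X s = tgt X (\<kappa> (fm P h) (src X h))" "tgt X t = tgt X (\<kappa> (fm P k) (src X k))"
    using s t C.tgt_cmp[of h s] C.tgt_cmp[of k t] so a overD by auto
  have ts: "src X (tiso R ?f ?x) = tgt X (\<Psi> (ide (cat_prod B B) (tgt (cat_prod B B) ?f)) (s, t))"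
    using R.tiso_src[OF f] vs st_tgt by simp
  let ?w = "tiso R ?f ?x \<cdot>\<^bsub>X\<^esub> \<Psi> (ide (cat_prod B B) (tgt (cat_prod B B) ?f)) (s, t)"
  have pt: "fo P (tgt X (\<Psi> ?f (h, k))) = pr S (fo P (tgt X h)) (fo P (tgt X k))" using over_obj(2)[OF \<psi>(1)] a by simp
  have w: "is_iso (pobj F (fo P (tgt X (\<Psi> ?f (h, k))))) ?w"
  proof -
    interpret W: categ "pobj F (pr S (fo P (tgt X h)) (fo P (tgt X k)))"
      using a by unfold_locales (simp add: F.category_fibre)
    show ?thesis using W.is_iso_cmp[of "\<Psi> (ide (cat_prod B B) (tgt (cat_prod B B) ?f)) (s, t)" "tiso R ?f ?x"] ti vi ts a
      by (simp add: pt)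
  qed
  have w2: "src X ?w = tgt X (\<Psi> ?f (h, k))" using vs R.tiso_simps[OF f] ts \<psi> s t by simp
  have w3: "?w \<cdot>\<^bsub>X\<^esub> \<Psi> ?f (h, k) = \<kappa> (fm P (\<Psi> ?f (h, k))) (src X (\<Psi> ?f (h, k)))"
    using vs R.tiso_simps[OF f] ts \<psi> s t e[symmetric] R.tiso_lift[OF f] overD(2)[OF \<psi>(1)] by simp
  show ?thesis using cocartesian_iff[OF \<psi>(2)] w w2 w3 by blast
qed

end

text \<open>The statement with which each of the three conditions is compared. Since whole product
  cones lie over those of the base, \<open>P\<close> preserves pairings, and with them every arrow
  built from pairings and projections.\<close>

locale cart_opfib = cloven_prod X B P \<kappa> S + T: fin_prod X T
  for X :: "('o, 'm) cat" and B :: "('b, 'f) cat" and P :: "('o, 'm, 'b, 'f) func" and \<kappa> :: "'f \<Rightarrow> 'o \<Rightarrow> 'm" and S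
    and T :: "('o, 'm) fprods" +
  assumes P_pr: "x \<in> obj X \<Longrightarrow> y \<in> obj X \<Longrightarrow> fo P (pr T x y) = pr S (fo P x) (fo P y)"
    and P_one: "fo P (one T) = one S"
    and P_pi1: "x \<in> obj X \<Longrightarrow> y \<in> obj X \<Longrightarrow> fm P (pi1 T x y) = pi1 S (fo P x) (fo P y)"
    and P_pi2: "x \<in> obj X \<Longrightarrow> y \<in> obj X \<Longrightarrow> fm P (pi2 T x y) = pi2 S (fo P x) (fo P y)"
    and cocartesian_par: "cocartesian X B P h \<Longrightarrow> cocartesian X B P k \<Longrightarrow> cocartesian X B P (par X T h k)"
begin

lemma P_pair:
  assumes "f \<in> arr X" "g \<in> arr X" "src X f = src X g"
  shows "fm P (pair X T f g) = pair B S (fm P f) (fm P g)"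
proof (rule S.prod_eqI[of "fo P (tgt X f)" "fo P (tgt X g)"])
  show "pi1 S (fo P (tgt X f)) (fo P (tgt X g)) \<cdot>\<^bsub>B\<^esub> fm P (pair X T f g) =
    pi1 S (fo P (tgt X f)) (fo P (tgt X g)) \<cdot>\<^bsub>B\<^esub> pair B S (fm P f) (fm P g)"
    using assms fm_cmp[of "pair X T f g" "pi1 T (tgt X f) (tgt X g)", symmetric] by (simp add: P_pi1)
  show "pi2 S (fo P (tgt X f)) (fo P (tgt X g)) \<cdot>\<^bsub>B\<^esub> fm P (pair X T f g) =
    pi2 S (fo P (tgt X f)) (fo P (tgt X g)) \<cdot>\<^bsub>B\<^esub> pair B S (fm P f) (fm P g)"
    using assms fm_cmp[of "pair X T f g" "pi2 T (tgt X f) (tgt X g)", symmetric] by (simp add: P_pi2)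
qed (use assms in \<open>simp_all add: P_pr\<close>)

lemma P_par: "f \<in> arr X \<Longrightarrow> g \<in> arr X \<Longrightarrow> fm P (par X T f g) = par B S (fm P f) (fm P g)"
  unfolding par_def by (simp add: P_pair P_pi1 P_pi2)

lemma P_assoc: "x \<in> obj X \<Longrightarrow> y \<in> obj X \<Longrightarrow> z \<in> obj X \<Longrightarrow>
    fm P (prod_assoc X T x y z) = prod_assoc B S (fo P x) (fo P y) (fo P z)"
  unfolding prod_assoc_def by (simp add: P_pair P_pi1 P_pi2 P_pr)

lemma P_swap: "x \<in> obj X \<Longrightarrow> y \<in> obj X \<Longrightarrow> fm P (prod_swap X T x y) = prod_swap B S (fo P x) (fo P y)"
  unfolding prod_swap_def by (simp add: P_pair P_pi1 P_pi2)

lemma monoidal_opfibration: "monoidal_opfibration X (cartesian_monoidal X T) B (cartesian_monoidal B S) P"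
proof -
  have "opfibration X B P" using cloven by (fastforce simp: cloven_opfibration_def opfibration_def)
  then show ?thesis
    unfolding monoidal_opfibration_def strict_monoidal_functor_def
    using T.monoidal_category_cartesian S.monoidal_category_cartesian is_functor
    by (simp add: cartesian_monoidal_def P_pr P_one P_assoc P_par P_pi1 P_pi2 cocartesian_par prod_func_def)
qed

end

section \<open>Product cones from a strict monoidal functor, and the action of \<open>LL\<close> and
  \<open>L1\<close> on arrows\<close>

context cloven_prod
begin

text \<open>A strict monoidal functor controls a projection only when one factor is the unit, where
  the projection is a unit constraint. \<open>pi_via_one\<close>, applied in \<open>X\<close> and in
  \<open>B\<close>, extends this to all projections.\<close>

lemma cart_opfib_if_monoidal:
  assumes "finite_products X T" and m: "monoidal_opfibration X (cartesian_monoidal X T) B (cartesian_monoidal B S) P"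
  shows "cart_opfib X B P \<kappa> S T"
proof -
  interpret T: fin_prod X T by unfold_locales fact
  have pr: "fo P (pr T x y) = pr S (fo P x) (fo P y)" if "x \<in> obj X" "y \<in> obj X" for x y
    using m that by (simp add: monoidal_opfibration_def strict_monoidal_functor_def cartesian_monoidal_def prod_func_def)
  have par: "fm P (par X T f g) = par B S (fm P f) (fm P g)" if "f \<in> arr X" "g \<in> arr X" for f g
    using m that by (simp add: monoidal_opfibration_def strict_monoidal_functor_def cartesian_monoidal_def prod_func_def)
  have one: "fo P (one T) = one S"
    using m by (simp add: monoidal_opfibration_def strict_monoidal_functor_def cartesian_monoidal_def prod_func_def)
  have u: "fm P (pi2 T (one T) x) = pi2 S (one S) (fo P x)" "fm P (pi1 T x (one T)) = pi1 S (fo P x) (one S)" if "x \<in>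
    obj X" for x
    using m that by (simp_all add: monoidal_opfibration_def strict_monoidal_functor_def cartesian_monoidal_def prod_func_def)
  show ?thesis
  proof (unfold_locales)
    fix x y assume x: "x \<in> obj X" and y: "y \<in> obj X"
    obtain s where s: "s \<in> arr X" "src X s = y" "tgt X s = one T" using T.bang_ex y by blast
    have "fm P (pi1 T x y) = fm P (pi1 T x (one T) \<cdot>\<^bsub>X\<^esub> par X T (ide X x) s)"
      using T.pi_via_one(1)[OF x y s(1)] s by simp
    also have "\<dots> = pi1 S (fo P x) (one S) \<cdot>\<^bsub>B\<^esub> par B S (ide B (fo P x)) (fm P s)"
      using x s by (simp add: u par)
    also have "\<dots> = pi1 S (fo P x) (fo P y)"
      using S.pi_via_one(1)[of "fo P x" "fo P y" "fm P s"] x y s by (simp add: one)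
    finally show "fm P (pi1 T x y) = pi1 S (fo P x) (fo P y)" .
    obtain s where s: "s \<in> arr X" "src X s = x" "tgt X s = one T" using T.bang_ex x by blast
    have "fm P (pi2 T x y) = fm P (pi2 T (one T) y \<cdot>\<^bsub>X\<^esub> par X T s (ide X y))"
      using T.pi_via_one(2)[OF x y s(1)] s by simp
    also have "\<dots> = pi2 S (one S) (fo P y) \<cdot>\<^bsub>B\<^esub> par B S (fm P s) (ide B (fo P y))"
      using y s by (simp add: u par)
    also have "\<dots> = pi2 S (fo P x) (fo P y)"
      using S.pi_via_one(2)[of "fo P x" "fo P y" "fm P s"] x y s by (simp add: one)
    finally show "fm P (pi2 T x y) = pi2 S (fo P x) (fo P y)" .
  next
    fix h k assume "cocartesian X B P h" "cocartesian X B P k"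
    then show "cocartesian X B P (par X T h k)"
      using m by (simp add: monoidal_opfibration_def cartesian_monoidal_def prod_func_def)
  qed (fact pr one)+
qed

lemma LL_eq: "LL B S F = pnt_pair
    (pnt_whisker (cat_prod B B) F (prod_func B S) func_fst (\<lambda>(a, b). pi1 S a b))
    (pnt_whisker (cat_prod B B) F (prod_func B S) func_snd (\<lambda>(a, b). pi2 S a b))"
  by (simp add: LL_def Let_def pnt_pair_def)

text \<open>The two equations characterize \<open>\<Phi>1\<close> and \<open>\<Phi>2\<close> through
  the lifts of the projections, so computations with \<open>LL\<close> on arrows need not unfold its
  2-cells.\<close>

lemma ex_nat_LL:
  "\<exists>\<Phi>1 \<Phi>2. displayed_nat (cat_prod B B) X (psf_precomp (prod_func B S) F) over_pr \<kappa>_pr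
      (cat_prod X X) (psf_prod F F) over2 \<kappa>2 (LL B S F) (\<lambda>f h. (\<Phi>1 f h, \<Phi>2 f h)) \<and>
    (\<forall>f\<in>arr B. \<forall>g\<in>arr B. \<forall>h\<in>over (par B S f g).
      \<Phi>1 (f, g) h \<cdot>\<^bsub>X\<^esub> \<kappa> (pi1 S (src B f) (src B g)) (src X h) = \<kappa> (pi1 S (tgt B f) (tgt B g)) (tgt X h) \<cdot>\<^bsub>X\<^esub> h \<and>
      \<Phi>2 (f, g) h \<cdot>\<^bsub>X\<^esub> \<kappa> (pi2 S (src B f) (src B g)) (src X h) = \<kappa> (pi2 S (tgt B f) (tgt B g)) (tgt X h) \<cdot>\<^bsub>X\<^esub> h)"
proof -
  note st = functr_structural[OF D.category D.category]
  obtain \<Phi>1 where 1: "displayed_nat (cat_prod B B) X (psf_precomp (prod_func B S) F) over_pr \<kappa>_pr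
      X (psf_precomp func_fst F) (\<lambda>f. over (fst f)) (\<lambda>f. \<kappa> (fst f))
      (pnt_whisker (cat_prod B B) F (prod_func B S) func_fst (\<lambda>(a, b). pi1 S a b)) \<Phi>1"
     "\<forall>f\<in>arr (cat_prod B B). \<forall>h\<in>over_pr f. \<Phi>1 f h \<cdot>\<^bsub>X\<^esub> \<kappa> (pi1 S (src B (fst f)) (src B (snd f))) (src X h) =
        \<kappa> (pi1 S (tgt B (fst f)) (tgt B (snd f))) (tgt X h) \<cdot>\<^bsub>X\<^esub> h"
    using displayed_nat_whisker[OF displayed functr_prod_func st(2), of "\<lambda>(a, b). pi1 S a b"]
    by (auto simp: S.pi_par)
  obtain \<Phi>2 where 2: "displayed_nat (cat_prod B B) X (psf_precomp (prod_func B S) F) over_pr \<kappa>_pr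
      X (psf_precomp func_snd F) (\<lambda>f. over (snd f)) (\<lambda>f. \<kappa> (snd f))
      (pnt_whisker (cat_prod B B) F (prod_func B S) func_snd (\<lambda>(a, b). pi2 S a b)) \<Phi>2"
     "\<forall>f\<in>arr (cat_prod B B). \<forall>h\<in>over_pr f. \<Phi>2 f h \<cdot>\<^bsub>X\<^esub> \<kappa> (pi2 S (src B (fst f)) (src B (snd f))) (src X h) =
        \<kappa> (pi2 S (tgt B (fst f)) (tgt B (snd f))) (tgt X h) \<cdot>\<^bsub>X\<^esub> h"
    using displayed_nat_whisker[OF displayed functr_prod_func st(3), of "\<lambda>(a, b). pi2 S a b"]
    by (auto simp: S.pi_par)
  show ?thesis
    using displayed_nat_pair[OF displayed displayed 1(1) 2(1)] 1(2) 2(2) unfolding LL_eq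
    by (intro exI[of _ \<Phi>1] exI[of _ \<Phi>2]) simp
qed

lemma nat_L1: "displayed_nat cat_unit X (psf_precomp (func_point B (one S)) F) (\<lambda>_. over (ide B (one S))) (\<lambda>_. \<kappa> (ide B
  (one S)))
   cat_unit psf_unit (\<lambda>_. UNIV) (\<lambda>_ _. ()) L1 (\<lambda>_ _. ())"
  by (intro displayed_nat.intro displayed_nat_axioms.intro displayed_F_one displayed_unit)
    (simp_all add: L1_def func_bang_def psf_unit_def is_iso_def inverse_arrows_def hom_def)

end

context cloven_prod
begin

lemma LL_obj: "fo (tcomp (LL B S F) ab) x =
    (tgt X (\<kappa> (pi1 S (fst ab) (snd ab)) x), tgt X (\<kappa> (pi2 S (fst ab) (snd ab)) x))"
  by (simp add: LL_eq pnt_pair_def pnt_whisker_def F_simps case_prod_beta)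

end

section \<open>Right adjoints from products\<close>

context cart_opfib
begin

text \<open>All fibres share the operations of \<open>X\<close>, so the product functor of
  \<open>X\<close> serves as every component. A product of two lifts is cocartesian over
  \<open>f \<times> g\<close>, hence vertically isomorphic to the chosen lift; the 2-cell is a
  choice of such an isomorphism.\<close>

definition prodR :: "('b \<times> 'b, 'f \<times> 'f, 'o \<times> 'o, 'm \<times> 'm, 'o, 'm) pnt" where
  "prodR = \<lparr>tcomp = \<lambda>_. \<lparr>fo = \<lambda>p. pr T (fst p) (snd p), fm = \<lambda>h. par X T (fst h) (snd h)\<rparr>,
    tiso = \<lambda>f p. SOME t. is_iso (pobj F (pr S (tgt B (fst f)) (tgt B (snd f)))) t \<and>
      src X t = pr T (tgt X (\<kappa> (fst f) (fst p))) (tgt X (\<kappa> (snd f) (snd p))) \<and>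
      t \<cdot>\<^bsub>X\<^esub> par X T (\<kappa> (fst f) (fst p)) (\<kappa> (snd f) (snd p)) = \<kappa> (par B S (fst f) (snd f)) (pr T (fst p) (snd p))\<rparr>"

text \<open>The 2-cell has to lead from the terminal object to its pushforward along an identity.
  The lift of that identity is such an arrow, and it is vertical and invertible.\<close>

definition prod1 :: "(unit, unit, unit, unit, 'o, 'm) pnt" where
  "prod1 = \<lparr>tcomp = \<lambda>_. func_point X (one T), tiso = \<lambda>_ _. \<kappa> (ide B (one S)) (one T)\<rparr>"

lemma prodR_simps [simp]:
  "fo (tcomp prodR a) p = pr T (fst p) (snd p)" "fm (tcomp prodR a) h = par X T (fst h) (snd h)"
  by (simp_all add: prodR_def)

lemma prod1_simps [simp]:
  "fo (tcomp prod1 a) p = one T" "fm (tcomp prod1 a) h = ide X (one T)"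
  by (simp_all add: prod1_def)

lemma nat_prodR: "nat_R prodR (\<lambda>_ h. par X T (fst h) (snd h))"
proof -
  have t: "is_iso (pobj F (pr S (tgt B (fst f)) (tgt B (snd f)))) (tiso prodR f p) \<and>
      src X (tiso prodR f p) = pr T (tgt X (\<kappa> (fst f) (fst p))) (tgt X (\<kappa> (snd f) (snd p))) \<and>
      tiso prodR f p \<cdot>\<^bsub>X\<^esub> par X T (\<kappa> (fst f) (fst p)) (\<kappa> (snd f) (snd p)) = \<kappa> (par B S (fst f) (snd f)) (pr T (fst p)
        (snd p))"
    if f: "fst f \<in> arr B" "snd f \<in> arr B" "fst p \<in> obj X" "snd p \<in> obj X" "fo P (fst p) = src B (fst f)" "fo P (snd p) =
      src B (snd f)" for f p
  proof -
    note l = lift_simps[OF f(1,3,5)] lift_simps[OF f(2,4,6)]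
    let ?k = "par X T (\<kappa> (fst f) (fst p)) (\<kappa> (snd f) (snd p))"
    have k: "?k \<in> arr X" "cocartesian X B P ?k" using l by (simp_all add: cocartesian_par)
    have "\<exists>t. is_iso (pobj F (pr S (tgt B (fst f)) (tgt B (snd f)))) t \<and>
      src X t = pr T (tgt X (\<kappa> (fst f) (fst p))) (tgt X (\<kappa> (snd f) (snd p))) \<and>
      t \<cdot>\<^bsub>X\<^esub> ?k = \<kappa> (par B S (fst f) (snd f)) (pr T (fst p) (snd p))"
      using k(2) unfolding cocartesian_iff[OF k(1)] using l by (simp add: P_par P_pr)
    from someI_ex[OF this] show ?thesis by (simp add: prodR_def)
  qed
  have o: "h \<in> arr X" "fm P h = f" if "h \<in> over f" for h f using overD that by blast+
  show ?thesis
  proof (intro displayed_nat.intro displayed_nat_axioms.intro displayed_FF displayed_F_pr, goal_cases)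
    case (1 a x) then show ?case by (auto simp: P_pr)
  next case (2 f h) then show ?case using o[of "fst h" "fst f"] o[of "snd h" "snd f"] by (auto simp: over_def P_par)
  next case (3 f h) then show ?case using o[of "fst h" "fst f"] o[of "snd h" "snd f"] by (simp add: mem_Times_iff)
  next case (4 f h) then show ?case using o[of "fst h" "fst f"] o[of "snd h" "snd f"] by (simp add: mem_Times_iff)
  next case (5 a x) then show ?case by (simp add: mem_Times_iff T.par_ide)
  next case (6 f g h k) then show ?case
      using o[of "fst h" "fst f"] o[of "snd h" "snd f"] o[of "fst k" "fst g"] o[of "snd k" "snd g"]
      by (simp add: mem_Times_iff T.par_cmp)
  next case (7 a u) then show ?case by simp
  next case (8 f x) then show ?case using t[of f x] by (simp add: mem_Times_iff)
  next case (9 f x) then show ?case using t[of f x] by (simp add: mem_Times_iff)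
  next case (10 f x) then show ?case using t[of f x] by (simp add: mem_Times_iff)
  qed
qed

lemma nat_prod1: "nat_R1 prod1 (\<lambda>_ _. ide X (one T))"
proof (intro displayed_nat.intro displayed_nat_axioms.intro displayed_unit displayed_F_one, goal_cases)
  case (8 f x) then show ?case using is_iso_lift_ide[of "one T"] by (simp add: prod1_def P_one)
qed (auto simp: prod1_def P_one over_def psf_unit_def lift_simps)

text \<open>The unit at \<open>x\<close> is the arrow to the terminal object, vertical because the
  base arrow below it is an endomorphism of a terminal object. Terminality settles its naturality
  and the triangle identity for \<open>prod1\<close>.\<close>

lemma adjoint_one: "right_adjoint_in_CAT cat_unit (psf_precomp (func_point B (one S)) F) psf_unit L1 prod1"
proof -
  define \<eta> :: "unit \<Rightarrow> 'o \<Rightarrow> 'm" where "\<eta> = (\<lambda>_ x. SOME h. h \<in> arr X \<and> src X h = x \<and> tgt X h = one T)"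
  have \<eta>: "\<eta> a x \<in> arr X" "src X (\<eta> a x) = x" "tgt X (\<eta> a x) = one T" if "x \<in> obj X" for a x
    using someI_ex[OF T.bang_ex[OF that]] by (simp_all add: \<eta>_def)
  let ?G = "psf_precomp (func_point B (one S)) F"
  note comp = displayed_nat_comp[OF nat_L1 nat_prod1]
  note comp' = displayed_nat_comp[OF nat_prod1 nat_L1]
  have fo: "fo (tcomp (pnt_comp cat_unit G' prod1 L1) a) x = one T" for a x and G' :: "(unit, unit, 'o, 'm) psf" by
    (simp add: pnt_comp_def)
  have 1: "modification cat_unit ?G ?G (pnt_id cat_unit ?G) (pnt_comp cat_unit ?G prod1 L1) \<eta>"
  proof (rule displayed_nat_pair.modificationI[OF displayed_nat_pair.intro[OF displayed_nat_id[OF displayed_F_one]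
    comp]], goal_cases)
    case (1 a x)
    then have "fm P (\<eta> a x) = ide B (one S)" using \<eta>[of x a] by (intro S.bang_unique) (simp_all add: P_one)
    then show ?case using 1 \<eta>[of x a] by (simp add: over_def)
  next case (2 a x) then show ?case using \<eta>[of x a] by (simp add: pnt_id_def)
  next case (3 a x) then show ?case using \<eta>[of x a] by (simp add: fo)
  next case (4 f h) then show ?case using \<eta>[of "src X h"] \<eta>[of "tgt X h"] by (intro T.bang_unique) (simp_all add: over_def)
  qed
  have 2: "modification cat_unit psf_unit psf_unit (pnt_comp cat_unit psf_unit L1 prod1) (pnt_id cat_unit psf_unit) (\<lambda>_
    _. ())"
    by (rule displayed_nat_pair.modificationI[OF displayed_nat_pair.intro[OF comp' displayed_nat_id[OF
      displayed_unit]]]) auto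
  have "\<eta> a (one T) = ide X (one T)" for a
    by (rule T.bang_unique) (use \<eta>[of "one T"] in simp_all)
  then show ?thesis
    unfolding right_adjoint_in_CAT_def
    using displayed_nat.pseudonat[OF nat_L1] displayed_nat.pseudonat[OF nat_prod1] 1 2
    by (intro conjI exI[of _ \<eta>] exI[of _ "\<lambda>_ _. ()"]) (simp_all add: F_simps fibre_simps)
qed

text \<open>The unit at \<open>x\<close> over \<open>a \<times> b\<close> is the pairing of the
  lifts of the two projections at \<open>x\<close>; it is vertical because it lies over the pairing
  of the projections, an identity. The counit at \<open>(x, y)\<close> consists of the vertical
  parts of the projections of \<open>x \<times> y\<close>.\<close>

lemma adjoint_prod: "right_adjoint_in_CAT (cat_prod B B) (psf_precomp (prod_func B S) F) (psf_prod F F) (LL B S F) prodR"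
proof -
  obtain \<Phi>1 \<Phi>2 where LL: "displayed_nat (cat_prod B B) X (psf_precomp (prod_func B S) F) over_pr \<kappa>_pr
      (cat_prod X X) (psf_prod F F) over2 \<kappa>2 (LL B S F) (\<lambda>f h. (\<Phi>1 f h, \<Phi>2 f h))"
    and LL_lift: "\<And>f g h. f \<in> arr B \<Longrightarrow> g \<in> arr B \<Longrightarrow> h \<in> over (par B S f g) \<Longrightarrow>
      \<Phi>1 (f, g) h \<cdot>\<^bsub>X\<^esub> \<kappa> (pi1 S (src B f) (src B g)) (src X h) = \<kappa> (pi1 S (tgt B f) (tgt B g)) (tgt X h) \<cdot>\<^bsub>X\<^esub> h"
      "\<And>f g h. f \<in> arr B \<Longrightarrow> g \<in> arr B \<Longrightarrow> h \<in> over (par B S f g) \<Longrightarrow>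
      \<Phi>2 (f, g) h \<cdot>\<^bsub>X\<^esub> \<kappa> (pi2 S (src B f) (src B g)) (src X h) = \<kappa> (pi2 S (tgt B f) (tgt B g)) (tgt X h) \<cdot>\<^bsub>X\<^esub> h"
    using ex_nat_LL by blast
  interpret L: displayed_nat "cat_prod B B" X "psf_precomp (prod_func B S) F" over_pr \<kappa>_pr
      "cat_prod X X" "psf_prod F F" over2 \<kappa>2 "LL B S F" "\<lambda>f h. (\<Phi>1 f h, \<Phi>2 f h)" by (fact LL)
  let ?G = "psf_precomp (prod_func B S) F" and ?H = "psf_prod F F" and ?A = "cat_prod B B"
  define \<eta> where "\<eta> = (\<lambda>ab x. pair X T (\<kappa> (pi1 S (fst ab) (snd ab)) x) (\<kappa> (pi2 S (fst ab) (snd ab)) x))"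
  define \<epsilon> where "\<epsilon> = (\<lambda>ab xy. (cofactor X P (ide B (fst ab)) (\<kappa> (pi1 S (fst ab) (snd ab)) (pr T (fst xy) (snd xy)))
    (pi1 T (fst xy) (snd xy)),
       cofactor X P (ide B (snd ab)) (\<kappa> (pi2 S (fst ab) (snd ab)) (pr T (fst xy) (snd xy))) (pi2 T (fst xy) (snd xy))))"
  have kk: "\<kappa> (pi1 S a b) x \<in> arr X" "src X (\<kappa> (pi1 S a b) x) = x" "fm P (\<kappa> (pi1 S a b) x) = pi1 S a b"
      "fo P (tgt X (\<kappa> (pi1 S a b) x)) = a"
      "\<kappa> (pi2 S a b) x \<in> arr X" "src X (\<kappa> (pi2 S a b) x) = x" "fm P (\<kappa> (pi2 S a b) x) = pi2 S a b"
      "fo P (tgt X (\<kappa> (pi2 S a b) x)) = b"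
    if "a \<in> obj B" "b \<in> obj B" "x \<in> obj X" "fo P x = pr S a b" for a b x
    using that lift_simps[of "pi1 S a b" x] lift_simps[of "pi2 S a b" x] by simp_all
  have \<eta>: "\<eta> (a, b) x \<in> over (ide B (pr S a b))" "\<eta> (a, b) x \<in> arr X" "src X (\<eta> (a, b) x) = x"
      "tgt X (\<eta> (a, b) x) = pr T (tgt X (\<kappa> (pi1 S a b) x)) (tgt X (\<kappa> (pi2 S a b) x))"
    if "a \<in> obj B" "b \<in> obj B" "x \<in> obj X" "fo P x = pr S a b" for a b x
    using kk[OF that] that by (simp_all add: \<eta>_def over_def P_pair)
  have \<epsilon>: "fst (\<epsilon> (fo P x, fo P y) (x, y)) \<in> over (ide B (fo P x))"
      "src X (fst (\<epsilon> (fo P x, fo P y) (x, y))) = tgt X (\<kappa> (pi1 S (fo P x) (fo P y)) (pr T x y))"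
      "tgt X (fst (\<epsilon> (fo P x, fo P y) (x, y))) = x"
      "fst (\<epsilon> (fo P x, fo P y) (x, y)) \<cdot>\<^bsub>X\<^esub> \<kappa> (pi1 S (fo P x) (fo P y)) (pr T x y) = pi1 T x y"
      "snd (\<epsilon> (fo P x, fo P y) (x, y)) \<in> over (ide B (fo P y))"
      "src X (snd (\<epsilon> (fo P x, fo P y) (x, y))) = tgt X (\<kappa> (pi2 S (fo P x) (fo P y)) (pr T x y))"
      "tgt X (snd (\<epsilon> (fo P x, fo P y) (x, y))) = y"
      "snd (\<epsilon> (fo P x, fo P y) (x, y)) \<cdot>\<^bsub>X\<^esub> \<kappa> (pi2 S (fo P x) (fo P y)) (pr T x y) = pi2 T x y"
    if "x \<in> obj X" "y \<in> obj X" for x y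
    using that cofactor_over[of "pi1 S (fo P x) (fo P y)" "pi1 T x y"] cofactor_over[of "pi2 S (fo P x) (fo P y)" "pi2 T
      x y"]
    by (simp_all add: \<epsilon>_def over_def P_pi1 P_pi2)
  have Lv: "\<Phi>1 (ide B a, ide B b) u \<in> over (ide B a)" "src X (\<Phi>1 (ide B a, ide B b) u) = tgt X (\<kappa> (pi1 S a b) (src X u))"
      "\<Phi>1 (ide B a, ide B b) u \<cdot>\<^bsub>X\<^esub> \<kappa> (pi1 S a b) (src X u) = \<kappa> (pi1 S a b) (tgt X u) \<cdot>\<^bsub>X\<^esub> u"
      "tgt X (\<Phi>1 (ide B a, ide B b) u) = tgt X (\<kappa> (pi1 S a b) (tgt X u))"
      "\<Phi>2 (ide B a, ide B b) u \<in> over (ide B b)" "src X (\<Phi>2 (ide B a, ide B b) u) = tgt X (\<kappa> (pi2 S a b) (src X u))"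
      "\<Phi>2 (ide B a, ide B b) u \<cdot>\<^bsub>X\<^esub> \<kappa> (pi2 S a b) (src X u) = \<kappa> (pi2 S a b) (tgt X u) \<cdot>\<^bsub>X\<^esub> u"
      "tgt X (\<Phi>2 (ide B a, ide B b) u) = tgt X (\<kappa> (pi2 S a b) (tgt X u))"
      "fm (tcomp (LL B S F) (a, b)) u = (\<Phi>1 (ide B a, ide B b) u, \<Phi>2 (ide B a, ide B b) u)"
    if "a \<in> obj B" "b \<in> obj B" "u \<in> over (ide B (pr S a b))" for a b u
    using that L.Phi_vert_simps[of "(a, b)" u] LL_lift[of "ide B a" "ide B b" u] L.Phi_vert[of "(a, b)" u]
    by (simp_all add: S.par_ide LL_obj)
  have 1: "modification ?A ?G ?G (pnt_id ?A ?G) (pnt_comp ?A ?G prodR (LL B S F)) \<eta>"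
  proof (rule displayed_nat_pair.modificationI[OF displayed_nat_pair.intro[OF displayed_nat_id[OF displayed_F_pr]
    displayed_nat_comp[OF LL nat_prodR]]], goal_cases)
    case (1 ab x) then show ?case using \<eta>[of "fst ab" "snd ab" x] by (auto simp: S.par_ide)
  next case (2 ab x) then show ?case using \<eta>[of "fst ab" "snd ab" x] by (auto simp: pnt_id_def)
  next case (3 ab x) then show ?case using \<eta>[of "fst ab" "snd ab" x] by (auto simp: pnt_comp_def LL_obj)
  next case (4 f h)
    obtain f1 f2 where f: "f = (f1, f2)" "f1 \<in> arr B" "f2 \<in> arr B" using 4 by (cases f) auto
    have h: "h \<in> over (par B S f1 f2)" using 4 f by simp
    note ha = overD(1)[OF h] over_obj[OF h]
    have o: "fo P (src X h) = pr S (src B f1) (src B f2)" "fo P (tgt X h) = pr S (tgt B f1) (tgt B f2)" using ha f by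
      simp_all
    note k1 = kk[of "src B f1" "src B f2" "src X h"] and k2 = kk[of "tgt B f1" "tgt B f2" "tgt X h"]
    note l = LL_lift[OF f(2,3) h]
    have ov: "\<Phi>1 (f1, f2) h \<in> over f1" "\<Phi>2 (f1, f2) h \<in> over f2"
      using L.Phi_over[of "(f1, f2)" h] f h by simp_all
    have s: "src X (\<Phi>1 (f1, f2) h) = tgt X (\<kappa> (pi1 S (src B f1) (src B f2)) (src X h))"
      "src X (\<Phi>2 (f1, f2) h) = tgt X (\<kappa> (pi2 S (src B f1) (src B f2)) (src X h))"
      using L.Phi_src[of "(f1, f2)" h] f h by (simp_all add: LL_obj)
    note ova = overD(1)[OF ov(1)] overD(1)[OF ov(2)]
    show ?case using f ha o k1 k2 l s ova by (simp add: \<eta>_def T.par_pair)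
  qed
  have 2: "modification ?A ?H ?H (pnt_comp ?A ?H (LL B S F) prodR) (pnt_id ?A ?H) \<epsilon>"
  proof (rule displayed_nat_pair.modificationI[OF displayed_nat_pair.intro[OF displayed_nat_comp[OF nat_prodR LL]
    displayed_nat_id[OF displayed_FF]]], goal_cases)
    case (1 ab x) then show ?case using \<epsilon>[of "fst x" "snd x"] by (auto simp: mem_Times_iff)
  next case (2 ab x) then show ?case using \<epsilon>[of "fst x" "snd x"] by (cases ab; cases x) (auto simp: pnt_comp_def LL_obj
    prod_eq_iff)
  next case (3 ab x) then show ?case using \<epsilon>[of "fst x" "snd x"] by (cases ab; cases x) (auto simp: pnt_id_def prod_eq_iff)
  next case (4 fg hk)
    obtain f g h k where e: "fg = (f, g)" "hk = (h, k)" by fastforce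
    have f: "f \<in> arr B" "g \<in> arr B" "h \<in> over f" "k \<in> over g" using 4 e by simp_all
    note h = overD[OF f(3)] over_obj[OF f(3)] and k = overD[OF f(4)] over_obj[OF f(4)]
    have o: "src X h \<in> obj X" "src X k \<in> obj X" "tgt X h \<in> obj X" "tgt X k \<in> obj X" using h k by simp_all
    have p: "par X T h k \<in> over (par B S f g)" using h k by (simp add: over_def P_par)
    note l = LL_lift[OF f(1,2) p]
    have ov: "\<Phi>1 (f, g) (par X T h k) \<in> over f" "\<Phi>2 (f, g) (par X T h k) \<in> over g"
      using L.Phi_over[of "(f, g)" "par X T h k"] f p by simp_all
    have s: "src X (\<Phi>1 (f, g) (par X T h k)) = tgt X (\<kappa> (pi1 S (src B f) (src B g)) (pr T (src X h) (src X k)))"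
      "tgt X (\<Phi>1 (f, g) (par X T h k)) = tgt X (\<kappa> (pi1 S (tgt B f) (tgt B g)) (pr T (tgt X h) (tgt X k)))"
      "src X (\<Phi>2 (f, g) (par X T h k)) = tgt X (\<kappa> (pi2 S (src B f) (src B g)) (pr T (src X h) (src X k)))"
      "tgt X (\<Phi>2 (f, g) (par X T h k)) = tgt X (\<kappa> (pi2 S (tgt B f) (tgt B g)) (pr T (tgt X h) (tgt X k)))"
      using L.Phi_src[of "(f, g)" "par X T h k"] L.Phi_tgt[of "(f, g)" "par X T h k"] f p h k by (simp_all add: LL_obj)
    note ova = overD[OF ov(1)] overD[OF ov(2)]
    note e1 = \<epsilon>[OF o(1,2), unfolded h k] and e2 = \<epsilon>[OF o(3,4), unfolded h k]
    have pp: "fo P (pr T (src X h) (src X k)) = pr S (src B f) (src B g)"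
      "fo P (pr T (tgt X h) (tgt X k)) = pr S (tgt B f) (tgt B g)" using o h k by (simp_all add: P_pr)
    have pa: "par X T h k \<in> arr X" "src X (par X T h k) = pr T (src X h) (src X k)"
      "tgt X (par X T h k) = pr T (tgt X h) (tgt X k)" using h k by simp_all
    note k1 = kk[OF D.src_obj[OF f(1)] D.src_obj[OF f(2)] T.pr_obj[OF o(1,2)] pp(1)]
    note k2 = kk[OF D.tgt_obj[OF f(1)] D.tgt_obj[OF f(2)] T.pr_obj[OF o(3,4)] pp(2)]
    have x1: "pr T (src X h) (src X k) \<in> obj (pobj F (src B (pi1 S (src B f) (src B g))))"
      and x2: "pr T (src X h) (src X k) \<in> obj (pobj F (src B (pi2 S (src B f) (src B g))))" using o pp f by simp_all
    note ea = overD(1)[OF e1(1)] overD(1)[OF e1(5)] overD(1)[OF e2(1)] overD(1)[OF e2(5)]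
    \<comment> \<open>After the lift of the first projection both sides are the projection to
      \<open>src h\<close> followed by \<open>h\<close>: on the left through naturality of the
      product projection, on the right by definition of the counit.\<close>
    have 1: "fst (\<epsilon> (tgt B f, tgt B g) (tgt X h, tgt X k)) \<cdot>\<^bsub>X\<^esub> \<Phi>1 (f, g) (par X T h k) = h \<cdot>\<^bsub>X\<^esub> fst (\<epsilon> (src B f, src B
      g) (src X h, src X k))"
    proof (rule F.lift_unique[OF _ f(1) _ x1])
      show "fst (\<epsilon> (tgt B f, tgt B g) (tgt X h, tgt X k)) \<cdot>\<^bsub>X\<^esub> \<Phi>1 (f, g) (par X T h k) \<in> over f"
        by (rule F.vert_over) (use f e2 ov s in simp_all)
      show "h \<cdot>\<^bsub>X\<^esub> fst (\<epsilon> (src B f, src B g) (src X h, src X k)) \<in> over f"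
        by (rule F.over_vert) (use f e1 in simp_all)
      have "(fst (\<epsilon> (tgt B f, tgt B g) (tgt X h, tgt X k)) \<cdot>\<^bsub>X\<^esub> \<Phi>1 (f, g) (par X T h k)) \<cdot>\<^bsub>X\<^esub> \<kappa> (pi1 S (src B f) (src B
        g)) (pr T (src X h) (src X k))
        = fst (\<epsilon> (tgt B f, tgt B g) (tgt X h, tgt X k)) \<cdot>\<^bsub>X\<^esub> (\<kappa> (pi1 S (tgt B f) (tgt B g)) (pr T (tgt X h) (tgt X k))
          \<cdot>\<^bsub>X\<^esub> par X T h k)"
        using ea e2 ova s k1 l pa by simp
      also have "\<dots> = pi1 T (tgt X h) (tgt X k) \<cdot>\<^bsub>X\<^esub> par X T h k"
        by (rule C.cmp_reassoc[OF e2(4)]) (use ea e2 k2 pa in simp_all)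
      also have "\<dots> = h \<cdot>\<^bsub>X\<^esub> pi1 T (src X h) (src X k)" using h k by (simp add: T.pi_par)
      finally show "(fst (\<epsilon> (tgt B f, tgt B g) (tgt X h, tgt X k)) \<cdot>\<^bsub>X\<^esub> \<Phi>1 (f, g) (par X T h k)) \<cdot>\<^bsub>X\<^esub> \<kappa> (pi1 S (src B f)
        (src B g)) (pr T (src X h) (src X k))
        = (h \<cdot>\<^bsub>X\<^esub> fst (\<epsilon> (src B f, src B g) (src X h, src X k))) \<cdot>\<^bsub>X\<^esub> \<kappa> (pi1 S (src B f) (src B g)) (pr T (src X h) (src
          X k))"
        using ea e1 k1 h by simp
    qed (use ea e1 e2 ova s h f in simp_all)
    have 2: "snd (\<epsilon> (tgt B f, tgt B g) (tgt X h, tgt X k)) \<cdot>\<^bsub>X\<^esub> \<Phi>2 (f, g) (par X T h k) = k \<cdot>\<^bsub>X\<^esub> snd (\<epsilon> (src B f, src B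
      g) (src X h, src X k))"
    proof (rule F.lift_unique[OF _ f(2) _ x2])
      show "snd (\<epsilon> (tgt B f, tgt B g) (tgt X h, tgt X k)) \<cdot>\<^bsub>X\<^esub> \<Phi>2 (f, g) (par X T h k) \<in> over g"
        by (rule F.vert_over) (use f e2 ov s in simp_all)
      show "k \<cdot>\<^bsub>X\<^esub> snd (\<epsilon> (src B f, src B g) (src X h, src X k)) \<in> over g"
        by (rule F.over_vert) (use f e1 in simp_all)
      have "(snd (\<epsilon> (tgt B f, tgt B g) (tgt X h, tgt X k)) \<cdot>\<^bsub>X\<^esub> \<Phi>2 (f, g) (par X T h k)) \<cdot>\<^bsub>X\<^esub> \<kappa> (pi2 S (src B f) (src B
        g)) (pr T (src X h) (src X k))
        = snd (\<epsilon> (tgt B f, tgt B g) (tgt X h, tgt X k)) \<cdot>\<^bsub>X\<^esub> (\<kappa> (pi2 S (tgt B f) (tgt B g)) (pr T (tgt X h) (tgt X k))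
          \<cdot>\<^bsub>X\<^esub> par X T h k)"
        using ea e2 ova s k1 l pa by simp
      also have "\<dots> = pi2 T (tgt X h) (tgt X k) \<cdot>\<^bsub>X\<^esub> par X T h k"
        by (rule C.cmp_reassoc[OF e2(8)]) (use ea e2 k2 pa in simp_all)
      also have "\<dots> = k \<cdot>\<^bsub>X\<^esub> pi2 T (src X h) (src X k)" using h k by (simp add: T.pi_par)
      finally show "(snd (\<epsilon> (tgt B f, tgt B g) (tgt X h, tgt X k)) \<cdot>\<^bsub>X\<^esub> \<Phi>2 (f, g) (par X T h k)) \<cdot>\<^bsub>X\<^esub> \<kappa> (pi2 S (src B f)
        (src B g)) (pr T (src X h) (src X k))
        = (k \<cdot>\<^bsub>X\<^esub> snd (\<epsilon> (src B f, src B g) (src X h, src X k))) \<cdot>\<^bsub>X\<^esub> \<kappa> (pi2 S (src B f) (src B g)) (pr T (src X h) (src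
          X k))"
        using ea e1 k1 k by simp
    qed (use ea e1 e2 ova s k f in simp_all)
    show ?case using 1 2 by (simp add: e)
  qed
  \<comment> \<open>Tested on the lift of a projection: the counit turns the lift into the
    projection of the product, and this projection of the unit is the lift again.\<close>
  have tri1: "\<epsilon> (a, b) (fo (tcomp (LL B S F) (a, b)) x) \<cdot>\<^bsub>cat_prod X X\<^esub> fm (tcomp (LL B S F) (a, b)) (\<eta> (a, b) x) =
      ide (cat_prod X X) (fo (tcomp (LL B S F) (a, b)) x)"
    if ab: "a \<in> obj B" "b \<in> obj B" and x: "x \<in> obj X" "fo P x = pr S a b" for a b x
  proof -
    note k1 = kk[OF ab x] and e = \<eta>[OF ab x]
    let ?y = "tgt X (\<kappa> (pi1 S a b) x)" and ?z = "tgt X (\<kappa> (pi2 S a b) x)"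
    have yz: "?y \<in> obj X" "?z \<in> obj X" "fo P ?y = a" "fo P ?z = b" using k1 by simp_all
    note v = Lv[OF ab e(1)] and c = \<epsilon>[OF yz(1,2), unfolded yz]
    note k2 = kk[OF ab T.pr_obj[OF yz(1,2)]]
    note va = overD(1)[OF v(1)] overD(1)[OF v(5)] overD(1)[OF c(1)] overD(1)[OF c(5)]
    have pp: "fo P (pr T ?y ?z) = pr S a b" using yz by (simp add: P_pr)
    have pe: "pi1 T ?y ?z \<cdot>\<^bsub>X\<^esub> \<eta> (a, b) x = \<kappa> (pi1 S a b) x" "pi2 T ?y ?z \<cdot>\<^bsub>X\<^esub> \<eta> (a, b) x = \<kappa> (pi2 S a b) x"
      using k1 by (simp_all add: \<eta>_def)
    have "fst (\<epsilon> (a, b) (?y, ?z)) \<cdot>\<^bsub>X\<^esub> \<Phi>1 (ide B a, ide B b) (\<eta> (a, b) x) = ide X ?y"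
    proof (rule F.vert_unique[of "pi1 S a b" x])
      have "fst (\<epsilon> (a, b) (?y, ?z)) \<cdot>\<^bsub>X\<^esub> (\<kappa> (pi1 S a b) (pr T ?y ?z) \<cdot>\<^bsub>X\<^esub> \<eta> (a, b) x) = pi1 T ?y ?z \<cdot>\<^bsub>X\<^esub> \<eta> (a, b) x"
        by (rule C.cmp_reassoc[OF c(4)]) (use va c k2 pp e in simp_all)
      then show "(fst (\<epsilon> (a, b) (?y, ?z)) \<cdot>\<^bsub>X\<^esub> \<Phi>1 (ide B a, ide B b) (\<eta> (a, b) x)) \<cdot>\<^bsub>X\<^esub> \<kappa> (pi1 S a b) x = ide X ?y \<cdot>\<^bsub>X\<^esub>
        \<kappa> (pi1 S a b) x"
        using v(1-4) va c k1 e pe by simp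
      show "fst (\<epsilon> (a, b) (?y, ?z)) \<cdot>\<^bsub>X\<^esub> \<Phi>1 (ide B a, ide B b) (\<eta> (a, b) x) \<in> over (ide B (tgt B (pi1 S a b)))"
        using ab v c e by (simp add: F.vert_cmp)
    qed (use ab x yz v va c k1 e F.over_ide[of a ?y] in simp_all)
    moreover have "snd (\<epsilon> (a, b) (?y, ?z)) \<cdot>\<^bsub>X\<^esub> \<Phi>2 (ide B a, ide B b) (\<eta> (a, b) x) = ide X ?z"
    proof (rule F.vert_unique[of "pi2 S a b" x])
      have "snd (\<epsilon> (a, b) (?y, ?z)) \<cdot>\<^bsub>X\<^esub> (\<kappa> (pi2 S a b) (pr T ?y ?z) \<cdot>\<^bsub>X\<^esub> \<eta> (a, b) x) = pi2 T ?y ?z \<cdot>\<^bsub>X\<^esub> \<eta> (a, b) x"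
        by (rule C.cmp_reassoc[OF c(8)]) (use va c k2 pp e in simp_all)
      then show "(snd (\<epsilon> (a, b) (?y, ?z)) \<cdot>\<^bsub>X\<^esub> \<Phi>2 (ide B a, ide B b) (\<eta> (a, b) x)) \<cdot>\<^bsub>X\<^esub> \<kappa> (pi2 S a b) x = ide X ?z \<cdot>\<^bsub>X\<^esub>
        \<kappa> (pi2 S a b) x"
        using v(5-8) va c k1 e pe by simp
      show "snd (\<epsilon> (a, b) (?y, ?z)) \<cdot>\<^bsub>X\<^esub> \<Phi>2 (ide B a, ide B b) (\<eta> (a, b) x) \<in> over (ide B (tgt B (pi2 S a b)))"
        using ab v c e by (simp add: F.vert_cmp)
    qed (use ab x yz v va c k1 e F.over_ide[of b ?z] in simp_all)
    ultimately show ?thesis by (simp add: LL_obj v)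
  qed
  \<comment> \<open>A product of arrows after a pairing is the pairing of the composites. These
    composites are the two projections, by definition of the counit, and their pairing is the
    identity.\<close>
  have tri2: "par X T (fst (\<epsilon> (fo P x, fo P y) (x, y))) (snd (\<epsilon> (fo P x, fo P y) (x, y))) \<cdot>\<^bsub>X\<^esub> \<eta> (fo P x, fo P y) (pr T
    x y) = ide X (pr T x y)"
    if xy: "x \<in> obj X" "y \<in> obj X" for x y
    using \<epsilon>[OF xy] kk[of "fo P x" "fo P y" "pr T x y"] xy overD(1)[OF \<epsilon>(1)[OF xy]] overD(1)[OF \<epsilon>(5)[OF xy]]
    by (simp add: \<eta>_def T.par_pair P_pr)
  show ?thesis
    unfolding right_adjoint_in_CAT_def
  proof (intro conjI exI[of _ \<eta>] exI[of _ \<epsilon>] ballI 1 2)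
    show "pseudonat ?A ?G ?H (LL B S F)" by (rule L.pseudonat)
    show "pseudonat ?A ?H ?G prodR" by (rule displayed_nat.pseudonat[OF nat_prodR])
    fix ab assume ab: "ab \<in> obj ?A"
    { fix x assume "x \<in> obj (pobj ?G ab)"
      then show "\<epsilon> ab (fo (tcomp (LL B S F) ab) x) \<cdot>\<^bsub>pobj ?H ab\<^esub> fm (tcomp (LL B S F) ab) (\<eta> ab x) = ide (pobj ?H ab)
        (fo (tcomp (LL B S F) ab) x)"
        using tri1[of "fst ab" "snd ab" x] ab by (auto simp: F.pobj_simps) }
    { fix y assume "y \<in> obj (pobj ?H ab)"
      then show "fm (tcomp prodR ab) (\<epsilon> ab y) \<cdot>\<^bsub>pobj ?G ab\<^esub> \<eta> ab (fo (tcomp prodR ab) y) = ide (pobj ?G ab) (fo (tcomp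
        prodR ab) y)"
        using tri2[of "fst y" "snd y"] ab by (cases ab; cases y) (auto simp: F.pobj_simps) }
  qed
qed

end

section \<open>Products from right adjoints\<close>

context cloven_prod
begin

text \<open>If the product functor is the action of a pseudonatural transformation,
  \<open>cocartesian_R\<close> shows that products of cocartesian arrows are cocartesian.\<close>

lemma cart_opfibI:
  assumes fp: "finite_products X T"
    and pr: "\<And>x y. x \<in> obj X \<Longrightarrow> y \<in> obj X \<Longrightarrow> fo P (pr T x y) = pr S (fo P x) (fo P y)"
    and one: "fo P (one T) = one S"
    and pi: "\<And>x y. x \<in> obj X \<Longrightarrow> y \<in> obj X \<Longrightarrow> fm P (pi1 T x y) = pi1 S (fo P x) (fo P y)"
      "\<And>x y. x \<in> obj X \<Longrightarrow> y \<in> obj X \<Longrightarrow> fm P (pi2 T x y) = pi2 S (fo P x) (fo P y)"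
    and R: "nat_R R \<Psi>" and par: "\<And>h k. h \<in> arr X \<Longrightarrow> k \<in> arr X \<Longrightarrow> \<Psi> (fm P h, fm P k) (h, k) = par X T h k"
  shows "cart_opfib X B P \<kappa> S T"
proof -
  interpret T: fin_prod X T by unfold_locales fact
  show ?thesis
    by unfold_locales (use pr one pi par cocartesian_R[OF R] in \<open>auto simp: cocartesian_def\<close>)
qed

text \<open>The products are the values of \<open>R\<close>, with projections made from the counit,
  and the terminal object is the value of \<open>R1\<close>. The adjunctions speak only of vertical
  arrows, so a cone from an arbitrary object \<open>z\<close> is first moved into the fibre over the
  product, or over the terminal object, by a lift out of \<open>z\<close>.\<close>

lemma cart_opfib_if_adjoints:
  assumes one: "right_adjoint_in_CAT cat_unit (psf_precomp (func_point B (one S)) F) psf_unit L1 R1"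
    and prod: "right_adjoint_in_CAT (cat_prod B B) (psf_precomp (prod_func B S) F) (psf_prod F F) (LL B S F) R"
  shows "\<exists>T. cart_opfib X B P \<kappa> S T"
proof -
  define r where "r = fo (tcomp R1 ()) ()"
  have "r \<in> obj X \<and> fo P r = one S \<and> (\<forall>z\<in>obj X. \<exists>!f. f \<in> hom X z r)"
  proof -
    let ?G = "psf_precomp (func_point B (one S)) F"
    obtain \<eta> \<epsilon> where m: "modification cat_unit ?G ?G (pnt_id cat_unit ?G) (pnt_comp cat_unit ?G R1 L1) \<eta>"
      and t: "fm (tcomp R1 ()) (\<epsilon> () ()) \<cdot>\<^bsub>pobj ?G ()\<^esub> \<eta> () (fo (tcomp R1 ()) ()) = ide (pobj ?G ()) (fo (tcomp R1 ()) ())"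
      using one unfolding right_adjoint_in_CAT_def by (force simp: psf_unit_def)
    have "pseudonat cat_unit psf_unit ?G R1" using one by (simp add: right_adjoint_in_CAT_def)
    then obtain \<Psi> where R1: "nat_R1 R1 \<Psi>" using ex_nat_R1 by blast
    interpret R1: displayed_nat cat_unit cat_unit psf_unit "\<lambda>_. UNIV" "\<lambda>_ _. ()" X ?G "\<lambda>_. over (ide B (one S))" "\<lambda>_. \<kappa>
      (ide B (one S))" R1 \<Psi> by fact
    note R1.G.lift_src [simp del] \<comment> \<open>at type \<open>unit\<close> this rule makes the simplifier loop\<close>
    have r: "r \<in> obj X" "fo P r = one S" using R1.Phi_obj[of "()" "()"] by (simp_all add: r_def psf_unit_def)
    interpret N: displayed_nat_pair cat_unit X ?G "\<lambda>_. over (ide B (one S))" "\<lambda>_. \<kappa> (ide B (one S))"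
       X ?G "\<lambda>_. over (ide B (one S))" "\<lambda>_. \<kappa> (ide B (one S))" "pnt_id cat_unit ?G" "\<lambda>_ h. h" "pnt_comp cat_unit ?G R1
         L1" "\<lambda>f h. \<Psi> f ()"
      by (rule displayed_nat_pair.intro[OF displayed_nat_id[OF displayed_F_one] displayed_nat_comp[OF nat_L1 R1]])
    have i: "\<Psi> () () = ide X r" using R1.Phi_ide[of "()" "()"] by (simp add: r_def psf_unit_def)
    have \<eta>: "\<eta> () x \<in> over (ide B (one S))" "src X (\<eta> () x) = x" "tgt X (\<eta> () x) = r" if "x \<in> obj X" "fo P x = one S" for x
    proof -
      have x: "() \<in> obj cat_unit" "x \<in> obj (pobj ?G ())" using that by simp_all
      show "\<eta> () x \<in> over (ide B (one S))" using N.modificationD(1)[OF m x] .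
      show "src X (\<eta> () x) = x" unfolding N.modificationD(2)[OF m x] by (simp add: pnt_id_def)
      show "tgt X (\<eta> () x) = r" unfolding N.modificationD(3)[OF m x] by (simp add: pnt_comp_def r_def)
    qed
    have "fm (tcomp R1 ()) u = ide X r" for u using R1.Phi_vert[of "()" u] i by simp
    then have "ide X r \<cdot>\<^bsub>X\<^esub> \<eta> () r = ide X r"
      using t by (simp add: F.pobj_simps flip: r_def)
    \<comment> \<open>\<open>R1\<close> sends every arrow of the terminal category to the identity
      of \<open>r\<close>, so this is the triangle identity.\<close>
    then have \<eta>r: "\<eta> () r = ide X r"
      using \<eta>[OF r] overD(1)[OF \<eta>(1)[OF r]] by simp
    \<comment> \<open>Naturality of the unit at \<open>h\<close>: the transpose of \<open>h\<close>
      lives in the terminal category, so it becomes an identity, and the unit at \<open>r\<close> is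
      one as well.\<close>
    have uniq: "h = \<eta> () (src X h)" if h: "h \<in> over (ide B (one S))" "tgt X h = r" for h
    proof -
      note ha = overD(1)[OF h(1)] over_obj(1)[OF h(1)]
      have x: "src X h \<in> obj X" "fo P (src X h) = one S" using ha by simp_all
      have "\<eta> () r \<cdot>\<^bsub>X\<^esub> h = \<Psi> () () \<cdot>\<^bsub>X\<^esub> \<eta> () (src X h)"
        using N.modificationD(4)[OF m, of "()" h] h by simp
      then show ?thesis unfolding i \<eta>r using ha(1) h(2) \<eta>[OF x] overD(1)[OF \<eta>(1)[OF x]] by simp
    qed
    have "\<exists>!f. f \<in> hom X z r" if z: "z \<in> obj X" for z
    proof -
    obtain s where s: "s \<in> arr B" "src B s = fo P z" "tgt B s = one S" using S.bang_ex[of "fo P z"] z by auto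
    note l = lift_simps[OF s(1) z s(2)[symmetric]]
    let ?y = "tgt X (\<kappa> s z)"
    have y: "?y \<in> obj X" "fo P ?y = one S" using l s by simp_all
    show "\<exists>!f. f \<in> hom X z r"
    proof
      show "\<eta> () ?y \<cdot>\<^bsub>X\<^esub> \<kappa> s z \<in> hom X z r" using \<eta>[OF y] l overD by (simp add: hom_def)
      fix h assume "h \<in> hom X z r"
      then have h: "h \<in> arr X" "src X h = z" "tgt X h = r" by (simp_all add: hom_def)
      have "fm P h = s" by (rule S.bang_unique) (use h s r in simp_all)
      then have ho: "h \<in> over s" using h by (simp add: over_def)
      obtain u where u: "u \<in> over (ide B (tgt B s))" "u \<cdot>\<^bsub>X\<^esub> \<kappa> s z = h" "src X u = ?y" "tgt X u = tgt X h"
        using F.vert_factor[OF s(1) ho] h by metis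
      then show "h = \<eta> () ?y \<cdot>\<^bsub>X\<^esub> \<kappa> s z" using uniq[of u] s h by simp
    qed
    qed
    then show ?thesis using r by blast
  qed
  then have r: "r \<in> obj X" "fo P r = one S" and terminal: "\<And>z. z \<in> obj X \<Longrightarrow> \<exists>!f. f \<in> hom X z r" by blast+
  let ?G = "psf_precomp (prod_func B S) F" and ?H = "psf_prod F F" and ?A = "cat_prod B B"
  obtain \<eta> \<epsilon> where m\<eta>: "modification ?A ?G ?G (pnt_id ?A ?G) (pnt_comp ?A ?G R (LL B S F)) \<eta>"
    and m\<epsilon>: "modification ?A ?H ?H (pnt_comp ?A ?H (LL B S F) R) (pnt_id ?A ?H) \<epsilon>"
    and t1: "\<And>a x. a \<in> obj ?A \<Longrightarrow> x \<in> obj (pobj ?G a) \<Longrightarrow>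
           \<epsilon> a (fo (tcomp (LL B S F) a) x) \<cdot>\<^bsub>pobj ?H a\<^esub> fm (tcomp (LL B S F) a) (\<eta> a x) = ide (pobj ?H a) (fo (tcomp (LL
             B S F) a) x)"
    and t2: "\<And>a y. a \<in> obj ?A \<Longrightarrow> y \<in> obj (pobj ?H a) \<Longrightarrow>
           fm (tcomp R a) (\<epsilon> a y) \<cdot>\<^bsub>pobj ?G a\<^esub> \<eta> a (fo (tcomp R a) y) = ide (pobj ?G a) (fo (tcomp R a) y)"
    using prod unfolding right_adjoint_in_CAT_def by auto
  have "pseudonat ?A ?H ?G R" using prod by (simp add: right_adjoint_in_CAT_def)
  then obtain \<Psi> where R: "nat_R R \<Psi>" using ex_nat_R by blast
  obtain \<Phi>1 \<Phi>2 where LL: "displayed_nat ?A X ?G over_pr \<kappa>_pr (cat_prod X X) ?H over2 \<kappa>2 (LL B S F) (\<lambda>f h. (\<Phi>1 f h, \<Phi>2 f h))"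
    and LL_lift: "\<And>f g h. f \<in> arr B \<Longrightarrow> g \<in> arr B \<Longrightarrow> h \<in> over (par B S f g) \<Longrightarrow>
      \<Phi>1 (f, g) h \<cdot>\<^bsub>X\<^esub> \<kappa> (pi1 S (src B f) (src B g)) (src X h) = \<kappa> (pi1 S (tgt B f) (tgt B g)) (tgt X h) \<cdot>\<^bsub>X\<^esub> h"
      "\<And>f g h. f \<in> arr B \<Longrightarrow> g \<in> arr B \<Longrightarrow> h \<in> over (par B S f g) \<Longrightarrow>
      \<Phi>2 (f, g) h \<cdot>\<^bsub>X\<^esub> \<kappa> (pi2 S (src B f) (src B g)) (src X h) = \<kappa> (pi2 S (tgt B f) (tgt B g)) (tgt X h) \<cdot>\<^bsub>X\<^esub> h"
    using ex_nat_LL by blast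
  interpret R: displayed_nat ?A "cat_prod X X" ?H over2 \<kappa>2 X ?G over_pr \<kappa>_pr R \<Psi> by (fact R)
  interpret L: displayed_nat ?A X ?G over_pr \<kappa>_pr "cat_prod X X" ?H over2 \<kappa>2 "LL B S F" "\<lambda>f h. (\<Phi>1 f h, \<Phi>2 f h)" by (fact LL)
  interpret N: displayed_nat_pair ?A X ?G over_pr \<kappa>_pr X ?G over_pr \<kappa>_pr "pnt_id ?A ?G" "\<lambda>_ h. h"
      "pnt_comp ?A ?G R (LL B S F)" "\<lambda>f h. \<Psi> f (\<Phi>1 f h, \<Phi>2 f h)"
    by (rule displayed_nat_pair.intro[OF displayed_nat_id[OF displayed_F_pr] displayed_nat_comp[OF LL R]])
  interpret E: displayed_nat_pair ?A "cat_prod X X" ?H over2 \<kappa>2 "cat_prod X X" ?H over2 \<kappa>2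
      "pnt_comp ?A ?H (LL B S F) R" "\<lambda>f h. (\<Phi>1 f (\<Psi> f h), \<Phi>2 f (\<Psi> f h))" "pnt_id ?A ?H" "\<lambda>_ h. h"
    by (rule displayed_nat_pair.intro[OF displayed_nat_comp[OF R LL] displayed_nat_id[OF displayed_FF]])
  \<comment> \<open>\<open>W\<close> is the future product of objects. \<open>e1\<close> and
    \<open>e2\<close> are the components of the counit, vertical arrows out of the pushforwards of
    \<open>W x y\<close> along the base projections; putting the lifts before them gives arrows
    \<open>p1\<close> and \<open>p2\<close> out of \<open>W x y\<close> itself.\<close>
  define W where "W x y = fo (tcomp R (fo P x, fo P y)) (x, y)" for x y
  define e1 where "e1 x y = fst (\<epsilon> (fo P x, fo P y) (x, y))" for x y
  define e2 where "e2 x y = snd (\<epsilon> (fo P x, fo P y) (x, y))" for x y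
  define p1 where "p1 x y = e1 x y \<cdot>\<^bsub>X\<^esub> \<kappa> (pi1 S (fo P x) (fo P y)) (W x y)" for x y
  define p2 where "p2 x y = e2 x y \<cdot>\<^bsub>X\<^esub> \<kappa> (pi2 S (fo P x) (fo P y)) (W x y)" for x y
  have W: "W x y \<in> obj X" "fo P (W x y) = pr S (fo P x) (fo P y)" if "x \<in> obj X" "y \<in> obj X" for x y
    using R.Phi_obj[of "(fo P x, fo P y)" "(x, y)"] that by (simp_all add: W_def)
  have e: "e1 x y \<in> over (ide B (fo P x))" "src X (e1 x y) = tgt X (\<kappa> (pi1 S (fo P x) (fo P y)) (W x y))" "tgt X (e1 x
    y) = x"
      "e2 x y \<in> over (ide B (fo P y))" "src X (e2 x y) = tgt X (\<kappa> (pi2 S (fo P x) (fo P y)) (W x y))" "tgt X (e2 x y) = y"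
      "e1 x y \<in> arr X" "e2 x y \<in> arr X"
      if "x \<in> obj X" "y \<in> obj X" for x y
  proof -
    let ?a = "(fo P x, fo P y)"
    note E.modificationD(1-3)[OF m\<epsilon>, of ?a "(x, y)"]
    then show "e1 x y \<in> over (ide B (fo P x))" "src X (e1 x y) = tgt X (\<kappa> (pi1 S (fo P x) (fo P y)) (W x y))" "tgt X (e1
      x y) = x"
      "e2 x y \<in> over (ide B (fo P y))" "src X (e2 x y) = tgt X (\<kappa> (pi2 S (fo P x) (fo P y)) (W x y))" "tgt X (e2 x y) = y"
      "e1 x y \<in> arr X" "e2 x y \<in> arr X"
      using that overD(1) by (auto simp: e1_def e2_def W_def pnt_comp_def pnt_id_def LL_obj mem_Times_iff)
  qed
  have kk: "\<kappa> (pi1 S a b) x \<in> arr X" "src X (\<kappa> (pi1 S a b) x) = x" "fm P (\<kappa> (pi1 S a b) x) = pi1 S a b"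
      "fo P (tgt X (\<kappa> (pi1 S a b) x)) = a"
      "\<kappa> (pi2 S a b) x \<in> arr X" "src X (\<kappa> (pi2 S a b) x) = x" "fm P (\<kappa> (pi2 S a b) x) = pi2 S a b"
      "fo P (tgt X (\<kappa> (pi2 S a b) x)) = b"
    if "a \<in> obj B" "b \<in> obj B" "x \<in> obj X" "fo P x = pr S a b" for a b x
    using that lift_simps[of "pi1 S a b" x] lift_simps[of "pi2 S a b" x] by simp_all
  have p: "p1 x y \<in> arr X" "src X (p1 x y) = W x y" "tgt X (p1 x y) = x" "fm P (p1 x y) = pi1 S (fo P x) (fo P y)"
    "p2 x y \<in> arr X" "src X (p2 x y) = W x y" "tgt X (p2 x y) = y" "fm P (p2 x y) = pi2 S (fo P x) (fo P y)"
    if "x \<in> obj X" "y \<in> obj X" for x y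
    using e[OF that] W[OF that] kk[of "fo P x" "fo P y" "W x y"] that overD(2)[OF e(1)[OF that]] overD(2)[OF e(4)[OF that]]
    by (simp_all add: p1_def p2_def)
  have psi: "\<Psi> (f, g) (h, k) \<in> over (par B S f g)" "\<Psi> (f, g) (h, k) \<in> arr X" "src X (\<Psi> (f, g) (h, k)) = W (src X h) (src
    X k)"
      "tgt X (\<Psi> (f, g) (h, k)) = W (tgt X h) (tgt X k)"
    if "h \<in> over f" "k \<in> over g" for f g h k
  proof -
    have a: "(f, g) \<in> arr ?A" "(h, k) \<in> over2 (f, g)" using that over_base by auto
    show "\<Psi> (f, g) (h, k) \<in> over (par B S f g)" "\<Psi> (f, g) (h, k) \<in> arr X" "src X (\<Psi> (f, g) (h, k)) = W (src X h) (src X k)"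
      "tgt X (\<Psi> (f, g) (h, k)) = W (tgt X h) (tgt X k)"
      using R.Phi_over[OF a] R.Phi_arr[OF a] R.Phi_src[OF a] R.Phi_tgt[OF a] that over_obj by (simp_all add: W_def)
  qed
  \<comment> \<open>The naturality of the counit at \<open>(h, k)\<close>, followed back along the
    lifts of the projections by the characterization of \<open>LL\<close> on arrows.\<close>
  have p_nat: "p1 (tgt X h) (tgt X k) \<cdot>\<^bsub>X\<^esub> \<Psi> (f, g) (h, k) = h \<cdot>\<^bsub>X\<^esub> p1 (src X h) (src X k)"
      "p2 (tgt X h) (tgt X k) \<cdot>\<^bsub>X\<^esub> \<Psi> (f, g) (h, k) = k \<cdot>\<^bsub>X\<^esub> p2 (src X h) (src X k)"
    if hk: "h \<in> over f" "k \<in> over g" for f g h k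
  proof -
    have f: "f \<in> arr B" "g \<in> arr B" using hk over_base by auto
    note h = overD[OF hk(1)] over_obj[OF hk(1)] and k = overD[OF hk(2)] over_obj[OF hk(2)]
    note s = psi[OF hk]
    have n: "e1 (tgt X h) (tgt X k) \<cdot>\<^bsub>X\<^esub> \<Phi>1 (f, g) (\<Psi> (f, g) (h, k)) = h \<cdot>\<^bsub>X\<^esub> e1 (src X h) (src X k)"
       "e2 (tgt X h) (tgt X k) \<cdot>\<^bsub>X\<^esub> \<Phi>2 (f, g) (\<Psi> (f, g) (h, k)) = k \<cdot>\<^bsub>X\<^esub> e2 (src X h) (src X k)"
      using E.modificationD(4)[OF m\<epsilon>, of "(f, g)" "(h, k)"] hk f h k by (simp_all add: e1_def e2_def)
    have sk: "src X h \<in> obj X" "src X k \<in> obj X" "tgt X h \<in> obj X" "tgt X k \<in> obj X" using h k by simp_all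
    note es = e[OF sk(1,2), unfolded h(3) k(3)] and et = e[OF sk(3,4), unfolded h(4) k(4)]
    note Ws = W[OF sk(1,2), unfolded h(3) k(3)] and Wt = W[OF sk(3,4), unfolded h(4) k(4)]
    note ks = kk[OF D.src_obj[OF f(1)] D.src_obj[OF f(2)] Ws] and kt = kk[OF D.tgt_obj[OF f(1)] D.tgt_obj[OF f(2)] Wt]
    note l = LL_lift[OF f s(1), unfolded s(3,4)]
    have ph: "\<Phi>1 (f, g) (\<Psi> (f, g) (h, k)) \<in> arr X" "\<Phi>2 (f, g) (\<Psi> (f, g) (h, k)) \<in> arr X"
      "src X (\<Phi>1 (f, g) (\<Psi> (f, g) (h, k))) = tgt X (\<kappa> (pi1 S (src B f) (src B g)) (W (src X h) (src X k)))"
      "src X (\<Phi>2 (f, g) (\<Psi> (f, g) (h, k))) = tgt X (\<kappa> (pi2 S (src B f) (src B g)) (W (src X h) (src X k)))"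
      "tgt X (\<Phi>1 (f, g) (\<Psi> (f, g) (h, k))) = tgt X (\<kappa> (pi1 S (tgt B f) (tgt B g)) (W (tgt X h) (tgt X k)))"
      "tgt X (\<Phi>2 (f, g) (\<Psi> (f, g) (h, k))) = tgt X (\<kappa> (pi2 S (tgt B f) (tgt B g)) (W (tgt X h) (tgt X k)))"
      using L.Phi_arr[of "(f, g)" "\<Psi> (f, g) (h, k)"] L.Phi_src[of "(f, g)" "\<Psi> (f, g) (h, k)"] L.Phi_tgt[of "(f, g)" "\<Psi>
        (f, g) (h, k)"] f s
      by (simp_all add: LL_obj)
    have "p1 (tgt X h) (tgt X k) \<cdot>\<^bsub>X\<^esub> \<Psi> (f, g) (h, k) = e1 (tgt X h) (tgt X k) \<cdot>\<^bsub>X\<^esub> (\<Phi>1 (f, g) (\<Psi> (f, g) (h, k)) \<cdot>\<^bsub>X\<^esub> \<kappa>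
      (pi1 S (src B f) (src B g)) (W (src X h) (src X k)))"
      unfolding l(1) p1_def h k using et kt s by simp
    also have "\<dots> = (h \<cdot>\<^bsub>X\<^esub> e1 (src X h) (src X k)) \<cdot>\<^bsub>X\<^esub> \<kappa> (pi1 S (src B f) (src B g)) (W (src X h) (src X k))"
      by (rule C.cmp_reassoc[OF n(1)]) (use ph et ks in simp_all)
    also have "\<dots> = h \<cdot>\<^bsub>X\<^esub> p1 (src X h) (src X k)" unfolding p1_def h k using es ks h(1) by simp
    finally show "p1 (tgt X h) (tgt X k) \<cdot>\<^bsub>X\<^esub> \<Psi> (f, g) (h, k) = h \<cdot>\<^bsub>X\<^esub> p1 (src X h) (src X k)" .
    have "p2 (tgt X h) (tgt X k) \<cdot>\<^bsub>X\<^esub> \<Psi> (f, g) (h, k) = e2 (tgt X h) (tgt X k) \<cdot>\<^bsub>X\<^esub> (\<Phi>2 (f, g) (\<Psi> (f, g) (h, k)) \<cdot>\<^bsub>X\<^esub> \<kappa>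
      (pi2 S (src B f) (src B g)) (W (src X h) (src X k)))"
      unfolding l(2) p2_def h k using et kt s by simp
    also have "\<dots> = (k \<cdot>\<^bsub>X\<^esub> e2 (src X h) (src X k)) \<cdot>\<^bsub>X\<^esub> \<kappa> (pi2 S (src B f) (src B g)) (W (src X h) (src X k))"
      by (rule C.cmp_reassoc[OF n(2)]) (use ph et ks in simp_all)
    also have "\<dots> = k \<cdot>\<^bsub>X\<^esub> p2 (src X h) (src X k)" unfolding p2_def h k using es ks k(1) by simp
    finally show "p2 (tgt X h) (tgt X k) \<cdot>\<^bsub>X\<^esub> \<Psi> (f, g) (h, k) = k \<cdot>\<^bsub>X\<^esub> p2 (src X h) (src X k)" .
  qed
  have Lv: "\<Phi>1 (ide B a, ide B b) u \<in> over (ide B a)" "\<Phi>1 (ide B a, ide B b) u \<in> arr X" "src X (\<Phi>1 (ide B a, ide B b) u)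
    = tgt X (\<kappa> (pi1 S a b) (src X u))"
      "\<Phi>1 (ide B a, ide B b) u \<cdot>\<^bsub>X\<^esub> \<kappa> (pi1 S a b) (src X u) = \<kappa> (pi1 S a b) (tgt X u) \<cdot>\<^bsub>X\<^esub> u"
      "tgt X (\<Phi>1 (ide B a, ide B b) u) = tgt X (\<kappa> (pi1 S a b) (tgt X u))"
      "\<Phi>2 (ide B a, ide B b) u \<in> over (ide B b)" "\<Phi>2 (ide B a, ide B b) u \<in> arr X" "src X (\<Phi>2 (ide B a, ide B b) u) =
        tgt X (\<kappa> (pi2 S a b) (src X u))"
      "\<Phi>2 (ide B a, ide B b) u \<cdot>\<^bsub>X\<^esub> \<kappa> (pi2 S a b) (src X u) = \<kappa> (pi2 S a b) (tgt X u) \<cdot>\<^bsub>X\<^esub> u"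
      "tgt X (\<Phi>2 (ide B a, ide B b) u) = tgt X (\<kappa> (pi2 S a b) (tgt X u))"
      "fm (tcomp (LL B S F) (a, b)) u = (\<Phi>1 (ide B a, ide B b) u, \<Phi>2 (ide B a, ide B b) u)"
    if "a \<in> obj B" "b \<in> obj B" "u \<in> over (ide B (pr S a b))" for a b u
    using that L.Phi_vert_simps[of "(a, b)" u] LL_lift[of "ide B a" "ide B b" u] L.Phi_vert[of "(a, b)" u]
    by (simp_all add: S.par_ide LL_obj)
  \<comment> \<open>The last two equations are the first triangle identity: after the unit, the
    projections become the lifts of the base projections at \<open>z\<close>.\<close>
  have unit: "\<eta> (a, b) z \<in> over (ide B (pr S a b))" "\<eta> (a, b) z \<in> arr X" "src X (\<eta> (a, b) z) = z"
      "tgt X (\<eta> (a, b) z) = W (tgt X (\<kappa> (pi1 S a b) z)) (tgt X (\<kappa> (pi2 S a b) z))"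
      "p1 (tgt X (\<kappa> (pi1 S a b) z)) (tgt X (\<kappa> (pi2 S a b) z)) \<cdot>\<^bsub>X\<^esub> \<eta> (a, b) z = \<kappa> (pi1 S a b) z"
      "p2 (tgt X (\<kappa> (pi1 S a b) z)) (tgt X (\<kappa> (pi2 S a b) z)) \<cdot>\<^bsub>X\<^esub> \<eta> (a, b) z = \<kappa> (pi2 S a b) z"
    if ab: "a \<in> obj B" "b \<in> obj B" and z: "z \<in> obj X" "fo P z = pr S a b" for a b z
  proof -
    note k1 = kk[OF ab z]
    let ?y = "tgt X (\<kappa> (pi1 S a b) z)" and ?w = "tgt X (\<kappa> (pi2 S a b) z)"
    have yz: "?y \<in> obj X" "?w \<in> obj X" "fo P ?y = a" "fo P ?w = b" using k1 by simp_all
    have "\<eta> (a, b) z \<in> over (ide B (pr S a b)) \<and> src X (\<eta> (a, b) z) = z \<and> tgt X (\<eta> (a, b) z) = W ?y ?w"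
      using N.modificationD(1-3)[OF m\<eta>, of "(a, b)" z] ab z yz by (simp add: pnt_id_def pnt_comp_def LL_obj W_def S.par_ide)
    then show n: "\<eta> (a, b) z \<in> over (ide B (pr S a b))" "src X (\<eta> (a, b) z) = z" "tgt X (\<eta> (a, b) z) = W ?y ?w" by blast+
    show na: "\<eta> (a, b) z \<in> arr X" using n overD by blast
    note v = Lv[OF ab n(1), unfolded n(2,3)]
    note k2 = kk[OF ab W[OF yz(1,2), unfolded yz]] and ee = e[OF yz(1,2), unfolded yz]
    have tr: "e1 ?y ?w \<cdot>\<^bsub>X\<^esub> \<Phi>1 (ide B a, ide B b) (\<eta> (a, b) z) = ide X ?y" "e2 ?y ?w \<cdot>\<^bsub>X\<^esub> \<Phi>2 (ide B a, ide B b) (\<eta> (a,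
      b) z) = ide X ?w"
      using t1[of "(a, b)" z] ab z by (simp_all add: LL_obj v(11) e1_def e2_def yz F.pobj_simps)
    have "p1 ?y ?w \<cdot>\<^bsub>X\<^esub> \<eta> (a, b) z = e1 ?y ?w \<cdot>\<^bsub>X\<^esub> (\<Phi>1 (ide B a, ide B b) (\<eta> (a, b) z) \<cdot>\<^bsub>X\<^esub> \<kappa> (pi1 S a b) z)"
      unfolding v(4) p1_def yz using ee k2 n na by simp
    also have "\<dots> = ide X ?y \<cdot>\<^bsub>X\<^esub> \<kappa> (pi1 S a b) z" by (rule C.cmp_reassoc[OF tr(1)]) (use v ee k1 in simp_all)
    finally show "p1 ?y ?w \<cdot>\<^bsub>X\<^esub> \<eta> (a, b) z = \<kappa> (pi1 S a b) z" using k1 by simp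
    have "p2 ?y ?w \<cdot>\<^bsub>X\<^esub> \<eta> (a, b) z = e2 ?y ?w \<cdot>\<^bsub>X\<^esub> (\<Phi>2 (ide B a, ide B b) (\<eta> (a, b) z) \<cdot>\<^bsub>X\<^esub> \<kappa> (pi2 S a b) z)"
      unfolding v(9) p2_def yz using ee k2 n na by simp
    also have "\<dots> = ide X ?w \<cdot>\<^bsub>X\<^esub> \<kappa> (pi2 S a b) z" by (rule C.cmp_reassoc[OF tr(2)]) (use v ee k1 in simp_all)
    finally show "p2 ?y ?w \<cdot>\<^bsub>X\<^esub> \<eta> (a, b) z = \<kappa> (pi2 S a b) z" using k1 by simp
  qed
  text \<open>A vertical arrow into \<open>W x y\<close> is recovered from its transpose by the triangle identity.\<close>
  have transpose: "u = \<Psi> (ide B (fo P x), ide B (fo P y)) (e1 x y \<cdot>\<^bsub>X\<^esub> \<Phi>1 (ide B (fo P x), ide B (fo P y)) u,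
      e2 x y \<cdot>\<^bsub>X\<^esub> \<Phi>2 (ide B (fo P x), ide B (fo P y)) u) \<cdot>\<^bsub>X\<^esub> \<eta> (fo P x, fo P y) (src X u)"
    if xy: "x \<in> obj X" "y \<in> obj X" and u: "u \<in> over (ide B (pr S (fo P x) (fo P y)))" "tgt X u = W x y" for x y u
  proof -
    let ?a = "fo P x" and ?b = "fo P y" let ?i = "(ide B ?a, ide B ?b)"
    have ab: "?a \<in> obj B" "?b \<in> obj B" using xy by simp_all
    note ua = overD[OF u(1)] over_obj[OF u(1)]
    have z: "src X u \<in> obj X" "fo P (src X u) = pr S ?a ?b" using ua ab by simp_all
    note v = Lv[OF ab u(1), unfolded u(2)] and ee = e[OF xy] and n = unit[OF ab z] and n' = unit[OF ab W[OF xy]]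
    have id: "\<Psi> ?i (e1 x y, e2 x y) \<cdot>\<^bsub>X\<^esub> \<eta> (?a, ?b) (W x y) = ide X (W x y)"
      using t2[of "(?a, ?b)" "(x, y)"] R.Phi_vert[of "(?a, ?b)" "\<epsilon> (?a, ?b) (x, y)"] E.modificationD(1)[OF m\<epsilon>, of "(?a,
        ?b)" "(x, y)"] xy ab
      by (simp add: W_def e1_def e2_def F.pobj_simps)
    have nn: "\<eta> (?a, ?b) (W x y) \<cdot>\<^bsub>X\<^esub> u = \<Psi> ?i (\<Phi>1 ?i u, \<Phi>2 ?i u) \<cdot>\<^bsub>X\<^esub> \<eta> (?a, ?b) (src X u)"
      using N.modificationD(4)[OF m\<eta>, of ?i u] u ab by (simp add: S.par_ide)
    have c: "\<Psi> ?i (e1 x y \<cdot>\<^bsub>X\<^esub> \<Phi>1 ?i u, e2 x y \<cdot>\<^bsub>X\<^esub> \<Phi>2 ?i u) = \<Psi> ?i (e1 x y, e2 x y) \<cdot>\<^bsub>X\<^esub> \<Psi> ?i (\<Phi>1 ?i u, \<Phi>2 ?i u)"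
      using R.Phi_cmp[of ?i ?i "(\<Phi>1 ?i u, \<Phi>2 ?i u)" "(e1 x y, e2 x y)"] ab ee v by simp
    note s1 = psi[OF ee(1,4)] and s2 = psi[OF v(1,6)]
    have zz: "tgt X (\<eta> (?a, ?b) (src X u)) = src X (\<Psi> ?i (\<Phi>1 ?i u, \<Phi>2 ?i u))"
      using n v s2 by simp
    have "u = (\<Psi> ?i (e1 x y, e2 x y) \<cdot>\<^bsub>X\<^esub> \<eta> (?a, ?b) (W x y)) \<cdot>\<^bsub>X\<^esub> u" using id ua u by simp
    also have "\<dots> = \<Psi> ?i (e1 x y, e2 x y) \<cdot>\<^bsub>X\<^esub> (\<eta> (?a, ?b) (W x y) \<cdot>\<^bsub>X\<^esub> u)"
      by (rule C.cmp_assoc) (use s1 n' ua u ee in simp_all)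
    also have "\<dots> = (\<Psi> ?i (e1 x y, e2 x y) \<cdot>\<^bsub>X\<^esub> \<Psi> ?i (\<Phi>1 ?i u, \<Phi>2 ?i u)) \<cdot>\<^bsub>X\<^esub> \<eta> (?a, ?b) (src X u)"
      unfolding nn using s1 s2 n zz v ee by simp
    finally show ?thesis unfolding c .
  qed
  define T where "T = \<lparr>pr = W, pi1 = p1, pi2 = p2, one = r\<rparr>"
  have prod: "is_product X x y (W x y) (p1 x y) (p2 x y)" if xy: "x \<in> obj X" "y \<in> obj X" for x y
    unfolding is_product_def
  proof (intro conjI ballI)
    show "p1 x y \<in> hom X (W x y) x" "p2 x y \<in> hom X (W x y) y" using p[OF xy] by (simp_all add: hom_def)
    fix z h k assume z: "z \<in> obj X" and "h \<in> hom X z x" "k \<in> hom X z y"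
    then have h: "h \<in> arr X" "src X h = z" "tgt X h = x" and k: "k \<in> arr X" "src X k = z" "tgt X k = y" by (simp_all
      add: hom_def)
    let ?a = "fo P x" and ?b = "fo P y" let ?i = "(ide B ?a, ide B ?b)"
    have ab: "?a \<in> obj B" "?b \<in> obj B" using xy by simp_all
    let ?m = "pair B S (fm P h) (fm P k)"
    have m: "?m \<in> arr B" "src B ?m = fo P z" "tgt B ?m = pr S ?a ?b" "pi1 S ?a ?b \<cdot>\<^bsub>B\<^esub> ?m = fm P h" "pi2 S ?a ?b \<cdot>\<^bsub>B\<^esub> ?m
      = fm P k"
      using h k by simp_all
    note l = lift_simps[OF m(1) z m(2)[symmetric]]
    \<comment> \<open>The pushforward of \<open>z\<close> along the pairing of the base arrows. It
      lies over the product, where the adjunction applies.\<close>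
    define w where "w = tgt X (\<kappa> ?m z)"
    have w: "w \<in> obj X" "fo P w = pr S ?a ?b" using l m by (simp_all add: w_def)
    note kw = kk[OF ab w] and n = unit[OF ab w]
    let ?y1 = "tgt X (\<kappa> (pi1 S ?a ?b) w)" and ?y2 = "tgt X (\<kappa> (pi2 S ?a ?b) w)"
    have zo: "z \<in> obj (pobj F (src B ?m))" using z m by simp
    have pa: "pi1 S ?a ?b \<in> arr B" "src B (pi1 S ?a ?b) = tgt B ?m" "pi2 S ?a ?b \<in> arr B" "src B (pi2 S ?a ?b) = tgt B
      ?m" using ab m by simp_all
    \<comment> \<open>Factoring \<open>h\<close> through the lift of the pairing and then through
      the lift of the first projection leaves the vertical arrow \<open>h2\<close> into
      \<open>x\<close>; similarly \<open>k2\<close> for \<open>k\<close>. The pair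
      \<open>(h2, k2)\<close> is an arrow out of the image of \<open>w\<close> under
      \<open>LL\<close>, whose transpose under the adjunction is the vertical part of the mediating
      arrow.\<close>
    obtain h1 where h1: "h1 \<in> over (pi1 S ?a ?b)" "src X h1 = w" "h1 \<cdot>\<^bsub>X\<^esub> \<kappa> ?m z = h"
      using F.lift_factor[OF m(1) pa(1,2) zo, of h] h m by (auto simp: over_def w_def)
    obtain k1 where k1: "k1 \<in> over (pi2 S ?a ?b)" "src X k1 = w" "k1 \<cdot>\<^bsub>X\<^esub> \<kappa> ?m z = k"
      using F.lift_factor[OF m(1) pa(3,4) zo, of k] k m by (auto simp: over_def w_def)
    obtain h2 where h2: "h2 \<in> over (ide B ?a)" "src X h2 = ?y1" "h2 \<cdot>\<^bsub>X\<^esub> \<kappa> (pi1 S ?a ?b) w = h1" "tgt X h2 = tgt X h1"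
      using F.vert_factor[OF pa(1) h1(1)] h1 ab by (metis S.pi_simps(3))
    obtain k2 where k2: "k2 \<in> over (ide B ?b)" "src X k2 = ?y2" "k2 \<cdot>\<^bsub>X\<^esub> \<kappa> (pi2 S ?a ?b) w = k1" "tgt X k2 = tgt X k1"
      using F.vert_factor[OF pa(3) k1(1)] k1 ab by (metis S.pi_simps(6))
    note ha = overD(1)[OF h1(1)] overD(1)[OF h2(1)] and ka = overD(1)[OF k1(1)] overD(1)[OF k2(1)]
    have tx: "tgt X h2 = x" "tgt X k2 = y"
      using C.tgt_cmp[of "\<kappa> ?m z" h1] C.tgt_cmp[of "\<kappa> ?m z" k1] h1 k1 h2 k2 ha ka l h k by (simp_all add: w_def)
    note s = psi[OF h2(1) k2(1), unfolded h2(2) k2(2) tx] and pn = p_nat[OF h2(1) k2(1), unfolded h2(2) k2(2) tx]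
    note pw = p[OF C.tgt_obj[OF kw(1)] C.tgt_obj[OF kw(5)]] and pxy = p[OF xy]
    \<comment> \<open>The transpose of \<open>(h2, k2)\<close>, namely its image under
      \<open>R\<close> after the unit at \<open>w\<close>, composed with the lift from
      \<open>z\<close> to \<open>w\<close>.\<close>
    let ?t = "\<Psi> ?i (h2, k2) \<cdot>\<^bsub>X\<^esub> (\<eta> (?a, ?b) w \<cdot>\<^bsub>X\<^esub> \<kappa> ?m z)"
    have ex: "?t \<in> arr X" "src X ?t = z" "tgt X ?t = W x y" using s n l by (simp_all add: w_def)
    have "p1 x y \<cdot>\<^bsub>X\<^esub> ?t = (h2 \<cdot>\<^bsub>X\<^esub> p1 ?y1 ?y2) \<cdot>\<^bsub>X\<^esub> (\<eta> (?a, ?b) w \<cdot>\<^bsub>X\<^esub> \<kappa> ?m z)"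
      by (rule C.cmp_reassoc[OF pn(1)]) (use s n l pxy in \<open>simp_all add: w_def\<close>)
    also have "\<dots> = h2 \<cdot>\<^bsub>X\<^esub> (\<kappa> (pi1 S ?a ?b) w \<cdot>\<^bsub>X\<^esub> \<kappa> ?m z)"
      using C.cmp_reassoc[OF n(5), of "\<kappa> ?m z"] ha h2 pw n l by (simp add: w_def)
    also have "\<dots> = h" using C.cmp_reassoc[OF h2(3), of "\<kappa> ?m z"] ha h2 kw l h1 by (simp add: w_def)
    finally have ex1: "p1 x y \<cdot>\<^bsub>X\<^esub> ?t = h" .
    have "p2 x y \<cdot>\<^bsub>X\<^esub> ?t = (k2 \<cdot>\<^bsub>X\<^esub> p2 ?y1 ?y2) \<cdot>\<^bsub>X\<^esub> (\<eta> (?a, ?b) w \<cdot>\<^bsub>X\<^esub> \<kappa> ?m z)"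
      by (rule C.cmp_reassoc[OF pn(2)]) (use s n l pxy in \<open>simp_all add: w_def\<close>)
    also have "\<dots> = k2 \<cdot>\<^bsub>X\<^esub> (\<kappa> (pi2 S ?a ?b) w \<cdot>\<^bsub>X\<^esub> \<kappa> ?m z)"
      using C.cmp_reassoc[OF n(6), of "\<kappa> ?m z"] ka k2 pw n l by (simp add: w_def)
    also have "\<dots> = k" using C.cmp_reassoc[OF k2(3), of "\<kappa> ?m z"] ka k2 kw l k1 by (simp add: w_def)
    finally have ex2: "p2 x y \<cdot>\<^bsub>X\<^esub> ?t = k" .
    \<comment> \<open>A competitor \<open>t\<close> lies over the pairing \<open>?m\<close>, since
      its image in the base solves the same product problem. Its vertical part \<open>u\<close> has
      transpose \<open>(h2, k2)\<close>, because both agree after the two successive lifts; by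
      \<open>transpose\<close> this determines \<open>u\<close>, and so \<open>t\<close>.\<close>
    have key: "\<exists>u. u \<in> over (ide B (pr S ?a ?b)) \<and> src X u = w \<and> tgt X u = W x y \<and> u \<cdot>\<^bsub>X\<^esub> \<kappa> ?m z = t \<and>
        e1 x y \<cdot>\<^bsub>X\<^esub> \<Phi>1 ?i u = h2 \<and> e2 x y \<cdot>\<^bsub>X\<^esub> \<Phi>2 ?i u = k2"
      if t: "t \<in> arr X" "src X t = z" "tgt X t = W x y" "p1 x y \<cdot>\<^bsub>X\<^esub> t = h" "p2 x y \<cdot>\<^bsub>X\<^esub> t = k" for t
    proof -
      have "fm P t = ?m"
      proof (rule S.prod_eqI[OF ab])
        show "pi1 S ?a ?b \<cdot>\<^bsub>B\<^esub> fm P t = pi1 S ?a ?b \<cdot>\<^bsub>B\<^esub> ?m"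
          unfolding m(4) using arg_cong[OF t(4), of "fm P"] t(1-3) pxy by simp
        show "pi2 S ?a ?b \<cdot>\<^bsub>B\<^esub> fm P t = pi2 S ?a ?b \<cdot>\<^bsub>B\<^esub> ?m"
          unfolding m(5) using arg_cong[OF t(5), of "fm P"] t(1-3) pxy by simp
      qed (use t m W[OF xy] in simp_all)
      then have to: "t \<in> over ?m" using t by (simp add: over_def)
      obtain u where u: "u \<in> over (ide B (pr S ?a ?b))" "src X u = w" "u \<cdot>\<^bsub>X\<^esub> \<kappa> ?m z = t" "tgt X u = W x y"
        using F.vert_factor[OF m(1) to] t m by (metis w_def)
      note ua = overD(1)[OF u(1)]
      note v = Lv[OF ab u(1), unfolded u(2,4)]
      note ee = e[OF xy] and kW = kk[OF ab W[OF xy]]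
      have "e1 x y \<cdot>\<^bsub>X\<^esub> \<Phi>1 ?i u = h2"
      proof (rule F.lift_unique2[OF m(1) pa(1,2) zo, folded w_def])
        have "e1 x y \<cdot>\<^bsub>X\<^esub> (\<Phi>1 ?i u \<cdot>\<^bsub>X\<^esub> \<kappa> (pi1 S ?a ?b) w) = p1 x y \<cdot>\<^bsub>X\<^esub> u"
          unfolding v(4) p1_def using ee kW ua u by simp
        then have "(e1 x y \<cdot>\<^bsub>X\<^esub> (\<Phi>1 ?i u \<cdot>\<^bsub>X\<^esub> \<kappa> (pi1 S ?a ?b) w)) \<cdot>\<^bsub>X\<^esub> \<kappa> ?m z = p1 x y \<cdot>\<^bsub>X\<^esub> t"
          using u ua pxy l by (simp add: w_def)
        then have "(e1 x y \<cdot>\<^bsub>X\<^esub> \<Phi>1 ?i u) \<cdot>\<^bsub>X\<^esub> (\<kappa> (pi1 S ?a ?b) w \<cdot>\<^bsub>X\<^esub> \<kappa> ?m z) = h"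
          using v(1-3,5) ee kw l t(4) by (simp add: w_def)
        moreover have "h2 \<cdot>\<^bsub>X\<^esub> (\<kappa> (pi1 S ?a ?b) w \<cdot>\<^bsub>X\<^esub> \<kappa> ?m z) = h"
          using C.cmp_reassoc[OF h2(3), of "\<kappa> ?m z"] ha h2 kw l h1 by (simp add: w_def)
        ultimately show "(e1 x y \<cdot>\<^bsub>X\<^esub> \<Phi>1 ?i u) \<cdot>\<^bsub>X\<^esub> (\<kappa> (pi1 S ?a ?b) w \<cdot>\<^bsub>X\<^esub> \<kappa> ?m z) = h2 \<cdot>\<^bsub>X\<^esub> (\<kappa> (pi1 S ?a ?b) w \<cdot>\<^bsub>X\<^esub> \<kappa>
          ?m z)"
          by simp
        show "e1 x y \<cdot>\<^bsub>X\<^esub> \<Phi>1 ?i u \<in> over (ide B (tgt B (pi1 S ?a ?b)))" using ab v ee by (simp add: F.vert_cmp)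
      qed (use ab v ee h2 in simp_all)
      moreover have "e2 x y \<cdot>\<^bsub>X\<^esub> \<Phi>2 ?i u = k2"
      proof (rule F.lift_unique2[OF m(1) pa(3,4) zo, folded w_def])
        have "e2 x y \<cdot>\<^bsub>X\<^esub> (\<Phi>2 ?i u \<cdot>\<^bsub>X\<^esub> \<kappa> (pi2 S ?a ?b) w) = p2 x y \<cdot>\<^bsub>X\<^esub> u"
          unfolding v(9) p2_def using ee kW ua u by simp
        then have "(e2 x y \<cdot>\<^bsub>X\<^esub> (\<Phi>2 ?i u \<cdot>\<^bsub>X\<^esub> \<kappa> (pi2 S ?a ?b) w)) \<cdot>\<^bsub>X\<^esub> \<kappa> ?m z = p2 x y \<cdot>\<^bsub>X\<^esub> t"
          using u ua pxy l by (simp add: w_def)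
        then have "(e2 x y \<cdot>\<^bsub>X\<^esub> \<Phi>2 ?i u) \<cdot>\<^bsub>X\<^esub> (\<kappa> (pi2 S ?a ?b) w \<cdot>\<^bsub>X\<^esub> \<kappa> ?m z) = k"
          using v(6-8,10) ee kw l t(5) by (simp add: w_def)
        moreover have "k2 \<cdot>\<^bsub>X\<^esub> (\<kappa> (pi2 S ?a ?b) w \<cdot>\<^bsub>X\<^esub> \<kappa> ?m z) = k"
          using C.cmp_reassoc[OF k2(3), of "\<kappa> ?m z"] ka k2 kw l k1 by (simp add: w_def)
        ultimately show "(e2 x y \<cdot>\<^bsub>X\<^esub> \<Phi>2 ?i u) \<cdot>\<^bsub>X\<^esub> (\<kappa> (pi2 S ?a ?b) w \<cdot>\<^bsub>X\<^esub> \<kappa> ?m z) = k2 \<cdot>\<^bsub>X\<^esub> (\<kappa> (pi2 S ?a ?b) w \<cdot>\<^bsub>X\<^esub> \<kappa>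
          ?m z)"
          by simp
        show "e2 x y \<cdot>\<^bsub>X\<^esub> \<Phi>2 ?i u \<in> over (ide B (tgt B (pi2 S ?a ?b)))" using ab v ee by (simp add: F.vert_cmp)
      qed (use ab v ee k2 in simp_all)
      ultimately show ?thesis using u by blast
    qed
    show "\<exists>!t. t \<in> hom X z (W x y) \<and> p1 x y \<cdot>\<^bsub>X\<^esub> t = h \<and> p2 x y \<cdot>\<^bsub>X\<^esub> t = k"
    proof (rule ex1I[of _ ?t])
      show "?t \<in> hom X z (W x y) \<and> p1 x y \<cdot>\<^bsub>X\<^esub> ?t = h \<and> p2 x y \<cdot>\<^bsub>X\<^esub> ?t = k"
        using ex ex1 ex2 by (simp add: hom_def)
      fix t assume "t \<in> hom X z (W x y) \<and> p1 x y \<cdot>\<^bsub>X\<^esub> t = h \<and> p2 x y \<cdot>\<^bsub>X\<^esub> t = k"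
      then obtain u where u: "u \<in> over (ide B (pr S ?a ?b))" "src X u = w" "tgt X u = W x y" "u \<cdot>\<^bsub>X\<^esub> \<kappa> ?m z = t"
        "e1 x y \<cdot>\<^bsub>X\<^esub> \<Phi>1 ?i u = h2" "e2 x y \<cdot>\<^bsub>X\<^esub> \<Phi>2 ?i u = k2"
        using key[of t] by (auto simp: hom_def)
      have "u = \<Psi> ?i (h2, k2) \<cdot>\<^bsub>X\<^esub> \<eta> (?a, ?b) w"
        using transpose[OF xy u(1,3)] unfolding u(2,5,6) .
      then have "t = (\<Psi> ?i (h2, k2) \<cdot>\<^bsub>X\<^esub> \<eta> (?a, ?b) w) \<cdot>\<^bsub>X\<^esub> \<kappa> ?m z" using u(4) by simp
      then show "t = ?t" using s n l by (simp add: w_def)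
    qed
  qed
  have fp: "finite_products X T"
    using prod terminal r C.category by (simp add: finite_products_def T_def is_terminal_def)
  interpret T: fin_prod X T by unfold_locales (fact fp)
  have "cart_opfib X B P \<kappa> S T"
  proof (rule cart_opfibI[OF fp _ _ _ _ R])
    fix h k assume "h \<in> arr X" "k \<in> arr X"
    \<comment> \<open>\<open>p_nat\<close> says that the action of \<open>R\<close> commutes with
      the projections as a product of arrows does, and a product of arrows is determined by
      this.\<close>
    then show "\<Psi> (fm P h, fm P k) (h, k) = par X T h k"
      using psi[of h "fm P h" k "fm P k"] p_nat[of h "fm P h" k "fm P k"]
      by (intro T.par_eqI) (simp_all add: T_def over_def)
  qed (use W p r in \<open>simp_all add: T_def\<close>)
  then show ?thesis by blast
qed

end

section \<open>Modifications out of a whiskered transformation\<close>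

text \<open>A modification from \<open>(F * \<alpha>) \<circ> \<sigma>\<close> to \<open>\<tau>\<close> is the same as a natural family of arrows of the
  total category lying over \<open>\<alpha>\<close>.\<close>

locale whiskering =
  cloven X B P \<kappa> + K: functr A B K + K': functr A B K' +
  S: displayed_nat A E G D L X "psf_precomp K F" "\<lambda>f. over (fm K f)" "\<lambda>f. \<kappa> (fm K f)" \<sigma> \<Phi> +
  T: displayed_nat A E G D L X "psf_precomp K' F" "\<lambda>f. over (fm K' f)" "\<lambda>f. \<kappa> (fm K' f)" \<tau> \<Psi>
  for X :: "('o, 'm) cat" and B :: "('b, 'f) cat" and P :: "('o, 'm, 'b, 'f) func" and \<kappa> :: "'f \<Rightarrow> 'o \<Rightarrow> 'm"
    and A :: "('a, 'g) cat" and K K' E G D L \<sigma> \<Phi> \<tau> \<Psi> +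
  fixes \<alpha> :: "'a \<Rightarrow> 'f"
  assumes \<alpha>: "a \<in> obj A \<Longrightarrow> \<alpha> a \<in> arr B" "a \<in> obj A \<Longrightarrow> src B (\<alpha> a) = fo K a" "a \<in> obj A \<Longrightarrow> tgt B (\<alpha> a) = fo K' a"
    and \<alpha>_natural: "f \<in> arr A \<Longrightarrow> \<alpha> (tgt A f) \<cdot>\<^bsub>B\<^esub> fm K f = fm K' f \<cdot>\<^bsub>B\<^esub> \<alpha> (src A f)"
begin

lemma sigma_lift:
  assumes "a \<in> obj A" "x \<in> obj (pobj G a)"
  shows "fo (tcomp \<sigma> a) x \<in> obj X" "fo P (fo (tcomp \<sigma> a) x) = src B (\<alpha> a)" "\<kappa> (\<alpha> a) (fo (tcomp \<sigma> a) x) \<in> arr X"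
    "src X (\<kappa> (\<alpha> a) (fo (tcomp \<sigma> a) x)) = fo (tcomp \<sigma> a) x" "\<kappa> (\<alpha> a) (fo (tcomp \<sigma> a) x) \<in> over (\<alpha> a)"
    "fo (tcomp \<sigma> a) x \<in> obj (pobj F (src B (\<alpha> a)))"
proof -
  show "fo (tcomp \<sigma> a) x \<in> obj X" "fo P (fo (tcomp \<sigma> a) x) = src B (\<alpha> a)"
    using S.Phi_obj[OF assms] assms by (simp_all add: \<alpha>)
  then show "\<kappa> (\<alpha> a) (fo (tcomp \<sigma> a) x) \<in> arr X"
    "src X (\<kappa> (\<alpha> a) (fo (tcomp \<sigma> a) x)) = fo (tcomp \<sigma> a) x" "\<kappa> (\<alpha> a) (fo (tcomp \<sigma> a) x) \<in> over (\<alpha> a)"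
    "fo (tcomp \<sigma> a) x \<in> obj (pobj F (src B (\<alpha> a)))"
    using lift_simps[of "\<alpha> a" "fo (tcomp \<sigma> a) x"] assms by (simp_all add: \<alpha> over_def)
qed

lemma whiskered:
  obtains \<Theta> where "displayed_nat A E G D L X (psf_precomp K' F) (\<lambda>f. over (fm K' f)) (\<lambda>f. \<kappa> (fm K' f))
      (pnt_comp A (psf_precomp K' F) (pnt_whisker A F K K' \<alpha>) \<sigma>) \<Theta>"
    "\<And>f h. f \<in> arr A \<Longrightarrow> h \<in> D f \<Longrightarrow>
      \<Theta> f h \<cdot>\<^bsub>X\<^esub> \<kappa> (\<alpha> (src A f)) (fo (tcomp \<sigma> (src A f)) (src E h)) =
      \<kappa> (\<alpha> (tgt A f)) (fo (tcomp \<sigma> (tgt A f)) (tgt E h)) \<cdot>\<^bsub>X\<^esub> \<Phi> f h"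
proof -
  obtain W where W: "displayed_nat A X (psf_precomp K F) (\<lambda>f. over (fm K f)) (\<lambda>f. \<kappa> (fm K f))
      X (psf_precomp K' F) (\<lambda>f. over (fm K' f)) (\<lambda>f. \<kappa> (fm K' f)) (pnt_whisker A F K K' \<alpha>) W"
    and l: "\<forall>f\<in>arr A. \<forall>h\<in>over (fm K f). W f h \<cdot>\<^bsub>X\<^esub> \<kappa> (\<alpha> (src A f)) (src X h) = \<kappa> (\<alpha> (tgt A f)) (tgt X h) \<cdot>\<^bsub>X\<^esub> h"
    using displayed_nat_whisker[OF displayed K.functr_axioms K'.functr_axioms \<alpha> \<alpha>_natural] by blast
  show ?thesis
  proof (rule that[OF displayed_nat_comp[OF S.displayed_nat_axioms W]])
    fix f h assume fh: "f \<in> arr A" "h \<in> D f"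
    show "W f (\<Phi> f h) \<cdot>\<^bsub>X\<^esub> \<kappa> (\<alpha> (src A f)) (fo (tcomp \<sigma> (src A f)) (src E h)) =
      \<kappa> (\<alpha> (tgt A f)) (fo (tcomp \<sigma> (tgt A f)) (tgt E h)) \<cdot>\<^bsub>X\<^esub> \<Phi> f h"
      using bspec[OF bspec[OF l fh(1)] S.Phi_over[OF fh]] by (simp add: S.Phi_src[OF fh] S.Phi_tgt[OF fh])
  qed
qed

text \<open>The cell \<open>m\<close> is the vertical part of the arrow \<open>c\<close>. Its
  naturality is checked after the lift of \<alpha>, where it becomes naturality of
  \<open>c\<close>.\<close>

lemma whisker_modI:
  assumes over: "\<And>a x. a \<in> obj A \<Longrightarrow> x \<in> obj (pobj G a) \<Longrightarrow> c a x \<in> over (\<alpha> a)"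
    and src: "\<And>a x. a \<in> obj A \<Longrightarrow> x \<in> obj (pobj G a) \<Longrightarrow> src X (c a x) = fo (tcomp \<sigma> a) x"
    and tgt: "\<And>a x. a \<in> obj A \<Longrightarrow> x \<in> obj (pobj G a) \<Longrightarrow> tgt X (c a x) = fo (tcomp \<tau> a) x"
    and iso: "\<And>a x. a \<in> obj A \<Longrightarrow> x \<in> obj (pobj G a) \<Longrightarrow> is_iso X (c a x)"
    and nat: "\<And>f h. f \<in> arr A \<Longrightarrow> h \<in> D f \<Longrightarrow>
      c (tgt A f) (tgt E h) \<cdot>\<^bsub>X\<^esub> \<Phi> f h = \<Psi> f h \<cdot>\<^bsub>X\<^esub> c (src A f) (src E h)"
    and m: "m = (\<lambda>a x. cofactor X P (ide B (fo K' a)) (\<kappa> (\<alpha> a) (fo (tcomp \<sigma> a) x)) (c a x))"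
  shows "invertible_modification A G (psf_precomp K' F) (pnt_comp A (psf_precomp K' F) (pnt_whisker A F K K' \<alpha>) \<sigma>) \<tau> m"
proof -
  obtain \<Theta> where \<Theta>: "displayed_nat A E G D L X (psf_precomp K' F) (\<lambda>f. over (fm K' f)) (\<lambda>f. \<kappa> (fm K' f))
      (pnt_comp A (psf_precomp K' F) (pnt_whisker A F K K' \<alpha>) \<sigma>) \<Theta>"
    and l: "\<And>f h. f \<in> arr A \<Longrightarrow> h \<in> D f \<Longrightarrow>
      \<Theta> f h \<cdot>\<^bsub>X\<^esub> \<kappa> (\<alpha> (src A f)) (fo (tcomp \<sigma> (src A f)) (src E h)) =
      \<kappa> (\<alpha> (tgt A f)) (fo (tcomp \<sigma> (tgt A f)) (tgt E h)) \<cdot>\<^bsub>X\<^esub> \<Phi> f h"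
    using whiskered by blast
  interpret W: displayed_nat A E G D L X "psf_precomp K' F" "\<lambda>f. over (fm K' f)" "\<lambda>f. \<kappa> (fm K' f)"
    "pnt_comp A (psf_precomp K' F) (pnt_whisker A F K K' \<alpha>) \<sigma>" \<Theta> by (fact \<Theta>)
  have mm: "m a x \<in> over (ide B (fo K' a))" "src X (m a x) = tgt X (\<kappa> (\<alpha> a) (fo (tcomp \<sigma> a) x))"
      "tgt X (m a x) = fo (tcomp \<tau> a) x" "m a x \<cdot>\<^bsub>X\<^esub> \<kappa> (\<alpha> a) (fo (tcomp \<sigma> a) x) = c a x" "m a x \<in> arr X"
    if "a \<in> obj A" "x \<in> obj (pobj G a)" for a x
  proof -
    show "m a x \<in> over (ide B (fo K' a))" "src X (m a x) = tgt X (\<kappa> (\<alpha> a) (fo (tcomp \<sigma> a) x))"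
      "tgt X (m a x) = fo (tcomp \<tau> a) x" "m a x \<cdot>\<^bsub>X\<^esub> \<kappa> (\<alpha> a) (fo (tcomp \<sigma> a) x) = c a x"
      using cofactor_over[OF \<alpha>(1)[OF that(1)] over[OF that]] that by (simp_all add: m src tgt \<alpha>)
    then show "m a x \<in> arr X" using overD(1) by blast
  qed
  have wsrc: "fo (tcomp (pnt_comp A (psf_precomp K' F) (pnt_whisker A F K K' \<alpha>) \<sigma>) a) x = tgt X (\<kappa> (\<alpha> a) (fo (tcomp \<sigma> a)
    x))" for a x
    by (simp add: pnt_comp_def pnt_whisker_def F_simps)
  have "modification A G (psf_precomp K' F) (pnt_comp A (psf_precomp K' F) (pnt_whisker A F K K' \<alpha>) \<sigma>) \<tau> m"
  proof (rule displayed_nat_pair.modificationI[OF displayed_nat_pair.intro[OF \<Theta> T.displayed_nat_axioms]])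
    fix a x assume ax: "a \<in> obj A" "x \<in> obj (pobj G a)"
    show "m a x \<in> over (fm K' (ide A a))" using mm[OF ax] ax by simp
    show "src X (m a x) = fo (tcomp (pnt_comp A (psf_precomp K' F) (pnt_whisker A F K K' \<alpha>) \<sigma>) a) x"
      unfolding wsrc using mm[OF ax] by simp
    show "tgt X (m a x) = fo (tcomp \<tau> a) x" using mm[OF ax] by simp
  next
    fix f h assume fh: "f \<in> arr A" "h \<in> D f"
    have a: "src A f \<in> obj A" "tgt A f \<in> obj A" using fh by simp_all
    note x = S.G.over_src[OF fh] and y = S.G.over_tgt[OF fh]
    note mx = mm[OF a(1) x] and my = mm[OF a(2) y] and lx = sigma_lift[OF a(1) x] and ly = sigma_lift[OF a(2) y]
    note w = W.Phi_over[OF fh] W.Phi_arr[OF fh] W.Phi_src[OF fh, unfolded wsrc] W.Phi_tgt[OF fh, unfolded wsrc]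
    note s = S.Phi_arr[OF fh] S.Phi_src[OF fh] S.Phi_tgt[OF fh]
    note t = T.Phi_over[OF fh] T.Phi_arr[OF fh] T.Phi_src[OF fh] T.Phi_tgt[OF fh]
    show "m (tgt A f) (tgt E h) \<cdot>\<^bsub>X\<^esub> \<Theta> f h = \<Psi> f h \<cdot>\<^bsub>X\<^esub> m (src A f) (src E h)"
    proof (rule F.lift_unique[OF \<alpha>(1)[OF a(1)] _ _ lx(6)])
      show "fm K' f \<in> arr B" "src B (fm K' f) = tgt B (\<alpha> (src A f))" using fh a by (simp_all add: \<alpha>)
      show "m (tgt A f) (tgt E h) \<cdot>\<^bsub>X\<^esub> \<Theta> f h \<in> over (fm K' f)"
        by (rule F.vert_over) (use fh w my in simp_all)
      show "\<Psi> f h \<cdot>\<^bsub>X\<^esub> m (src A f) (src E h) \<in> over (fm K' f)"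
        by (rule F.over_vert) (use fh t mx in simp_all)
      show "src X (m (tgt A f) (tgt E h) \<cdot>\<^bsub>X\<^esub> \<Theta> f h) = tgt X (\<kappa> (\<alpha> (src A f)) (fo (tcomp \<sigma> (src A f)) (src E h)))"
        "src X (\<Psi> f h \<cdot>\<^bsub>X\<^esub> m (src A f) (src E h)) = tgt X (\<kappa> (\<alpha> (src A f)) (fo (tcomp \<sigma> (src A f)) (src E h)))"
        using w t mx my by simp_all
      have "(m (tgt A f) (tgt E h) \<cdot>\<^bsub>X\<^esub> \<Theta> f h) \<cdot>\<^bsub>X\<^esub> \<kappa> (\<alpha> (src A f)) (fo (tcomp \<sigma> (src A f)) (src E h)) =
        m (tgt A f) (tgt E h) \<cdot>\<^bsub>X\<^esub> (\<kappa> (\<alpha> (tgt A f)) (fo (tcomp \<sigma> (tgt A f)) (tgt E h)) \<cdot>\<^bsub>X\<^esub> \<Phi> f h)"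
        using w my lx l[OF fh] by simp
      also have "\<dots> = c (tgt A f) (tgt E h) \<cdot>\<^bsub>X\<^esub> \<Phi> f h"
        by (rule C.cmp_reassoc[OF my(4)]) (use my ly s in simp_all)
      also have "\<dots> = \<Psi> f h \<cdot>\<^bsub>X\<^esub> (m (src A f) (src E h) \<cdot>\<^bsub>X\<^esub> \<kappa> (\<alpha> (src A f)) (fo (tcomp \<sigma> (src A f)) (src E h)))"
        by (simp add: nat[OF fh] mx)
      also have "\<dots> = (\<Psi> f h \<cdot>\<^bsub>X\<^esub> m (src A f) (src E h)) \<cdot>\<^bsub>X\<^esub> \<kappa> (\<alpha> (src A f)) (fo (tcomp \<sigma> (src A f)) (src E h))"
        by (rule C.cmp_assoc[symmetric]) (use t mx lx in simp_all)
      finally show "(m (tgt A f) (tgt E h) \<cdot>\<^bsub>X\<^esub> \<Theta> f h) \<cdot>\<^bsub>X\<^esub> \<kappa> (\<alpha> (src A f)) (fo (tcomp \<sigma> (src A f)) (src E h)) =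
        (\<Psi> f h \<cdot>\<^bsub>X\<^esub> m (src A f) (src E h)) \<cdot>\<^bsub>X\<^esub> \<kappa> (\<alpha> (src A f)) (fo (tcomp \<sigma> (src A f)) (src E h))" .
    qed
  qed
  moreover have "is_iso (pobj F (fo K' a)) (m a x)" if ax: "a \<in> obj A" "x \<in> obj (pobj G a)" for a x
  proof -
    note mx = mm[OF ax] and lx = sigma_lift[OF ax]
    let ?k = "\<kappa> (\<alpha> a) (fo (tcomp \<sigma> a) x)"
    \<comment> \<open>The inverse of \<open>m\<close>: run \<open>c\<close> backwards and then lift
      \<alpha>. The result is vertical because it lies over \<alpha> after its inverse.\<close>
    let ?v = "?k \<cdot>\<^bsub>X\<^esub> inv_arr X (c a x)"
    note i = iso[OF ax] and ca = over[OF ax] overD[OF over[OF ax]]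
    have va: "?v \<in> arr X" "src X ?v = fo (tcomp \<tau> a) x" "tgt X ?v = tgt X ?k"
      using C.inv_arr_simps[OF i] lx src[OF ax] tgt[OF ax] by simp_all
    have "fm P (inv_arr X (c a x)) = inv_arr B (\<alpha> a)"
      using D.inv_arr_eqI[OF fm_inverse[OF C.inverse_inv_arr[OF i]]] ca by simp
    moreover have "is_iso B (\<alpha> a)" using fm_inverse[OF C.inverse_inv_arr[OF i]] ca by (auto simp: is_iso_def)
    ultimately have vo: "?v \<in> over (ide B (fo K' a))"
      using va lx overD(2)[OF lx(5)] C.inv_arr_simps[OF i] src[OF ax] ax by (simp add: over_def \<alpha>)
    have mv: "m a x \<cdot>\<^bsub>X\<^esub> ?v = ide X (fo (tcomp \<tau> a) x)"
      using C.cmp_reassoc[OF mx(4), of "inv_arr X (c a x)"] mx lx C.inv_arr_simps[OF i] src[OF ax] tgt[OF ax] by simp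
    have vm: "?v \<cdot>\<^bsub>X\<^esub> m a x = ide X (tgt X ?k)"
    proof (rule F.vert_unique[OF \<alpha>(1)[OF ax(1)] lx(6)])
      show "?v \<cdot>\<^bsub>X\<^esub> m a x \<in> over (ide B (tgt B (\<alpha> a)))" using ax vo mx va by (simp add: \<alpha> F.vert_cmp)
      show "ide X (tgt X ?k) \<in> over (ide B (tgt B (\<alpha> a)))" using lx over_obj(2)[OF lx(5)] by (simp add: over_def)
      have "(?v \<cdot>\<^bsub>X\<^esub> m a x) \<cdot>\<^bsub>X\<^esub> ?k = ?v \<cdot>\<^bsub>X\<^esub> c a x"
        unfolding mx(4)[symmetric] by (rule C.cmp_assoc) (use va mx lx in simp_all)
      also have "\<dots> = ?k" using C.inv_arr_simps[OF i] lx src[OF ax] ca by simp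
      finally show "(?v \<cdot>\<^bsub>X\<^esub> m a x) \<cdot>\<^bsub>X\<^esub> ?k = ide X (tgt X ?k) \<cdot>\<^bsub>X\<^esub> ?k" using lx by simp
    qed (use va mx lx in simp_all)
    show ?thesis by (rule F.is_iso_fibreI[where v = ?v]) (use ax vo mx va mv vm in simp_all)
  qed
  ultimately show ?thesis by (simp add: invertible_modification_def)
qed

text \<open>Composing the vertical cell with the lift of \<alpha> restores the arrow over \<alpha>.
  Its invertibility uses that the lift of an isomorphism is an isomorphism, hence the condition on
  \<alpha>.\<close>

lemma whisker_modD:
  assumes m: "invertible_modification A G (psf_precomp K' F) (pnt_comp A (psf_precomp K' F) (pnt_whisker A F K K' \<alpha>) \<sigma>) \<tau> m"
  defines "c \<equiv> \<lambda>a x. m a x \<cdot>\<^bsub>X\<^esub> \<kappa> (\<alpha> a) (fo (tcomp \<sigma> a) x)"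
  shows "\<And>a x. a \<in> obj A \<Longrightarrow> x \<in> obj (pobj G a) \<Longrightarrow> c a x \<in> over (\<alpha> a)"
    and "\<And>a x. a \<in> obj A \<Longrightarrow> x \<in> obj (pobj G a) \<Longrightarrow> src X (c a x) = fo (tcomp \<sigma> a) x"
    and "\<And>a x. a \<in> obj A \<Longrightarrow> x \<in> obj (pobj G a) \<Longrightarrow> tgt X (c a x) = fo (tcomp \<tau> a) x"
    and "\<And>a x. a \<in> obj A \<Longrightarrow> x \<in> obj (pobj G a) \<Longrightarrow> is_iso B (\<alpha> a) \<Longrightarrow> is_iso X (c a x)"
    and "\<And>f h. f \<in> arr A \<Longrightarrow> h \<in> D f \<Longrightarrow>
      c (tgt A f) (tgt E h) \<cdot>\<^bsub>X\<^esub> \<Phi> f h = \<Psi> f h \<cdot>\<^bsub>X\<^esub> c (src A f) (src E h)"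
proof -
  obtain \<Theta> where \<Theta>: "displayed_nat A E G D L X (psf_precomp K' F) (\<lambda>f. over (fm K' f)) (\<lambda>f. \<kappa> (fm K' f))
      (pnt_comp A (psf_precomp K' F) (pnt_whisker A F K K' \<alpha>) \<sigma>) \<Theta>"
    and l: "\<And>f h. f \<in> arr A \<Longrightarrow> h \<in> D f \<Longrightarrow>
      \<Theta> f h \<cdot>\<^bsub>X\<^esub> \<kappa> (\<alpha> (src A f)) (fo (tcomp \<sigma> (src A f)) (src E h)) =
      \<kappa> (\<alpha> (tgt A f)) (fo (tcomp \<sigma> (tgt A f)) (tgt E h)) \<cdot>\<^bsub>X\<^esub> \<Phi> f h"
    using whiskered by blast
  interpret W: displayed_nat A E G D L X "psf_precomp K' F" "\<lambda>f. over (fm K' f)" "\<lambda>f. \<kappa> (fm K' f)"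
    "pnt_comp A (psf_precomp K' F) (pnt_whisker A F K K' \<alpha>) \<sigma>" \<Theta> by (fact \<Theta>)
  have wsrc: "fo (tcomp (pnt_comp A (psf_precomp K' F) (pnt_whisker A F K K' \<alpha>) \<sigma>) a) x = tgt X (\<kappa> (\<alpha> a) (fo (tcomp \<sigma> a)
    x))" for a x
    by (simp add: pnt_comp_def pnt_whisker_def F_simps)
  have mod: "modification A G (psf_precomp K' F) (pnt_comp A (psf_precomp K' F) (pnt_whisker A F K K' \<alpha>) \<sigma>) \<tau> m"
    and iso: "\<And>a x. a \<in> obj A \<Longrightarrow> x \<in> obj (pobj G a) \<Longrightarrow> is_iso (pobj F (fo K' a)) (m a x)"
    using m by (simp_all add: invertible_modification_def)
  note md = displayed_nat_pair.modificationD[OF displayed_nat_pair.intro[OF \<Theta> T.displayed_nat_axioms] mod]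
  have mm: "m a x \<in> over (ide B (fo K' a))" "m a x \<in> arr X" "src X (m a x) = tgt X (\<kappa> (\<alpha> a) (fo (tcomp \<sigma> a) x))"
      "tgt X (m a x) = fo (tcomp \<tau> a) x" if ax: "a \<in> obj A" "x \<in> obj (pobj G a)" for a x
    using md(1-3)[OF ax] ax overD(1) wsrc by auto
  show "c a x \<in> over (\<alpha> a)" and "src X (c a x) = fo (tcomp \<sigma> a) x" and "tgt X (c a x) = fo (tcomp \<tau> a) x"
    if ax: "a \<in> obj A" "x \<in> obj (pobj G a)" for a x
    using mm[OF ax] sigma_lift[OF ax] ax by (auto simp: c_def \<alpha> intro!: F.vert_over)
  show "is_iso X (c a x)" if ax: "a \<in> obj A" "x \<in> obj (pobj G a)" and i: "is_iso B (\<alpha> a)" for a x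
    unfolding c_def
    using F.iso_fibre_total(1)[OF _ iso[OF ax]] is_iso_lift[OF sigma_lift(1,2)[OF ax] i] mm[OF ax] ax by simp
  show "c (tgt A f) (tgt E h) \<cdot>\<^bsub>X\<^esub> \<Phi> f h = \<Psi> f h \<cdot>\<^bsub>X\<^esub> c (src A f) (src E h)" if fh: "f \<in> arr A" "h \<in> D f" for f h
  proof -
    have a: "src A f \<in> obj A" "tgt A f \<in> obj A" using fh by simp_all
    note x = S.G.over_src[OF fh] and y = S.G.over_tgt[OF fh]
    note mx = mm[OF a(1) x] and my = mm[OF a(2) y] and lx = sigma_lift[OF a(1) x] and ly = sigma_lift[OF a(2) y]
    note w = W.Phi_arr[OF fh] W.Phi_src[OF fh, unfolded wsrc] W.Phi_tgt[OF fh, unfolded wsrc]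
    note s = S.Phi_arr[OF fh] S.Phi_src[OF fh] S.Phi_tgt[OF fh]
    note t = T.Phi_arr[OF fh] T.Phi_src[OF fh] T.Phi_tgt[OF fh]
    have "c (tgt A f) (tgt E h) \<cdot>\<^bsub>X\<^esub> \<Phi> f h = m (tgt A f) (tgt E h) \<cdot>\<^bsub>X\<^esub> (\<Theta> f h \<cdot>\<^bsub>X\<^esub> \<kappa> (\<alpha> (src A f)) (fo (tcomp \<sigma> (src A
      f)) (src E h)))"
      unfolding l[OF fh] c_def using my ly s by simp
    also have "\<dots> = (\<Psi> f h \<cdot>\<^bsub>X\<^esub> m (src A f) (src E h)) \<cdot>\<^bsub>X\<^esub> \<kappa> (\<alpha> (src A f)) (fo (tcomp \<sigma> (src A f)) (src E h))"
      by (rule C.cmp_reassoc[OF md(4)[OF fh]]) (use my w lx in simp_all)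
    also have "\<dots> = \<Psi> f h \<cdot>\<^bsub>X\<^esub> c (src A f) (src E h)"
      unfolding c_def by (rule C.cmp_assoc) (use t mx lx in simp_all)
    finally show ?thesis .
  qed
qed

end

section \<open>Arrows of the Grothendieck construction\<close>

context cloven
begin

abbreviation "garr \<equiv> arr_to_garr X B P \<kappa>"

lemma cofactor_eqI:
  assumes "f \<in> arr B" "h \<in> over f" "t \<in> over (ide B (tgt B f))" "src X t = tgt X (\<kappa> f (src X h))"
    "t \<cdot>\<^bsub>X\<^esub> \<kappa> f (src X h) = h"
  shows "cofactor X P (ide B (tgt B f)) (\<kappa> f (src X h)) h = t"
  by (rule F.vert_unique[of f "src X h"])
    (use assms cofactor_over[OF assms(1,2)] overD[OF assms(2)] over_obj[OF assms(2)] in simp_all)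

lemma garr_eqI:
  assumes "h \<in> arr X" "t \<in> over (ide B (fo P (tgt X h)))" "src X t = tgt X (\<kappa> (fm P h) (src X h))"
    "t \<cdot>\<^bsub>X\<^esub> \<kappa> (fm P h) (src X h) = h"
  shows "garr h = (src X h, fm P h, t)"
  using cofactor_eqI[of "fm P h" h t] assms by (simp add: arr_to_garr_def over_def)

lemma garr_obtain:
  assumes "h \<in> arr X"
  obtains t where "garr h = (src X h, fm P h, t)" "t \<in> over (ide B (fo P (tgt X h)))" "t \<in> arr X" "fm P t = ide B (fo P
    (tgt X h))"
    "src X t = tgt X (\<kappa> (fm P h) (src X h))" "tgt X t = tgt X h" "t \<cdot>\<^bsub>X\<^esub> \<kappa> (fm P h) (src X h) = h"
    "\<kappa> (fm P h) (src X h) \<in> arr X" "src X (\<kappa> (fm P h) (src X h)) = src X h"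
proof -
  have o: "h \<in> over (fm P h)" using assms by (simp add: over_def)
  note c = cofactor_over[OF over_base[OF o] o, unfolded tgt_fm[OF assms]]
  show ?thesis
    by (rule that[OF _ c(1) overD[OF c(1)] c(2-4)])
      (use lift_simps[of "fm P h" "src X h"] assms in \<open>simp_all add: arr_to_garr_def\<close>)
qed

lemma garr_to_arr_garr: "h \<in> arr X \<Longrightarrow> garr_to_arr X \<kappa> (garr h) = h"
  by (erule garr_obtain) (simp add: garr_to_arr_def)

lemma gide_garr: "x \<in> obj X \<Longrightarrow> fo P x = a \<Longrightarrow> gide B F a x = garr (ide X x)"
  by (auto simp: gide_def arr_to_garr_def F_simps)

text \<open>Together with \<open>gide_garr\<close>, \<open>ginv_garr\<close> and
  \<open>gtens_garr\<close>, this turns each operation on triples into the corresponding operation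
  on arrows of \<open>X\<close>. A coherence condition on cells then becomes the image under
  \<open>garr\<close> of an equation in \<open>X\<close>.\<close>

lemma gcomp_garr:
  assumes "h \<in> arr X" "k \<in> arr X" "src X k = tgt X h"
  shows "gcomp B F (garr k) (garr h) = garr (k \<cdot>\<^bsub>X\<^esub> h)"
proof -
  obtain v where v: "garr h = (src X h, fm P h, v)" "v \<in> over (ide B (fo P (tgt X h)))" "v \<in> arr X" "fm P v = ide B (fo
    P (tgt X h))"
    "src X v = tgt X (\<kappa> (fm P h) (src X h))" "tgt X v = tgt X h" "v \<cdot>\<^bsub>X\<^esub> \<kappa> (fm P h) (src X h) = h"
    "\<kappa> (fm P h) (src X h) \<in> arr X" "src X (\<kappa> (fm P h) (src X h)) = src X h"
    by (rule garr_obtain[OF assms(1)])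
  obtain w where w: "garr k = (src X k, fm P k, w)" "w \<in> over (ide B (fo P (tgt X k)))" "w \<in> arr X" "fm P w = ide B (fo
    P (tgt X k))"
    "src X w = tgt X (\<kappa> (fm P k) (src X k))" "tgt X w = tgt X k" "w \<cdot>\<^bsub>X\<^esub> \<kappa> (fm P k) (src X k) = k"
    "\<kappa> (fm P k) (src X k) \<in> arr X" "src X (\<kappa> (fm P k) (src X k)) = src X k"
    by (rule garr_obtain[OF assms(2)])
  let ?f = "fm P h" and ?g = "fm P k" and ?x = "src X h"
  have f: "?f \<in> arr B" "?g \<in> arr B" "src B ?g = tgt B ?f" "?x \<in> obj (pobj F (src B ?f))" using assms by simp_all
  have vv: "v \<in> over (ide B (src B ?g))" using v(2) assms by simp
  note p = F.pcomp_over[OF f] F.pcomp_simps(1,2)[OF f] F.pcomp_src[OF f] F.pcomp_lift[OF f]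
  note m = F.pmor_over[OF f(2) vv] F.pmor_simps[OF f(2) vv] F.pmor_src[OF f(2) vv] F.pmor_lift[OF f(2) vv]
  let ?w = "w \<cdot>\<^bsub>X\<^esub> (fm (pmor F ?g) v \<cdot>\<^bsub>X\<^esub> pcomp F ?g ?f ?x)"
  let ?y = "tgt X (\<kappa> ?f ?x)"
  have l: "\<kappa> (?g \<cdot>\<^bsub>B\<^esub> ?f) ?x \<in> arr X" "\<kappa> ?g ?y \<in> arr X" "src X (\<kappa> ?g ?y) = ?y"
    using f F.lift_simps[of "?g \<cdot>\<^bsub>B\<^esub> ?f" ?x] F.lift_simps[OF f(1,4)] F.lift_simps[of ?g ?y] F.lift_src[of ?g ?y] by simp_all
  have fp: "fm (pmor F ?g) v \<cdot>\<^bsub>X\<^esub> pcomp F ?g ?f ?x \<in> over (ide B (tgt B ?g))"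
    using m p v f by (intro F.vert_cmp) simp_all
  have "garr (k \<cdot>\<^bsub>X\<^esub> h) = (src X (k \<cdot>\<^bsub>X\<^esub> h), fm P (k \<cdot>\<^bsub>X\<^esub> h), ?w)"
  proof (rule garr_eqI)
    show "k \<cdot>\<^bsub>X\<^esub> h \<in> arr X" using assms by simp
    show "?w \<in> over (ide B (fo P (tgt X (k \<cdot>\<^bsub>X\<^esub> h))))"
      using F.vert_cmp[OF _ fp, of w] assms w m p f v by simp
    show "src X ?w = tgt X (\<kappa> (fm P (k \<cdot>\<^bsub>X\<^esub> h)) (src X (k \<cdot>\<^bsub>X\<^esub> h)))"
      using w m p v assms by simp
    have "?w \<cdot>\<^bsub>X\<^esub> \<kappa> (?g \<cdot>\<^bsub>B\<^esub> ?f) ?x = w \<cdot>\<^bsub>X\<^esub> (fm (pmor F ?g) v \<cdot>\<^bsub>X\<^esub> (\<kappa> ?g ?y \<cdot>\<^bsub>X\<^esub> \<kappa> ?f ?x))"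
      using w m p v l assms by simp
    also have "\<dots> = w \<cdot>\<^bsub>X\<^esub> (\<kappa> ?g (src X k) \<cdot>\<^bsub>X\<^esub> (v \<cdot>\<^bsub>X\<^esub> \<kappa> ?f ?x))"
      using C.cmp_reassoc[OF m(5), of "\<kappa> ?f ?x"] m v l w assms by simp
    also have "\<dots> = k \<cdot>\<^bsub>X\<^esub> h" using C.cmp_reassoc[OF w(7), of h] v w assms by simp
    finally show "?w \<cdot>\<^bsub>X\<^esub> \<kappa> (fm P (k \<cdot>\<^bsub>X\<^esub> h)) (src X (k \<cdot>\<^bsub>X\<^esub> h)) = k \<cdot>\<^bsub>X\<^esub> h" using assms by simp
  qed
  then show ?thesis using f assms by (simp add: gcomp_def v(1) w(1))
qed

text \<open>By \<open>garr_eqI\<close> it suffices that the last component of \<open>ginv\<close>,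
  composed with the lift of the inverse base arrow, is \<open>k\<close>. The inverse of the base
  arrow is the image of \<open>k\<close>, as functors preserve inverses.\<close>

lemma ginv_garr:
  assumes "inverse_arrows X h k"
  shows "ginv B F (garr h) = garr k"
proof -
  have hk: "h \<in> arr X" "k \<in> arr X" "src X k = tgt X h" "tgt X k = src X h" "k \<cdot>\<^bsub>X\<^esub> h = ide X (src X h)" "h \<cdot>\<^bsub>X\<^esub> k = ide
    X (tgt X h)"
    using assms by (auto simp: inverse_arrows_def hom_def)
  obtain v where v: "garr h = (src X h, fm P h, v)" "v \<in> over (ide B (fo P (tgt X h)))" "v \<in> arr X" "fm P v = ide B (fo
    P (tgt X h))"
    "src X v = tgt X (\<kappa> (fm P h) (src X h))" "tgt X v = tgt X h" "v \<cdot>\<^bsub>X\<^esub> \<kappa> (fm P h) (src X h) = h"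
    "\<kappa> (fm P h) (src X h) \<in> arr X" "src X (\<kappa> (fm P h) (src X h)) = src X h"
    by (rule garr_obtain[OF hk(1)])
  let ?f = "fm P h" and ?g = "fm P k" and ?x = "src X h" and ?y = "tgt X h"
  have inv: "inv_arr B ?f = ?g" using D.inv_arr_eqI[OF fm_inverse[OF assms]] .
  have gf: "?g \<cdot>\<^bsub>B\<^esub> ?f = ide B (fo P ?x)" "?f \<cdot>\<^bsub>B\<^esub> ?g = ide B (fo P ?y)"
    using fm_inverse[OF assms] hk by (simp_all add: inverse_arrows_def)
  have f: "?f \<in> arr B" "?g \<in> arr B" "src B ?g = tgt B ?f" "?x \<in> obj (pobj F (src B ?f))" using hk by simp_all
  have ab: "fo P ?x \<in> obj B" "fo P ?y \<in> obj B" using hk by simp_all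
  text \<open>\<open>v\<close> is invertible since \<open>\<kappa> f x \<cdot> k\<close> is a vertical inverse.\<close>
  let ?z = "tgt X (\<kappa> ?f ?x)"
  define v' where "v' = \<kappa> ?f ?x \<cdot>\<^bsub>X\<^esub> k"
  have z: "?z \<in> obj X" "fo P ?z = fo P ?y" using v hk lift_simps(4)[of ?f ?x] by simp_all
  have v': "v' \<in> over (ide B (fo P ?y))" "v' \<in> arr X" "src X v' = ?y" "tgt X v' = ?z"
    using v hk gf lift_simps(3)[of ?f ?x] by (simp_all add: v'_def over_def)
  have vv': "v \<cdot>\<^bsub>X\<^esub> v' = ide X ?y" using C.cmp_reassoc[OF v(7), of k] v hk by (simp add: v'_def)
  have v'v: "v' \<cdot>\<^bsub>X\<^esub> v = ide X ?z"
  proof (rule F.vert_unique[OF f(1,4)])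
    show "v' \<cdot>\<^bsub>X\<^esub> v \<in> over (ide B (tgt B ?f))" using v v' hk ab by (simp add: F.vert_cmp)
    show "(v' \<cdot>\<^bsub>X\<^esub> v) \<cdot>\<^bsub>X\<^esub> \<kappa> ?f ?x = ide X ?z \<cdot>\<^bsub>X\<^esub> \<kappa> ?f ?x" using v v' hk by (simp add: v'_def)
  qed (use v v' hk z in \<open>simp_all add: over_def\<close>)
  have vi: "inv_arr (fibre X B P (fo P ?y)) v = v'"
  proof -
    interpret Y: categ "pobj F (fo P ?y)" using ab by unfold_locales (simp add: F.category_fibre)
    have "inv_arr (pobj F (fo P ?y)) v = v'"
      by (rule Y.inv_arr_eqI) (use v v' vv' v'v ab in \<open>simp add: inverse_arrows_def hom_def\<close>)
    then show ?thesis by (simp add: F_simps(1))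
  qed
  note p = F.pcomp_over[OF f] F.pcomp_simps[OF f] F.pcomp_src[OF f] F.pcomp_lift[OF f]
  have pi: "is_iso (pobj F (fo P ?x)) (pcomp F ?g ?f ?x)" using p(4) hk by simp
  define q where "q = inv_arr (pobj F (fo P ?x)) (pcomp F ?g ?f ?x)"
  note i = F.iso_fibre[OF ab(1) pi, folded q_def]
  have qa: "q \<in> arr X" using i overD by blast
  have w: "v' \<in> over (ide B (src B ?g))" using v' hk by simp
  note m = F.pmor_over[OF f(2) w] F.pmor_simps[OF f(2) w] F.pmor_src[OF f(2) w] F.pmor_lift[OF f(2) w]
  have x: "?x \<in> obj (pobj F (fo P ?x))" using hk by simp
  note u = F.punit_over[OF ab(1) x] F.punit_simps[OF ab(1) x] F.punit_src[OF ab(1) x] F.punit_lift[OF ab(1) x]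
  let ?u = "punit F (fo P ?x) ?x \<cdot>\<^bsub>X\<^esub> (q \<cdot>\<^bsub>X\<^esub> fm (pmor F ?g) v')"
  have l: "\<kappa> ?g ?y \<in> arr X" "src X (\<kappa> ?g ?y) = ?y" "\<kappa> ?g ?z \<in> arr X" "src X (\<kappa> ?g ?z) = ?z"
     "\<kappa> (ide B (fo P ?x)) ?x \<in> arr X"  "\<kappa> (?g \<cdot>\<^bsub>B\<^esub> ?f) ?x \<in> arr X"
    using lift_simps[of ?g ?y] lift_simps[of ?g ?z] lift_simps[of "ide B (fo P ?x)" ?x] z hk gf by simp_all
  have qm: "src X q = tgt X (fm (pmor F ?g) v')" "tgt X q = src X (punit F (fo P ?x) ?x)"
    using i m p u v' gf by simp_all
  let ?K = "\<kappa> (?g \<cdot>\<^bsub>B\<^esub> ?f) ?x"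
  have K: "?K \<in> arr X" "src X ?K = ?x" "?K = \<kappa> (ide B (fo P ?x)) ?x"
    using lift_simps[of "ide B (fo P ?x)" ?x] hk(1) gf(1) by simp_all
  have Kk: "?K \<cdot>\<^bsub>X\<^esub> k \<in> arr X" "tgt X (?K \<cdot>\<^bsub>X\<^esub> k) = tgt X ?K" using K(1,2) hk(2,4) by simp_all
  \<comment> \<open>The composite telescopes. The pushforward of \<open>v'\<close> slides past the
    lift; the two successive lifts equal \<open>pcomp\<close> after the lift of the composite, and
    \<open>q\<close> cancels this \<open>pcomp\<close>; the composite is an identity, so
    \<open>punit\<close> removes its lift and \<open>k\<close> remains.\<close>
  have "?u \<cdot>\<^bsub>X\<^esub> \<kappa> ?g ?y = punit F (fo P ?x) ?x \<cdot>\<^bsub>X\<^esub> (q \<cdot>\<^bsub>X\<^esub> (\<kappa> ?g ?z \<cdot>\<^bsub>X\<^esub> v'))"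
    using u qa qm m l v' by simp
  also have "\<kappa> ?g ?z \<cdot>\<^bsub>X\<^esub> v' = (\<kappa> ?g ?z \<cdot>\<^bsub>X\<^esub> \<kappa> ?f ?x) \<cdot>\<^bsub>X\<^esub> k"
    unfolding v'_def by (rule C.cmp_assoc[symmetric]) (use l v hk in simp_all)
  also have "\<dots> = pcomp F ?g ?f ?x \<cdot>\<^bsub>X\<^esub> (?K \<cdot>\<^bsub>X\<^esub> k)"
    by (rule C.cmp_reassoc[OF p(6), symmetric]) (use p(2,5) K(1,2) hk(2,4) in simp_all)
  also have "q \<cdot>\<^bsub>X\<^esub> \<dots> = ide X (src X (pcomp F ?g ?f ?x)) \<cdot>\<^bsub>X\<^esub> (?K \<cdot>\<^bsub>X\<^esub> k)"
    by (rule C.cmp_reassoc[OF i(5)]) (use p(2,5) Kk i(3) qa in simp_all)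
  also have "\<dots> = ?K \<cdot>\<^bsub>X\<^esub> k" using Kk p(5) by simp
  also have "punit F (fo P ?x) ?x \<cdot>\<^bsub>X\<^esub> (?K \<cdot>\<^bsub>X\<^esub> k) = ide X ?x \<cdot>\<^bsub>X\<^esub> k"
    unfolding K(3) by (rule C.cmp_reassoc[OF u(6)]) (use u K hk(2,4) in simp_all)
  also have "\<dots> = k" using hk by simp
  finally have uk: "?u \<cdot>\<^bsub>X\<^esub> \<kappa> ?g ?y = k" .
  have uo: "?u \<in> over (ide B (fo P ?x))"
    using u i m qm qa ab hk by (intro F.vert_cmp) simp_all
  have "garr k = (src X k, ?g, ?u)"
    by (rule garr_eqI) (use hk uk uo qm m u qa v' in simp_all)
  then show ?thesis using hk ab by (simp add: ginv_def v(1) inv Let_def F_simps(1) fibre_simps v vi q_def)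
qed

end

text \<open>In a pasting, the same intermediate pseudofunctor appears as a product of precomposites
  and as a precomposite of a product. These are equal on the nose, which lets
  \<open>displayed_nat_comp\<close> join the pieces.\<close>

lemma psf_precomp_prod:
  "psf_precomp (func_prod K K') (psf_prod F G) = psf_prod (psf_precomp K F) (psf_precomp K' G)"
  by (rule psf.equality) (simp_all add: fun_eq_iff)

lemma psf_precomp_comp: "psf_precomp (func_comp K' K) F = psf_precomp K (psf_precomp K' F)"
  by (rule psf.equality) (simp_all add: fun_eq_iff)

lemma psf_precomp_id: "psf_precomp func_id F = F"
  by (rule psf.equality) (simp_all add: fun_eq_iff)

lemmas psf_precomp_normalize = psf_precomp_prod psf_precomp_comp psf_precomp_id

section \<open>The pastings in a lax symmetric monoidal structure, as operations on arrows\<close>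

context cloven_prod
begin

text \<open>Inserting the vertical parts of \<open>h\<close> and \<open>k\<close> into
  \<open>Phi_eq\<close> for \<open>R\<close> produces the formula of \<open>gtens\<close>.\<close>

lemma gtens_garr:
  assumes R: "nat_R R \<Psi>" and h: "h \<in> arr X" and k: "k \<in> arr X"
  shows "gtens B S F R (garr h) (garr k) = garr (\<Psi> (fm P h, fm P k) (h, k))"
proof -
  interpret R: displayed_nat "cat_prod B B" "cat_prod X X" "psf_prod F F" over2 \<kappa>2
    X "psf_precomp (prod_func B S) F" over_pr \<kappa>_pr R \<Psi> by (fact R)
  obtain v where v: "garr h = (src X h, fm P h, v)" "v \<in> over (ide B (fo P (tgt X h)))" "v \<in> arr X"
    "src X v = tgt X (\<kappa> (fm P h) (src X h))" "tgt X v = tgt X h" "v \<cdot>\<^bsub>X\<^esub> \<kappa> (fm P h) (src X h) = h"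
    by (rule garr_obtain[OF h])
  obtain w where w: "garr k = (src X k, fm P k, w)" "w \<in> over (ide B (fo P (tgt X k)))" "w \<in> arr X"
    "src X w = tgt X (\<kappa> (fm P k) (src X k))" "tgt X w = tgt X k" "w \<cdot>\<^bsub>X\<^esub> \<kappa> (fm P k) (src X k) = k"
    by (rule garr_obtain[OF k])
  let ?f = "(fm P h, fm P k)" and ?x = "(src X h, src X k)"
  let ?b = "(fo P (tgt X h), fo P (tgt X k))"
  have f: "?f \<in> arr (cat_prod B B)" "?x \<in> obj (pobj (psf_prod F F) (src (cat_prod B B) ?f))" using h k by simp_all
  have b: "tgt (cat_prod B B) ?f = ?b" "?b \<in> obj (cat_prod B B)" "pr S (fo P (tgt X h)) (fo P (tgt X k)) \<in> obj B" using
    h k by simp_all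
  have u: "(v, w) \<in> over2 (ide (cat_prod B B) (tgt (cat_prod B B) ?f))" "src (cat_prod X X) (v, w) = tgt (cat_prod X X)
    (\<kappa>2 ?f ?x)"
    using v w h k by simp_all
  let ?s = "inv_arr (pobj F (pr S (fo P (tgt X h)) (fo P (tgt X k)))) (tiso R ?f ?x)"
  let ?t = "fm (tcomp R ?b) (v, w) \<cdot>\<^bsub>X\<^esub> ?s"
  have e: "\<Psi> ?f (h, k) = ?t \<cdot>\<^bsub>X\<^esub> \<kappa> (par B S (fm P h) (fm P k)) (fo (tcomp R (fo P (src X h), fo P (src X k))) ?x)"
    using R.Phi_eq[OF f u] v w h k by simp
  have hk: "(h, k) \<in> over2 ?f" using h k by (simp add: over_def)
  note \<psi> = R.Phi_over[OF f(1) hk] R.Phi_arr[OF f(1) hk] R.Phi_src[OF f(1) hk] R.Phi_tgt[OF f(1) hk]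
  have ti: "is_iso (pobj F (pr S (fo P (tgt X h)) (fo P (tgt X k)))) (tiso R ?f ?x)"
    using R.tiso_iso[OF f] h k by simp
  note i = F.iso_fibre[OF b(3) ti]
  note vv = R.Phi_vert_simps[OF b(2), of "(v, w)"] R.Phi_vert[OF b(2), of "(v, w)"]
  have s: "src X ?s = tgt X (\<kappa> (par B S (fm P h) (fm P k)) (fo (tcomp R (fo P (src X h), fo P (src X k))) ?x))"
    "tgt X ?s = fo (tcomp R ?b) (src X v, src X w)"
    using i R.tiso_simps[OF f] R.tiso_src[OF f] v w h k by simp_all
  have fa: "fm (tcomp R ?b) (v, w) \<in> over (ide B (pr S (fo P (tgt X h)) (fo P (tgt X k))))" "fm (tcomp R ?b) (v, w) \<in> arr X"
    "src X (fm (tcomp R ?b) (v, w)) = fo (tcomp R ?b) (src X v, src X w)"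
    using vv v w h k by (simp_all add: S.par_ide)
  have "?s \<in> arr X" using i(2) overD by blast
  then have st: "?t \<in> over (ide B (pr S (fo P (tgt X h)) (fo P (tgt X k))))" "src X ?t = src X ?s"
    using fa i(2) s b by (auto intro!: F.vert_cmp)
  have "garr (\<Psi> ?f (h, k)) = (src X (\<Psi> ?f (h, k)), fm P (\<Psi> ?f (h, k)), ?t)"
    by (rule garr_eqI) (use \<psi> overD(2)[OF \<psi>(1)] over_obj[OF \<psi>(1)] st s e h k in simp_all)
  then show ?thesis using overD(2)[OF \<psi>(1)] \<psi>(3) h k b(3) by (simp add: gtens_def v(1) w(1))
qed

text \<open>Identifies the action on arrows prescribed in condition (iii) with
  \<open>\<Psi>\<close>, so that the condition says that \<open>\<Psi>\<close> is the product
  functor.\<close>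

lemma total_tensor_arr:
  assumes "nat_R R \<Psi>" "h \<in> arr X" "k \<in> arr X"
  shows "fm (total_tensor X B S P \<kappa> R) (h, k) = \<Psi> (fm P h, fm P k) (h, k)"
proof -
  have "\<Psi> (fm P h, fm P k) (h, k) \<in> arr X"
    using displayed_nat.Phi_arr[OF assms(1), of "(fm P h, fm P k)" "(h, k)"] assms by (simp add: over_def)
  then show ?thesis by (simp add: total_tensor_def gtens_garr[OF assms] garr_to_arr_garr)
qed

lemma functr_id: "functr B B func_id"
  by (rule functr_structural(1)[OF D.category D.category])

text \<open>The pasting acts on arrows by bracketing three factors to the left. The bracketing
  appears directly because each constituent transformation enters with its own action; the 2-cells
  of the pasting are not unfolded. The analogous lemmas below treat the other pastings.\<close>

lemma pnt_assoc_source: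
  assumes R: "nat_R R \<Psi>"
  defines "K \<equiv> func_prod (prod_func B S) func_id"
  shows "displayed_nat (cat_prod (cat_prod B B) B) (cat_prod (cat_prod X X) X) (psf_prod (psf_prod F F) F)
    (\<lambda>f. over2 (fst f) \<times> over (snd f)) (\<lambda>f x. (\<kappa>2 (fst f) (fst x), \<kappa> (snd f) (snd x)))
    X (psf_precomp (func_comp (prod_func B S) K) F) (\<lambda>f. over (fm (func_comp (prod_func B S) K) f)) (\<lambda>f. \<kappa> (fm
      (func_comp (prod_func B S) K) f))
    (pnt_comp (cat_prod (cat_prod B B) B) (psf_precomp (func_comp (prod_func B S) K) F) (pnt_precomp K R) (pnt_prod R
      (pnt_id B F)))
    (\<lambda>f h. \<Psi> (fm K f) (\<Psi> (fst f) (fst h), snd h))"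
proof -
  have 1: "displayed_nat (cat_prod (cat_prod B B) B) (cat_prod (cat_prod X X) X) (psf_prod (psf_prod F F) F)
    (\<lambda>f. over2 (fst f) \<times> over (snd f)) (\<lambda>f x. (\<kappa>2 (fst f) (fst x), \<kappa> (snd f) (snd x)))
    (cat_prod X X) (psf_precomp K (psf_prod F F)) (\<lambda>f. over2 (fm K f)) (\<lambda>f. \<kappa>2 (fm K f))
    (pnt_prod R (pnt_id B F)) (\<lambda>f h. (\<Psi> (fst f) (fst h), snd h))"
    using displayed_nat_prod[OF R displayed_nat_id[OF displayed]] by (simp add: K_def psf_precomp_normalize)
  have "functr (cat_prod (cat_prod B B) B) (cat_prod B B) K"
    unfolding K_def by (rule functr_prod[OF functr_prod_func functr_id])
  from displayed_nat_precomp[OF this R]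
  have "displayed_nat (cat_prod (cat_prod B B) B) (cat_prod X X) (psf_precomp K (psf_prod F F)) (\<lambda>f. over2 (fm K f))
    (\<lambda>f. \<kappa>2 (fm K f))
     X (psf_precomp (func_comp (prod_func B S) K) F) (\<lambda>f. over (fm (func_comp (prod_func B S) K) f)) (\<lambda>f. \<kappa> (fm
       (func_comp (prod_func B S) K) f))
     (pnt_precomp K R) (\<lambda>f. \<Psi> (fm K f))" by (simp add: psf_precomp_normalize)
  from displayed_nat_comp[OF 1 this] show ?thesis .
qed

lemma pnt_assoc_target:
  assumes R: "nat_R R \<Psi>"
  defines "K \<equiv> func_comp (func_prod func_id (prod_func B S)) func_assoc"
  shows "displayed_nat (cat_prod (cat_prod B B) B) (cat_prod (cat_prod X X) X) (psf_prod (psf_prod F F) F)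
    (\<lambda>f. over2 (fst f) \<times> over (snd f)) (\<lambda>f x. (\<kappa>2 (fst f) (fst x), \<kappa> (snd f) (snd x)))
    X (psf_precomp (func_comp (prod_func B S) K) F) (\<lambda>f. over (fm (func_comp (prod_func B S) K) f)) (\<lambda>f. \<kappa> (fm
      (func_comp (prod_func B S) K) f))
    (pnt_comp (cat_prod (cat_prod B B) B) (psf_precomp (func_comp (prod_func B S) K) F) (pnt_precomp K R)
      (pnt_comp (cat_prod (cat_prod B B) B) (psf_precomp K (psf_prod F F))
        (pnt_precomp func_assoc (pnt_prod (pnt_id B F) R))
        (pnt_strict (cat_prod (cat_prod B B) B) (psf_precomp func_assoc (psf_prod F (psf_prod F F))) func_assoc)))
    (\<lambda>f h. \<Psi> (fm K f) (fst (fst h), \<Psi> (snd (fst f), snd f) (snd (fst h), snd h)))"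
proof -
  let ?A = "cat_prod (cat_prod B B) B"
  note aB = functr_assoc[OF D.category D.category D.category] and aX = functr_assoc[OF C.category C.category C.category]
  have FFF: "displayed ?A (cat_prod (cat_prod X X) X) (psf_prod (psf_prod F F) F)
     (\<lambda>f. over2 (fst f) \<times> over (snd f)) (\<lambda>f x. (\<kappa>2 (fst f) (fst x), \<kappa> (snd f) (snd x)))"
    by (rule displayed_prod[OF displayed_FF displayed])
  have 1: "displayed_nat ?A (cat_prod (cat_prod X X) X) (psf_prod (psf_prod F F) F)
    (\<lambda>f. over2 (fst f) \<times> over (snd f)) (\<lambda>f x. (\<kappa>2 (fst f) (fst x), \<kappa> (snd f) (snd x)))
    (cat_prod X (cat_prod X X)) (psf_precomp func_assoc (psf_prod F (psf_prod F F)))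
    (\<lambda>f. over (fst (fst f)) \<times> over (snd (fst f)) \<times> over (snd f)) (\<lambda>f x. (\<kappa> (fst (fst f)) (fst x), \<kappa> (snd (fst f)) (fst
      (snd x)), \<kappa> (snd f) (snd (snd x))))
    (pnt_strict ?A (psf_precomp func_assoc (psf_prod F (psf_prod F F))) func_assoc) (\<lambda>_ h. (fst (fst h), (snd (fst h),
      snd h)))"
    using displayed_precomp[OF aB displayed_prod[OF displayed displayed_FF]]
    by (intro displayed_nat_strict[OF FFF _ aX]) auto
  have 2: "displayed_nat ?A (cat_prod X (cat_prod X X)) (psf_precomp func_assoc (psf_prod F (psf_prod F F)))
    (\<lambda>f. over (fst (fst f)) \<times> over (snd (fst f)) \<times> over (snd f)) (\<lambda>f x. (\<kappa> (fst (fst f)) (fst x), \<kappa> (snd (fst f)) (fst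
      (snd x)), \<kappa> (snd f) (snd (snd x))))
    (cat_prod X X) (psf_precomp K (psf_prod F F)) (\<lambda>f. over2 (fm K f)) (\<lambda>f. \<kappa>2 (fm K f))
    (pnt_precomp func_assoc (pnt_prod (pnt_id B F) R)) (\<lambda>f h. (fst h, \<Psi> (snd (fst f), snd f) (snd h)))"
    using displayed_nat_precomp[OF aB displayed_nat_prod[OF displayed_nat_id[OF displayed] R]]
    by (simp add: K_def psf_precomp_normalize)
  have "functr ?A (cat_prod B B) K"
    unfolding K_def by (rule functr_comp[OF aB functr_prod[OF functr_id functr_prod_func]])
  from displayed_nat_precomp[OF this R]
  have 3: "displayed_nat ?A (cat_prod X X) (psf_precomp K (psf_prod F F)) (\<lambda>f. over2 (fm K f)) (\<lambda>f. \<kappa>2 (fm K f))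
     X (psf_precomp (func_comp (prod_func B S) K) F) (\<lambda>f. over (fm (func_comp (prod_func B S) K) f)) (\<lambda>f. \<kappa> (fm
       (func_comp (prod_func B S) K) f))
     (pnt_precomp K R) (\<lambda>f. \<Psi> (fm K f))" by (simp add: psf_precomp_normalize)
  from displayed_nat_comp[OF displayed_nat_comp[OF 1 2] 3] show ?thesis by simp
qed

abbreviation "runit_K \<equiv> func_prod func_id (func_point B (one S))"
abbreviation "lunit_K \<equiv> func_prod (func_point B (one S)) func_id"

lemma displayed_F1: "displayed (cat_prod B cat_unit) (cat_prod X cat_unit) (psf_prod F psf_unit)
    (\<lambda>f. over (fst f) \<times> UNIV) (\<lambda>f x. (\<kappa> (fst f) (fst x), ()))"
  by (rule displayed_prod[OF displayed displayed_unit])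

lemma displayed_1F: "displayed (cat_prod cat_unit B) (cat_prod cat_unit X) (psf_prod psf_unit F)
    (\<lambda>f. UNIV \<times> over (snd f)) (\<lambda>f x. ((), \<kappa> (snd f) (snd x)))"
  by (rule displayed_prod[OF displayed_unit displayed])

lemma pnt_runit_source:
  assumes R: "nat_R R \<Psi>" and R1: "nat_R1 R1 \<Psi>1"
  shows "displayed_nat (cat_prod B cat_unit) (cat_prod X cat_unit) (psf_prod F psf_unit)
    (\<lambda>f. over (fst f) \<times> UNIV) (\<lambda>f x. (\<kappa> (fst f) (fst x), ()))
    X (psf_precomp (func_comp (prod_func B S) runit_K) F) (\<lambda>f. over (fm (func_comp (prod_func B S) runit_K) f)) (\<lambda>f. \<kappa>
      (fm (func_comp (prod_func B S) runit_K) f))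
    (pnt_comp (cat_prod B cat_unit) (psf_precomp (func_comp (prod_func B S) runit_K) F) (pnt_precomp runit_K R)
      (pnt_prod (pnt_id B F) R1))
    (\<lambda>f h. \<Psi> (fst f, ide B (one S)) (fst h, \<Psi>1 (snd f) (snd h)))"
proof -
  have 1: "displayed_nat (cat_prod B cat_unit) (cat_prod X cat_unit) (psf_prod F psf_unit)
    (\<lambda>f. over (fst f) \<times> UNIV) (\<lambda>f x. (\<kappa> (fst f) (fst x), ()))
    (cat_prod X X) (psf_precomp runit_K (psf_prod F F)) (\<lambda>f. over (fst f) \<times> over (ide B (one S))) (\<lambda>f x. (\<kappa> (fst f) (fst
      x), \<kappa> (ide B (one S)) (snd x)))
    (pnt_prod (pnt_id B F) R1) (\<lambda>f h. (fst h, \<Psi>1 (snd f) (snd h)))"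
    using displayed_nat_prod[OF displayed_nat_id[OF displayed] R1] by (simp add: psf_precomp_normalize)
  from displayed_nat_precomp[OF functr_prod[OF functr_id functr_one] R]
  have "displayed_nat (cat_prod B cat_unit) (cat_prod X X) (psf_precomp runit_K (psf_prod F F)) (\<lambda>f. over (fst f) \<times> over
    (ide B (one S))) (\<lambda>f x. (\<kappa> (fst f) (fst x), \<kappa> (ide B (one S)) (snd x)))
     X (psf_precomp (func_comp (prod_func B S) runit_K) F) (\<lambda>f. over (fm (func_comp (prod_func B S) runit_K) f)) (\<lambda>f. \<kappa>
       (fm (func_comp (prod_func B S) runit_K) f))
     (pnt_precomp runit_K R) (\<lambda>f. \<Psi> (fst f, ide B (one S)))" by (simp add: psf_precomp_normalize)
  from displayed_nat_comp[OF 1 this] show ?thesis .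
qed

lemma pnt_lunit_source:
  assumes R: "nat_R R \<Psi>" and R1: "nat_R1 R1 \<Psi>1"
  shows "displayed_nat (cat_prod cat_unit B) (cat_prod cat_unit X) (psf_prod psf_unit F)
    (\<lambda>f. UNIV \<times> over (snd f)) (\<lambda>f x. ((), \<kappa> (snd f) (snd x)))
    X (psf_precomp (func_comp (prod_func B S) lunit_K) F) (\<lambda>f. over (fm (func_comp (prod_func B S) lunit_K) f)) (\<lambda>f. \<kappa>
      (fm (func_comp (prod_func B S) lunit_K) f))
    (pnt_comp (cat_prod cat_unit B) (psf_precomp (func_comp (prod_func B S) lunit_K) F) (pnt_precomp lunit_K R)
      (pnt_prod R1 (pnt_id B F)))
    (\<lambda>f h. \<Psi> (ide B (one S), snd f) (\<Psi>1 (fst f) (fst h), snd h))"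
proof -
  have 1: "displayed_nat (cat_prod cat_unit B) (cat_prod cat_unit X) (psf_prod psf_unit F)
    (\<lambda>f. UNIV \<times> over (snd f)) (\<lambda>f x. ((), \<kappa> (snd f) (snd x)))
    (cat_prod X X) (psf_precomp lunit_K (psf_prod F F)) (\<lambda>f. over (ide B (one S)) \<times> over (snd f)) (\<lambda>f x. (\<kappa> (ide B (one
      S)) (fst x), \<kappa> (snd f) (snd x)))
    (pnt_prod R1 (pnt_id B F)) (\<lambda>f h. (\<Psi>1 (fst f) (fst h), snd h))"
    using displayed_nat_prod[OF R1 displayed_nat_id[OF displayed]] by (simp add: psf_precomp_normalize)
  from displayed_nat_precomp[OF functr_prod[OF functr_one functr_id] R]
  have "displayed_nat (cat_prod cat_unit B) (cat_prod X X) (psf_precomp lunit_K (psf_prod F F)) (\<lambda>f. over (ide B (one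
    S)) \<times> over (snd f)) (\<lambda>f x. (\<kappa> (ide B (one S)) (fst x), \<kappa> (snd f) (snd x)))
     X (psf_precomp (func_comp (prod_func B S) lunit_K) F) (\<lambda>f. over (fm (func_comp (prod_func B S) lunit_K) f)) (\<lambda>f. \<kappa>
       (fm (func_comp (prod_func B S) lunit_K) f))
     (pnt_precomp lunit_K R) (\<lambda>f. \<Psi> (ide B (one S), snd f))" by (simp add: psf_precomp_normalize)
  from displayed_nat_comp[OF 1 this] show ?thesis .
qed

lemma pnt_runit_target: "displayed_nat (cat_prod B cat_unit) (cat_prod X cat_unit) (psf_prod F psf_unit)
    (\<lambda>f. over (fst f) \<times> UNIV) (\<lambda>f x. (\<kappa> (fst f) (fst x), ()))
    X (psf_precomp func_fst F) (\<lambda>f. over (fst f)) (\<lambda>f. \<kappa> (fst f))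
    (pnt_strict (cat_prod B cat_unit) (psf_precomp func_fst F) func_fst) (\<lambda>_. fst)"
  using displayed_precomp[OF functr_structural(2)[OF D.category category_cat_unit] displayed]
  by (intro displayed_nat_strict[OF displayed_F1 _ functr_structural(2)[OF C.category category_cat_unit]]) auto

lemma pnt_lunit_target: "displayed_nat (cat_prod cat_unit B) (cat_prod cat_unit X) (psf_prod psf_unit F)
    (\<lambda>f. UNIV \<times> over (snd f)) (\<lambda>f x. ((), \<kappa> (snd f) (snd x)))
    X (psf_precomp func_snd F) (\<lambda>f. over (snd f)) (\<lambda>f. \<kappa> (snd f))
    (pnt_strict (cat_prod cat_unit B) (psf_precomp func_snd F) func_snd) (\<lambda>_. snd)"
  using displayed_precomp[OF functr_structural(3)[OF category_cat_unit D.category] displayed]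
  by (intro displayed_nat_strict[OF displayed_1F _ functr_structural(3)[OF category_cat_unit C.category]]) auto

lemma pnt_swap_target:
  assumes R: "nat_R R \<Psi>"
  shows "displayed_nat (cat_prod B B) (cat_prod X X) (psf_prod F F) over2 \<kappa>2
    X (psf_precomp (func_comp (prod_func B S) func_swap) F)
    (\<lambda>f. over (fm (func_comp (prod_func B S) func_swap) f)) (\<lambda>f. \<kappa> (fm (func_comp (prod_func B S) func_swap) f))
    (pnt_comp (cat_prod B B) (psf_precomp (func_comp (prod_func B S) func_swap) F) (pnt_precomp func_swap R)
      (pnt_strict (cat_prod B B) (psf_precomp func_swap (psf_prod F F)) func_swap))
    (\<lambda>f h. \<Psi> (snd f, fst f) (snd h, fst h))"
proof -
  note sB = functr_structural(4)[OF D.category D.category] and sX = functr_structural(4)[OF C.category C.category]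
  have 1: "displayed_nat (cat_prod B B) (cat_prod X X) (psf_prod F F) over2 \<kappa>2
    (cat_prod X X) (psf_precomp func_swap (psf_prod F F)) (\<lambda>f. over (snd f) \<times> over (fst f)) (\<lambda>f x. (\<kappa> (snd f) (fst x), \<kappa>
      (fst f) (snd x)))
    (pnt_strict (cat_prod B B) (psf_precomp func_swap (psf_prod F F)) func_swap) (\<lambda>_ h. (snd h, fst h))"
    using displayed_precomp[OF sB displayed_FF] by (intro displayed_nat_strict[OF displayed_FF _ sX]) auto
  from displayed_nat_precomp[OF sB R]
  have "displayed_nat (cat_prod B B) (cat_prod X X) (psf_precomp func_swap (psf_prod F F)) (\<lambda>f. over (snd f) \<times> over (fst
    f)) (\<lambda>f x. (\<kappa> (snd f) (fst x), \<kappa> (fst f) (snd x)))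
    X (psf_precomp (func_comp (prod_func B S) func_swap) F)
    (\<lambda>f. over (fm (func_comp (prod_func B S) func_swap) f)) (\<lambda>f. \<kappa> (fm (func_comp (prod_func B S) func_swap) f))
    (pnt_precomp func_swap R) (\<lambda>f. \<Psi> (snd f, fst f))" by (simp add: psf_precomp_normalize)
  from displayed_nat_comp[OF 1 this] show ?thesis by simp
qed

text \<open>In this form the source of \<zeta> is the projection from \<open>a \<times> 1\<close>
  whiskered after tensoring with the unit, so \<open>whisker_modI\<close> and
  \<open>whisker_modD\<close> exchange \<zeta> for a natural family of arrows of \<open>X\<close>
  lying over these projections. The next three lemmas do the same for \<xi>, \<omega> and
  \<theta>.\<close>

lemma whiskering_runit:
  assumes R: "nat_R R \<Psi>" and R1: "nat_R1 R1 \<Psi>1"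
  shows "whiskering X B P \<kappa> (cat_prod B cat_unit) (func_comp (prod_func B S) runit_K) func_fst
    (cat_prod X cat_unit) (psf_prod F psf_unit) (\<lambda>f. over (fst f) \<times> UNIV) (\<lambda>f x. (\<kappa> (fst f) (fst x), ()))
    (pnt_comp (cat_prod B cat_unit) (psf_precomp (func_comp (prod_func B S) runit_K) F) (pnt_precomp runit_K R)
      (pnt_prod (pnt_id B F) R1))
    (\<lambda>f h. \<Psi> (fst f, ide B (one S)) (fst h, \<Psi>1 (snd f) (snd h)))
    (pnt_strict (cat_prod B cat_unit) (psf_precomp func_fst F) func_fst) (\<lambda>_. fst)
    (\<lambda>(a, _). pi1 S a (one S))"
  by (intro whiskering.intro whiskering_axioms.intro cloven_axioms pnt_runit_source[OF R R1]
      functr_comp[OF functr_prod[OF functr_id functr_one] functr_prod_func] functr_structural(2)[OF D.category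
        category_cat_unit])
    (use pnt_runit_target in \<open>auto simp: S.pi_par\<close>)

lemma whiskering_lunit:
  assumes R: "nat_R R \<Psi>" and R1: "nat_R1 R1 \<Psi>1"
  shows "whiskering X B P \<kappa> (cat_prod cat_unit B) (func_comp (prod_func B S) lunit_K) func_snd
    (cat_prod cat_unit X) (psf_prod psf_unit F) (\<lambda>f. UNIV \<times> over (snd f)) (\<lambda>f x. ((), \<kappa> (snd f) (snd x)))
    (pnt_comp (cat_prod cat_unit B) (psf_precomp (func_comp (prod_func B S) lunit_K) F) (pnt_precomp lunit_K R)
      (pnt_prod R1 (pnt_id B F)))
    (\<lambda>f h. \<Psi> (ide B (one S), snd f) (\<Psi>1 (fst f) (fst h), snd h))
    (pnt_strict (cat_prod cat_unit B) (psf_precomp func_snd F) func_snd) (\<lambda>_. snd)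
    (\<lambda>(_, a). pi2 S (one S) a)"
  by (intro whiskering.intro whiskering_axioms.intro cloven_axioms pnt_lunit_source[OF R R1]
      functr_comp[OF functr_prod[OF functr_one functr_id] functr_prod_func] functr_structural(3)[OF category_cat_unit
        D.category])
    (use pnt_lunit_target in \<open>auto simp: S.pi_par\<close>)

lemma whiskering_assoc:
  assumes R: "nat_R R \<Psi>"
  shows "whiskering X B P \<kappa> (cat_prod (cat_prod B B) B) (func_comp (prod_func B S) (func_prod (prod_func B S) func_id))
    (func_comp (prod_func B S) (func_comp (func_prod func_id (prod_func B S)) func_assoc))
    (cat_prod (cat_prod X X) X) (psf_prod (psf_prod F F) F)
    (\<lambda>f. over2 (fst f) \<times> over (snd f)) (\<lambda>f x. (\<kappa>2 (fst f) (fst x), \<kappa> (snd f) (snd x)))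
    (pnt_comp (cat_prod (cat_prod B B) B) (psf_precomp (func_comp (prod_func B S) (func_prod (prod_func B S) func_id)) F)
      (pnt_precomp (func_prod (prod_func B S) func_id) R) (pnt_prod R (pnt_id B F)))
    (\<lambda>f h. \<Psi> (par B S (fst (fst f)) (snd (fst f)), snd f) (\<Psi> (fst f) (fst h), snd h))
    (pnt_comp (cat_prod (cat_prod B B) B) (psf_precomp (func_comp (prod_func B S) (func_comp (func_prod func_id
      (prod_func B S)) func_assoc)) F)
      (pnt_precomp (func_comp (func_prod func_id (prod_func B S)) func_assoc) R)
      (pnt_comp (cat_prod (cat_prod B B) B) (psf_precomp (func_comp (func_prod func_id (prod_func B S)) func_assoc)
        (psf_prod F F))
        (pnt_precomp func_assoc (pnt_prod (pnt_id B F) R))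
        (pnt_strict (cat_prod (cat_prod B B) B) (psf_precomp func_assoc (psf_prod F (psf_prod F F))) func_assoc)))
    (\<lambda>f h. \<Psi> (fst (fst f), par B S (snd (fst f)) (snd f)) (fst (fst h), \<Psi> (snd (fst f), snd f) (snd (fst h), snd h)))
    (\<lambda>((a, b), c). prod_assoc B S a b c)"
proof -
  note aB = functr_assoc[OF D.category D.category D.category]
  show ?thesis
    by (intro whiskering.intro whiskering_axioms.intro cloven_axioms
        functr_comp[OF functr_prod[OF functr_prod_func functr_id] functr_prod_func]
        functr_comp[OF functr_comp[OF aB functr_prod[OF functr_id functr_prod_func]] functr_prod_func])
      (use pnt_assoc_source[OF R] pnt_assoc_target[OF R] in \<open>auto simp: S.prod_assoc_natural\<close>)
qed

lemma whiskering_swap: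
  assumes R: "nat_R R \<Psi>"
  shows "whiskering X B P \<kappa> (cat_prod B B) (prod_func B S) (func_comp (prod_func B S) func_swap)
    (cat_prod X X) (psf_prod F F) over2 \<kappa>2 R \<Psi>
    (pnt_comp (cat_prod B B) (psf_precomp (func_comp (prod_func B S) func_swap) F) (pnt_precomp func_swap R)
      (pnt_strict (cat_prod B B) (psf_precomp func_swap (psf_prod F F)) func_swap))
    (\<lambda>f h. \<Psi> (snd f, fst f) (snd h, fst h))
    (\<lambda>(a, b). prod_swap B S a b)"
  by (intro whiskering.intro whiskering_axioms.intro cloven_axioms pnt_swap_target[OF R] functr_prod_func
        functr_comp[OF functr_structural(4)[OF D.category D.category] functr_prod_func])
    (use R in \<open>auto simp: S.prod_swap_natural\<close>)

end

lemma tcomp_pnt_comp [simp]: "tcomp (pnt_comp A H \<sigma> \<tau>) a = func_comp (tcomp \<sigma> a) (tcomp \<tau> a)"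
  by (simp add: pnt_comp_def)

lemma tcomp_pnt_precomp [simp]: "tcomp (pnt_precomp K \<tau>) a = tcomp \<tau> (fo K a)"
  by (simp add: pnt_precomp_def)

lemma tcomp_pnt_prod [simp]: "tcomp (pnt_prod \<sigma> \<tau>) ab = func_prod (tcomp \<sigma> (fst ab)) (tcomp \<tau> (snd ab))"
  by (simp add: pnt_prod_def case_prod_beta)

lemma tcomp_pnt_strict [simp]: "tcomp (pnt_strict A G K) a = K"
  by (simp add: pnt_strict_def)

lemma tcomp_pnt_id [simp]: "tcomp (pnt_id A G) a = func_id"
  by (simp add: pnt_id_def)

section \<open>A lax symmetric monoidal structure from products\<close>

context cart_opfib
begin

text \<open>The structure cells are the vertical parts of the corresponding arrows of the total category.\<close>

definition assoc_cell :: "('b \<times> 'b) \<times> 'b \<Rightarrow> ('o \<times> 'o) \<times> 'o \<Rightarrow> 'm" where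
  "assoc_cell = (\<lambda>((a, b), c) ((x, y), z). cofactor X P (ide B (pr S a (pr S b c)))
     (\<kappa> (prod_assoc B S a b c) (pr T (pr T x y) z)) (prod_assoc X T x y z))"

definition runit_cell :: "'b \<times> unit \<Rightarrow> 'o \<times> unit \<Rightarrow> 'm" where
  "runit_cell = (\<lambda>(a, _) (x, _). cofactor X P (ide B a) (\<kappa> (pi1 S a (one S)) (pr T x (one T))) (pi1 T x (one T)))"

definition lunit_cell :: "unit \<times> 'b \<Rightarrow> unit \<times> 'o \<Rightarrow> 'm" where
  "lunit_cell = (\<lambda>(_, a) (_, x). cofactor X P (ide B a) (\<kappa> (pi2 S (one S) a) (pr T (one T) x)) (pi2 T (one T) x))"

definition swap_cell :: "'b \<times> 'b \<Rightarrow> 'o \<times> 'o \<Rightarrow> 'm" where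
  "swap_cell = (\<lambda>(a, b) (x, y). cofactor X P (ide B (pr S b a)) (\<kappa> (prod_swap B S a b) (pr T x y)) (prod_swap X T x y))"

text \<open>By \<open>whisker_modI\<close>, the modification axioms for the cell and its
  invertibility reduce to naturality and invertibility of the associator of \<open>X\<close>. The
  other three cells are treated alike.\<close>

lemma assoc_mod: "assoc_mod B S F prodR assoc_cell"
  unfolding assoc_mod_def Let_def
proof (rule whiskering.whisker_modI[OF whiskering_assoc[OF nat_prodR],
    where c = "\<lambda>_ x. prod_assoc X T (fst (fst x)) (snd (fst x)) (snd x)"], goal_cases)
  case (5 f h)
  then have "fst (fst h) \<in> arr X" "snd (fst h) \<in> arr X" "snd h \<in> arr X" using overD(1) by auto
  then show ?case by (simp add: T.prod_assoc_natural)
qed (auto simp: over_def P_assoc T.is_iso_prod_assoc assoc_cell_def fun_eq_iff case_prod_beta)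

lemma runit_mod: "runit_mod B S F prodR prod1 runit_cell"
  unfolding runit_mod_def Let_def
proof (rule whiskering.whisker_modI[OF whiskering_runit[OF nat_prodR nat_prod1], where c = "\<lambda>_ x. pi1 T (fst x) (one
  T)"], goal_cases)
  case (5 f h)
  then have "fst h \<in> arr X" using overD(1) by auto
  then show ?case by (simp add: T.pi_par)
qed (auto simp: over_def P_pi1 P_one T.is_iso_pi_one runit_cell_def fun_eq_iff case_prod_beta)

lemma lunit_mod: "lunit_mod B S F prodR prod1 lunit_cell"
  unfolding lunit_mod_def Let_def
proof (rule whiskering.whisker_modI[OF whiskering_lunit[OF nat_prodR nat_prod1], where c = "\<lambda>_ x. pi2 T (one T) (snd
  x)"], goal_cases)
  case (5 f h)
  then have "snd h \<in> arr X" using overD(1) by auto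
  then show ?case by (simp add: T.pi_par)
qed (auto simp: over_def P_pi2 P_one T.is_iso_pi_one lunit_cell_def fun_eq_iff case_prod_beta)

lemma swap_mod: "swap_mod B S F prodR swap_cell"
  unfolding swap_mod_def Let_def
proof (rule whiskering.whisker_modI[OF whiskering_swap[OF nat_prodR], where c = "\<lambda>_ x. prod_swap X T (fst x) (snd x)"],
  goal_cases)
  case (5 f h)
  then have "fst h \<in> arr X" "snd h \<in> arr X" using overD(1) by auto
  then show ?case by (simp add: T.prod_swap_natural)
qed (auto simp: over_def P_swap T.is_iso_prod_swap swap_cell_def fun_eq_iff case_prod_beta)

text \<open>Recognizes the triple in the coherence conditions as the image of a structural arrow of
  \<open>X\<close>, after which \<open>gcomp_garr\<close> and its companions apply.\<close>

lemma garr_assoc: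
  assumes "x \<in> obj X" "y \<in> obj X" "z \<in> obj X" "fo P x = a" "fo P y = b" "fo P z = c"
  shows "(pr T (pr T x y) z, prod_assoc B S a b c, assoc_cell ((a, b), c) ((x, y), z)) = garr (prod_assoc X T x y z)"
  using assms by (auto simp: arr_to_garr_def assoc_cell_def P_assoc P_pr)

lemma garr_runit:
  "x \<in> obj X \<Longrightarrow> fo P x = a \<Longrightarrow> (pr T x (one T), pi1 S a (one S), runit_cell (a, ()) (x, ())) = garr (pi1 T x (one T))"
  by (auto simp: arr_to_garr_def runit_cell_def P_pi1 P_one)

lemma garr_lunit:
  "x \<in> obj X \<Longrightarrow> fo P x = a \<Longrightarrow> (pr T (one T) x, pi2 S (one S) a, lunit_cell ((), a) ((), x)) = garr (pi2 T (one T) x)"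
  by (auto simp: arr_to_garr_def lunit_cell_def P_pi2 P_one)

lemma garr_swap:
  "x \<in> obj X \<Longrightarrow> y \<in> obj X \<Longrightarrow> fo P x = a \<Longrightarrow> fo P y = b \<Longrightarrow>
    (pr T x y, prod_swap B S a b, swap_cell (a, b) (x, y)) = garr (prod_swap X T x y)"
  by (auto simp: arr_to_garr_def swap_cell_def P_swap P_pr)

lemma gtens_prodR: "h \<in> arr X \<Longrightarrow> k \<in> arr X \<Longrightarrow> gtens B S F prodR (garr h) (garr k) = garr (par X T h k)"
  by (simp add: gtens_garr[OF nat_prodR])

lemma assoc_inv_simps [simp]:
  assumes "a \<in> obj X" "b \<in> obj X" "c \<in> obj X"
  shows "T.assoc_inv a b c \<in> arr X" "src X (T.assoc_inv a b c) = pr T a (pr T b c)"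
    "tgt X (T.assoc_inv a b c) = pr T (pr T a b) c"
  using T.inverse_prod_assoc[OF assms] assms by (simp_all add: inverse_arrows_def hom_def)

lemma ginv_assoc:
  "x \<in> obj X \<Longrightarrow> y \<in> obj X \<Longrightarrow> z \<in> obj X \<Longrightarrow> ginv B F (garr (prod_assoc X T x y z)) = garr (T.assoc_inv x y z)"
  by (rule ginv_garr[OF T.inverse_prod_assoc])

lemma lax_symmetric_monoidal:
  "lax_symmetric_monoidal B S F prodR prod1 assoc_cell runit_cell lunit_cell swap_cell"
  unfolding lax_symmetric_monoidal_def Let_def
proof (intro conjI ballI, goal_cases)
  case 1 show ?case by (rule displayed_nat.pseudonat[OF nat_prodR])
next case 2 show ?case by (rule displayed_nat.pseudonat[OF nat_prod1])
next case 3 show ?case by (rule assoc_mod)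
next case 4 show ?case by (rule runit_mod)
next case 5 show ?case by (rule lunit_mod)
next case 6 show ?case by (rule swap_mod)
next case (7 a b c d x y z w) then show ?case
    using T.pentagon[of x y z w]
    by (simp add: garr_assoc P_pr gide_garr gtens_prodR gcomp_garr)
next case (8 a b x y) then show ?case
    using T.triangle[of x y]
    by (simp add: garr_assoc garr_runit garr_lunit P_one gide_garr gtens_prodR gcomp_garr)
next case (9 a b c x y z) then show ?case
    using T.hexagon1[of x y z]
    by (simp add: garr_assoc garr_swap P_pr gide_garr gtens_prodR gcomp_garr)
next case (10 a b c x y z) then show ?case
    using T.hexagon2[of x y z]
    by (simp add: garr_assoc garr_swap ginv_assoc P_pr gide_garr gtens_prodR gcomp_garr)
next case (11 a b x y) then show ?case
    using T.swap_swap[of x y]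
    by (simp add: garr_swap P_pr gide_garr gcomp_garr)
qed

lemma total_tensor_par: "h \<in> arr X \<Longrightarrow> k \<in> arr X \<Longrightarrow> fm (total_tensor X B S P \<kappa> prodR) (h, k) = par X T h k"
  by (simp add: total_tensor_arr[OF nat_prodR])

end

section \<open>Products over the base from a lax symmetric monoidal structure\<close>

context cloven_prod
begin

text \<open>The projections of the given products need not lie over the projections of the base.  They
  are composed with the natural automorphisms that compare \<open>\<zeta>\<close> and \<open>\<xi>\<close> with the projections to
  one factor of \<open>x \<times> 1\<close> and \<open>1 \<times> x\<close>.\<close>

lemma cart_opfib_if_lax:
  assumes lax: "lax_symmetric_monoidal B S F R R1 \<omega> \<zeta> \<xi> \<theta>" and fp: "finite_products X T"
    and obj: "\<And>x y. x \<in> obj X \<Longrightarrow> y \<in> obj X \<Longrightarrow> fo (tcomp R (fo P x, fo P y)) (x, y) = pr T x y"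
    and arr: "\<And>h k. h \<in> arr X \<Longrightarrow> k \<in> arr X \<Longrightarrow> fm (total_tensor X B S P \<kappa> R) (h, k) = par X T h k"
    and one: "fo (tcomp R1 ()) () = one T"
  shows "\<exists>T. cart_opfib X B P \<kappa> S T"
proof -
  interpret T: fin_prod X T by unfold_locales (fact fp)
  have "pseudonat (cat_prod B B) (psf_prod F F) (psf_precomp (prod_func B S) F) R"
    "pseudonat cat_unit psf_unit (psf_precomp (func_point B (one S)) F) R1"
    and ru: "runit_mod B S F R R1 \<zeta>" and lu: "lunit_mod B S F R R1 \<xi>"
    using lax by (simp_all add: lax_symmetric_monoidal_def Let_def)
  then obtain \<Psi> \<Psi>1 where R: "nat_R R \<Psi>" and R1: "nat_R1 R1 \<Psi>1" using ex_nat_R ex_nat_R1 by blast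
  have psi: "\<Psi> (fm P h, fm P k) (h, k) = par X T h k" if "h \<in> arr X" "k \<in> arr X" for h k
    using total_tensor_arr[OF R that] arr[OF that] by simp
  \<comment> \<open>Only the tensor functor is known to be compatible with \<open>P\<close> so far:
    \<open>\<Psi>\<close> lies over the products of the base, and it is the product functor of
    \<open>T\<close>.\<close>
  have par_over: "par X T h k \<in> over (par B S (fm P h) (fm P k))" if "h \<in> arr X" "k \<in> arr X" for h k
    using displayed_nat.Phi_over[OF R, of "(fm P h, fm P k)" "(h, k)"] that psi[OF that] by (simp add: over_def)
  have pr_over: "fo P (pr T x y) = pr S (fo P x) (fo P y)" if "x \<in> obj X" "y \<in> obj X" for x y
    using displayed_nat.Phi_obj[OF R, of "(fo P x, fo P y)" "(x, y)"] that obj[OF that] by simp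
  have one_over: "fo P (one T) = one S"
    using displayed_nat.Phi_obj[OF R1, of "()" "()"] one by (simp add: psf_unit_def)
  have unit: "\<Psi>1 () () = ide X (one T)"
    using displayed_nat.Phi_ide[OF R1, of "()" "()"] one by (simp add: psf_unit_def)
  have psi_unit: "\<Psi> (fm P h, ide B (one S)) (h, ide X (one T)) = par X T h (ide X (one T))"
      "\<Psi> (ide B (one S), fm P h) (ide X (one T), h) = par X T (ide X (one T)) h" if "h \<in> arr X" for h
    using psi[of h "ide X (one T)"] psi[of "ide X (one T)" h] that by (simp_all add: one_over)
  \<comment> \<open>The unit constraints that \<zeta> and \<xi> induce on \<open>X\<close>. Unlike
    the projections of \<open>T\<close>, they lie over the projections of the base by
    construction.\<close>
  define \<rho> where "\<rho> x = \<zeta> (fo P x, ()) (x, ()) \<cdot>\<^bsub>X\<^esub> \<kappa> (pi1 S (fo P x) (one S)) (pr T x (one T))" for x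
  define \<mu> where "\<mu> x = \<xi> ((), fo P x) ((), x) \<cdot>\<^bsub>X\<^esub> \<kappa> (pi2 S (one S) (fo P x)) (pr T (one T) x)" for x
  note rD = whiskering.whisker_modD[OF whiskering_runit[OF R R1] ru[unfolded runit_mod_def Let_def]]
  note lD = whiskering.whisker_modD[OF whiskering_lunit[OF R R1] lu[unfolded lunit_mod_def Let_def]]
  have on: "fo (tcomp R (fo P x, one S)) (x, one T) = pr T x (one T)" "fo (tcomp R (one S, fo P x)) (one T, x) = pr T
    (one T) x"
    if "x \<in> obj X" for x using obj[of x "one T"] obj[of "one T" x] that by (simp_all add: one_over)
  have \<rho>: "\<rho> x \<in> over (pi1 S (fo P x) (one S))" "src X (\<rho> x) = pr T x (one T)" "tgt X (\<rho> x) = x" "is_iso X (\<rho> x)"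
    if "x \<in> obj X" for x
    using rD(1-4)[of "(fo P x, ())" "(x, ())"] that
    by (simp_all add: \<rho>_def one on S.is_iso_pi_one psf_unit_def)
  have \<mu>: "\<mu> x \<in> over (pi2 S (one S) (fo P x))" "src X (\<mu> x) = pr T (one T) x" "tgt X (\<mu> x) = x" "is_iso X (\<mu> x)"
    if "x \<in> obj X" for x
    using lD(1-4)[of "((), fo P x)" "((), x)"] that
    by (simp_all add: \<mu>_def one on S.is_iso_pi_one psf_unit_def)
  have \<rho>_nat: "\<rho> (tgt X h) \<cdot>\<^bsub>X\<^esub> par X T h (ide X (one T)) = h \<cdot>\<^bsub>X\<^esub> \<rho> (src X h)" if "h \<in> arr X" for h
    using rD(5)[of "(fm P h, ())" "(h, ())"] that by (simp add: \<rho>_def one on unit psi_unit over_def)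
  have \<mu>_nat: "\<mu> (tgt X h) \<cdot>\<^bsub>X\<^esub> par X T (ide X (one T)) h = h \<cdot>\<^bsub>X\<^esub> \<mu> (src X h)" if "h \<in> arr X" for h
    using lD(5)[of "((), fm P h)" "((), h)"] that by (simp add: \<mu>_def one on unit psi_unit over_def)
  \<comment> \<open>The automorphism of \<open>x\<close> by which the constraint
    \<open>\<rho> x\<close> differs from the projection of \<open>T\<close>; both are isomorphisms
    from \<open>x \<times> 1\<close> to \<open>x\<close>.\<close>
  define \<phi> where "\<phi> x = \<rho> x \<cdot>\<^bsub>X\<^esub> inv_arr X (pi1 T x (one T))" for x
  define \<psi> where "\<psi> x = \<mu> x \<cdot>\<^bsub>X\<^esub> inv_arr X (pi2 T (one T) x)" for x
  have \<phi>: "\<phi> x \<in> arr X" "src X (\<phi> x) = x" "tgt X (\<phi> x) = x" "is_iso X (\<phi> x)" "\<phi> x \<cdot>\<^bsub>X\<^esub> pi1 T x (one T) = \<rho> x" if "x \<in>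
    obj X" for x
    using \<rho>[OF that] overD(1)[OF \<rho>(1)[OF that]] T.is_iso_pi_one[OF that] that by (simp_all add: \<phi>_def)
  have \<psi>: "\<psi> x \<in> arr X" "src X (\<psi> x) = x" "tgt X (\<psi> x) = x" "is_iso X (\<psi> x)" "\<psi> x \<cdot>\<^bsub>X\<^esub> pi2 T (one T) x = \<mu> x" if "x \<in>
    obj X" for x
    using \<mu>[OF that] overD(1)[OF \<mu>(1)[OF that]] T.is_iso_pi_one[OF that] that by (simp_all add: \<psi>_def)
  \<comment> \<open>Both \<open>\<rho>\<close> and the projection are natural in \<open>x\<close>
    with respect to the same functor, tensoring with the terminal object, hence so is their
    quotient.\<close>
  have \<phi>_nat: "\<phi> (tgt X h) \<cdot>\<^bsub>X\<^esub> h = h \<cdot>\<^bsub>X\<^esub> \<phi> (src X h)" if h: "h \<in> arr X" for h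
  proof -
    let ?x = "src X h" and ?y = "tgt X h" and ?p = "par X T h (ide X (one T))"
    have i: "is_iso X (pi1 T ?x (one T))" using T.is_iso_pi_one h by simp
    have s: "?x \<in> obj X" "?y \<in> obj X" using h by simp_all
    have pp: "pi1 T ?y (one T) \<cdot>\<^bsub>X\<^esub> ?p = h \<cdot>\<^bsub>X\<^esub> pi1 T ?x (one T)" using h by (simp add: T.pi_par)
    have "pi1 T ?y (one T) \<cdot>\<^bsub>X\<^esub> (?p \<cdot>\<^bsub>X\<^esub> inv_arr X (pi1 T ?x (one T))) = (h \<cdot>\<^bsub>X\<^esub> pi1 T ?x (one T)) \<cdot>\<^bsub>X\<^esub> inv_arr X (pi1 T
      ?x (one T))"
      by (rule C.cmp_reassoc[OF pp]) (use C.inv_arr_simps[OF i] h in simp_all)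
    then have e: "pi1 T ?y (one T) \<cdot>\<^bsub>X\<^esub> (?p \<cdot>\<^bsub>X\<^esub> inv_arr X (pi1 T ?x (one T))) = h"
      using C.inv_arr_simps[OF i] h by simp
    have "\<phi> ?y \<cdot>\<^bsub>X\<^esub> h = (\<rho> ?y \<cdot>\<^bsub>X\<^esub> ?p) \<cdot>\<^bsub>X\<^esub> inv_arr X (pi1 T ?x (one T))"
      using C.cmp_reassoc[OF \<phi>(5)[OF s(2)], of "?p \<cdot>\<^bsub>X\<^esub> inv_arr X (pi1 T ?x (one T))"] C.inv_arr_simps[OF i] h \<phi>[OF s(2)]
        \<rho>[OF s(2)] overD(1)[OF \<rho>(1)[OF s(2)]] by (simp add: e)
    also have "\<dots> = h \<cdot>\<^bsub>X\<^esub> \<phi> ?x"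
      unfolding \<rho>_nat[OF h] \<phi>_def using C.inv_arr_simps[OF i] h \<rho>[OF s(1)] overD(1)[OF \<rho>(1)[OF s(1)]] by simp
    finally show ?thesis .
  qed
  have \<psi>_nat: "\<psi> (tgt X h) \<cdot>\<^bsub>X\<^esub> h = h \<cdot>\<^bsub>X\<^esub> \<psi> (src X h)" if h: "h \<in> arr X" for h
  proof -
    let ?x = "src X h" and ?y = "tgt X h" and ?p = "par X T (ide X (one T)) h"
    have i: "is_iso X (pi2 T (one T) ?x)" using T.is_iso_pi_one h by simp
    have s: "?x \<in> obj X" "?y \<in> obj X" using h by simp_all
    have pp: "pi2 T (one T) ?y \<cdot>\<^bsub>X\<^esub> ?p = h \<cdot>\<^bsub>X\<^esub> pi2 T (one T) ?x" using h by (simp add: T.pi_par)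
    have "pi2 T (one T) ?y \<cdot>\<^bsub>X\<^esub> (?p \<cdot>\<^bsub>X\<^esub> inv_arr X (pi2 T (one T) ?x)) = (h \<cdot>\<^bsub>X\<^esub> pi2 T (one T) ?x) \<cdot>\<^bsub>X\<^esub> inv_arr X (pi2 T
      (one T) ?x)"
      by (rule C.cmp_reassoc[OF pp]) (use C.inv_arr_simps[OF i] h in simp_all)
    then have e: "pi2 T (one T) ?y \<cdot>\<^bsub>X\<^esub> (?p \<cdot>\<^bsub>X\<^esub> inv_arr X (pi2 T (one T) ?x)) = h"
      using C.inv_arr_simps[OF i] h by simp
    have "\<psi> ?y \<cdot>\<^bsub>X\<^esub> h = (\<mu> ?y \<cdot>\<^bsub>X\<^esub> ?p) \<cdot>\<^bsub>X\<^esub> inv_arr X (pi2 T (one T) ?x)"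
      using C.cmp_reassoc[OF \<psi>(5)[OF s(2)], of "?p \<cdot>\<^bsub>X\<^esub> inv_arr X (pi2 T (one T) ?x)"] C.inv_arr_simps[OF i] h \<psi>[OF s(2)]
        \<mu>[OF s(2)] overD(1)[OF \<mu>(1)[OF s(2)]] by (simp add: e)
    also have "\<dots> = h \<cdot>\<^bsub>X\<^esub> \<psi> ?x"
      unfolding \<mu>_nat[OF h] \<psi>_def using C.inv_arr_simps[OF i] h \<mu>[OF s(1)] overD(1)[OF \<mu>(1)[OF s(1)]] by simp
    finally show ?thesis .
  qed
  \<comment> \<open>The same objects with the projections followed by the automorphisms. The cones
    stay universal because the automorphisms are invertible.\<close>
  define T' where "T' = \<lparr>pr = pr T, pi1 = \<lambda>x y. \<phi> x \<cdot>\<^bsub>X\<^esub> pi1 T x y, pi2 = \<lambda>x y. \<psi> y \<cdot>\<^bsub>X\<^esub> pi2 T x y, one = one T\<rparr>"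
  have prod: "is_product X x y (pr T x y) (\<phi> x \<cdot>\<^bsub>X\<^esub> pi1 T x y) (\<psi> y \<cdot>\<^bsub>X\<^esub> pi2 T x y)" if xy: "x \<in> obj X" "y \<in> obj X" for x y
    unfolding is_product_def
  proof (intro conjI ballI)
    note px = \<phi>[OF xy(1)] and py = \<psi>[OF xy(2)]
    show "\<phi> x \<cdot>\<^bsub>X\<^esub> pi1 T x y \<in> hom X (pr T x y) x" "\<psi> y \<cdot>\<^bsub>X\<^esub> pi2 T x y \<in> hom X (pr T x y) y"
      using px py xy by (simp_all add: hom_def)
    fix c f g assume "f \<in> hom X c x" "g \<in> hom X c y"
    then have f: "f \<in> arr X" "src X f = c" "tgt X f = x" and g: "g \<in> arr X" "src X g = c" "tgt X g = y"
      by (simp_all add: hom_def)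
    let ?t = "pair X T (inv_arr X (\<phi> x) \<cdot>\<^bsub>X\<^esub> f) (inv_arr X (\<psi> y) \<cdot>\<^bsub>X\<^esub> g)"
    show "\<exists>!h. h \<in> hom X c (pr T x y) \<and> (\<phi> x \<cdot>\<^bsub>X\<^esub> pi1 T x y) \<cdot>\<^bsub>X\<^esub> h = f \<and> (\<psi> y \<cdot>\<^bsub>X\<^esub> pi2 T x y) \<cdot>\<^bsub>X\<^esub> h = g"
    proof (rule ex1I[of _ ?t])
      show "?t \<in> hom X c (pr T x y) \<and> (\<phi> x \<cdot>\<^bsub>X\<^esub> pi1 T x y) \<cdot>\<^bsub>X\<^esub> ?t = f \<and> (\<psi> y \<cdot>\<^bsub>X\<^esub> pi2 T x y) \<cdot>\<^bsub>X\<^esub> ?t = g"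
        using f g px py xy by (simp add: hom_def)
      fix h assume h: "h \<in> hom X c (pr T x y) \<and> (\<phi> x \<cdot>\<^bsub>X\<^esub> pi1 T x y) \<cdot>\<^bsub>X\<^esub> h = f \<and> (\<psi> y \<cdot>\<^bsub>X\<^esub> pi2 T x y) \<cdot>\<^bsub>X\<^esub> h = g"
      then have ha: "h \<in> arr X" "src X h = c" "tgt X h = pr T x y" by (simp_all add: hom_def)
      have "f = \<phi> x \<cdot>\<^bsub>X\<^esub> (pi1 T x y \<cdot>\<^bsub>X\<^esub> h)" "g = \<psi> y \<cdot>\<^bsub>X\<^esub> (pi2 T x y \<cdot>\<^bsub>X\<^esub> h)"
        using h ha px py xy by auto
      then show "h = ?t" using ha px py xy by simp
    qed
  qed
  have fp': "finite_products X T'"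
    using fp prod by (simp add: finite_products_def T'_def)
  interpret T': fin_prod X T' by unfold_locales (fact fp')
  have "cart_opfib X B P \<kappa> S T'"
  proof (rule cart_opfibI[OF fp' _ _ _ _ R])
    fix x y assume xy: "x \<in> obj X" "y \<in> obj X"
    show "fo P (pr T' x y) = pr S (fo P x) (fo P y)" using pr_over[OF xy] by (simp add: T'_def)
    obtain t where t: "t \<in> arr X" "src X t = y" "tgt X t = one T" using T.bang_ex xy by blast
    \<comment> \<open>With one factor sent to the terminal object, the corrected projection becomes
      the constraint \<open>\<rho> x\<close>, whose image in the base is known; so is that of the
      product of arrows before it.\<close>
    have "\<phi> x \<cdot>\<^bsub>X\<^esub> pi1 T x y = \<rho> x \<cdot>\<^bsub>X\<^esub> par X T (ide X x) t"
      using T.pi_via_one(1)[OF xy t] C.cmp_reassoc[OF \<phi>(5)[OF xy(1)], of "par X T (ide X x) t"] xy t \<phi>[OF xy(1)] by simp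
    then have "fm P (\<phi> x \<cdot>\<^bsub>X\<^esub> pi1 T x y) = pi1 S (fo P x) (one S) \<cdot>\<^bsub>B\<^esub> par B S (ide B (fo P x)) (fm P t)"
      using \<rho>[OF xy(1)] overD[OF \<rho>(1)[OF xy(1)]] overD(2)[OF par_over[of "ide X x" t]] xy t by simp
    then show "fm P (pi1 T' x y) = pi1 S (fo P x) (fo P y)"
      using S.pi_via_one(1)[of "fo P x" "fo P y" "fm P t"] xy t by (simp add: T'_def one_over)
    obtain s where s: "s \<in> arr X" "src X s = x" "tgt X s = one T" using T.bang_ex xy by blast
    have "\<psi> y \<cdot>\<^bsub>X\<^esub> pi2 T x y = \<mu> y \<cdot>\<^bsub>X\<^esub> par X T s (ide X y)"
      using T.pi_via_one(2)[OF xy s] C.cmp_reassoc[OF \<psi>(5)[OF xy(2)], of "par X T s (ide X y)"] xy s \<psi>[OF xy(2)] by simp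
    then have "fm P (\<psi> y \<cdot>\<^bsub>X\<^esub> pi2 T x y) = pi2 S (one S) (fo P y) \<cdot>\<^bsub>B\<^esub> par B S (fm P s) (ide B (fo P y))"
      using \<mu>[OF xy(2)] overD[OF \<mu>(1)[OF xy(2)]] overD(2)[OF par_over[of s "ide X y"]] xy s by simp
    then show "fm P (pi2 T' x y) = pi2 S (fo P x) (fo P y)"
      using S.pi_via_one(2)[of "fo P x" "fo P y" "fm P s"] xy s by (simp add: T'_def one_over)
  next
    fix h k assume hk: "h \<in> arr X" "k \<in> arr X"
    have s: "src X h \<in> obj X" "src X k \<in> obj X" "tgt X h \<in> obj X" "tgt X k \<in> obj X" using hk by simp_all
    note f1 = \<phi>[OF s(1)] and f2 = \<phi>[OF s(3)] and g1 = \<psi>[OF s(2)] and g2 = \<psi>[OF s(4)]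
    \<comment> \<open>The automorphisms commute with \<open>h\<close> and \<open>k\<close>, so the
      old product of arrows also commutes with the corrected projections. The product functor is
      thus unchanged and is still the action of \<open>R\<close>.\<close>
    have "par X T h k = par X T' h k"
    proof (rule T'.par_eqI[OF hk])
      have "\<phi> (tgt X h) \<cdot>\<^bsub>X\<^esub> (pi1 T (tgt X h) (tgt X k) \<cdot>\<^bsub>X\<^esub> par X T h k) = h \<cdot>\<^bsub>X\<^esub> (\<phi> (src X h) \<cdot>\<^bsub>X\<^esub> pi1 T (src X h)
        (src X k))"
        using C.cmp_reassoc[OF \<phi>_nat[OF hk(1)], of "pi1 T (src X h) (src X k)"] hk f1 f2 by (simp add: T.pi_par)
      then show "pi1 T' (tgt X h) (tgt X k) \<cdot>\<^bsub>X\<^esub> par X T h k = h \<cdot>\<^bsub>X\<^esub> pi1 T' (src X h) (src X k)"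
        using hk f1 f2 by (simp add: T'_def)
      have "\<psi> (tgt X k) \<cdot>\<^bsub>X\<^esub> (pi2 T (tgt X h) (tgt X k) \<cdot>\<^bsub>X\<^esub> par X T h k) = k \<cdot>\<^bsub>X\<^esub> (\<psi> (src X k) \<cdot>\<^bsub>X\<^esub> pi2 T (src X h)
        (src X k))"
        using C.cmp_reassoc[OF \<psi>_nat[OF hk(2)], of "pi2 T (src X h) (src X k)"] hk g1 g2 by (simp add: T.pi_par)
      then show "pi2 T' (tgt X h) (tgt X k) \<cdot>\<^bsub>X\<^esub> par X T h k = k \<cdot>\<^bsub>X\<^esub> pi2 T' (src X h) (src X k)"
        using hk g1 g2 by (simp add: T'_def)
    qed (use hk in \<open>simp_all add: T'_def\<close>)
    then show "\<Psi> (fm P h, fm P k) (h, k) = par X T' h k" using psi[OF hk] by simp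
  qed (simp add: T'_def one_over)
  then show ?thesis by blast
qed

end

section \<open>Equivalence of the three conditions\<close>

theorem theorem4p7:
  fixes B :: "('b, 'f) cat" and S :: "('b, 'f) fprods"
    and X :: "('o, 'm) cat" and P :: "('o, 'm, 'b, 'f) func"
    and \<kappa> :: "'f \<Rightarrow> 'o \<Rightarrow> 'm"
  defines "F \<equiv> opfib_psf X B P \<kappa>"
  assumes "finite_products B S"
    and "cloven_opfibration X B P \<kappa>"
  defines "cond_i \<equiv>
      (\<exists>SX. finite_products X SX \<and>
         monoidal_opfibration X (cartesian_monoidal X SX) B (cartesian_monoidal B S) P)"
    and "cond_ii \<equiv>
      (\<exists>R1. right_adjoint_in_CAT cat_unit
         (psf_precomp (func_point B (one S)) F) psf_unit L1 R1) \<and>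
      (\<exists>R. right_adjoint_in_CAT (cat_prod B B)
         (psf_precomp (prod_func B S) F) (psf_prod F F) (LL B S F) R)"
    and "cond_iii \<equiv>
      (\<exists>R R1 \<omega> \<zeta> \<xi> \<theta> SX. lax_symmetric_monoidal B S F R R1 \<omega> \<zeta> \<xi> \<theta> \<and>
         finite_products X SX \<and>
         (\<forall>x\<in>obj X. \<forall>y\<in>obj X. fo (tcomp R (fo P x, fo P y)) (x, y) = pr SX x y) \<and>
         (\<forall>h\<in>arr X. \<forall>k\<in>arr X. fm (total_tensor X B S P \<kappa> R) (h, k) = par X SX h k) \<and>
         fo (tcomp R1 ()) () = one SX)"
  shows "(cond_i \<longleftrightarrow> cond_ii) \<and> (cond_ii \<longleftrightarrow> cond_iii)"
proof -
  interpret cloven_prod X B P \<kappa> S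
    using assms(2,3) by (intro cloven_prod.intro cloven.intro fin_prod.intro)
  let ?cart = "\<exists>T. cart_opfib X B P \<kappa> S T"
  have "cond_i \<longleftrightarrow> ?cart"
    unfolding cond_i_def
    using cart_opfib_if_monoidal cart_opfib.monoidal_opfibration fin_prod.finite_products cart_opfib.axioms(2) by blast
  moreover have "cond_ii \<longleftrightarrow> ?cart"
    unfolding cond_ii_def F_def
    using cart_opfib_if_adjoints cart_opfib.adjoint_one cart_opfib.adjoint_prod by blast
  moreover have "cond_iii \<longleftrightarrow> ?cart"
  proof
    assume cond_iii
    then show ?cart unfolding cond_iii_def F_def using cart_opfib_if_lax by blast
  next
    assume ?cart
    then obtain T where T: "cart_opfib X B P \<kappa> S T" by blast
    interpret cart_opfib X B P \<kappa> S T by (fact T)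
    show cond_iii
      unfolding cond_iii_def F_def
      using lax_symmetric_monoidal T.finite_products total_tensor_par by fastforce
  qed
  ultimately show ?thesis by blast
qed

end
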